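(* Let $f(X)=X^{p^2}+f_1X^{p^2-1}+\dots+f_{p^2-1}X+f_{p^2}\in\mathcal{O}_K[X]$ be an Eisenstein polynomial. Then $f$ determines a Galois cyclic extension of degree $p^2$ over $K$ (i.e. $K(\pi)/K$ is cyclic of degree $p^2$ for a root $\pi$ of $f$) if and only if all of the following hold: (1) $v_p(f_p)=1$, and $v_p(f_{pi})\geq 2$ for $i\in I(2,p-1)$; (2) $v_p(f_i)\geq 2$ for $i\in I(1,p-1)$, $v_p(f_{p+1})=2$, and $v_p(f_i)\geq 3$ for $i\in I(p+2,p^2-1)$; and, putting $F_p=\overline{f_p/p}$, $F_{p^2}=\overline{f_{p^2}/p}$ and $G_i=\overline{f_i/p^2}$ for all $i\neq p,p^2$, (3) $-F_p/F_{p^2}\in\kappa_K^{p-1}$; (4) $G_{p+1}^p=-F_p^{p+1}$; (5) $G_{p\ell}=F_{p^2}\left(G_\ell/F_p\right)^p$ for all $\ell\in I(3,p-1)$; (6) $G_{2p}=F_{p^2}\left(G_2/F_p\right)^p+\frac12F_p\left(F_p-F_{p^2}^{1/p}\right)$; (7) if $\theta\in\mathcal{O}_K$ is such that $\bar\theta^{\,p(p-1)}=-F_p/F_{p^2}$, then (for any choice of $\theta$) the polynomial $$F_{p^2}X^p+F_pX-\overline{\tfrac{1}{p^2}\left(f_{p^2}\theta^{p^2}+f_p\theta^p\right)}-G_1\bar\theta$$ has a root in $\kappa_K$.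
   Context: Throughout, $p$ is an odd prime and $K$ is a finite unramified extension of $\mathbb{Q}_p$, with ring of integers $\mathcal{O}_K$ and residue field $\kappa_K=\mathcal{O}_K/p\mathcal{O}_K$. For $x\in\mathcal{O}_K$, $\bar x$ (or $\overline{x}$) is its image in $\kappa_K$; $v_p$ is the valuation on $K$ with $v_p(p)=1$. For integers $a,b$, $I(a,b)$ is the set of integers $i$ with $a\le i\le b$ and $\gcd(i,p)=1$. $\kappa_K^{p-1}$ is the set of $(p-1)$-th powers of elements of $\kappa_K$. For $x\in\kappa_K$, $x^{1/p}$ is the unique $p$-th root of $x$ in $\kappa_K$. *)

theory Defs
  imports
    "HOL-Algebra.Algebraic_Closure_Type"
    "HOL-Algebra.Generated_Fields"
    "HOL-Algebra.Bij"
    "HOL-Algebra.Elementary_Groups"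
    "HOL-Library.Extended_Real"
begin

text \<open>
  A field \<open>K\<close> is the universe of a type; subfields, degrees and generated subfields come from
  HOL-Algebra via \<^const>\<open>ring_of_type_algebra\<close>.
\<close>

locale field_valuation =
  fixes v :: "'a :: field \<Rightarrow> ereal"
  assumes val_not_MInf: "v x \<noteq> -\<infinity>"
    and val_eq_PInf_iff: "v x = \<infinity> \<longleftrightarrow> x = 0"
    and val_mult: "v (x * y) = v x + v y"
    and val_add: "min (v x) (v y) \<le> v (x + y)"

definition valuation_ring :: "('a :: field \<Rightarrow> ereal) \<Rightarrow> 'a set" where
  "valuation_ring v = {x. 0 \<le> v x}"

text \<open>
  The subfield \<open>Q\<close> is a copy of the field of \<open>p\<close>-adic numbers, i.e. a completion of the rational
  numbers: \<open>v\<close> restricts to the \<open>p\<close>-adic valuation on \<open>\<rat>\<close> (by multiplicativity it suffices to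
  say this for positive integers), \<open>\<rat>\<close> is dense in \<open>Q\<close>, and \<open>Q\<close> is complete. This determines
  \<open>Q\<close> up to a unique isomorphism of valued fields.
\<close>

locale padic_subfield = field_valuation v
  for p :: nat and v :: "'a :: field_char_0 \<Rightarrow> ereal" and Q :: "'a set" +
  assumes prime_p: "Factorial_Ring.prime p"
    and subfield_Q: "subfield Q ring_of_type_algebra"
    and val_of_nat: "n > 0 \<Longrightarrow> v (of_nat n) = ereal (real (multiplicity p n))"
    and Rats_dense: "x \<in> Q \<Longrightarrow> \<exists>r\<in>\<rat>. ereal B \<le> v (x - r)"
    and complete_Q:
      "\<lbrakk>range s \<subseteq> Q; \<forall>B::real. \<exists>N::nat. \<forall>m\<ge>N. \<forall>n\<ge>N. ereal B \<le> v (s m - s n)\<rbrakk>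
        \<Longrightarrow> \<exists>x\<in>Q. \<forall>B::real. \<exists>N::nat. \<forall>n\<ge>N. ereal B \<le> v (s n - x)"

text \<open>
  Unramified means ramification index 1, i.e. equal value groups; separability of the residue
  field extension is automatic, since the residue field of \<open>Q\<close> is finite.
\<close>

locale finite_unramified_extension = padic_subfield p v Q
  for p :: nat and v :: "'a :: field_char_0 \<Rightarrow> ereal" and Q :: "'a set" +
  assumes finite_degree: "ring.finite_dimension ring_of_type_algebra Q (UNIV :: 'a set)"
    and unramified: "v ` (UNIV - {0}) = v ` (Q - {0})"

text \<open>
  The type \<open>'k\<close> together with \<open>r\<close> is the residue field \<open>O/pO\<close> with its reduction map: \<open>r\<close> is a
  surjective ring homomorphism on \<open>O\<close> with kernel \<open>pO\<close>. Its values outside \<open>O\<close> are irrelevant.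
\<close>

definition residue_map :: "nat \<Rightarrow> ('a :: field \<Rightarrow> ereal) \<Rightarrow> ('a \<Rightarrow> 'k :: field) \<Rightarrow> bool" where
  "residue_map p v r \<longleftrightarrow>
     r \<in> ring_hom (ring_of_type_algebra\<lparr>carrier := valuation_ring v\<rparr>) ring_of_type_algebra \<and>
     r ` valuation_ring v = UNIV \<and>
     {x \<in> valuation_ring v. r x = 0} = (\<lambda>y. of_nat p * y) ` valuation_ring v"

text \<open>
  For a valuation normalised by \<open>v p = 1\<close> on an unramified extension, the conditions
  \<open>v a \<ge> 1\<close> and \<open>v a = 1\<close> mean \<open>a \<in> pO\<close> and \<open>a \<in> pO - p\<^sup>2O\<close>.
\<close>

definition eisenstein :: "('a :: field \<Rightarrow> ereal) \<Rightarrow> 'a poly \<Rightarrow> bool" where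
  "eisenstein v f \<longleftrightarrow>
     Polynomial.degree f > 0 \<and> Polynomial.lead_coeff f = 1 \<and>
     (\<forall>i<Polynomial.degree f. v (Polynomial.coeff f i) \<ge> 1) \<and>
     v (Polynomial.coeff f 0) = 1"

definition coprime_range :: "nat \<Rightarrow> nat \<Rightarrow> nat \<Rightarrow> nat set" where
  "coprime_range p a b = {i. a \<le> i \<and> i \<le> b \<and> coprime i p}"

definition powers_of :: "nat \<Rightarrow> 'k :: field set" where
  "powers_of n = range (\<lambda>x. x ^ n)"

definition pth_root :: "nat \<Rightarrow> 'k :: field \<Rightarrow> 'k" where
  "pth_root p x = (THE y. y ^ p = x)"

text \<open>
  Intermediate fields of \<open>K\<close> and its algebraic closure; \<open>K\<close> is embedded by \<^const>\<open>to_ac\<close>.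
\<close>

definition adjoin_root :: "'a :: field alg_closure \<Rightarrow> 'a alg_closure set" where
  "adjoin_root \<alpha> = generate_field ring_of_type_algebra (insert \<alpha> (range to_ac))"

text \<open>Normal and separable; algebraicity is automatic inside the algebraic closure.\<close>

definition galois_extension :: "'a :: field alg_closure set \<Rightarrow> bool" where
  "galois_extension L \<longleftrightarrow>
     subfield L ring_of_type_algebra \<and> range to_ac \<subseteq> L \<and>
     (\<forall>g :: 'a poly. Factorial_Ring.irreducible g \<and> (\<exists>x\<in>L. poly (map_poly to_ac g) x = 0) \<longrightarrow>
        (\<forall>y. poly (map_poly to_ac g) y = 0 \<longrightarrow> y \<in> L) \<and>
        rsquarefree (map_poly to_ac g))"

definition galois_group :: "'a :: field alg_closure set \<Rightarrow> ('a alg_closure \<Rightarrow> 'a alg_closure) monoid" where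
  "galois_group L = (BijGroup L)\<lparr>carrier :=
     {\<sigma> \<in> Bij L. \<sigma> \<in> ring_hom (ring_of_type_algebra\<lparr>carrier := L\<rparr>) (ring_of_type_algebra\<lparr>carrier := L\<rparr>)
        \<and> (\<forall>x. \<sigma> (to_ac x) = to_ac x)}\<rparr>"

definition galois_cyclic_of_degree :: "nat \<Rightarrow> 'a :: field alg_closure set \<Rightarrow> bool" where
  "galois_cyclic_of_degree n L \<longleftrightarrow>
     ring.dimension ring_of_type_algebra n (range to_ac) L \<and>
     galois_extension L \<and> cyclic_group (galois_group L)"

end

theory Submission
  imports Defs
begin

text \<open>
  Only the expansion of \<open>f\<close> near its root \<open>\<pi>\<close> and a little ramification theory are used. Let \<open>A\<close> be the
  valuation ring of \<open>K(\<pi>)\<close>.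

  If \<open>K(\<pi>)\<close> is cyclic with generator \<open>\<sigma>\<close>, then \<open>\<sigma> \<pi> - \<pi>\<close> has valuation \<open>2\<close> and \<open>\<sigma>\<^sup>p \<pi> - \<pi>\<close> has valuation
  \<open>p + 2\<close>: the element \<open>\<pi>\<^bsup>p-1\<^esup>\<close>, on which \<open>\<sigma> - 1\<close> gains more than one degree, bounds the depth of \<open>\<sigma>\<^sup>p\<close>,
  and an automorphism of order \<open>p\<close> cannot be too close to the identity. So the valuations of all
  conjugates \<open>\<sigma>\<^sup>k \<pi> - \<pi>\<close> are known, and the coefficients of \<open>X\<close> and \<open>X\<^sup>p\<close> in \<open>f(X + \<pi>)\<close> have valuations
  \<open>3p\<^sup>2 - p - 2\<close> and \<open>2p\<^sup>2 - 2p\<close>; this gives (1) and (2).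

  Under (1) and (2) one has \<open>f(\<pi>(1 + \<pi>s)) \<equiv> p \<pi>\<^bsup>p^2\<^esup> \<Sigma>(s)\<close> modulo \<open>\<pi>\<^bsup>3p^2+1\<^esup>\<close>, where
  \<open>\<Sigma> = \<rho>\<^sup>p + (\<phi>1/\<phi>0) \<pi>\<^bsup>p^2-p\<^esup> \<rho> + T\<close> and \<open>T\<close> is a power series in \<open>\<pi>\<^sup>p\<close> up to the precision needed. With
  \<open>s = \<theta> + \<pi>r\<close>, vanishing of \<open>\<Sigma>(s)\<close> forces \<open>\<pi>\<^sup>p\<close> to divide \<open>\<rho>\<close>, and then the coefficients of \<open>T\<close> at the powers
  of \<open>\<pi>\<^sup>p\<close> give (3), (4), (5) and (6) one after the other; the last one is the equation in (7) for the
  leading coefficient of \<open>\<rho>\<close>. Conversely, (3)-(7) provide an approximate root of \<open>f\<close>, which Newton iteration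
  refines to a root \<open>\<pi>'\<close> in \<open>A\<close>; the automorphism \<open>\<pi> \<mapsto> \<pi>'\<close> has order \<open>p\<^sup>2\<close> by the computation of the depth of
  its \<open>p\<close>-th power.
\<close>

section \<open>Totally ramified extensions of degree \<open>p\<^sup>2\<close>\<close>

text \<open>Put z = \<pi> s. The summands of \<Sigma> with the factor \<open>\<pi>^M\<close> form
  \<open>rho s\<close>. Raising to the p-th power modulo p \<pi> replaces z by z^p and each
  coefficient by its p-th power, so \<open>rho s ^ p\<close> resembles the remaining summands.
  Exchanging \<open>Lam (z^p)\<close> for \<open>rho s ^ p\<close> leaves discrepancies between
  coefficients and p-th powers of coefficients, and these are the quantities in (4), (5) and (6).
  Modulo p the ring A is a truncated polynomial ring in \<pi> over a perfect field, where p-th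
  powers have only exponents divisible by p; this isolates \<open>\<pi>^M * \<rho>\<close>. The
  precision 3p^2 + 1 is dictated by ramification. The lower breaks are 1 and p + 1, so differences
  of roots have valuation 2 or p + 2, and f' has valuation 3p^2 - p - 2 at a root. A value of f in
  \<pi>^(3p^2 + 1) is corrected by a multiple of \<pi>^(p + 3), which is closer than any two roots.
  Applied repeatedly to \<pi>, \<sigma> - 1 meets the vanishing factor p only at its last step,
  after all second-order terms have accumulated; from \<pi>^(p - 1) it meets it at the second
  step.\<close>

text \<open>\<open>R\<close> is the image of \<open>\<O>\<^sub>K\<close> in \<open>A = \<O>\<^sub>K[\<pi>]\<close>, the valuation ring of \<open>K(\<pi>)\<close>; only the ring structure
  and the divisibility relations that the proof uses are recorded.\<close>

locale totally_ramified =
  fixes p :: nat and R A :: "'b::field_char_0 set" and \<pi> :: 'b and res :: "'b \<Rightarrow> 'k::field"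
  assumes prime_p: "Factorial_Ring.prime p" and odd_p: "odd p"
    and R_subset: "R \<subseteq> A"
    and R_1: "1 \<in> R"
    and R_add: "\<lbrakk>x \<in> R; y \<in> R\<rbrakk> \<Longrightarrow> x + y \<in> R"
    and R_mult: "\<lbrakk>x \<in> R; y \<in> R\<rbrakk> \<Longrightarrow> x * y \<in> R"
    and R_uminus: "x \<in> R \<Longrightarrow> - x \<in> R"
    and A_add: "\<lbrakk>x \<in> A; y \<in> A\<rbrakk> \<Longrightarrow> x + y \<in> A"
    and A_mult: "\<lbrakk>x \<in> A; y \<in> A\<rbrakk> \<Longrightarrow> x * y \<in> A"
    and A_uminus: "x \<in> A \<Longrightarrow> - x \<in> A"
    and pi_nz: "\<pi> \<noteq> 0" and pi_in: "\<pi> \<in> A"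
    and res_add: "\<lbrakk>x \<in> A; y \<in> A\<rbrakk> \<Longrightarrow> res (x + y) = res x + res y"
    and res_mult: "\<lbrakk>x \<in> A; y \<in> A\<rbrakk> \<Longrightarrow> res (x * y) = res x * res y"
    and res_1: "res 1 = 1"
    and res_eq_0_iff: "x \<in> A \<Longrightarrow> res x = 0 \<longleftrightarrow> x / \<pi> \<in> A"
    and res_lift: "\<exists>a\<in>R. res a = t"
    and res_perfect: "\<exists>u. u ^ p = (t :: 'k)"
    and R_div_p: "\<lbrakk>x \<in> R; res x = 0\<rbrakk> \<Longrightarrow> x / of_nat p \<in> R"
    and R_inverse: "\<lbrakk>x \<in> R; res x \<noteq> 0\<rbrakk> \<Longrightarrow> inverse x \<in> R"
    and A_inverse: "\<lbrakk>x \<in> A; res x \<noteq> 0\<rbrakk> \<Longrightarrow> inverse x \<in> A"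
    and p_over_pi: "of_nat p / \<pi> ^ p^2 \<in> A" and pi_over_p: "\<pi> ^ p^2 / of_nat p \<in> A"
    and separated: "(\<And>k. x / \<pi> ^ k \<in> A) \<Longrightarrow> x = 0"
    and complete: "\<lbrakk>\<And>k. s k \<in> A; \<And>k. (s (Suc k) - s k) / \<pi> ^ k \<in> A\<rbrakk>
      \<Longrightarrow> \<exists>y\<in>A. \<forall>k. (y - s k) / \<pi> ^ k \<in> A"
begin

declare One_nat_def [simp del]

lemma p_ge_3: "p \<ge> 3"
  using prime_p odd_p prime_ge_2_nat[of p] by (cases "p = 2") auto

lemma p_pos [simp]: "p > 0" "p \<noteq> 0"
  using p_ge_3 by simp_all

lemma p_sq: "p^2 = p * p" by (simp add: power2_eq_square)

lemma p_nz [simp]: "(of_nat p :: 'b) \<noteq> 0"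
  using p_ge_3 by simp

lemma R_0: "0 \<in> R" using R_add[OF R_1 R_uminus[OF R_1]] by simp
lemma R_diff: "\<lbrakk>x \<in> R; y \<in> R\<rbrakk> \<Longrightarrow> x - y \<in> R"
  using R_add[of x "-y"] R_uminus by simp
lemma R_of_nat: "of_nat n \<in> R" by (induction n) (auto intro: R_0 R_1 R_add)
lemma R_power: "x \<in> R \<Longrightarrow> x ^ n \<in> R" by (induction n) (auto intro: R_1 R_mult)
lemma R_numeral: "numeral n \<in> R" using R_of_nat[of "numeral n"] by simp
lemma R_sum: "(\<And>i. i \<in> S \<Longrightarrow> f i \<in> R) \<Longrightarrow> sum f S \<in> R"
  by (induction S rule: infinite_finite_induct) (auto intro: R_0 R_add)
lemma R_divide: "\<lbrakk>x \<in> R; y \<in> R; res y \<noteq> 0\<rbrakk> \<Longrightarrow> x / y \<in> R"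
  by (simp add: divide_inverse R_mult R_inverse)

lemma R_A: "x \<in> R \<Longrightarrow> x \<in> A" using R_subset by auto
lemma A_0: "0 \<in> A" using R_0 R_A by auto
lemma A_1: "1 \<in> A" using R_1 R_A by auto
lemma A_diff: "\<lbrakk>x \<in> A; y \<in> A\<rbrakk> \<Longrightarrow> x - y \<in> A"
  using A_add[of x "-y"] A_uminus by simp
lemma A_of_nat: "of_nat n \<in> A" by (rule R_A[OF R_of_nat])
lemma A_power: "x \<in> A \<Longrightarrow> x ^ n \<in> A" by (induction n) (auto intro: A_1 A_mult)
lemma A_numeral: "numeral n \<in> A" by (rule R_A[OF R_numeral])
lemma A_sum: "(\<And>i. i \<in> S \<Longrightarrow> f i \<in> A) \<Longrightarrow> sum f S \<in> A"
  by (induction S rule: infinite_finite_induct) (auto intro: A_0 A_add)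
lemma A_divide: "\<lbrakk>x \<in> A; y \<in> A; res y \<noteq> 0\<rbrakk> \<Longrightarrow> x / y \<in> A"
  by (simp add: divide_inverse A_mult A_inverse)

lemmas A_closed = A_0 A_1 A_add A_mult A_uminus A_diff A_of_nat A_power A_numeral A_sum pi_in
lemmas R_closed = R_0 R_1 R_add R_mult R_uminus R_diff R_of_nat R_power R_numeral R_sum

lemma res_0: "res 0 = 0" by (simp add: res_eq_0_iff A_closed)
lemma res_uminus: "x \<in> A \<Longrightarrow> res (- x) = - res x"
  using res_add[of x "-x"] by (simp add: A_closed res_0 eq_neg_iff_add_eq_0 add.commute)
lemma res_diff: "\<lbrakk>x \<in> A; y \<in> A\<rbrakk> \<Longrightarrow> res (x - y) = res x - res y"
  using res_add[of x "-y"] by (simp add: A_closed res_uminus)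
lemma res_power: "x \<in> A \<Longrightarrow> res (x ^ n) = res x ^ n"
  by (induction n) (auto simp: res_1 res_mult A_closed)
lemma res_of_nat: "res (of_nat n) = of_nat n"
  by (induction n) (auto simp: res_0 res_1 res_add A_closed)
lemma res_numeral: "res (numeral n) = numeral n" using res_of_nat[of "numeral n"] by simp
lemma res_sum: "(\<And>i. i \<in> S \<Longrightarrow> f i \<in> A) \<Longrightarrow> res (sum f S) = (\<Sum>i\<in>S. res (f i))"
  by (induction S rule: infinite_finite_induct) (auto simp: res_0 res_add A_closed)
lemma res_inverse: "\<lbrakk>x \<in> A; res x \<noteq> 0\<rbrakk> \<Longrightarrow> res (inverse x) = inverse (res x)"
  using res_mult[of x "inverse x"] res_1 A_inverse[of x]
  by (cases "x = 0") (auto simp: res_0 inverse_unique)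
lemma res_divide: "\<lbrakk>x \<in> A; y \<in> A; res y \<noteq> 0\<rbrakk> \<Longrightarrow> res (x / y) = res x / res y"
  by (simp add: divide_inverse res_mult A_inverse res_inverse)

lemmas res_simps = res_0 res_1 res_add res_mult res_uminus res_diff res_of_nat res_power
  res_numeral

lemma res_pi: "res \<pi> = 0" by (simp add: res_eq_0_iff pi_in pi_nz A_1)

section \<open>The filtration of \<open>A\<close> by powers of \<open>\<pi>\<close>\<close>

definition I :: "nat \<Rightarrow> 'b set" where "I k = {x. x / \<pi> ^ k \<in> A}"

lemma I_0: "I 0 = A" by (simp add: I_def)

lemma I_iff: "x \<in> I k \<longleftrightarrow> (\<exists>y\<in>A. x = \<pi> ^ k * y)"
  using pi_nz by (force simp: I_def)

lemma pi_mult_I: "y \<in> A \<Longrightarrow> \<pi> ^ k * y \<in> I k" using I_iff by blast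

lemma I_E:
  assumes "x \<in> I k" obtains y where "y \<in> A" "x = \<pi> ^ k * y"
  using assms I_iff by blast

lemma I_add: "\<lbrakk>x \<in> I k; y \<in> I k\<rbrakk> \<Longrightarrow> x + y \<in> I k"
  by (simp add: I_def add_divide_distrib A_add)
lemma I_uminus: "x \<in> I k \<Longrightarrow> - x \<in> I k"
  using A_uminus[of "x / \<pi>^k"] by (simp add: I_def)
lemma I_diff: "\<lbrakk>x \<in> I k; y \<in> I k\<rbrakk> \<Longrightarrow> x - y \<in> I k"
  by (simp add: I_def diff_divide_distrib A_diff)
lemma I_zero: "0 \<in> I k" by (simp add: I_def A_0)
lemma I_mult: "\<lbrakk>x \<in> I j; y \<in> I k\<rbrakk> \<Longrightarrow> x * y \<in> I (j + k)"
  using A_mult[of "x / \<pi>^j" "y / \<pi>^k"] by (simp add: I_def power_add)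
lemma I_mono:
  assumes "x \<in> I k" "j \<le> k" shows "x \<in> I j"
proof -
  obtain y where "y \<in> A" "x = \<pi> ^ k * y" using assms by (elim I_E)
  then have "x = \<pi> ^ j * (\<pi> ^ (k - j) * y)"
    using assms(2) by (simp add: power_add[symmetric] mult.assoc[symmetric])
  then show ?thesis using \<open>y \<in> A\<close> by (auto simp: I_iff intro!: A_closed)
qed
lemma I_A: "x \<in> I k \<Longrightarrow> x \<in> A" using I_mono[of x k 0] by (simp add: I_0)
lemma A_I_mult: "\<lbrakk>x \<in> A; y \<in> I k\<rbrakk> \<Longrightarrow> x * y \<in> I k"
  using I_mult[of x 0 y k] by (simp add: I_0)
lemma I_A_mult: "\<lbrakk>x \<in> I k; y \<in> A\<rbrakk> \<Longrightarrow> x * y \<in> I k"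
  using I_mult[of x k y 0] by (simp add: I_0)
lemma I_sum: "(\<And>i. i \<in> S \<Longrightarrow> f i \<in> I k) \<Longrightarrow> sum f S \<in> I k"
  by (induction S rule: infinite_finite_induct) (auto intro: I_zero I_add)
lemma I_power: "x \<in> I k \<Longrightarrow> x ^ m \<in> I (k * m)"
  by (induction m) (auto simp: I_0 A_1 dest: I_mult)
lemma pi_I: "\<pi> ^ k \<in> I k" using pi_mult_I[OF A_1, of k] by simp
lemma I_div: "x \<in> I (j + k) \<Longrightarrow> x / \<pi> ^ j \<in> I k"
  by (simp add: I_def power_add mult.commute)
lemma I_pi_mult_iff: "\<pi> ^ j * x \<in> I (j + k) \<longleftrightarrow> x \<in> I k"
  using pi_nz by (simp add: I_def power_add)

lemma res_eq_0_I: "x \<in> A \<Longrightarrow> res x = 0 \<longleftrightarrow> x \<in> I 1"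
  by (simp add: res_eq_0_iff I_def)

lemma p_I: "of_nat p \<in> I (p^2)" using p_over_pi by (simp add: I_def)
lemma p_I_power: "of_nat p ^ k \<in> I (p^2 * k)" by (rule I_power[OF p_I])
lemma p_times_I: "x \<in> I k \<Longrightarrow> of_nat p * x \<in> I (p^2 + k)" by (rule I_mult[OF p_I])
lemma I_div_p:
  assumes "x \<in> I (p^2 + k)" shows "x / of_nat p \<in> I k"
proof -
  have "x / of_nat p = (x / \<pi> ^ p^2) * (\<pi> ^ p^2 / of_nat p)"
    using pi_nz by (simp add: field_simps)
  then show ?thesis using I_A_mult[OF I_div[OF assms] pi_over_p] by simp
qed
lemma I_p_mult_iff: "of_nat p * x \<in> I (p^2 + k) \<longleftrightarrow> x \<in> I k"
  using I_div_p[of "of_nat p * x" k] p_times_I by auto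

lemma res_p: "res (of_nat p) = 0"
  using p_I p_ge_3 by (subst res_eq_0_I) (auto intro: A_of_nat I_mono)
lemma of_nat_p_zero: "(of_nat p :: 'k) = 0" using res_p res_of_nat by simp

lemma R_I_1: "x \<in> R \<Longrightarrow> x \<in> I 1 \<longleftrightarrow> x / of_nat p \<in> R"
proof
  assume "x \<in> R" "x \<in> I 1"
  then show "x / of_nat p \<in> R" using R_div_p res_eq_0_I R_A by auto
next
  assume "x / of_nat p \<in> R"
  then have "of_nat p * (x / of_nat p) \<in> I (p^2)" using I_A_mult[OF p_I R_A] by blast
  then show "x \<in> I 1" using p_ge_3 by (auto intro: I_mono)
qed

text \<open>The base is unramified and p has valuation \<open>p^2\<close>, so the valuation of an
  element of \<open>R\<close> jumps from 0 to \<open>p^2\<close>. Hence a coefficient whose residue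
  vanishes disappears from all orders below \<open>p^2\<close> at once.\<close>

lemma R_I_1_p: "\<lbrakk>x \<in> R; x \<in> I 1\<rbrakk> \<Longrightarrow> x \<in> I (p^2)"
  using I_A_mult[OF p_I R_A, of "x / of_nat p"] R_I_1 by simp

lemma R_res_0_I: "\<lbrakk>x \<in> R; res x = 0\<rbrakk> \<Longrightarrow> x \<in> I (p^2)"
  using R_I_1_p res_eq_0_I R_A by blast

lemma A_approx: "x \<in> A \<Longrightarrow> \<exists>a\<in>R. x - a \<in> I 1"
  using res_lift[of "res x"]
  by (metis A_diff R_A res_diff res_eq_0_I right_minus_eq)

definition cg :: "nat \<Rightarrow> 'b \<Rightarrow> 'b \<Rightarrow> bool" where "cg k x y \<longleftrightarrow> x - y \<in> I k"

lemma cg_refl [simp]: "cg k x x" by (simp add: cg_def I_zero)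
lemma cg_sym: "cg k x y \<Longrightarrow> cg k y x" unfolding cg_def using I_uminus[of "x - y" k] by simp
lemma cg_trans [trans]: "\<lbrakk>cg k x y; cg k y z\<rbrakk> \<Longrightarrow> cg k x z"
  unfolding cg_def using I_add[of "x - y" k "y - z"] by simp
lemma cg_eq_trans [trans]: "\<lbrakk>x = y; cg k y z\<rbrakk> \<Longrightarrow> cg k x z" by simp
lemma cg_trans_eq [trans]: "\<lbrakk>cg k x y; y = z\<rbrakk> \<Longrightarrow> cg k x z" by simp
lemma cg_mono: "\<lbrakk>cg k x y; j \<le> k\<rbrakk> \<Longrightarrow> cg j x y" unfolding cg_def by (rule I_mono)
lemma cg_add: "\<lbrakk>cg k x x'; cg k y y'\<rbrakk> \<Longrightarrow> cg k (x + y) (x' + y')"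
  unfolding cg_def using I_add[of "x - x'" k "y - y'"] by (simp add: algebra_simps)
lemma cg_diff: "\<lbrakk>cg k x x'; cg k y y'\<rbrakk> \<Longrightarrow> cg k (x - y) (x' - y')"
  unfolding cg_def using I_diff[of "x - x'" k "y - y'"] by (simp add: algebra_simps)
lemma cg_uminus: "cg k x x' \<Longrightarrow> cg k (- x) (- x')"
  unfolding cg_def using I_uminus[of "x - x'" k] by (simp add: algebra_simps)
lemma cg_sum: "(\<And>i. i \<in> S \<Longrightarrow> cg k (f i) (g i)) \<Longrightarrow> cg k (sum f S) (sum g S)"
  unfolding cg_def using I_sum[of S "\<lambda>i. f i - g i" k] by (simp add: sum_subtractf)
lemma cg_mult_I: "\<lbrakk>x \<in> I j; cg k y y'\<rbrakk> \<Longrightarrow> cg (j + k) (x * y) (x * y')"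
  unfolding cg_def using I_mult[of x j "y - y'" k] by (simp add: algebra_simps)
lemma cg_mult_left: "\<lbrakk>x \<in> A; cg k y y'\<rbrakk> \<Longrightarrow> cg k (x * y) (x * y')"
  using cg_mult_I[of x 0 k] by (simp add: I_0)
lemma cg_mult_right: "\<lbrakk>x \<in> A; cg k y y'\<rbrakk> \<Longrightarrow> cg k (y * x) (y' * x)"
  using cg_mult_left[of x k y y'] by (simp add: mult.commute)
lemma cg_mult: "\<lbrakk>cg k x x'; cg k y y'; x \<in> A; y' \<in> A\<rbrakk> \<Longrightarrow> cg k (x * y) (x' * y')"
  using cg_trans[OF cg_mult_left[of x k y y'] cg_mult_right[of y' k x x']] by simp
lemma cg_A: "\<lbrakk>cg k x y; y \<in> A\<rbrakk> \<Longrightarrow> x \<in> A"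
  using A_add[of "x - y" y] I_A by (auto simp: cg_def)
lemma cg_I: "\<lbrakk>cg k x y; y \<in> I j; j \<le> k\<rbrakk> \<Longrightarrow> x \<in> I j"
  using I_add[of "x - y" j y] I_mono by (auto simp: cg_def)
lemma cg_power: "\<lbrakk>cg k x y; y \<in> A\<rbrakk> \<Longrightarrow> cg k (x ^ m) (y ^ m)"
  by (induction m) (auto intro!: cg_mult A_power intro: cg_A)
lemma cg_pi_mult: "cg k x y \<Longrightarrow> cg (j + k) (\<pi> ^ j * x) (\<pi> ^ j * y)"
  by (rule cg_mult_I[OF pi_I])
lemma cg_pi_div: "cg (j + k) x y \<Longrightarrow> cg k (x / \<pi> ^ j) (y / \<pi> ^ j)"
  unfolding cg_def using I_div[of "x - y" j k] by (simp add: diff_divide_distrib)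
lemma cg_p_mult: "cg k x y \<Longrightarrow> cg (p^2 + k) (of_nat p * x) (of_nat p * y)"
  by (rule cg_mult_I[OF p_I])
lemma cg_0_iff: "cg k x 0 \<longleftrightarrow> x \<in> I k" by (simp add: cg_def)
lemma cg_1_iff: "\<lbrakk>x \<in> A; y \<in> A\<rbrakk> \<Longrightarrow> cg 1 x y \<longleftrightarrow> res x = res y"
  by (simp add: cg_def res_eq_0_I[symmetric] A_diff res_diff)
text \<open>After splitting off \<open>\<pi>^(a * m)\<close> only the relative precision
  \<open>d\<close> matters, and it survives taking powers.\<close>

lemma cg_power_I:
  assumes "cg (a + d) x y" "y \<in> I a" "x \<in> I a"
  shows "cg (a * m + d) (x ^ m) (y ^ m)"
proof (cases m)
  case (Suc m')
  obtain x' y' where x': "x' \<in> A" "x = \<pi> ^ a * x'" and y': "y' \<in> A" "y = \<pi> ^ a * y'"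
    using assms by (meson I_E)
  have "\<pi> ^ a * (x' - y') \<in> I (a + d)" using assms(1) x' y' by (simp add: cg_def algebra_simps)
  then have "cg d x' y'" by (simp add: I_pi_mult_iff cg_def)
  from cg_pi_mult[OF cg_power[OF this y'(1), of m], of "a * m"]
  show ?thesis using x' y' by (simp add: power_mult_distrib power_mult)
qed (simp add: )

section \<open>Frobenius congruences modulo \<open>p\<close> and slightly beyond\<close>

lemma zero_power_p [simp]: "(0 :: 'c :: semiring_1) ^ p = 0"
  by (simp add: zero_power)

text \<open>This is ((1 + x)^p - 1 - x^p) / p, written with integral coefficients instead of a
  division.\<close>

definition Lam :: "'b \<Rightarrow> 'b" where
  "Lam x = (\<Sum>k\<in>{1..<p}. of_nat ((p choose k) div p) * x ^ k)"

lemma binomial_p_factor: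
  assumes "k \<in> {1..<p}"
  shows "(of_nat (p choose k) :: 'b) = of_nat p * of_nat ((p choose k) div p)"
proof -
  have "p dvd (p choose k)" using assms prime_p by (intro dvd_choose_prime) auto
  then show ?thesis by (metis dvd_mult_div_cancel of_nat_mult)
qed

lemma power_p_add:
  "(x + y) ^ p = x ^ p + y ^ p
     + of_nat p * (\<Sum>k\<in>{1..<p}. of_nat ((p choose k) div p) * x ^ k * y ^ (p - k))" for x y :: 'b
proof -
  have "(x + y) ^ p = (\<Sum>k\<le>p. of_nat (p choose k) * x ^ k * y ^ (p - k))"
    by (rule binomial_ring)
  also have "{..p} = insert 0 (insert p {1..<p})" using p_ge_3 by auto
  also have "(\<Sum>k\<in>insert 0 (insert p {1..<p}). of_nat (p choose k) * x ^ k * y ^ (p - k))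
      = y ^ p + (x ^ p + (\<Sum>k\<in>{1..<p}. of_nat (p choose k) * x ^ k * y ^ (p - k)))"
    using p_ge_3 by (simp add: One_nat_def)
  also have "(\<Sum>k\<in>{1..<p}. of_nat (p choose k) * x ^ k * y ^ (p - k))
      = of_nat p * (\<Sum>k\<in>{1..<p}. of_nat ((p choose k) div p) * x ^ k * y ^ (p - k))"
    unfolding sum_distrib_left
    by (rule sum.cong[OF refl], subst binomial_p_factor) (simp_all add: mult_ac)
  finally show ?thesis by (simp add: add_ac)
qed

lemma one_plus_power_p: "(1 + x) ^ p = 1 + x ^ p + of_nat p * Lam x" for x :: 'b
  using power_p_add[of x 1] by (simp add: Lam_def add_ac)

lemma Lam_A: "x \<in> A \<Longrightarrow> Lam x \<in> A"
  by (auto simp: Lam_def intro!: A_closed)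

lemma Lam_I: "x \<in> I k \<Longrightarrow> Lam x \<in> I k"
  unfolding Lam_def
proof (rule I_sum)
  fix i assume i: "i \<in> {1..<p}" and x: "x \<in> I k"
  have "x ^ i \<in> I k" using I_power[OF x, of i] i by (auto intro: I_mono)
  then show "of_nat ((p choose i) div p) * x ^ i \<in> I k" by (rule A_I_mult[OF A_of_nat])
qed

lemma cg_Lam: "\<lbrakk>cg k x y; y \<in> A\<rbrakk> \<Longrightarrow> cg k (Lam x) (Lam y)"
  unfolding Lam_def by (intro cg_sum cg_mult_left A_of_nat cg_power)

lemma Lam_first_order:
  assumes "x \<in> I k" shows "cg (2 * k) (Lam x) x"
proof -
  have eq: "{1..<p} = insert 1 {2..<p}" using p_ge_3 by auto
  have "Lam x - x = (\<Sum>i\<in>{2..<p}. of_nat ((p choose i) div p) * x ^ i)"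
    unfolding Lam_def eq by (simp add: One_nat_def)
  also have "\<dots> \<in> I (2 * k)"
  proof (rule I_sum)
    fix i assume i: "i \<in> {2..<p}"
    have "x ^ i \<in> I (2 * k)" using I_power[OF assms, of i] i by (auto intro: I_mono)
    then show "of_nat ((p choose i) div p) * x ^ i \<in> I (2 * k)" by (rule A_I_mult[OF A_of_nat])
  qed
  finally show ?thesis by (simp add: cg_def)
qed

text \<open>Every mixed binomial term has a factor p, of valuation \<open>p^2\<close>, and at least
  one factor \<open>y\<close>. The gain of \<open>k\<close> over the usual congruence modulo p is
  what makes the precision \<open>p^2 + 1\<close> available.\<close>

lemma cg_freshman:
  assumes "x \<in> A" "y \<in> I k"
  shows "cg (p^2 + k) ((x + y) ^ p) (x ^ p + y ^ p)"
proof -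
  have "(\<Sum>i\<in>{1..<p}. of_nat ((p choose i) div p) * x ^ i * y ^ (p - i)) \<in> I k"
  proof (rule I_sum)
    fix i assume i: "i \<in> {1..<p}"
    then have "k * 1 \<le> k * (p - i)" by (intro mult_le_mono2) auto
    then have "y ^ (p - i) \<in> I k" using I_power[OF assms(2), of "p - i"] by (auto intro: I_mono)
    then show "of_nat ((p choose i) div p) * x ^ i * y ^ (p - i) \<in> I k"
      using assms(1) by (intro A_I_mult) (auto intro!: A_closed)
  qed
  from p_times_I[OF this] show ?thesis unfolding power_p_add by (simp add: cg_def)
qed

lemma cg_freshman_diff:
  assumes "x \<in> A" "y \<in> I k"
  shows "cg (p^2 + k) ((x - y) ^ p) (x ^ p - y ^ p)"
  using cg_freshman[OF assms(1) I_uminus[OF assms(2)]] odd_p by simp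

lemma cg_freshman_sum:
  assumes "finite S" "\<And>i. i \<in> S \<Longrightarrow> f i \<in> I 1"
  shows "cg (p^2 + 1) ((sum f S) ^ p) (\<Sum>i\<in>S. f i ^ p)"
  using assms
proof (induction S rule: finite_induct)
  case empty then show ?case by simp
next
  case (insert i S)
  have "cg (p^2 + 1) ((f i + sum f S) ^ p) (f i ^ p + sum f S ^ p)"
    using insert by (intro cg_freshman I_sum) (auto intro: I_A)
  also have "cg (p^2 + 1) \<dots> (f i ^ p + (\<Sum>i\<in>S. f i ^ p))"
    using insert by (intro cg_add cg_refl) auto
  finally show ?case using insert by simp
qed

lemma cg_fermat: "cg (p^2) (of_nat m ^ p) (of_nat m)"
proof (induction m)
  case (Suc m)
  have "cg (p^2) ((1 + of_nat m) ^ p) (1 ^ p + of_nat m ^ p)"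
    using cg_freshman[of 1 "of_nat m" 0] by (simp add: I_0 A_closed)
  also have "cg (p^2) \<dots> (1 ^ p + of_nat m)" by (intro cg_add cg_refl Suc)
  finally show ?case by simp
qed simp

text \<open>The coefficients of \<open>Lam\<close> are integers and hence fixed by Frobenius modulo
  p; each term also contains a power of \<open>z\<close>, which supplies the extra factor
  \<pi>.\<close>

lemma Lam_power_p:
  assumes "z \<in> I 1" shows "cg (p^2 + 1) (Lam z ^ p) (Lam (z ^ p))"
proof -
  have "cg (p^2 + 1) (Lam z ^ p) (\<Sum>k\<in>{1..<p}. (of_nat ((p choose k) div p) * z ^ k) ^ p)"
    unfolding Lam_def
  proof (intro cg_freshman_sum)
    fix i assume i: "i \<in> {1..<p}"
    have "z ^ i \<in> I 1" using I_power[OF assms, of i] i by (auto intro: I_mono)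
    then show "of_nat ((p choose i) div p) * z ^ i \<in> I 1" by (rule A_I_mult[OF A_of_nat])
  qed simp
  also have "cg (p^2 + 1) \<dots> (Lam (z ^ p))"
    unfolding Lam_def
  proof (rule cg_sum)
    fix k assume k: "k \<in> {1..<p}"
    have "1 * 1 \<le> k * p" using k p_ge_3 by (intro mult_le_mono) auto
    then have "z ^ (k * p) \<in> I 1" using I_power[OF assms, of "k * p"] by (intro I_mono[of _ "1 * (k * p)" 1]) auto
    from cg_mult_I[OF this cg_fermat[of "(p choose k) div p"]]
    show "cg (p^2 + 1) ((of_nat ((p choose k) div p) * z ^ k) ^ p)
       (of_nat ((p choose k) div p) * (z ^ p) ^ k)"
      by (simp add: power_mult_distrib power_mult[symmetric] mult.commute add.commute)
  qed
  finally show ?thesis .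
qed

lemma one_plus_power_third:
  assumes "x \<in> A"
  shows "\<exists>t\<in>A. (1 + x) ^ m = 1 + of_nat m * x + of_nat (m choose 2) * x ^ 2 + t * x ^ 3"
proof (induction m)
  case 0 then show ?case by (auto intro!: bexI[of _ 0] A_0 simp: binomial_eq_0)
next
  case (Suc m)
  then obtain t where t: "t \<in> A"
    "(1 + x) ^ m = 1 + of_nat m * x + of_nat (m choose 2) * x ^ 2 + t * x ^ 3" by auto
  have "Suc m choose 2 = m + (m choose 2)"
    by (simp add: numeral_2_eq_2)
  then have "(1 + x) ^ Suc m = 1 + of_nat (Suc m) * x + of_nat (Suc m choose 2) * x ^ 2
       + (t + t * x + of_nat (m choose 2)) * x ^ 3"
    using t(2) by (simp add: algebra_simps power2_eq_square power3_eq_cube)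
  then show ?case using t(1) assms by (auto intro!: bexI A_closed)
qed

lemma one_plus_power_second:
  assumes "x \<in> A"
  shows "\<exists>t\<in>A. (1 + x) ^ m = 1 + of_nat m * x + t * x ^ 2"
proof -
  obtain t where t: "t \<in> A" "(1 + x) ^ m = 1 + of_nat m * x + of_nat (m choose 2) * x ^ 2 + t * x ^ 3"
    using one_plus_power_third[OF assms] by blast
  have "(1 + x) ^ m = 1 + of_nat m * x + (of_nat (m choose 2) + t * x) * x ^ 2"
    unfolding t(2) by (simp add: algebra_simps power2_eq_square power3_eq_cube)
  then show ?thesis using t(1) assms by (auto intro!: bexI A_closed)
qed

lemma cg_one_plus_power:
  assumes "x \<in> I k" shows "cg (2 * k) ((1 + x) ^ m) (1 + of_nat m * x)"
proof -
  obtain t where "t \<in> A" "(1 + x) ^ m = 1 + of_nat m * x + t * x ^ 2"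
    using one_plus_power_second[OF I_A[OF assms]] by blast
  moreover have "x ^ 2 \<in> I (2 * k)" using I_power[OF assms, of 2] by (simp add: mult.commute)
  ultimately show ?thesis by (simp add: cg_def A_I_mult)
qed

lemma cg_one_plus_power_quad:
  assumes "x \<in> I k"
  shows "cg (3 * k) ((1 + x) ^ m) (1 + of_nat m * x + of_nat (m choose 2) * x ^ 2)"
proof -
  obtain t where "t \<in> A" "(1 + x) ^ m = 1 + of_nat m * x + of_nat (m choose 2) * x ^ 2 + t * x ^ 3"
    using one_plus_power_third[OF I_A[OF assms]] by blast
  moreover have "x ^ 3 \<in> I (3 * k)" using I_power[OF assms, of 3] by (simp add: mult.commute)
  ultimately show ?thesis by (simp add: cg_def A_I_mult)
qed

lemma one_plus_power_I:
  assumes "x \<in> I k" shows "(1 + x) ^ m - 1 \<in> I k"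
proof -
  obtain t where t: "t \<in> A" "(1 + x) ^ m = 1 + of_nat m * x + t * x ^ 2"
    using one_plus_power_second[OF I_A[OF assms]] by blast
  have "(1 + x) ^ m - 1 = x * (of_nat m + t * x)"
    unfolding t by (simp add: algebra_simps power2_eq_square)
  also have "\<dots> \<in> I k" using t(1) I_A[OF assms] by (intro I_A_mult assms A_closed)
  finally show ?thesis .
qed

end

section \<open>The expansion of the polynomial at its root\<close>

text \<open>The coefficient of \<open>X\<^sup>i\<close> is \<open>a i\<close>, so the \<open>f\<^sub>i\<close> of conditions (1) and (2), which are assumed here, is
  \<open>a (p\<^sup>2 - i)\<close>.\<close>

locale wild_eisenstein = totally_ramified p R A \<pi> res
  for p :: nat and R A :: "'b::field_char_0 set" and \<pi> :: 'b and res :: "'b \<Rightarrow> 'k::field" +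
  fixes a :: "nat \<Rightarrow> 'b"
  assumes a_lead: "a (p^2) = 1"
    and a_const: "a 0 / of_nat p \<in> R" "res (a 0 / of_nat p) \<noteq> 0"
    and a_p: "a (p * (p - 1)) / of_nat p \<in> R" "res (a (p * (p - 1)) / of_nat p) \<noteq> 0"
    and a_mult_p: "q \<in> {1..<p - 1} \<Longrightarrow> a (p * q) / of_nat p ^ 2 \<in> R"
    and a_top: "j \<in> {1..<p} \<Longrightarrow> a (p * (p - 1) + j) / of_nat p ^ 2 \<in> R"
    and a_different: "a (p * (p - 1) - 1) / of_nat p ^ 2 \<in> R"
      "res (a (p * (p - 1) - 1) / of_nat p ^ 2) \<noteq> 0"
    and a_low: "\<lbrakk>i < p * (p - 1) - 1; \<not> p dvd i\<rbrakk> \<Longrightarrow> a i / of_nat p ^ 3 \<in> R"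
    and pi_root: "(\<Sum>i\<le>p\<^sup>2. a i * \<pi> ^ i) = 0"
begin

text \<open>For \<open>1 \<le> l < p\<close>, the numbers \<open>\<phi>0\<close>, \<open>\<phi>1\<close>, \<open>g\<close>, \<open>h (p - l)\<close> and \<open>k (p - l)\<close> lift
  \<open>F\<^bsub>p^2\<^esub>\<close>, \<open>F\<^sub>p\<close>, \<open>G\<^bsub>p+1\<^esub>\<close>, \<open>G\<^bsub>pl\<^esub>\<close> and \<open>G\<^sub>l\<close>.\<close>

definition \<phi>0 where "\<phi>0 = a 0 / of_nat p"
definition \<phi>1 where "\<phi>1 = a (p * (p - 1)) / of_nat p"
definition g where "g = a (p * (p - 1) - 1) / of_nat p ^ 2"
definition h where "h q = a (p * q) / of_nat p ^ 2"
definition k where "k j = a (p * (p - 1) + j) / of_nat p ^ 2"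

lemma coeff_R: "\<phi>0 \<in> R" "\<phi>1 \<in> R" "g \<in> R" "q \<in> {1..<p - 1} \<Longrightarrow> h q \<in> R" "j \<in> {1..<p} \<Longrightarrow> k j \<in> R"
  using a_const a_p a_mult_p a_top a_different unfolding \<phi>0_def \<phi>1_def g_def h_def k_def by auto

lemma coeff_A: "\<phi>0 \<in> A" "\<phi>1 \<in> A" "g \<in> A" "q \<in> {1..<p - 1} \<Longrightarrow> h q \<in> A" "j \<in> {1..<p} \<Longrightarrow> k j \<in> A"
  using coeff_R R_A by blast+

lemma coeff_unit: "res \<phi>0 \<noteq> 0" "res \<phi>1 \<noteq> 0" "res g \<noteq> 0"
  using a_const a_p a_different unfolding \<phi>0_def \<phi>1_def g_def by auto

lemma coeff_nz: "\<phi>0 \<noteq> 0" "\<phi>1 \<noteq> 0" "g \<noteq> 0"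
  using coeff_unit res_0 by metis+

text \<open>All coefficients outside the displayed groups are divisible by p^3, except the constant
  one, which \<open>u 0 = 0\<close> removes. The sequence \<open>u\<close> is left general: it is
  the powers of \<pi> for the equation of \<pi>, the increments at \<pi>(1 + \<pi>s) for the
  expansion, and the increments of a Newton step.\<close>

lemma sum_decomposition:
  fixes u :: "nat \<Rightarrow> 'b"
  assumes u0: "u 0 = 0" and u: "\<And>i. u i \<in> I m"
  shows "cg (3 * p^2 + m) (\<Sum>i\<le>p\<^sup>2. a i * u i)
    (u (p^2) + of_nat p * \<phi>1 * u (p * (p - 1))
      + of_nat p ^ 2 * (\<Sum>q\<in>{1..<p-1}. h q * u (p * q))
      + of_nat p ^ 2 * (\<Sum>j\<in>{1..<p}. k j * u (p * (p - 1) + j))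
      + of_nat p ^ 2 * g * u (p * (p - 1) - 1))"
proof -
  define M where "M = p * (p - 1)"
  have "p * 3 \<le> p * p" using p_ge_3 by (intro mult_le_mono2)
  moreover have "M = p * p - p" by (simp add: M_def diff_mult_distrib2)
  ultimately have M: "M + p = p^2" "M > p" "p dvd M"
    using p_ge_3 p_sq unfolding M_def by (linarith, linarith, simp)
  define T1 where "T1 = (\<lambda>q. p * q) ` {1..<p-1}"
  define T2 where "T2 = (\<lambda>j. M + j) ` {1..<p}"
  define S where "S = insert 0 (insert (p^2) (insert M (insert (M - 1) (T1 \<union> T2))))"
  have S1: "x \<le> M - p \<and> x \<noteq> 0 \<and> p dvd x" if "x \<in> T1" for x
  proof -
    from that obtain q where "x = p * q" "q \<in> {1..<p-1}" unfolding T1_def by blast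
    moreover have "p * q \<le> p * (p - 2)" using calculation by (intro mult_le_mono2) auto
    moreover have "p * (p - 2) = M - p" unfolding M_def by (simp add: diff_mult_distrib2 algebra_simps)
    ultimately show ?thesis by auto
  qed
  have S2: "x > M \<and> x < p^2" if "x \<in> T2" for x
    using that M unfolding T2_def by auto
  have M1: "\<not> p dvd M - 1"
  proof
    assume "p dvd M - 1"
    with M(3) have "p dvd M - (M - 1)" by (rule dvd_diff_nat)
    moreover have "M - (M - 1) = 1" using M by linarith
    ultimately have "p dvd 1" by metis
    then show False using p_ge_3 dvd_imp_le[of p 1] by simp
  qed
  have fin: "finite T1" "finite T2" unfolding T1_def T2_def by simp_all
  have ord: "M < p^2" "M - 1 < M" "M - p < M - 1" "0 < M - p"
    using M p_ge_3 by linarith+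
  have sub: "S \<subseteq> {..p^2}" unfolding S_def using S1 S2 ord by fastforce
  \<comment> \<open>An exponent above M lies in \<open>T2\<close> or equals \<open>p^2\<close>, and
    a multiple of p below M is 0 or lies in \<open>T1\<close>. What is left is below M - 1 and prime
    to p.\<close>
  have rest: "a i * u i \<in> I (3 * p^2 + m)" if i: "i \<in> {..p^2} - S" for i
  proof -
    have "i < M - 1"
    proof (rule ccontr)
      assume "\<not> i < M - 1"
      then consider "i = M - 1" | "i = M" | "i = p^2" | "i > M" "i < p^2" using i by force
      then show False
      proof cases
        case 4
        then have "i = M + (i - M)" "i - M \<in> {1..<p}" using M by auto
        then have "i \<in> T2" unfolding T2_def by blast
        then show False using i by (auto simp: S_def)
      qed (use i in \<open>auto simp: S_def\<close>)
    qed
    moreover have "\<not> p dvd i"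
    proof
      assume "p dvd i"
      then obtain q where q: "i = p * q" by auto
      have "p * q < M" using q \<open>i < M - 1\<close> by linarith
      then have "p * q < p * (p - 1)" unfolding M_def .
      then have "q < p - 1" by simp
      moreover have "q \<noteq> 0" using i q by (auto simp: S_def)
      ultimately have "i \<in> T1" using q unfolding T1_def by auto
      then show False using i by (auto simp: S_def)
    qed
    ultimately have "a i / of_nat p ^ 3 \<in> A" using a_low R_A unfolding M_def by blast
    then have "of_nat p ^ 3 * (a i / of_nat p ^ 3) \<in> I (p^2 * 3)"
      by (intro I_A_mult p_I_power)
    then have "a i \<in> I (3 * p^2)" by (simp add: mult.commute)
    then show ?thesis using u by (rule I_mult)
  qed
  have inj: "inj_on (\<lambda>q. p * q) {1..<p-1}" by (auto simp: inj_on_def)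
  have "M - 1 \<notin> T1" using S1 M1 by blast
  moreover have "M - 1 \<notin> T2" using S2[of "M - 1"] ord by linarith
  moreover have "M \<notin> T1" using S1[of M] ord by linarith
  moreover have "M \<notin> T2" using S2[of M] by blast
  moreover have "p^2 \<notin> T1" using S1[of "p^2"] ord by linarith
  moreover have "p^2 \<notin> T2" using S2[of "p^2"] by blast
  moreover have "0 \<notin> T1" using S1[of 0] by blast
  moreover have "0 \<notin> T2" using S2[of 0] by blast
  moreover have "T1 \<inter> T2 = {}" using S1 S2 ord by fastforce
  moreover have "0 \<noteq> p^2" "0 \<noteq> M" "0 \<noteq> M - 1" "p^2 \<noteq> M" "p^2 \<noteq> M - 1" "M \<noteq> M - 1"
    using ord by linarith+
  ultimately have eq: "(\<Sum>i\<in>S. a i * u i) = a 0 * u 0 + (a (p^2) * u (p^2) + (a M * u M + (a (M - 1) * u (M - 1) +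
     ((\<Sum>i\<in>T1. a i * u i) + (\<Sum>i\<in>T2. a i * u i)))))"
    unfolding S_def using fin by (simp add: sum.union_disjoint del: add_eq_0_iff_both_eq_0 mult_eq_0_iff)
  have eq1: "(\<Sum>i\<in>T1. a i * u i) = of_nat p ^ 2 * (\<Sum>q\<in>{1..<p-1}. h q * u (p * q))"
    unfolding sum_distrib_left T1_def using inj by (simp add: sum.reindex h_def mult.assoc[symmetric])
  have eq2: "(\<Sum>i\<in>T2. a i * u i) = of_nat p ^ 2 * (\<Sum>j\<in>{1..<p}. k j * u (M + j))"
    unfolding sum_distrib_left T2_def
    by (subst sum.reindex) (auto simp: k_def M_def inj_on_def intro!: sum.cong)
  have "(\<Sum>i\<le>p\<^sup>2. a i * u i) = (\<Sum>i\<in>S. a i * u i) + (\<Sum>i\<in>{..p^2} - S. a i * u i)"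
    using sum.subset_diff[OF sub, of "\<lambda>i. a i * u i"] by (simp add: add.commute)
  moreover have "(\<Sum>i\<in>{..p^2} - S. a i * u i) \<in> I (3 * p^2 + m)" by (rule I_sum[OF rest])
  ultimately have "cg (3 * p^2 + m) (\<Sum>i\<le>p\<^sup>2. a i * u i) (\<Sum>i\<in>S. a i * u i)"
    by (simp add: cg_def)
  moreover have "a M = of_nat p * \<phi>1" "a (M - 1) = of_nat p ^ 2 * g"
    by (simp_all add: \<phi>1_def g_def M_def)
  ultimately show ?thesis unfolding eq eq1 eq2 using u0 a_lead by (simp add: M_def add_ac)
qed

end

context totally_ramified
begin

lemma power_perturb:
  assumes "x \<in> A" "y \<in> A"
  shows "\<exists>t\<in>A. (x + y) ^ Suc m = x ^ Suc m + of_nat (Suc m) * x ^ m * y + t * y ^ 2"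
proof (induction m)
  case 0 then show ?case by (auto intro!: bexI[of _ 0] A_0)
next
  case (Suc m)
  then obtain t where t: "t \<in> A" "(x + y) ^ Suc m = x ^ Suc m + of_nat (Suc m) * x ^ m * y + t * y ^ 2"
    by blast
  have "(x + y) ^ Suc (Suc m) = (x + y) * (x + y) ^ Suc m" by simp
  also have "\<dots> = x ^ Suc (Suc m) + of_nat (Suc (Suc m)) * x ^ Suc m * y
      + (of_nat (Suc m) * x ^ m + t * x + t * y) * y ^ 2"
    unfolding t(2) by (simp add: algebra_simps power2_eq_square)
  finally show ?case using t(1) assms by (auto intro!: bexI A_closed)
qed

lemma cg_power_perturb:
  assumes "x \<in> A" "y \<in> I j"
  shows "cg (2 * j) ((x + y) ^ Suc m) (x ^ Suc m + of_nat (Suc m) * x ^ m * y)"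
proof -
  obtain t where "t \<in> A" "(x + y) ^ Suc m = x ^ Suc m + of_nat (Suc m) * x ^ m * y + t * y ^ 2"
    using power_perturb[OF assms(1) I_A[OF assms(2)]] by blast
  moreover have "y ^ 2 \<in> I (2 * j)" using I_power[OF assms(2), of 2] by (simp add: mult.commute)
  ultimately show ?thesis by (simp add: cg_def A_I_mult)
qed

text \<open>The monomial \<open>X^M\<close> carries the coefficient f_p. Since M + p = p^2, the
  terms \<open>\<rho>^p\<close> and \<open>\<pi>^M * \<rho>\<close> have equal order exactly when
  \<rho> has valuation p.\<close>

definition M where "M = p * (p - 1)"

lemma M_facts: "M + p = p^2" "2 * p \<le> M" "p + 3 \<le> M" "p * (p - 2) + p = M" "M - 1 = p * (p - 2) + (p - 1)"
proof -
  have "M = p * p - p" by (simp add: M_def diff_mult_distrib2)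
  moreover have 1: "3 * p \<le> p * p" using p_ge_3 by (intro mult_le_mono1)
  ultimately show "M + p = p^2" "2 * p \<le> M" "p + 3 \<le> M"
    using p_sq p_ge_3 by linarith+
  have "p - 1 = Suc (p - 2)" using p_ge_3 by linarith
  then show *: "p * (p - 2) + p = M" unfolding M_def by (metis mult_Suc_right add.commute)
  show "M - 1 = p * (p - 2) + (p - 1)" using * p_ge_3 by linarith
qed

lemma one_le_p_sq: "1 \<le> p^2" using p_ge_3 by (simp add: Suc_le_eq One_nat_def)

lemma one_le_p_mult: "1 \<le> j \<Longrightarrow> 1 \<le> p * j"
  using p_ge_3 by (simp add: Suc_le_eq One_nat_def)

lemma one_plus_power_mult_p:
  assumes "z \<in> A"
  shows "(1 + z) ^ (p * q) = (1 + (z ^ p + of_nat p * Lam z)) ^ q"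
  unfolding power_mult one_plus_power_p by (simp add: add_ac)

end

context wild_eisenstein
begin

text \<open>Solve f(\<pi>) = 0 for the leading power. Besides the constant term and the one at
  \<open>X^M\<close>, every term has a coefficient divisible by p^2 and a factor \<pi>, so it has
  valuation at least 2p^2 + 1.\<close>

lemma pi_power_p_sq: "cg (2 * p^2 + 1) (\<pi> ^ p^2) (- (of_nat p * (\<phi>0 + \<phi>1 * \<pi> ^ M)))"
proof -
  \<comment> \<open>The constant term is set to 0 to suit \<open>sum_decomposition\<close> and is
    restored at the end.\<close>
  define u where "u i = (if i = 0 then 0 else \<pi> ^ i)" for i
  have u: "u i \<in> I 1" for i
    using pi_I[of i] I_mono[of "\<pi> ^ i" i 1] by (cases "i = 0") (simp_all add: u_def I_zero)
  have "cg (2 * p^2 + 1) (\<Sum>i\<le>p\<^sup>2. a i * u i) (u (p^2) + of_nat p * \<phi>1 * u M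
      + of_nat p ^ 2 * (\<Sum>q\<in>{1..<p-1}. h q * u (p * q))
      + of_nat p ^ 2 * (\<Sum>j\<in>{1..<p}. k j * u (M + j))
      + of_nat p ^ 2 * g * u (M - 1))"
    by (rule cg_mono[OF sum_decomposition[of u 1, folded M_def]]) (simp_all add: u u_def[of 0])
  also have "cg (2 * p^2 + 1) \<dots> (u (p^2) + of_nat p * \<phi>1 * u M + 0 + 0 + 0)"
  proof (intro cg_add cg_refl)
    have p2: "of_nat p ^ 2 \<in> I (2 * p^2)" using p_I_power[of 2] by (simp add: mult.commute)
    show "cg (2 * p^2 + 1) (of_nat p ^ 2 * (\<Sum>q\<in>{1..<p-1}. h q * u (p * q))) 0"
      unfolding cg_0_iff by (intro I_mult p2 I_sum A_I_mult u coeff_A)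
    show "cg (2 * p^2 + 1) (of_nat p ^ 2 * (\<Sum>j\<in>{1..<p}. k j * u (M + j))) 0"
      unfolding cg_0_iff by (intro I_mult p2 I_sum A_I_mult u coeff_A)
    show "cg (2 * p^2 + 1) (of_nat p ^ 2 * g * u (M - 1)) 0"
      unfolding cg_0_iff by (intro I_mult I_A_mult p2 u coeff_A)
  qed
  finally have 1: "cg (2 * p^2 + 1) (\<Sum>i\<le>p\<^sup>2. a i * u i) (\<pi> ^ p^2 + of_nat p * \<phi>1 * \<pi> ^ M)"
    using p_ge_3 M_facts(3) by (simp add: u_def)
  have "(\<Sum>i\<le>p\<^sup>2. a i * \<pi> ^ i) = a 0 + (\<Sum>i\<le>p\<^sup>2. a i * u i)"
    by (simp add: sum.atMost_shift u_def)
  then have "(\<Sum>i\<le>p\<^sup>2. a i * u i) = - (of_nat p * \<phi>0)"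
    using pi_root by (simp add: \<phi>0_def add_eq_0_iff)
  with 1 have "cg (2 * p^2 + 1) (\<pi> ^ p^2 + of_nat p * \<phi>1 * \<pi> ^ M) (- (of_nat p * \<phi>0))"
    using cg_sym by metis
  from cg_diff[OF this cg_refl[of _ "of_nat p * \<phi>1 * \<pi> ^ M"]]
  show ?thesis by (simp add: algebra_simps)
qed

text \<open>In the exact relation between p and \<pi>^(p^2) the unit \<phi>0 + \<phi>1 \<pi>^M may
  be cut down to \<phi>0 at the cost of relative precision M.\<close>

lemma p_approx: "cg (p^2 + M) (of_nat p) (- (1 / \<phi>0) * \<pi> ^ p^2)"
proof -
  have "cg (p^2 + M) (\<pi> ^ p^2) (- (of_nat p * (\<phi>0 + \<phi>1 * \<pi> ^ M)))"
    by (rule cg_mono[OF pi_power_p_sq]) (use M_facts p_ge_3 in arith)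
  also have "cg (p^2 + M) \<dots> (- (of_nat p * (\<phi>0 + 0)))"
    by (intro cg_uminus cg_p_mult cg_add cg_refl, unfold cg_0_iff)
       (intro A_I_mult coeff_A pi_I)
  finally have "cg (p^2 + M) (- (1 / \<phi>0) * \<pi> ^ p^2) (- (1 / \<phi>0) * (- (of_nat p * \<phi>0)))"
    by (intro cg_mult_left A_uminus A_divide A_1 coeff_A coeff_unit) simp
  then have "cg (p^2 + M) (- (1 / \<phi>0) * \<pi> ^ p^2) (of_nat p)" using coeff_nz by simp
  then show ?thesis by (rule cg_sym)
qed

definition f_eval :: "'b \<Rightarrow> 'b" where "f_eval x = (\<Sum>i\<le>p\<^sup>2. a i * x ^ i)"

text \<open>The contributions of \<open>X^M\<close>, of the \<open>X^(M + j)\<close> and of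
  \<open>X^(M - 1)\<close> that share the factor \<open>\<phi>1 / \<phi>0 * \<pi>^M\<close>. In the
  last one, (1 + \<pi>s)^(M - 1) is rewritten by means of M - 1 = p(p - 2) + (p - 1).\<close>

definition rho :: "'b \<Rightarrow> 'b" where
  "rho s = Lam (\<pi> * s) - (\<Sum>j\<in>{1..<p}. k j / \<phi>1 * (\<pi> ^ j * ((1 + \<pi> * s) ^ j - 1)))
     - g / \<phi>1 * (((1 + (\<pi> * s) ^ p) ^ (p - 2) * (1 + \<pi> * s) ^ (p - 1) - 1) / \<pi>)"

text \<open>The quotient of f(\<pi>(1 + \<pi>s)) by p \<pi>^(p^2) up to order \<open>p^2\<close>.
  The first two summands come from \<open>X^(p^2)\<close>, the third from \<open>X^M\<close>, and
  the last from the multiples of p below M.\<close>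

definition Sigma_p :: "'b \<Rightarrow> 'b" where
  "Sigma_p s = - ((\<phi>0 + \<phi>1 * \<pi> ^ M) * s ^ p^2) + Lam ((\<pi> * s) ^ p)
     + \<phi>1 * (((1 + (\<pi> * s) ^ p) ^ (p - 1) - 1) / \<pi> ^ p) + \<phi>1 / \<phi>0 * \<pi> ^ M * rho s
     - 1 / \<phi>0 * (\<Sum>q\<in>{1..<p-1}. h q * (\<pi> ^ (p * q) * ((1 + (\<pi> * s) ^ p) ^ q - 1)))"

lemma f_eval_diff: "f_eval (\<pi> * (1 + z)) = (\<Sum>i\<le>p\<^sup>2. a i * (\<pi> ^ i * ((1 + z) ^ i - 1)))"
proof -
  have "f_eval (\<pi> * (1 + z)) = (\<Sum>i\<le>p\<^sup>2. a i * \<pi> ^ i) + (\<Sum>i\<le>p\<^sup>2. a i * (\<pi> ^ i * ((1 + z) ^ i - 1)))"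
    unfolding f_eval_def sum.distrib[symmetric]
    by (intro sum.cong refl, subst power_mult_distrib) (simp add: right_diff_distrib)
  then show ?thesis using pi_root by simp
qed

text \<open>With \<open>E = z^p + p * Lam z\<close> one has (1 + z)^(p q) = (1 + E)^q. The
  correction \<open>p * Lam z\<close> survives only at \<open>X^M\<close>, where it produces the
  first term of \<open>rho\<close>: at \<open>X^(p^2)\<close> the outer p-th power suppresses it,
  and the other coefficients already carry two factors p.\<close>

lemma f_eval_expansion:
  assumes s: "s \<in> A"
  shows "cg (3 * p^2 + 1) (f_eval (\<pi> * (1 + \<pi> * s))) (of_nat p * (\<pi> ^ p^2 * Sigma_p s))"
proof -
  define z where "z = \<pi> * s"
  define Y where "Y = z ^ p"
  define E where "E = Y + of_nat p * Lam z"
  have n: "M + p = p^2" "2 * p \<le> M" "p + 3 \<le> M" by (rule M_facts)+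
  have ex: "p^2 + (p^2 + (p^2 + 1)) = 3 * p^2 + 1" "p^2 + (2 * p^2 + 1) = 3 * p^2 + 1"
    "p^2 + (M + (p^2 + p + 1)) = 3 * p^2 + 1" "p + (M + 1) = p^2 + 1"
    "p + 1 + (p^2 + M) = 2 * p^2 + 1" "p^2 + 1 + p = p^2 + p + 1"
    using n by linarith+
  have z: "z \<in> I 1" unfolding z_def using pi_mult_I[OF s, of 1] by simp
  have zA: "z \<in> A" using z I_A by blast
  have Y: "Y \<in> I p" using I_power[OF z, of p] by (simp add: Y_def)
  have YA: "Y \<in> A" using Y I_A by blast
  have LamA: "Lam z \<in> A" by (rule Lam_A[OF zA])
  have eta: "of_nat p * Lam z \<in> I (p^2 + 1)" by (intro p_times_I Lam_I z)
  have EY: "cg (p^2 + 1) E Y" using eta by (simp add: E_def cg_def)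
  have EA: "E \<in> A" using EY YA cg_A by blast
  have E: "E \<in> I p" using cg_I[OF EY Y] n by linarith
  have zE: "(1 + z) ^ (p * q) = (1 + E) ^ q" for q
    unfolding E_def Y_def by (rule one_plus_power_mult_p[OF zA])
  define u where "u i = \<pi> ^ i * ((1 + z) ^ i - 1)" for i
  have u: "u i \<in> I 1" for i unfolding u_def
    by (intro A_I_mult one_plus_power_I z A_closed)
  have dec: "cg (3 * p^2 + 1) (f_eval (\<pi> * (1 + z))) (u (p^2) + of_nat p * \<phi>1 * u M
      + of_nat p ^ 2 * (\<Sum>q\<in>{1..<p-1}. h q * u (p * q))
      + of_nat p ^ 2 * (\<Sum>j\<in>{1..<p}. k j * u (M + j))
      + of_nat p ^ 2 * g * u (M - 1))"
    unfolding f_eval_diff u_def[symmetric] by (intro sum_decomposition[folded M_def] u) (simp add: u_def)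
  have inv: "1 / \<phi>0 \<in> A" by (intro A_divide A_1 coeff_A coeff_unit)
  \<comment> \<open>One of the two factors p becomes a multiple of \<pi>^(p^2). The relative error
    \<pi>^M is harmless because \<open>y'\<close> contributes p + 1 and M + p + 1 = p^2 + 1.\<close>
  have trade: "cg (3 * p^2 + 1) (of_nat p ^ 2 * y) (of_nat p * (\<pi> ^ p^2 * (- (1 / \<phi>0) * y')))"
    if "cg (p^2 + 1) y y'" "y' \<in> I (p + 1)" for y y'
  proof -
    have 1: "cg (3 * p^2 + 1) (of_nat p * (of_nat p * y)) (of_nat p * (of_nat p * y'))"
      using cg_p_mult[OF cg_p_mult[OF that(1)]] by (simp only: ex)
    have "cg (p + 1 + (p^2 + M)) (y' * of_nat p) (y' * (- (1 / \<phi>0) * \<pi> ^ p^2))"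
      by (rule cg_mult_I[OF that(2) p_approx])
    then have "cg (2 * p^2 + 1) (of_nat p * y') (y' * (- (1 / \<phi>0) * \<pi> ^ p^2))"
      by (simp only: ex mult.commute[of y' "of_nat p"])
    from cg_p_mult[OF this] have "cg (3 * p^2 + 1) (of_nat p * (of_nat p * y'))
       (of_nat p * (y' * (- (1 / \<phi>0) * \<pi> ^ p^2)))" by (simp only: ex)
    from cg_trans[OF 1 this] show ?thesis by (simp add: power2_eq_square mult_ac)
  qed
  have t1: "cg (3 * p^2 + 1) (u (p^2)) (of_nat p * (\<pi> ^ p^2 * (- ((\<phi>0 + \<phi>1 * \<pi> ^ M) * s ^ p^2) + Lam Y)))"
  proof -
    have "u (p^2) = \<pi> ^ p^2 * E ^ p + of_nat p * (\<pi> ^ p^2 * Lam E)"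
      unfolding u_def p_sq zE one_plus_power_p by (simp add: algebra_simps)
    also have "cg (3 * p^2 + 1) \<dots> (of_nat p * (\<pi> ^ p^2 * (- ((\<phi>0 + \<phi>1 * \<pi> ^ M) * s ^ p^2)))
       + of_nat p * (\<pi> ^ p^2 * Lam Y))"
    proof (rule cg_add)
      have "cg (p^2 + (p^2 + (p^2 + 1))) (of_nat p * (\<pi> ^ p^2 * Lam E)) (of_nat p * (\<pi> ^ p^2 * Lam Y))"
        by (intro cg_p_mult cg_pi_mult cg_Lam EY YA)
      then show "cg (3 * p^2 + 1) (of_nat p * (\<pi> ^ p^2 * Lam E)) (of_nat p * (\<pi> ^ p^2 * Lam Y))"
        by (simp only: ex)
    next
      have "cg (p + (M + 1)) E Y" using EY by (simp only: ex)
      from cg_power_I[OF this Y E, of p] have "cg (p^2 + (M + 1)) (E ^ p) (Y ^ p)" by (simp add: p_sq)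
      moreover have "Y ^ p = \<pi> ^ p^2 * s ^ p^2"
        unfolding Y_def z_def power_mult[symmetric] p_sq power_mult_distrib ..
      ultimately have E1: "cg (p^2 + (M + 1)) (E ^ p) (\<pi> ^ p^2 * s ^ p^2)" by simp
      obtain H where H: "H \<in> A" "E = \<pi> ^ p * H" using E by (elim I_E)
      have "E ^ p = \<pi> ^ p^2 * H ^ p" unfolding H(2) power_mult_distrib power_mult[symmetric] p_sq ..
      with E1 have "\<pi> ^ p^2 * (H ^ p - s ^ p^2) \<in> I (p^2 + (M + 1))" by (simp add: cg_def algebra_simps)
      then have Hs: "H ^ p - s ^ p^2 \<in> I (M + 1)" by (simp only: I_pi_mult_iff)
      \<comment> \<open>Division by \<pi>^p leaves a congruence of precision M + 1 between
        \<open>H\<close> and \<open>s^p\<close>; taking p-th powers raises this to at least p^2 +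
        1.\<close>
      have HH: "cg (p^2 + 1) (H ^ p) (s ^ p^2)"
      proof -
        have "cg (p + (M + 1)) (\<pi> ^ p * H) (\<pi> ^ p * s ^ p)"
          using \<open>cg (p + (M + 1)) E Y\<close> unfolding H(2) Y_def z_def power_mult_distrib .
        then have "cg (M + 1) H (s ^ p)"
          unfolding cg_def right_diff_distrib[symmetric] I_pi_mult_iff .
        then have "H - s ^ p \<in> I (M + 1)" by (simp add: cg_def)
        from cg_freshman[OF A_power[OF s, of p] this, of ]
        have "cg (p^2 + (M + 1)) (H ^ p) ((s ^ p) ^ p + (H - s ^ p) ^ p)" by simp
        then have "cg (p^2 + 1) (H ^ p) ((s ^ p) ^ p + (H - s ^ p) ^ p)" by (rule cg_mono) simp
        also have "cg (p^2 + 1) \<dots> ((s ^ p) ^ p + 0)"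
        proof (intro cg_add cg_refl, unfold cg_0_iff)
          have "(M + 1) * 2 \<le> (M + 1) * p" using p_ge_3 by (intro mult_le_mono2) simp
          moreover have "p^2 + 1 \<le> (M + 1) * 2" unfolding n(1)[symmetric] using n(3) by simp
          ultimately have "p^2 + 1 \<le> (M + 1) * p" by (rule order_trans[rotated])
          then show "(H - s ^ p) ^ p \<in> I (p^2 + 1)"
            using I_power[OF \<open>H - s ^ p \<in> I (M + 1)\<close>, of p] by (rule I_mono[rotated])
        qed
        finally show ?thesis by (simp add: power_mult[symmetric] p_sq)
      qed
      have "\<pi> ^ p^2 * E ^ p = H ^ p * \<pi> ^ p^2 * \<pi> ^ p^2" by (simp add: \<open>E ^ p = _\<close>)
      also have "cg (p^2 + (2 * p^2 + 1)) \<dots> (H ^ p * \<pi> ^ p^2 * (- (of_nat p * (\<phi>0 + \<phi>1 * \<pi> ^ M))))"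
        by (intro cg_mult_I A_I_mult pi_I A_closed H pi_power_p_sq)
      also have "H ^ p * \<pi> ^ p^2 * (- (of_nat p * (\<phi>0 + \<phi>1 * \<pi> ^ M)))
         = of_nat p * (\<pi> ^ p^2 * (- ((\<phi>0 + \<phi>1 * \<pi> ^ M) * H ^ p)))" by (simp add: algebra_simps)
      also have "cg (p^2 + (2 * p^2 + 1)) \<dots> (of_nat p * (\<pi> ^ p^2 * (- ((\<phi>0 + \<phi>1 * \<pi> ^ M) * s ^ p^2))))"
      proof -
        have "cg (p^2 + (p^2 + (p^2 + 1))) (of_nat p * (\<pi> ^ p^2 * (- ((\<phi>0 + \<phi>1 * \<pi> ^ M) * H ^ p))))
            (of_nat p * (\<pi> ^ p^2 * (- ((\<phi>0 + \<phi>1 * \<pi> ^ M) * s ^ p^2))))"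
          by (intro cg_p_mult cg_pi_mult cg_uminus cg_mult_left HH A_closed coeff_A)
        then show ?thesis by (simp only: ex)
      qed
      finally show "cg (3 * p^2 + 1) (\<pi> ^ p^2 * E ^ p)
          (of_nat p * (\<pi> ^ p^2 * (- ((\<phi>0 + \<phi>1 * \<pi> ^ M) * s ^ p^2))))" by (simp only: ex)
    qed
    finally show ?thesis by (simp only: distrib_left)
  qed
  have t2: "cg (3 * p^2 + 1) (of_nat p * \<phi>1 * u M)
     (of_nat p * (\<pi> ^ p^2 * (\<phi>1 * (((1 + Y) ^ (p - 1) - 1) / \<pi> ^ p) + \<phi>1 / \<phi>0 * \<pi> ^ M * Lam z)))"
  proof -
    obtain m where m: "p - 1 = Suc m" using p_ge_3 by (cases "p - 1") auto
    have "1 + E = (1 + Y) + of_nat p * Lam z" by (simp add: E_def)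
    then have "cg (2 * (p^2 + 1)) ((1 + E) ^ (p - 1))
        ((1 + Y) ^ (p - 1) + of_nat (p - 1) * (1 + Y) ^ m * (of_nat p * Lam z))"
      unfolding m by (simp only:) (intro cg_power_perturb A_closed YA eta)
    then have "cg (p^2 + p + 1) ((1 + E) ^ (p - 1))
        ((1 + Y) ^ (p - 1) + of_nat (p - 1) * (1 + Y) ^ m * (of_nat p * Lam z))"
      by (rule cg_mono) (use n in arith)
    \<comment> \<open>The derivative factor (p - 1)(1 + Y)^(p - 2) is -1 modulo \<pi>^p, which is
      enough because it multiplies \<open>p * Lam z\<close>.\<close>
    also have "cg (p^2 + p + 1) \<dots> ((1 + Y) ^ (p - 1) + (- 1) * (of_nat p * Lam z))"
    proof (intro cg_add cg_refl)
      have "cg p (of_nat (p - 1) * (1 + Y) ^ m) ((- 1) * 1)"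
      proof (rule cg_mult)
        have "of_nat p \<in> I p" using I_mono[OF p_I] n by simp
        then show "cg p (of_nat (p - 1)) (- 1)" using p_ge_3 by (simp add: cg_def of_nat_diff)
        show "cg p ((1 + Y) ^ m) 1" using one_plus_power_I[OF Y] by (simp add: cg_def)
      qed (auto intro: A_closed)
      from cg_mult_I[OF eta this]
      have "cg (p^2 + 1 + p) (of_nat p * Lam z * (of_nat (p - 1) * (1 + Y) ^ m))
        (of_nat p * Lam z * (- 1 * 1))" .
      then show "cg (p^2 + p + 1) (of_nat (p - 1) * (1 + Y) ^ m * (of_nat p * Lam z)) (- 1 * (of_nat p * Lam z))"
        by (simp only: ex mult_ac mult_1_right mult_1_left)
    qed
    also have "cg (p^2 + p + 1) \<dots> ((1 + Y) ^ (p - 1) + (- 1) * ((- (1 / \<phi>0) * \<pi> ^ p^2) * Lam z))"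
    proof (intro cg_add cg_refl cg_mult_left A_closed)
      have "cg (1 + (p^2 + M)) (Lam z * of_nat p) (Lam z * (- (1 / \<phi>0) * \<pi> ^ p^2))"
        by (intro cg_mult_I Lam_I z p_approx)
      then have "cg (p^2 + p + 1) (Lam z * of_nat p) (Lam z * (- (1 / \<phi>0) * \<pi> ^ p^2))"
        by (rule cg_mono) (use n in arith)
      then show "cg (p^2 + p + 1) (of_nat p * Lam z) ((- (1 / \<phi>0) * \<pi> ^ p^2) * Lam z)"
        by (simp add: mult_ac)
    qed
    finally have "cg (p^2 + p + 1) ((1 + E) ^ (p - 1)) ((1 + Y) ^ (p - 1) + 1 / \<phi>0 * \<pi> ^ p^2 * Lam z)"
      by (simp add: algebra_simps)
    then have "cg (p^2 + (M + (p^2 + p + 1)))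
        (of_nat p * (\<pi> ^ M * (\<phi>1 * ((1 + E) ^ (p - 1) - 1))))
        (of_nat p * (\<pi> ^ M * (\<phi>1 * ((1 + Y) ^ (p - 1) + 1 / \<phi>0 * \<pi> ^ p^2 * Lam z - 1))))"
      by (intro cg_p_mult cg_pi_mult cg_mult_left cg_diff cg_refl coeff_A)
    moreover have "of_nat p * (\<pi> ^ M * (\<phi>1 * ((1 + E) ^ (p - 1) - 1))) = of_nat p * \<phi>1 * u M"
      unfolding u_def M_def zE by (simp add: mult_ac)
    moreover have "of_nat p * (\<pi> ^ M * (\<phi>1 * ((1 + Y) ^ (p - 1) + 1 / \<phi>0 * \<pi> ^ p^2 * Lam z - 1)))
       = of_nat p * (\<pi> ^ p^2 * (\<phi>1 * (((1 + Y) ^ (p - 1) - 1) / \<pi> ^ p) + \<phi>1 / \<phi>0 * \<pi> ^ M * Lam z))"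
    proof -
      have "\<pi> ^ p^2 * (w / \<pi> ^ p) = \<pi> ^ M * w" for w
        unfolding n(1)[symmetric] power_add using pi_nz by simp
      then have "\<pi> ^ p^2 * (\<phi>1 * (((1 + Y) ^ (p - 1) - 1) / \<pi> ^ p)) = \<pi> ^ M * (\<phi>1 * ((1 + Y) ^ (p - 1) - 1))"
        by (metis mult.left_commute)
      then show ?thesis by (simp only: distrib_left) (simp add: algebra_simps)
    qed
    ultimately show ?thesis by (simp only: ex)
  qed
  have t3: "cg (3 * p^2 + 1) (of_nat p ^ 2 * (\<Sum>q\<in>{1..<p-1}. h q * u (p * q)))
     (of_nat p * (\<pi> ^ p^2 * (- (1 / \<phi>0) * (\<Sum>q\<in>{1..<p-1}. h q * (\<pi> ^ (p * q) * ((1 + Y) ^ q - 1))))))"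
  proof (rule trade)
    show "cg (p^2 + 1) (\<Sum>q\<in>{1..<p-1}. h q * u (p * q)) (\<Sum>q\<in>{1..<p-1}. h q * (\<pi> ^ (p * q) * ((1 + Y) ^ q - 1)))"
      unfolding u_def zE
      by (intro cg_sum cg_mult_left coeff_A cg_diff cg_refl cg_power cg_add EY A_closed YA)
    show "(\<Sum>q\<in>{1..<p-1}. h q * (\<pi> ^ (p * q) * ((1 + Y) ^ q - 1))) \<in> I (p + 1)"
    proof (rule I_sum, rule A_I_mult[OF coeff_A(4)])
      fix q assume q: "q \<in> {1..<p-1}"
      have "p * 1 \<le> p * q" using q by (intro mult_le_mono2) auto
      moreover have "1 \<le> p" using p_ge_3 by linarith
      ultimately have "p + 1 \<le> p * q + p" by (simp only: mult_1_right add_mono)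
      with I_mult[OF pi_I one_plus_power_I[OF Y]]
      show "\<pi> ^ (p * q) * ((1 + Y) ^ q - 1) \<in> I (p + 1)" by (rule I_mono)
    qed
  qed
  have t4: "cg (3 * p^2 + 1) (of_nat p ^ 2 * (\<Sum>j\<in>{1..<p}. k j * u (M + j)))
     (of_nat p * (\<pi> ^ p^2 * (- (1 / \<phi>0) * (\<pi> ^ M * (\<Sum>j\<in>{1..<p}. k j * (\<pi> ^ j * ((1 + z) ^ j - 1)))))))"
  proof (rule trade)
    have eq: "\<pi> ^ M * (\<Sum>j\<in>{1..<p}. k j * (\<pi> ^ j * ((1 + z) ^ j - 1)))
       = (\<Sum>j\<in>{1..<p}. k j * (\<pi> ^ (M + j) * ((1 + z) ^ j - 1)))"
      unfolding sum_distrib_left by (intro sum.cong refl) (simp add: power_add mult_ac)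
    show "cg (p^2 + 1) (\<Sum>j\<in>{1..<p}. k j * u (M + j)) (\<pi> ^ M * (\<Sum>j\<in>{1..<p}. k j * (\<pi> ^ j * ((1 + z) ^ j - 1))))"
      unfolding eq u_def
    proof (rule cg_sum, rule cg_mult_left[OF coeff_A(5)])
      fix j assume j: "j \<in> {1..<p}"
      have "cg p ((1 + z) ^ (M + j)) (1 * (1 + z) ^ j)"
        unfolding power_add M_def zE
        using one_plus_power_I[OF E, of "p - 1"] zA
        by (intro cg_mult_right A_closed) (auto simp: cg_def)
      then have "cg (M + j + p) (\<pi> ^ (M + j) * ((1 + z) ^ (M + j) - 1)) (\<pi> ^ (M + j) * ((1 + z) ^ j - 1))"
        by (intro cg_pi_mult cg_diff cg_refl) simp
      then show "cg (p^2 + 1) (\<pi> ^ (M + j) * ((1 + z) ^ (M + j) - 1)) (\<pi> ^ (M + j) * ((1 + z) ^ j - 1))"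
        by (rule cg_mono) (use n j in auto)
    qed
    have "\<pi> ^ M * (\<Sum>j\<in>{1..<p}. k j * (\<pi> ^ j * ((1 + z) ^ j - 1))) \<in> I (M + 1)"
      by (intro I_mult pi_I I_sum A_I_mult coeff_A one_plus_power_I z A_closed)
    then show "\<pi> ^ M * (\<Sum>j\<in>{1..<p}. k j * (\<pi> ^ j * ((1 + z) ^ j - 1))) \<in> I (p + 1)"
      by (rule I_mono) (use n in arith)
  qed
  have t5: "cg (3 * p^2 + 1) (of_nat p ^ 2 * (g * u (M - 1)))
     (of_nat p * (\<pi> ^ p^2 * (- (1 / \<phi>0) * (g * (\<pi> ^ (M - 1) * ((1 + Y) ^ (p - 2) * (1 + z) ^ (p - 1) - 1))))))"
  proof (rule trade)
    have *: "cg (p^2 + 1) ((1 + z) ^ (M - 1)) ((1 + Y) ^ (p - 2) * (1 + z) ^ (p - 1))"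
      unfolding M_facts(5) power_add zE
      by (intro cg_mult_right A_closed zA cg_power cg_add cg_refl EY YA)
    then show "cg (p^2 + 1) (g * u (M - 1)) (g * (\<pi> ^ (M - 1) * ((1 + Y) ^ (p - 2) * (1 + z) ^ (p - 1) - 1)))"
      unfolding u_def by (intro cg_mult_left coeff_A cg_diff cg_refl A_closed)
    have "g * (\<pi> ^ (M - 1) * ((1 + Y) ^ (p - 2) * (1 + z) ^ (p - 1) - 1)) \<in> I (M - 1)"
      by (intro A_I_mult I_A_mult pi_I A_closed coeff_A YA zA)
    then show "g * (\<pi> ^ (M - 1) * ((1 + Y) ^ (p - 2) * (1 + z) ^ (p - 1) - 1)) \<in> I (p + 1)"
      by (rule I_mono) (use n in arith)
  qed
  have total: "cg (3 * p^2 + 1) (f_eval (\<pi> * (1 + z)))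
    (of_nat p * (\<pi> ^ p^2 * (- ((\<phi>0 + \<phi>1 * \<pi> ^ M) * s ^ p^2) + Lam Y))
     + of_nat p * (\<pi> ^ p^2 * (\<phi>1 * (((1 + Y) ^ (p - 1) - 1) / \<pi> ^ p) + \<phi>1 / \<phi>0 * \<pi> ^ M * Lam z))
     + of_nat p * (\<pi> ^ p^2 * (- (1 / \<phi>0) * (\<Sum>q\<in>{1..<p-1}. h q * (\<pi> ^ (p * q) * ((1 + Y) ^ q - 1)))))
     + of_nat p * (\<pi> ^ p^2 * (- (1 / \<phi>0) * (\<pi> ^ M * (\<Sum>j\<in>{1..<p}. k j * (\<pi> ^ j * ((1 + z) ^ j - 1))))))
     + of_nat p * (\<pi> ^ p^2 * (- (1 / \<phi>0) * (g * (\<pi> ^ (M - 1) * ((1 + Y) ^ (p - 2) * (1 + z) ^ (p - 1) - 1))))))"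
    using cg_trans[OF dec cg_add[OF cg_add[OF cg_add[OF cg_add[OF t1 t2] t3] t4] t5[folded mult.assoc]]]
    by (simp only: mult.assoc)
  have piM: "\<pi> ^ (M - 1) * w = \<pi> ^ M * (w / \<pi>)" for w
    using power_minus_mult[of M \<pi>] pi_nz n by (simp add: field_simps)
  have sum1: "(\<Sum>j\<in>{1..<p}. k j / \<phi>1 * w j) = (\<Sum>j\<in>{1..<p}. k j * w j) / \<phi>1" for w
    by (simp add: sum_divide_distrib)
  have split: "\<phi>1 / \<phi>0 * P * (L - S / \<phi>1 - g / \<phi>1 * W)
      = \<phi>1 / \<phi>0 * P * L - 1 / \<phi>0 * (P * S) - 1 / \<phi>0 * (g * (P * W))" for P L S W
    using coeff_nz by (simp add: field_simps)
  have "Sigma_p s = (- ((\<phi>0 + \<phi>1 * \<pi> ^ M) * s ^ p^2) + Lam Y)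
     + (\<phi>1 * (((1 + Y) ^ (p - 1) - 1) / \<pi> ^ p) + \<phi>1 / \<phi>0 * \<pi> ^ M * Lam z)
     + (- (1 / \<phi>0) * (\<Sum>q\<in>{1..<p-1}. h q * (\<pi> ^ (p * q) * ((1 + Y) ^ q - 1))))
     + (- (1 / \<phi>0) * (\<pi> ^ M * (\<Sum>j\<in>{1..<p}. k j * (\<pi> ^ j * ((1 + z) ^ j - 1)))))
     + (- (1 / \<phi>0) * (g * (\<pi> ^ (M - 1) * ((1 + Y) ^ (p - 2) * (1 + z) ^ (p - 1) - 1))))"
    unfolding Sigma_p_def rho_def z_def[symmetric] Y_def[symmetric] piM sum1 split
    by (simp add: algebra_simps diff_divide_distrib)
  then show ?thesis using total unfolding z_def[symmetric] by (simp only: distrib_left)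
qed

section \<open>The p-th power of \<open>rho\<close>\<close>

definition \<gamma> where "\<gamma> = g / \<phi>1"

lemma gamma_R: "\<gamma> \<in> R" unfolding \<gamma>_def by (intro R_divide coeff_R coeff_unit)
lemma gamma_A: "\<gamma> \<in> A" by (rule R_A[OF gamma_R])
lemma res_gamma: "res \<gamma> = res g / res \<phi>1"
  unfolding \<gamma>_def by (intro res_divide coeff_A coeff_unit)
lemma gamma_unit: "res \<gamma> \<noteq> 0" using coeff_unit by (simp add: res_gamma)

lemma k_phi_R: "j \<in> {1..<p} \<Longrightarrow> k j / \<phi>1 \<in> R"
  by (intro R_divide coeff_R coeff_unit)
lemma k_phi_A: "j \<in> {1..<p} \<Longrightarrow> k j / \<phi>1 \<in> A"
  using k_phi_R R_A by blast

lemma cg_fermat_pred: "cg (p^2 + 1) (of_nat (p - 1) ^ p) (of_nat (p - 1) - of_nat p)"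
proof -
  have eq: "of_nat (p - 1) = (-1 :: 'b) + of_nat p" using p_ge_3 by (simp add: of_nat_diff)
  have "cg (p^2 + p^2) ((-1 + of_nat p) ^ p) ((-1) ^ p + of_nat p ^ p)"
    by (intro cg_freshman p_I A_closed)
  then have "cg (p^2 + 1) ((-1 + of_nat p) ^ p) ((-1) ^ p + of_nat p ^ p)"
    by (rule cg_mono) (use one_le_p_sq in simp)
  also have "cg (p^2 + 1) \<dots> ((-1) ^ p + 0)"
  proof (intro cg_add cg_refl, unfold cg_0_iff)
    have "p^2 * 2 \<le> p^2 * p" using p_ge_3 by (intro mult_le_mono2) simp
    moreover note one_le_p_sq
    ultimately have "p^2 + 1 \<le> p^2 * p" by arith
    with p_I_power[of p] show "of_nat p ^ p \<in> I (p^2 + 1)" by (rule I_mono)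
  qed
  also have "(-1) ^ p + 0 = of_nat (p - 1) - (of_nat p :: 'b)" unfolding eq using odd_p by simp
  finally show ?thesis unfolding eq .
qed

text \<open>The anomalous summand \<open>- of_nat p * s ^ p\<close> comes from \<open>(p - 1) ^ p \<equiv> - 1\<close> modulo \<open>p\<^sup>2\<close>.\<close>

lemma power_p_of_pred_power:
  assumes s: "s \<in> A"
  shows "cg (p^2 + 1) ((((1 + \<pi> * s) ^ (p - 1) - 1) / \<pi>) ^ p)
    (((1 + (\<pi> * s) ^ p) ^ (p - 1) - 1) / \<pi> ^ p - of_nat p * s ^ p)"
proof -
  define B where "B i = of_nat ((p - 1) choose i) * (\<pi> ^ (i - 1) * s ^ i)" for i
  have set_eq: "{..p-1} = insert 0 (insert 1 {2..<p})" using p_ge_3 by auto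
  have expand: "((1 + x) ^ (p - 1) - 1) = of_nat (p - 1) * x + (\<Sum>i\<in>{2..<p}. of_nat ((p - 1) choose i) * x ^ i)" for x :: 'b
  proof -
    have "(1 + x) ^ (p - 1) = (\<Sum>i\<le>p-1. of_nat ((p - 1) choose i) * x ^ i)"
      using binomial_ring[of x 1 "p - 1"] by (simp add: add.commute)
    then show ?thesis unfolding set_eq by (simp add: One_nat_def)
  qed
  have pw: "\<pi> ^ i = \<pi> * \<pi> ^ (i - 1)" if "i \<in> {2..<p}" for i
    using that by (cases i) (auto simp: One_nat_def)
  have "((1 + \<pi> * s) ^ (p - 1) - 1) = \<pi> * (of_nat (p - 1) * s + (\<Sum>i\<in>{2..<p}. B i))"
    unfolding expand distrib_left sum_distrib_left
    by (intro arg_cong2[of _ _ _ _ "(+)"] sum.cong refl)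
       (auto simp: B_def power_mult_distrib pw mult_ac)
  then have "((1 + \<pi> * s) ^ (p - 1) - 1) / \<pi> = of_nat (p - 1) * s + (\<Sum>i\<in>{2..<p}. B i)"
    using pi_nz by simp
  moreover have BI: "B i \<in> I 1" if "i \<in> {2..<p}" for i
    unfolding B_def
  proof (rule A_I_mult[OF A_of_nat I_A_mult[OF _ A_power[OF s]]])
    show "\<pi> ^ (i - 1) \<in> I 1" by (rule I_mono[OF pi_I]) (use that in auto)
  qed
  ultimately have "cg (p^2 + 1) ((((1 + \<pi> * s) ^ (p - 1) - 1) / \<pi>) ^ p)
      ((of_nat (p - 1) * s) ^ p + (\<Sum>i\<in>{2..<p}. B i) ^ p)"
    using s by (simp only:) (intro cg_freshman I_sum A_closed)
  also have "cg (p^2 + 1) \<dots> ((of_nat (p - 1) - of_nat p) * s ^ p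
      + (\<Sum>i\<in>{2..<p}. of_nat ((p - 1) choose i) * (\<pi> ^ (p * (i - 1)) * s ^ (p * i))))"
  proof (rule cg_add)
    show "cg (p^2 + 1) ((of_nat (p - 1) * s) ^ p) ((of_nat (p - 1) - of_nat p) * s ^ p)"
      unfolding power_mult_distrib using s by (intro cg_mult_right A_closed cg_fermat_pred)
    have "cg (p^2 + 1) ((\<Sum>i\<in>{2..<p}. B i) ^ p) (\<Sum>i\<in>{2..<p}. B i ^ p)"
      by (intro cg_freshman_sum BI) auto
    also have "cg (p^2 + 1) \<dots> (\<Sum>i\<in>{2..<p}. of_nat ((p - 1) choose i) * (\<pi> ^ (p * (i - 1)) * s ^ (p * i)))"
    proof (rule cg_sum)
      fix i assume i: "i \<in> {2..<p}"
      have "1 \<le> p * (i - 1)" using i by (intro one_le_p_mult) auto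
      with pi_I have "\<pi> ^ (p * (i - 1)) \<in> I 1" by (rule I_mono)
      then have "\<pi> ^ (p * (i - 1)) * s ^ (p * i) \<in> I 1" using s by (intro I_A_mult A_closed)
      from cg_mult_I[OF this cg_fermat[of "(p - 1) choose i"]]
      show "cg (p^2 + 1) (B i ^ p) (of_nat ((p - 1) choose i) * (\<pi> ^ (p * (i - 1)) * s ^ (p * i)))"
        unfolding B_def by (simp add: power_mult_distrib power_mult[symmetric] mult_ac add_ac)
    qed
    finally show "cg (p^2 + 1) ((\<Sum>i\<in>{2..<p}. B i) ^ p)
      (\<Sum>i\<in>{2..<p}. of_nat ((p - 1) choose i) * (\<pi> ^ (p * (i - 1)) * s ^ (p * i)))" .
  qed
  also have "(of_nat (p - 1) - of_nat p) * s ^ p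
      + (\<Sum>i\<in>{2..<p}. of_nat ((p - 1) choose i) * (\<pi> ^ (p * (i - 1)) * s ^ (p * i)))
      = ((1 + (\<pi> * s) ^ p) ^ (p - 1) - 1) / \<pi> ^ p - of_nat p * s ^ p"
  proof -
    have pp: "((\<pi> * s) ^ p) ^ i = \<pi> ^ p * (\<pi> ^ (p * (i - 1)) * s ^ (p * i))" if "i \<in> {2..<p}" for i
    proof -
      have "p * i = p + p * (i - 1)" using that by (cases i) auto
      then have "\<pi> ^ (p * i) = \<pi> ^ p * \<pi> ^ (p * (i - 1))" by (metis power_add)
      then show ?thesis unfolding power_mult[symmetric] power_mult_distrib by simp
    qed
    have "((1 + (\<pi> * s) ^ p) ^ (p - 1) - 1) = \<pi> ^ p * (of_nat (p - 1) * s ^ p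
       + (\<Sum>i\<in>{2..<p}. of_nat ((p - 1) choose i) * (\<pi> ^ (p * (i - 1)) * s ^ (p * i))))"
      unfolding expand distrib_left sum_distrib_left
      by (intro arg_cong2[of _ _ _ _ "(+)"] sum.cong refl)
         (auto simp: power_mult_distrib pp[unfolded power_mult_distrib] mult_ac)
    then have "((1 + (\<pi> * s) ^ p) ^ (p - 1) - 1) / \<pi> ^ p = of_nat (p - 1) * s ^ p
       + (\<Sum>i\<in>{2..<p}. of_nat ((p - 1) choose i) * (\<pi> ^ (p * (i - 1)) * s ^ (p * i)))"
      using pi_nz by simp
    then show ?thesis by (simp only: left_diff_distrib add_diff_eq diff_add_eq)
  qed
  finally show ?thesis .
qed

lemma cg_pi_s_power_p:
  assumes s: "s \<in> A"
  shows "cg (p^2 + 1) ((1 + \<pi> * s) ^ (p * i)) ((1 + (\<pi> * s) ^ p) ^ i)"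
proof -
  have z: "\<pi> * s \<in> I 1" using pi_mult_I[OF s, of 1] by simp
  have zA: "\<pi> * s \<in> A" using z I_A by blast
  show ?thesis unfolding one_plus_power_mult_p[OF zA]
  proof (intro cg_power cg_add cg_refl A_closed s)
    show "cg (p^2 + 1) ((\<pi> * s) ^ p + of_nat p * Lam (\<pi> * s)) ((\<pi> * s) ^ p)"
      using p_times_I[OF Lam_I[OF z]] by (simp add: cg_def)
  qed
qed

text \<open>The bracket is ((1 + z)^(p - 1) - 1)/\<pi> plus (1 + z)^(p - 1) \<open>Q\<close>, where
  \<open>Q\<close> begins with -2 \<pi>^(p - 1) s^p. The p-th power of \<open>Q\<close> gives the
  term of order M, and the factor (1 + z)^(p(p - 1)), which is 1 - Y to the precision needed, gives
  the term of order p^2.\<close>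

lemma power_p_of_unit_part:
  assumes s: "s \<in> A"
  shows "cg (p^2 + 1) ((((1 + (\<pi> * s) ^ p) ^ (p - 2) * (1 + \<pi> * s) ^ (p - 1) - 1) / \<pi>) ^ p)
    (((1 + (\<pi> * s) ^ p) ^ (p - 1) - 1) / \<pi> ^ p - of_nat p * s ^ p
      - 2 * (\<pi> ^ M * s ^ p^2) + 2 * (\<pi> ^ p^2 * s ^ (p^2 + p)))"
proof -
  have n: "M + p = p^2" "2 * p \<le> M" "p + 3 \<le> M" by (rule M_facts)+
  have z: "\<pi> * s \<in> I 1" using pi_mult_I[OF s, of 1] by simp
  have zA: "\<pi> * s \<in> A" using z I_A by blast
  define Y where "Y = (\<pi> * s) ^ p"
  have Y: "Y \<in> I p" using I_power[OF z, of p] by (simp add: Y_def)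
  have YA: "Y \<in> A" using Y I_A by blast
  have Yp: "Y = \<pi> ^ p * s ^ p" by (simp add: Y_def power_mult_distrib)
  define Q where "Q = ((1 + Y) ^ (p - 2) - 1) / \<pi>"
  obtain p' where p': "p = Suc p'" "p' \<ge> 2" using p_ge_3 by (cases p) auto
  have "p - 1 = p'" using p' by simp
  then have Mp: "M = p' * p" by (simp add: M_def mult.commute)
  have Yd: "Y / \<pi> = \<pi> ^ p' * s ^ p" using pi_nz unfolding Yp by (simp add: p'(1))
  have dd: "cg (1 + (p' + p)) ((1 + Y) ^ (p - 2) - 1) (1 + of_nat (p - 2) * Y - 1)"
    using cg_diff[OF cg_one_plus_power[OF Y, of "p - 2"] cg_refl[of _ 1]]
    by (rule cg_mono) (simp add: p'(1) One_nat_def)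
  then have "cg (1 + (p' + p)) ((1 + Y) ^ (p - 2) - 1) (of_nat (p - 2) * Y)" by simp
  from cg_pi_div[of 1, OF this] have "cg (p' + p) Q (of_nat (p - 2) * (\<pi> ^ p' * s ^ p))"
    unfolding Q_def using Yd by (simp add: times_divide_eq_right[symmetric] del: times_divide_eq_right)
  then have e: "Q - of_nat (p - 2) * (\<pi> ^ p' * s ^ p) \<in> I (p' + p)" by (simp add: cg_def)
  have "cg (p^2 + (p' + p)) ((of_nat (p - 2) * (\<pi> ^ p' * s ^ p) + (Q - of_nat (p - 2) * (\<pi> ^ p' * s ^ p))) ^ p)
     ((of_nat (p - 2) * (\<pi> ^ p' * s ^ p)) ^ p + (Q - of_nat (p - 2) * (\<pi> ^ p' * s ^ p)) ^ p)"
    using s by (intro cg_freshman e A_closed)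
  then have "cg (p^2 + 1) (Q ^ p)
     ((of_nat (p - 2) * (\<pi> ^ p' * s ^ p)) ^ p + (Q - of_nat (p - 2) * (\<pi> ^ p' * s ^ p)) ^ p)"
    by (simp only: add_diff_cancel_left' add.commute[of _ "Q - _"] diff_add_cancel) (erule cg_mono, use p' in simp)
  also have "cg (p^2 + 1) \<dots> ((- 2) * (\<pi> ^ M * s ^ p^2) + 0)"
  proof (rule cg_add)
    have "(p + 1) * p \<le> (p' + p) * p" using p' by (intro mult_le_mono1) simp
    moreover have "p^2 + 1 \<le> (p + 1) * p"
      unfolding p_sq add_mult_distrib using p_ge_3 by simp
    ultimately have "p^2 + 1 \<le> (p' + p) * p" by (rule order_trans[rotated])
    with I_power[OF e, of p]
    show "cg (p^2 + 1) ((Q - of_nat (p - 2) * (\<pi> ^ p' * s ^ p)) ^ p) 0"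
      unfolding cg_0_iff by (rule I_mono)
    have "cg (p^2) (of_nat (p - 2) ^ p) (of_nat (p - 2))" by (rule cg_fermat)
    also have "cg (p^2) (of_nat (p - 2)) (-2)" using p_I p_ge_3 by (simp add: cg_def of_nat_diff)
    finally have "cg (M + p^2) ((\<pi> ^ M * s ^ p^2) * of_nat (p - 2) ^ p) ((\<pi> ^ M * s ^ p^2) * (-2))"
      using s by (intro cg_mult_I I_A_mult pi_I A_closed)
    then have "cg (p^2 + 1) ((\<pi> ^ M * s ^ p^2) * of_nat (p - 2) ^ p) ((\<pi> ^ M * s ^ p^2) * (-2))"
      by (rule cg_mono) (use n in arith)
    moreover have "(of_nat (p - 2) * (\<pi> ^ p' * s ^ p)) ^ p = (\<pi> ^ M * s ^ p^2) * of_nat (p - 2) ^ p"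
      unfolding power_mult_distrib power_mult[symmetric] p_sq Mp by (simp add: mult_ac)
    ultimately show "cg (p^2 + 1) ((of_nat (p - 2) * (\<pi> ^ p' * s ^ p)) ^ p) ((- 2) * (\<pi> ^ M * s ^ p^2))"
      by (simp add: mult_ac)
  qed
  finally have Qp: "cg (p^2 + 1) (Q ^ p) ((- 2) * (\<pi> ^ M * s ^ p^2))" by simp
  have "(1 + Y) ^ (p - 2) - 1 \<in> I (1 + p')"
    by (rule I_mono[OF one_plus_power_I[OF Y]]) (use p' in simp)
  from I_div[OF this] have QI: "Q \<in> I p'" unfolding Q_def by simp
  have QA: "Q \<in> A" using QI I_A by blast
  have un: "cg (2 * p) (((1 + \<pi> * s) ^ (p - 1)) ^ p) (1 - Y)"
  proof -
    have "((1 + \<pi> * s) ^ (p - 1)) ^ p = (1 + \<pi> * s) ^ (p * (p - 1))"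
      by (simp only: power_mult[symmetric] mult.commute)
    also have "cg (p^2 + 1) \<dots> ((1 + Y) ^ (p - 1))" unfolding Y_def by (rule cg_pi_s_power_p[OF s])
    finally have "cg (2 * p) (((1 + \<pi> * s) ^ (p - 1)) ^ p) ((1 + Y) ^ (p - 1))"
      by (rule cg_mono) (use n in arith)
    also have "cg (2 * p) \<dots> (1 + of_nat (p - 1) * Y)" by (rule cg_one_plus_power[OF Y])
    also have "1 + of_nat (p - 1) * Y = 1 - Y + of_nat p * Y"
      using p_ge_3 by (simp add: of_nat_diff algebra_simps)
    also have "cg (2 * p) \<dots> (1 - Y + 0)"
    proof (intro cg_add cg_refl, unfold cg_0_iff)
      show "of_nat p * Y \<in> I (2 * p)" by (rule I_mono[OF p_times_I[OF Y]]) (use n in arith)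
    qed
    finally show ?thesis by simp
  qed
  have split: "((1 + Y) ^ (p - 2) * (1 + \<pi> * s) ^ (p - 1) - 1) / \<pi>
     = ((1 + \<pi> * s) ^ (p - 1) - 1) / \<pi> + (1 + \<pi> * s) ^ (p - 1) * Q"
    unfolding Q_def using pi_nz by (simp add: field_simps)
  have VA: "((1 + \<pi> * s) ^ (p - 1) - 1) / \<pi> \<in> A"
    using one_plus_power_I[OF z, of "p - 1"] by (simp add: I_def)
  have "cg (p^2 + 1) ((((1 + Y) ^ (p - 2) * (1 + \<pi> * s) ^ (p - 1) - 1) / \<pi>) ^ p)
     ((((1 + \<pi> * s) ^ (p - 1) - 1) / \<pi>) ^ p + ((1 + \<pi> * s) ^ (p - 1) * Q) ^ p)"
    unfolding split
  proof (intro cg_freshman VA A_I_mult)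
    show "(1 + \<pi> * s) ^ (p - 1) \<in> A" using s by (intro A_closed)
    show "Q \<in> I 1" using QI by (rule I_mono) (use p' in simp)
  qed
  also have "cg (p^2 + 1) \<dots> ((((1 + Y) ^ (p - 1) - 1) / \<pi> ^ p - of_nat p * s ^ p)
     + (1 - Y) * ((- 2) * (\<pi> ^ M * s ^ p^2)))"
  proof (rule cg_add)
    show "cg (p^2 + 1) ((((1 + \<pi> * s) ^ (p - 1) - 1) / \<pi>) ^ p) (((1 + Y) ^ (p - 1) - 1) / \<pi> ^ p - of_nat p * s ^ p)"
      unfolding Y_def by (rule power_p_of_pred_power[OF s])
    have "cg (p^2 + 1) (((1 + \<pi> * s) ^ (p - 1)) ^ p * Q ^ p) (((1 + \<pi> * s) ^ (p - 1)) ^ p * ((- 2) * (\<pi> ^ M * s ^ p^2)))"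
      using s by (intro cg_mult_left Qp A_closed)
    also have "cg (p^2 + 1) \<dots> ((1 - Y) * ((- 2) * (\<pi> ^ M * s ^ p^2)))"
    proof -
      have "(- 2) * (\<pi> ^ M * s ^ p^2) \<in> I M"
        using s by (intro A_I_mult I_A_mult pi_I A_closed)
      from cg_mult_I[OF this un]
      have "cg (M + 2 * p) (((1 + \<pi> * s) ^ (p - 1)) ^ p * ((- 2) * (\<pi> ^ M * s ^ p^2))) ((1 - Y) * ((- 2) * (\<pi> ^ M * s ^ p^2)))"
        by (simp add: mult_ac)
      then show ?thesis by (rule cg_mono) (use n p_ge_3 in arith)
    qed
    finally show "cg (p^2 + 1) (((1 + \<pi> * s) ^ (p - 1) * Q) ^ p) ((1 - Y) * ((- 2) * (\<pi> ^ M * s ^ p^2)))"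
      unfolding power_mult_distrib .
  qed
  also have "(((1 + Y) ^ (p - 1) - 1) / \<pi> ^ p - of_nat p * s ^ p) + (1 - Y) * ((- 2) * (\<pi> ^ M * s ^ p^2))
     = ((1 + Y) ^ (p - 1) - 1) / \<pi> ^ p - of_nat p * s ^ p
      - 2 * (\<pi> ^ M * s ^ p^2) + 2 * (\<pi> ^ p^2 * s ^ (p^2 + p))"
  proof -
    have "Y * (\<pi> ^ M * s ^ p^2) = \<pi> ^ p^2 * s ^ (p^2 + p)"
      unfolding Yp n(1)[symmetric] by (simp add: power_add mult_ac)
    then show ?thesis by (simp add: left_diff_distrib)
  qed
  finally show ?thesis unfolding Y_def .
qed

text \<open>All summands of \<open>rho\<close> except the last lie in \<open>I 1\<close>, so
  Frobenius distributes over them modulo p \<pi>. Each summand turns into its counterpart in z^p,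
  with coefficients raised to the p-th power.\<close>

lemma rho_power_p:
  assumes s: "s \<in> A"
  shows "cg (p^2 + 1) (rho s ^ p) (Lam ((\<pi> * s) ^ p)
    - (\<Sum>j\<in>{1..<p}. (k j / \<phi>1) ^ p * (\<pi> ^ (p * j) * ((1 + (\<pi> * s) ^ p) ^ j - 1)))
    - \<gamma> ^ p * (((1 + (\<pi> * s) ^ p) ^ (p - 1) - 1) / \<pi> ^ p - of_nat p * s ^ p
      - 2 * (\<pi> ^ M * s ^ p^2) + 2 * (\<pi> ^ p^2 * s ^ (p^2 + p))))"
proof -
  have z: "\<pi> * s \<in> I 1" using pi_mult_I[OF s, of 1] by simp
  have zA: "\<pi> * s \<in> A" using z I_A by blast
  define W where "W = ((1 + (\<pi> * s) ^ p) ^ (p - 2) * (1 + \<pi> * s) ^ (p - 1) - 1) / \<pi>"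
  define U where "U j = k j / \<phi>1 * (\<pi> ^ j * ((1 + \<pi> * s) ^ j - 1))" for j
  have U: "U j \<in> I 1" if "j \<in> {1..<p}" for j
    unfolding U_def using that by (intro A_I_mult k_phi_A one_plus_power_I z A_closed)
  have WA: "W \<in> A"
  proof -
    have "(1 + (\<pi> * s) ^ p) ^ (p - 2) * (1 + \<pi> * s) ^ (p - 1) - 1
      = ((1 + (\<pi> * s) ^ p) ^ (p - 2) - 1) * (1 + \<pi> * s) ^ (p - 1) + ((1 + \<pi> * s) ^ (p - 1) - 1)"
      by (simp add: algebra_simps)
    also have "\<dots> \<in> I 1"
      using s I_mono[OF I_power[OF z, of p], of 1] p_ge_3
      by (intro I_add I_A_mult one_plus_power_I z A_closed) auto
    finally show ?thesis unfolding W_def by (simp add: I_def)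
  qed
  have "rho s = - (\<gamma> * W) + (Lam (\<pi> * s) - (\<Sum>j\<in>{1..<p}. U j))"
    by (simp add: rho_def W_def U_def \<gamma>_def)
  then have "cg (p^2 + 1) (rho s ^ p) ((- (\<gamma> * W)) ^ p + (Lam (\<pi> * s) - (\<Sum>j\<in>{1..<p}. U j)) ^ p)"
    by (simp only:) (intro cg_freshman I_diff Lam_I I_sum U z A_closed gamma_A WA)
  also have "cg (p^2 + 1) \<dots> (- (\<gamma> ^ p * (((1 + (\<pi> * s) ^ p) ^ (p - 1) - 1) / \<pi> ^ p - of_nat p * s ^ p
      - 2 * (\<pi> ^ M * s ^ p^2) + 2 * (\<pi> ^ p^2 * s ^ (p^2 + p))))
     + (Lam ((\<pi> * s) ^ p) - (\<Sum>j\<in>{1..<p}. (k j / \<phi>1) ^ p * (\<pi> ^ (p * j) * ((1 + (\<pi> * s) ^ p) ^ j - 1)))))"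
  proof (rule cg_add)
    have "(- (\<gamma> * W)) ^ p = - (\<gamma> ^ p * W ^ p)" using odd_p by (simp add: power_mult_distrib)
    also have "cg (p^2 + 1) \<dots> (- (\<gamma> ^ p * (((1 + (\<pi> * s) ^ p) ^ (p - 1) - 1) / \<pi> ^ p - of_nat p * s ^ p
      - 2 * (\<pi> ^ M * s ^ p^2) + 2 * (\<pi> ^ p^2 * s ^ (p^2 + p)))))"
      unfolding W_def by (intro cg_uminus cg_mult_left A_power gamma_A power_p_of_unit_part s)
    finally show "cg (p^2 + 1) ((- (\<gamma> * W)) ^ p) (- (\<gamma> ^ p * (((1 + (\<pi> * s) ^ p) ^ (p - 1) - 1) / \<pi> ^ p - of_nat p * s ^ p
      - 2 * (\<pi> ^ M * s ^ p^2) + 2 * (\<pi> ^ p^2 * s ^ (p^2 + p)))))" .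
    have SI: "(\<Sum>j\<in>{1..<p}. U j) \<in> I 1" by (intro I_sum U)
    have "cg (p^2 + 1) ((Lam (\<pi> * s) - (\<Sum>j\<in>{1..<p}. U j)) ^ p) (Lam (\<pi> * s) ^ p - (\<Sum>j\<in>{1..<p}. U j) ^ p)"
      by (intro cg_freshman_diff Lam_A zA SI)
    also have "cg (p^2 + 1) \<dots> (Lam ((\<pi> * s) ^ p) - (\<Sum>j\<in>{1..<p}. U j ^ p))"
      by (intro cg_diff Lam_power_p z cg_freshman_sum U) auto
    also have "cg (p^2 + 1) \<dots> (Lam ((\<pi> * s) ^ p) - (\<Sum>j\<in>{1..<p}. (k j / \<phi>1) ^ p * (\<pi> ^ (p * j) * ((1 + (\<pi> * s) ^ p) ^ j - 1))))"
    proof (rule cg_diff[OF cg_refl], rule cg_sum)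
      fix j assume j: "j \<in> {1..<p}"
      have "cg (p^2 + 0) (((1 + \<pi> * s) ^ j - 1) ^ p) (((1 + \<pi> * s) ^ j) ^ p - 1 ^ p)"
        using s by (intro cg_freshman_diff) (auto simp: I_0 intro!: A_closed)
      then have "cg (p^2) (((1 + \<pi> * s) ^ j - 1) ^ p) ((1 + \<pi> * s) ^ (p * j) - 1)"
        by (simp add: power_mult[symmetric] mult.commute)
      also have "cg (p^2) \<dots> ((1 + (\<pi> * s) ^ p) ^ j - 1)"
        using cg_pi_s_power_p[OF s, of j] by (intro cg_diff cg_refl) (erule cg_mono, simp)
      finally have "cg (1 + p^2) (\<pi> ^ (p * j) * (((1 + \<pi> * s) ^ j - 1) ^ p)) (\<pi> ^ (p * j) * ((1 + (\<pi> * s) ^ p) ^ j - 1))"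
      proof (rule cg_mult_I[rotated])
        have "1 \<le> p * j" using j by (intro one_le_p_mult) simp
        with pi_I show "\<pi> ^ (p * j) \<in> I 1" by (rule I_mono)
      qed
      then have "cg (p^2 + 1) ((k j / \<phi>1) ^ p * (\<pi> ^ (p * j) * (((1 + \<pi> * s) ^ j - 1) ^ p)))
         ((k j / \<phi>1) ^ p * (\<pi> ^ (p * j) * ((1 + (\<pi> * s) ^ p) ^ j - 1)))"
        by (subst add.commute) (rule cg_mult_left[OF A_power[OF k_phi_A[OF j]]])
      then show "cg (p^2 + 1) (U j ^ p) ((k j / \<phi>1) ^ p * (\<pi> ^ (p * j) * ((1 + (\<pi> * s) ^ p) ^ j - 1)))"
        unfolding U_def power_mult_distrib power_mult[symmetric] by (simp add: mult.commute[of j p])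
    qed
    finally show "cg (p^2 + 1) ((Lam (\<pi> * s) - (\<Sum>j\<in>{1..<p}. U j)) ^ p)
       (Lam ((\<pi> * s) ^ p) - (\<Sum>j\<in>{1..<p}. (k j / \<phi>1) ^ p * (\<pi> ^ (p * j) * ((1 + (\<pi> * s) ^ p) ^ j - 1))))" .
  qed
  finally show ?thesis by (simp add: algebra_simps)
qed

end

section \<open>Binomials near \<open>p\<close>, and p-th powers modulo \<open>p\<close>\<close>

context totally_ramified
begin

lemma of_nat_choose_two: "(of_nat (m choose 2) :: 'b) = of_nat m * (of_nat m - 1) / 2"
proof (induction m)
  case (Suc m)
  have "Suc m choose 2 = m + (m choose 2)" by (simp add: numeral_2_eq_2)
  then show ?case using Suc by (simp add: field_simps)
qed (simp add: binomial_eq_0)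

lemma two_nz: "(2 :: 'k) \<noteq> 0"
proof
  assume "(2 :: 'k) = 0"
  moreover obtain m where "p = 2 * m + 1" using odd_p by (auto elim!: oddE)
  then have "(of_nat p :: 'k) = 2 * of_nat m + 1" by simp
  ultimately show False using of_nat_p_zero by simp
qed

lemma half_A: "1 / 2 \<in> A"
  using two_nz by (intro A_divide A_closed) (simp add: res_numeral)

lemma choose_pred_two: "cg (p^2) (of_nat ((p - 1) choose 2)) 1"
proof -
  have "(of_nat (p - 1) :: 'b) = of_nat p - 1" using p_ge_3 by (simp add: of_nat_diff)
  then have "of_nat ((p - 1) choose 2) - 1 = of_nat p * ((of_nat p - 3) * (1 / 2) :: 'b)"
    by (simp add: of_nat_choose_two) (simp add: field_simps)
  also have "\<dots> \<in> I (p^2)" by (intro I_A_mult p_I A_closed half_A)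
  finally show ?thesis by (simp add: cg_def)
qed

lemma choose_pred_pred_two: "cg (p^2) (of_nat ((p - 2) choose 2)) 3"
proof -
  have "(of_nat (p - 2) :: 'b) = of_nat p - 2" using p_ge_3 by (simp add: of_nat_diff)
  then have "of_nat ((p - 2) choose 2) - 3 = of_nat p * ((of_nat p - 5) * (1 / 2) :: 'b)"
    by (simp add: of_nat_choose_two) (simp add: field_simps)
  also have "\<dots> \<in> I (p^2)" by (intro I_A_mult p_I A_closed half_A)
  finally show ?thesis by (simp add: cg_def)
qed

lemma of_nat_pred: "cg (p^2) (of_nat (p - 1)) (- 1)"
  using p_I p_ge_3 by (simp add: cg_def of_nat_diff)

lemma of_nat_pred_pred: "cg (p^2) (of_nat (p - 2)) (- 2)"
  using p_I p_ge_3 by (simp add: cg_def of_nat_diff)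

lemma I_cancel:
  assumes "\<pi> ^ j * (u * x) \<in> I (j + k)" "u \<in> A" "res u \<noteq> 0"
  shows "u * x \<in> I k" "x \<in> I k"
proof -
  show 1: "u * x \<in> I k" using assms(1) by (simp only: I_pi_mult_iff)
  have "u \<noteq> 0" using assms res_0 by auto
  then show "x \<in> I k" using A_I_mult[OF A_inverse[OF assms(2,3)] 1] by (simp add: mult.assoc[symmetric])
qed

text \<open>As long as \<open>w\<close> has not reached depth \<open>k\<close>, its leading residue
  has a vanishing \<open>m\<close>-th power and therefore vanishes itself.\<close>

lemma I_root:
  assumes "w \<in> A" "w ^ m \<in> I (m * k)" "m > 0" shows "w \<in> I k"
proof -
  have "i \<le> k \<Longrightarrow> w \<in> I i" for i
  proof (induction i)
    case 0 then show ?case using assms by (simp add: I_0)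
  next
    case (Suc i)
    then obtain w' where w': "w' \<in> A" "w = \<pi> ^ i * w'" by (auto elim: I_E)
    have "w ^ m \<in> I (i * m + 1)"
    proof (rule I_mono[OF assms(2)])
      have "Suc i * m \<le> k * m" using Suc by (intro mult_le_mono1) simp
      then show "i * m + 1 \<le> m * k" using assms(3) by (simp add: mult.commute)
    qed
    then have "\<pi> ^ (i * m) * w' ^ m \<in> I (i * m + 1)"
      using w' by (simp add: power_mult_distrib power_mult)
    then have "w' ^ m \<in> I 1" by (simp only: I_pi_mult_iff)
    then have "res w' ^ m = 0" using w' by (simp add: res_eq_0_I[symmetric] A_power res_power)
    then have "res w' = 0" using assms(3) by simp
    then have "w' \<in> I 1" using w' by (simp add: res_eq_0_I)
    from I_mult[OF pi_I this, of i] show ?case using w' by (simp add: One_nat_def)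
  qed
  then show ?thesis by simp
qed

text \<open>The image of Frobenius modulo \<open>p\<close>; informally, the power series in \<open>\<pi> ^ p\<close>.\<close>

definition is_power :: "'b \<Rightarrow> bool" where "is_power x \<longleftrightarrow> (\<exists>y\<in>A. cg (p^2) x (y ^ p))"

lemma is_power_cg: "\<lbrakk>is_power x; cg (p^2) x y\<rbrakk> \<Longrightarrow> is_power y"
  unfolding is_power_def using cg_trans cg_sym by meson

lemma is_power_power: "y \<in> A \<Longrightarrow> is_power (y ^ p)"
  unfolding is_power_def by (intro bexI[of _ y] cg_refl)

lemma is_power_A: "is_power x \<Longrightarrow> x \<in> A"
  unfolding is_power_def using cg_A A_power by blast

lemma is_power_add: assumes "is_power x" "is_power y" shows "is_power (x + y)"
proof -
  obtain x' y' where xy: "x' \<in> A" "cg (p^2) x (x' ^ p)" "y' \<in> A" "cg (p^2) y (y' ^ p)"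
    using assms unfolding is_power_def by blast
  have "cg (p^2) (x + y) (x' ^ p + y' ^ p)" using xy by (intro cg_add)
  also have "cg (p^2) \<dots> ((x' + y') ^ p)"
    using cg_sym[OF cg_freshman[of x' y' 0]] xy by (simp add: I_0)
  finally show ?thesis unfolding is_power_def using xy A_add by blast
qed

lemma is_power_mult: assumes "is_power x" "is_power y" shows "is_power (x * y)"
proof -
  obtain x' y' where xy: "x' \<in> A" "cg (p^2) x (x' ^ p)" "y' \<in> A" "cg (p^2) y (y' ^ p)"
    using assms unfolding is_power_def by blast
  have "cg (p^2) (x * y) ((x' * y') ^ p)"
    unfolding power_mult_distrib using xy is_power_A[OF assms(1)] by (intro cg_mult A_power)
  then show ?thesis unfolding is_power_def using xy A_mult by blast
qed

text \<open>The residue has a p-th root because the residue field is perfect, and an element of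
  \<open>R\<close> with residue 0 is divisible by p.\<close>

lemma is_power_R: assumes "x \<in> R" shows "is_power x"
proof -
  obtain u where u: "u ^ p = res x" using res_perfect by blast
  obtain b where b: "b \<in> R" "res b = u" using res_lift by blast
  have "x - b ^ p \<in> R" "res (x - b ^ p) = 0"
    using assms b u R_A by (auto simp: res_simps A_closed intro!: R_closed)
  then have "cg (p^2) x (b ^ p)" unfolding cg_def by (rule R_res_0_I)
  then show ?thesis unfolding is_power_def using R_A[OF b(1)] by (intro bexI)
qed

lemma is_power_I: "x \<in> I (p^2) \<Longrightarrow> is_power x"
  unfolding is_power_def by (intro bexI[of _ 0] A_0) (simp add: cg_0_iff)

lemma is_power_uminus: "is_power x \<Longrightarrow> is_power (- x)"
  using is_power_mult[OF is_power_R[of "-1"], of x] R_uminus[OF R_1] by simp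

lemma is_power_diff: "\<lbrakk>is_power x; is_power y\<rbrakk> \<Longrightarrow> is_power (x - y)"
  using is_power_add[OF _ is_power_uminus, of x y] by simp

lemma is_power_pow: "is_power x \<Longrightarrow> is_power (x ^ m)"
  by (induction m) (auto intro: is_power_mult is_power_R R_1)

lemma is_power_sum: "(\<And>i. i \<in> S \<Longrightarrow> is_power (f i)) \<Longrightarrow> is_power (sum f S)"
  by (induction S rule: infinite_finite_induct) (auto intro: is_power_add is_power_R R_0)

lemma is_power_pi: "is_power (\<pi> ^ (p * i))"
  using is_power_power[OF A_power[OF pi_in], of i] by (simp add: power_mult[symmetric] mult.commute)

text \<open>A power series in \<open>\<pi> ^ p\<close> that starts in degree \<open>M\<close> has no term in degree between
  \<open>M\<close> and \<open>M + p\<close>.\<close>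

lemma is_power_gap:
  assumes "x \<in> I 1" "is_power (\<pi> ^ M * x)" shows "x \<in> I p"
proof -
  obtain w where w: "w \<in> A" "cg (p^2) (\<pi> ^ M * x) (w ^ p)" using assms(2) unfolding is_power_def by blast
  have "\<pi> ^ M * x \<in> I (p * (p - 1))"
    using A_I_mult[OF I_A[OF assms(1)] pi_I[of M]] by (simp add: M_def mult.commute)
  then have "w ^ p \<in> I (p * (p - 1))" by (rule cg_I[OF cg_sym[OF w(2)]]) (simp add: p_sq)
  from I_root[OF w(1) this] have "w \<in> I (p - 1)" by simp
  then obtain w' where w': "w' \<in> A" "w = \<pi> ^ (p - 1) * w'" by (elim I_E)
  have "w ^ p = \<pi> ^ M * w' ^ p"
    unfolding w'(2) power_mult_distrib power_mult[symmetric] M_def by (simp add: mult.commute)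
  with w(2) have "\<pi> ^ M * (x - w' ^ p) \<in> I (M + p)"
    unfolding M_facts(1) by (simp add: cg_def right_diff_distrib)
  then have 1: "cg p x (w' ^ p)" by (simp only: I_pi_mult_iff cg_def)
  obtain b e where b: "b \<in> R" "e \<in> A" "w' = b + \<pi> * e"
  proof -
    obtain b where b: "b \<in> R" "w' - b \<in> I 1" using A_approx w' by blast
    then obtain e where "e \<in> A" "w' - b = \<pi> * e" by (auto elim: I_E)
    with b show ?thesis by (intro that[of b e]) (auto simp: algebra_simps)
  qed
  have "cg (p^2 + 1) (w' ^ p) (b ^ p + (\<pi> * e) ^ p)"
    unfolding b(3) using b R_A pi_mult_I[of e 1] by (intro cg_freshman) auto
  then have "cg p (w' ^ p) (b ^ p + (\<pi> * e) ^ p)"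
    by (rule cg_mono) (use M_facts in arith)
  also have "cg p \<dots> (b ^ p + 0)"
    using b by (intro cg_add cg_refl, unfold cg_0_iff power_mult_distrib) (intro I_A_mult pi_I A_power)
  finally have 2: "cg p x (b ^ p)" using cg_trans[OF 1] by simp
  \<comment> \<open>\<open>x\<close> has no constant term, so neither has \<open>b^p\<close>; being
    in \<open>R\<close>, it is then divisible by p.\<close>
  have "b ^ p \<in> I 1"
    using cg_I[OF cg_mono[OF cg_sym[OF 2], of 1] assms(1)] p_ge_3 by simp
  then have "b ^ p \<in> I (p^2)" using b R_I_1_p R_power by blast
  then show ?thesis
    using p_ge_3 by (intro cg_I[OF 2] I_mono[of "b ^ p" "p^2" p]) (simp_all add: p_sq)
qed

end

context wild_eisenstein
begin

text \<open>Conditions (5) and (6) say that \<open>Delta j\<close> vanishes for \<open>j < p - 2\<close> and that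
  \<open>2 Delta (p - 2) \<theta>\<^sup>p = kappa0 \<theta>\<close> in the residue field.\<close>

definition Delta where "Delta j = (k j / \<phi>1) ^ p - h j / \<phi>0"

lemma Delta_R: "j \<in> {1..<p - 1} \<Longrightarrow> Delta j \<in> R"
  unfolding Delta_def by (intro R_diff R_power k_phi_R R_divide coeff_R coeff_unit) auto

text \<open>The coefficient of \<open>\<pi>^M\<close> outside the sum over \<open>Delta\<close>. It
  collects the shift from \<open>rho\<close> to \<open>rho - \<gamma> * \<theta>\<close> in the
  linear term, the term \<open>\<phi>1 * \<pi>^M * s^(p^2)\<close> of \<open>Sigma_p\<close>, and
  the -2 of \<open>power_p_of_unit_part\<close>.\<close>

definition kappa0 where "kappa0 \<theta> = \<phi>1 / \<phi>0 * \<gamma> * \<theta> - (\<phi>1 + 2 * \<gamma> ^ p) * \<theta> ^ p^2"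

lemma kappa0_R: "\<theta> \<in> R \<Longrightarrow> kappa0 \<theta> \<in> R"
  unfolding kappa0_def by (intro R_closed R_divide coeff_R coeff_unit gamma_R)

definition W where "W s j = \<pi> ^ (p * j) * ((1 + (\<pi> * s) ^ p) ^ j - 1)"

text \<open>The quotient begins with -s^p, so adding \<theta>^p makes the whole expression divisible
  by \<pi>^p.\<close>

definition Cq where "Cq \<theta> s = ((1 + (\<pi> * s) ^ p) ^ (p - 1) - 1) / \<pi> ^ p + \<theta> ^ p"

text \<open>The part of \<open>Sigma_p (\<theta> + \<pi> * r)\<close> that remains after removal of
  the two terms in \<rho>. Two terms \<gamma>^p \<theta>^p have already cancelled: one from
  splitting the p-th power of \<open>rho\<close>, one from the shift by \<theta>^p in
  \<open>Cq\<close>.\<close>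

definition T where
  "T \<theta> r = - (\<phi>0 * \<theta> ^ p^2 + \<phi>1 * \<theta> ^ p) - \<phi>0 * (\<pi> ^ p^2 * r ^ p^2) - of_nat p * (\<gamma> ^ p * \<theta> ^ p)
     + (\<phi>1 + \<gamma> ^ p) * Cq \<theta> (\<theta> + \<pi> * r) + \<pi> ^ M * kappa0 \<theta> + 2 * (\<gamma> ^ p * (\<pi> ^ p^2 * \<theta> ^ (p^2 + p)))
     + (\<Sum>j\<in>{1..<p-1}. Delta j * W (\<theta> + \<pi> * r) j) - (k (p - 1) / \<phi>1) ^ p * (\<theta> ^ p * \<pi> ^ p^2)"

context
  fixes \<theta> r assumes th: "\<theta> \<in> R" and r: "r \<in> A"
begin

private lemma thA: "\<theta> \<in> A" by (rule R_A[OF th])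

private lemma s_in: "\<theta> + \<pi> * r \<in> A" using thA r by (intro A_closed)

lemma s_power_p: "cg (p^2 + 1) ((\<theta> + \<pi> * r) ^ p) (\<theta> ^ p + \<pi> ^ p * r ^ p)"
  using cg_freshman[OF thA, of "\<pi> * r" 1] pi_mult_I[OF r, of 1] by (simp add: power_mult_distrib)

lemma s_power_p_sq: "cg (p^2 + 1) ((\<theta> + \<pi> * r) ^ p^2) (\<theta> ^ p^2 + \<pi> ^ p^2 * r ^ p^2)"
proof -
  have "cg (p^2 + 1) (((\<theta> + \<pi> * r) ^ p) ^ p) ((\<theta> ^ p + \<pi> ^ p * r ^ p) ^ p)"
    using thA r by (intro cg_power s_power_p A_closed)
  also have "cg (p^2 + 1) \<dots> ((\<theta> ^ p) ^ p + (\<pi> ^ p * r ^ p) ^ p)"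
    using cg_freshman[of "\<theta> ^ p" "\<pi> ^ p * r ^ p" p] thA r pi_mult_I[of "r ^ p" p] p_ge_3
    by (intro cg_mono[of "p^2 + p" _ _ "p^2 + 1"]) (auto intro: A_closed)
  finally show ?thesis by (simp add: power_mult_distrib power_mult[symmetric] p_sq)
qed

text \<open>To this order only three things are visible: the linear term of \<open>Lam\<close>, the
  value -1 of p - 1 modulo p, and the value 1 of (p - 1 choose 2) modulo p. The sum over
  \<open>k\<close> starts at order 2.\<close>

lemma rho_first_order:
  "cg 2 (rho (\<theta> + \<pi> * r)) (\<gamma> * \<theta> + \<pi> * (\<theta> + \<gamma> * (r - \<theta> ^ 2)))"
proof -
  define s where "s = \<theta> + \<pi> * r"
  have s: "s \<in> A" unfolding s_def by (rule s_in)
  have z: "\<pi> * s \<in> I 1" using pi_mult_I[OF s, of 1] by simp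
  have s1: "cg 1 s \<theta>" using pi_mult_I[OF r, of 1] by (simp add: s_def cg_def)
  have L: "cg 2 (Lam (\<pi> * s)) (\<pi> * \<theta>)"
  proof -
    have "cg 2 (Lam (\<pi> * s)) (\<pi> * s)" using Lam_first_order[OF z] by simp
    also have "cg 2 (\<pi> * s) (\<pi> * \<theta>)" using cg_pi_mult[OF s1, of 1] by simp
    finally show ?thesis .
  qed
  have S: "cg 2 (\<Sum>j\<in>{1..<p}. k j / \<phi>1 * (\<pi> ^ j * ((1 + \<pi> * s) ^ j - 1))) 0"
    unfolding cg_0_iff
  proof (rule I_sum, rule A_I_mult[OF k_phi_A])
    fix j assume j: "j \<in> {1..<p}"
    from I_mult[OF pi_I one_plus_power_I[OF z]]
    show "\<pi> ^ j * ((1 + \<pi> * s) ^ j - 1) \<in> I 2" by (rule I_mono) (use j in auto)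
  qed
  define Y where "Y = (\<pi> * s) ^ p"
  have Y: "Y \<in> I 3" unfolding Y_def using I_power[OF z, of p] p_ge_3 by (auto intro: I_mono)
  have "cg 3 ((1 + Y) ^ (p - 2) * (1 + \<pi> * s) ^ (p - 1) - 1) (1 * (1 + \<pi> * s) ^ (p - 1) - 1)"
    using one_plus_power_I[OF Y, of "p - 2"] s
    by (intro cg_diff cg_refl cg_mult_right A_closed) (simp_all add: cg_def)
  also have "cg 3 \<dots> (1 + of_nat (p - 1) * (\<pi> * s) + of_nat ((p - 1) choose 2) * (\<pi> * s) ^ 2 - 1)"
    using cg_one_plus_power_quad[OF z, of "p - 1"] by (intro cg_diff cg_refl) simp
  also have "cg 3 \<dots> (1 + (- 1) * (\<pi> * s) + 1 * (\<pi> * s) ^ 2 - 1)"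
  proof (intro cg_diff cg_add cg_refl cg_mult_right A_closed s)
    have "3 \<le> p^2" using M_facts by arith
    then show "cg 3 (of_nat (p - 1)) (- 1)" "cg 3 (of_nat ((p - 1) choose 2)) 1"
      using cg_mono[OF of_nat_pred] cg_mono[OF choose_pred_two] by auto
  qed
  also have "1 + (- 1) * (\<pi> * s) + 1 * (\<pi> * s) ^ 2 - 1 = \<pi> * (- s + \<pi> * s ^ 2)"
    by (simp add: algebra_simps power2_eq_square)
  finally have "cg (1 + 2) ((1 + Y) ^ (p - 2) * (1 + \<pi> * s) ^ (p - 1) - 1) (\<pi> * (- s + \<pi> * s ^ 2))"
    by simp
  from cg_pi_div[OF this]
  have "cg 2 (((1 + Y) ^ (p - 2) * (1 + \<pi> * s) ^ (p - 1) - 1) / \<pi>) (- s + \<pi> * s ^ 2)"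
    using pi_nz by simp
  also have "cg 2 \<dots> (- s + \<pi> * \<theta> ^ 2)"
    using cg_pi_mult[OF cg_power[OF s1 thA, of 2], of 1] by (intro cg_add cg_refl) simp
  finally have "cg 2 (\<gamma> * (((1 + Y) ^ (p - 2) * (1 + \<pi> * s) ^ (p - 1) - 1) / \<pi>)) (\<gamma> * (- s + \<pi> * \<theta> ^ 2))"
    by (intro cg_mult_left gamma_A)
  from cg_diff[OF cg_diff[OF L S] this]
  have "cg 2 (rho s) (\<pi> * \<theta> - 0 - \<gamma> * (- s + \<pi> * \<theta> ^ 2))"
    unfolding rho_def Y_def \<gamma>_def .
  also have "\<pi> * \<theta> - 0 - \<gamma> * (- s + \<pi> * \<theta> ^ 2) = \<gamma> * \<theta> + \<pi> * (\<theta> + \<gamma> * (r - \<theta> ^ 2))"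
    by (simp add: s_def algebra_simps)
  finally show ?thesis unfolding s_def .
qed

lemma rho_zeroth_order: "rho (\<theta> + \<pi> * r) - \<gamma> * \<theta> \<in> I 1"
proof -
  have "cg 1 (rho (\<theta> + \<pi> * r)) (\<gamma> * \<theta> + \<pi> * (\<theta> + \<gamma> * (r - \<theta> ^ 2)))"
    by (rule cg_mono[OF rho_first_order]) simp
  also have "cg 1 \<dots> (\<gamma> * \<theta> + 0)"
    using pi_mult_I[of "\<theta> + \<gamma> * (r - \<theta> ^ 2)" 1] thA r gamma_A
    by (intro cg_add cg_refl) (auto simp: cg_0_iff intro!: A_closed)
  finally show ?thesis by (simp add: cg_def)
qed

text \<open>Read backwards, \<open>rho_power_p\<close> expresses Lam(z^p) by the p-th power of
  \<open>rho\<close>. After this substitution the sums over \<open>k\<close> and \<open>h\<close>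
  combine to \<open>Delta\<close>, and the two multiples of the quotient in \<open>Cq\<close>
  combine to the factor \<phi>1 + \<gamma>^p.\<close>

lemma Sigma_p_expansion:
  "cg (p^2 + 1) (Sigma_p (\<theta> + \<pi> * r))
    ((rho (\<theta> + \<pi> * r) - \<gamma> * \<theta>) ^ p
      + \<phi>1 / \<phi>0 * \<pi> ^ M * (rho (\<theta> + \<pi> * r) - \<gamma> * \<theta>) + T \<theta> r)"
proof -
  define s where "s = \<theta> + \<pi> * r"
  have s: "s \<in> A" unfolding s_def by (rule s_in)
  define \<rho> where "\<rho> = rho s - \<gamma> * \<theta>"
  have \<rho>: "\<rho> \<in> I 1" unfolding \<rho>_def s_def by (rule rho_zeroth_order)
  have n: "M + p = p^2" "2 * p \<le> M" "p + 3 \<le> M" by (rule M_facts)+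
  define L where "L = Lam ((\<pi> * s) ^ p)"
  define V where "V = ((1 + (\<pi> * s) ^ p) ^ (p - 1) - 1) / \<pi> ^ p"
  define S1 where "S1 = (\<Sum>j\<in>{1..<p}. (k j / \<phi>1) ^ p * W s j)"
  define S2 where "S2 = (\<Sum>q\<in>{1..<p-1}. h q * W s q)"
  define K where "K = k (p - 1) / \<phi>1"
  have KA: "K \<in> A" unfolding K_def using p_ge_3 by (intro k_phi_A) simp
  have Sig: "Sigma_p s = - ((\<phi>0 + \<phi>1 * \<pi> ^ M) * s ^ p^2) + L + \<phi>1 * V + \<phi>1 / \<phi>0 * \<pi> ^ M * rho s - 1 / \<phi>0 * S2"
    unfolding Sigma_p_def L_def V_def S2_def W_def ..
  have rp: "cg (p^2 + 1) (rho s ^ p) (L - S1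
     - \<gamma> ^ p * (V - of_nat p * s ^ p - 2 * (\<pi> ^ M * s ^ p^2) + 2 * (\<pi> ^ p^2 * s ^ (p^2 + p))))"
    using rho_power_p[OF s] unfolding L_def V_def S1_def W_def .
  have rp': "cg (p^2 + 1) (rho s ^ p) (\<gamma> ^ p * \<theta> ^ p + \<rho> ^ p)"
    using cg_freshman[of "\<gamma> * \<theta>" \<rho> 1] \<rho> gamma_A thA
    by (simp add: A_mult \<rho>_def power_mult_distrib)
  have Lc: "cg (p^2 + 1) L (\<gamma> ^ p * \<theta> ^ p + \<rho> ^ p + S1
     + \<gamma> ^ p * (V - of_nat p * s ^ p - 2 * (\<pi> ^ M * s ^ p^2) + 2 * (\<pi> ^ p^2 * s ^ (p^2 + p))))"
  proof -
    define x where "x = S1 + \<gamma> ^ p * (V - of_nat p * s ^ p - 2 * (\<pi> ^ M * s ^ p^2) + 2 * (\<pi> ^ p^2 * s ^ (p^2 + p)))"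
    have "cg (p^2 + 1) (L - x + x) (\<gamma> ^ p * \<theta> ^ p + \<rho> ^ p + x)"
      using cg_trans[OF cg_sym[OF rp] rp'] by (intro cg_add cg_refl) (simp add: x_def algebra_simps)
    then show ?thesis by (simp add: x_def add.assoc)
  qed
  have WI: "W s j \<in> I (p * j + p)" for j
    unfolding W_def using I_power[OF pi_mult_I[OF s, of 1], of p]
    by (intro I_mult pi_I one_plus_power_I) simp
  \<comment> \<open>The sum over \<open>k\<close> has one index more than the sum over
    \<open>h\<close>. At this index p - 1 the factor \<open>W\<close> has order p^2, so only its
    leading term counts.\<close>
  have S1c: "cg (p^2 + 1) (S1 - 1 / \<phi>0 * S2) ((\<Sum>j\<in>{1..<p-1}. Delta j * W s j) - K ^ p * (\<theta> ^ p * \<pi> ^ p^2))"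
  proof -
    have "{1..<p} = insert (p - 1) {1..<p-1}" using p_ge_3 by auto
    then have "S1 - 1 / \<phi>0 * S2 = (\<Sum>j\<in>{1..<p-1}. Delta j * W s j) + K ^ p * W s (p - 1)"
      unfolding S1_def S2_def sum_distrib_left Delta_def K_def
      by (simp add: sum_subtractf[symmetric] left_diff_distrib mult.assoc)
    also have "cg (p^2 + 1) \<dots> ((\<Sum>j\<in>{1..<p-1}. Delta j * W s j) + K ^ p * (- (\<theta> ^ p * \<pi> ^ p^2)))"
    proof (rule cg_add[OF cg_refl], rule cg_mult_left[OF A_power[OF KA]])
      have "cg (2 * p) ((1 + (\<pi> * s) ^ p) ^ (p - 1)) (1 + of_nat (p - 1) * (\<pi> * s) ^ p)"
        using I_power[OF pi_mult_I[OF s, of 1], of p] by (intro cg_one_plus_power) simp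
      from cg_diff[OF this cg_refl[of _ 1]]
      have "cg (2 * p) ((1 + (\<pi> * s) ^ p) ^ (p - 1) - 1) (of_nat (p - 1) * (\<pi> * s) ^ p)" by simp
      then have "cg (p + 1) ((1 + (\<pi> * s) ^ p) ^ (p - 1) - 1) (of_nat (p - 1) * (\<pi> * s) ^ p)"
        by (rule cg_mono) (use p_ge_3 in arith)
      also have "of_nat (p - 1) * (\<pi> * s) ^ p = \<pi> ^ p * (of_nat (p - 1) * s ^ p)"
        by (simp add: power_mult_distrib)
      also have "cg (p + 1) \<dots> (\<pi> ^ p * ((- 1) * \<theta> ^ p))"
      proof (intro cg_pi_mult cg_mult A_closed thA)
        show "cg 1 (of_nat (p - 1)) (- 1)" by (rule cg_mono[OF of_nat_pred one_le_p_sq])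
        have "cg 1 s \<theta>" using pi_mult_I[OF r, of 1] by (simp add: s_def cg_def)
        then show "cg 1 (s ^ p) (\<theta> ^ p)" by (intro cg_power thA)
      qed
      finally have "cg (M + (p + 1)) (\<pi> ^ M * ((1 + (\<pi> * s) ^ p) ^ (p - 1) - 1)) (\<pi> ^ M * (\<pi> ^ p * ((- 1) * \<theta> ^ p)))"
        by (rule cg_pi_mult)
      moreover have "M + (p + 1) = p^2 + 1" using n by simp
      moreover have "\<pi> ^ M * (\<pi> ^ p * ((- 1) * \<theta> ^ p)) = - (\<theta> ^ p * \<pi> ^ p^2)"
        unfolding n(1)[symmetric] by (simp add: power_add mult_ac)
      moreover have "\<pi> ^ M * ((1 + (\<pi> * s) ^ p) ^ (p - 1) - 1) = W s (p - 1)"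
        by (simp add: W_def M_def)
      ultimately show "cg (p^2 + 1) (W s (p - 1)) (- (\<theta> ^ p * \<pi> ^ p^2))" by (simp only:)
    qed
    finally show ?thesis by simp
  qed
  have sn: "cg (p^2 + 1) (s ^ p^2) (\<theta> ^ p^2 + \<pi> ^ p^2 * r ^ p^2)" unfolding s_def by (rule s_power_p_sq)
  have sn1: "cg 1 s \<theta>" using pi_mult_I[OF r, of 1] by (simp add: s_def cg_def)
  have sM: "cg (p^2 + 1) (\<pi> ^ M * s ^ p^2) (\<pi> ^ M * \<theta> ^ p^2)"
  proof -
    have "cg (p^2) (s ^ p^2) (\<theta> ^ p^2 + \<pi> ^ p^2 * r ^ p^2)" by (rule cg_mono[OF sn]) simp
    also have "cg (p^2) \<dots> (\<theta> ^ p^2 + 0)"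
      using r by (intro cg_add cg_refl) (auto simp: cg_0_iff intro!: pi_mult_I A_power)
    finally have "cg (M + p^2) (\<pi> ^ M * s ^ p^2) (\<pi> ^ M * \<theta> ^ p^2)" by (intro cg_pi_mult) simp
    then show ?thesis by (rule cg_mono) (use n in arith)
  qed
  have sp: "cg (p^2 + 1) (of_nat p * s ^ p) (of_nat p * \<theta> ^ p)"
    by (intro cg_p_mult cg_power sn1 thA)
  have snp: "cg (p^2 + 1) (\<pi> ^ p^2 * s ^ (p^2 + p)) (\<pi> ^ p^2 * \<theta> ^ (p^2 + p))"
    by (intro cg_pi_mult cg_power sn1 thA)
  have "Sigma_p s = L + (S1 - 1 / \<phi>0 * S2) - S1 + \<phi>1 / \<phi>0 * \<pi> ^ M * rho s + \<phi>1 * V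
     - \<phi>0 * s ^ p^2 - \<phi>1 * (\<pi> ^ M * s ^ p^2)"
    unfolding Sig by (simp add: algebra_simps)
  also have "cg (p^2 + 1) \<dots> ((\<gamma> ^ p * \<theta> ^ p + \<rho> ^ p + S1
       + \<gamma> ^ p * (V - of_nat p * s ^ p - 2 * (\<pi> ^ M * s ^ p^2) + 2 * (\<pi> ^ p^2 * s ^ (p^2 + p))))
     + ((\<Sum>j\<in>{1..<p-1}. Delta j * W s j) - K ^ p * (\<theta> ^ p * \<pi> ^ p^2)) - S1
     + \<phi>1 / \<phi>0 * \<pi> ^ M * rho s + \<phi>1 * V
     - \<phi>0 * s ^ p^2 - \<phi>1 * (\<pi> ^ M * s ^ p^2))"
    by (intro cg_diff cg_add cg_refl Lc S1c)
  also have "\<dots> = (\<gamma> ^ p * \<theta> ^ p + \<rho> ^ p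
       + \<gamma> ^ p * (V - of_nat p * s ^ p - 2 * (\<pi> ^ M * s ^ p^2) + 2 * (\<pi> ^ p^2 * s ^ (p^2 + p))))
     + ((\<Sum>j\<in>{1..<p-1}. Delta j * W s j) - K ^ p * (\<theta> ^ p * \<pi> ^ p^2))
     + \<phi>1 / \<phi>0 * \<pi> ^ M * rho s + \<phi>1 * V
     - \<phi>0 * s ^ p^2 - \<phi>1 * (\<pi> ^ M * s ^ p^2)" by simp
  also have "cg (p^2 + 1) \<dots> ((\<gamma> ^ p * \<theta> ^ p + \<rho> ^ p
       + \<gamma> ^ p * (V - of_nat p * \<theta> ^ p - 2 * (\<pi> ^ M * \<theta> ^ p^2) + 2 * (\<pi> ^ p^2 * \<theta> ^ (p^2 + p))))
     + ((\<Sum>j\<in>{1..<p-1}. Delta j * W s j) - K ^ p * (\<theta> ^ p * \<pi> ^ p^2))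
     + \<phi>1 / \<phi>0 * \<pi> ^ M * rho s + \<phi>1 * V
     - \<phi>0 * (\<theta> ^ p^2 + \<pi> ^ p^2 * r ^ p^2) - \<phi>1 * (\<pi> ^ M * \<theta> ^ p^2))"
    by (rule cg_diff cg_add cg_refl cg_mult_left[OF coeff_A(1)] cg_mult_left[OF coeff_A(2)]
        cg_mult_left[OF A_power[OF gamma_A]] cg_mult_left[OF A_numeral] sp sM snp sn)+
  also have "\<dots> = \<rho> ^ p + \<phi>1 / \<phi>0 * \<pi> ^ M * \<rho> + T \<theta> r"
    unfolding T_def Cq_def kappa0_def s_def[symmetric] V_def[symmetric] K_def[symmetric] \<rho>_def
    by (simp add: algebra_simps diff_divide_distrib)
  finally show ?thesis unfolding \<rho>_def s_def .
qed

end

end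

context totally_ramified
begin

lemma of_nat_unit:
  assumes "j \<in> {1..<p}" shows "(of_nat j :: 'k) \<noteq> 0"
proof
  assume "(of_nat j :: 'k) = 0"
  then have "CHAR('k) dvd j" by (simp add: of_nat_eq_0_iff_char_dvd)
  moreover have "CHAR('k) dvd p" using of_nat_p_zero by (simp add: of_nat_eq_0_iff_char_dvd)
  ultimately have "CHAR('k) dvd gcd j p" by simp
  moreover have "coprime j p"
    using assms prime_p by (metis atLeastLessThan_iff coprime_commute dvd_imp_le not_le
        prime_imp_coprime_nat less_le_trans zero_less_one)
  ultimately have "CHAR('k) = 1" by (simp add: One_nat_def)
  then show False using CHAR_not_1' by (simp add: One_nat_def)
qed

lemma CHAR_residue: "CHAR('k) = p"
proof -
  have "CHAR('k) dvd p" using of_nat_p_zero by (simp add: of_nat_eq_0_iff_char_dvd)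
  then have "CHAR('k) = 1 \<or> CHAR('k) = p" using prime_p unfolding prime_nat_iff by blast
  moreover have "CHAR('k) \<noteq> 1" using CHAR_not_1' by (simp add: One_nat_def)
  ultimately show ?thesis by blast
qed

lemma res_power_add: "((x :: 'k) + y) ^ p = x ^ p + y ^ p"
  by (rule freshmans_dream) (simp_all only: CHAR_residue prime_p)

lemma res_power_inj: "(x :: 'k) ^ p = y ^ p \<Longrightarrow> x = y"
proof -
  assume "x ^ p = y ^ p"
  moreover have "(x - y + y) ^ p = (x - y) ^ p + y ^ p" by (rule res_power_add)
  ultimately have "(x - y) ^ p = 0" by simp
  then show ?thesis by simp
qed

end

context wild_eisenstein
begin

lemma Delta_last_R: "Delta (p - 2) \<in> R"
proof (rule Delta_R)
  have "1 \<le> p - 2" "p - 2 < p - 1" using p_ge_3 by linarith+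
  then show "p - 2 \<in> {1..<p - 1}" by simp
qed

text \<open>The coefficient of \<pi>^(p^2) in \<open>T\<close> once the lower ones vanish. Multiples
  of p enter through p \<equiv> -\<pi>^(p^2)/\<phi>0, and the third summand already uses \<gamma>^p
  \<equiv> -\<phi>1.\<close>

definition D_const where
  "D_const \<theta> r = (\<phi>0 * \<theta> ^ p^2 + \<phi>1 * \<theta> ^ p) / of_nat p / \<phi>0 - \<phi>0 * r ^ p^2 - \<phi>1 / \<phi>0 * \<theta> ^ p
     + 2 * (\<gamma> ^ p * \<theta> ^ (p^2 + p)) - (k (p - 1) / \<phi>1) ^ p * \<theta> ^ p
     + Delta (p - 2) * (3 * \<theta> ^ (2 * p) - 2 * r ^ p)"

context
  fixes \<theta> r assumes th: "\<theta> \<in> R" and r: "r \<in> A"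
begin

private lemma th_A1: "\<theta> \<in> A" by (rule R_A[OF th])

private lemma s_in1: "\<theta> + \<pi> * r \<in> A" using th_A1 r by (intro A_closed)

private lemma Y_eq: "(\<pi> * (\<theta> + \<pi> * r)) ^ p = \<pi> ^ p * (\<theta> + \<pi> * r) ^ p"
  by (rule power_mult_distrib)

private lemma Y_I: "(\<pi> * (\<theta> + \<pi> * r)) ^ p \<in> I p"
  unfolding Y_eq using s_in1 by (intro pi_mult_I A_power)

private lemma s_power_p_weak: "cg p ((\<theta> + \<pi> * r) ^ p) (\<theta> ^ p)"
proof -
  have "cg p ((\<theta> + \<pi> * r) ^ p) (\<theta> ^ p + \<pi> ^ p * r ^ p)"
    by (rule cg_mono[OF s_power_p[OF th r]]) (use M_facts in arith)
  also have "cg p \<dots> (\<theta> ^ p + 0)"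
    using r by (intro cg_add cg_refl) (auto simp: cg_0_iff intro!: pi_mult_I A_power)
  finally show ?thesis by simp
qed

private lemma s_power_p_2p: "cg (2 * p) ((\<theta> + \<pi> * r) ^ p) (\<theta> ^ p + \<pi> ^ p * r ^ p)"
  by (rule cg_mono[OF s_power_p[OF th r]]) (use M_facts in arith)

lemma W_I: "W (\<theta> + \<pi> * r) j \<in> I (p * j + p)"
  unfolding W_def by (intro I_mult pi_I one_plus_power_I Y_I)

lemma W_leading: "cg (p * j + 2 * p) (W (\<theta> + \<pi> * r) j) (\<pi> ^ (p * j + p) * (of_nat j * \<theta> ^ p))"
proof -
  have "cg (2 * p) ((1 + (\<pi> * (\<theta> + \<pi> * r)) ^ p) ^ j - 1)
     (1 + of_nat j * (\<pi> * (\<theta> + \<pi> * r)) ^ p - 1)"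
    by (intro cg_diff cg_refl cg_one_plus_power Y_I)
  also have "1 + of_nat j * (\<pi> * (\<theta> + \<pi> * r)) ^ p - 1 = \<pi> ^ p * (of_nat j * (\<theta> + \<pi> * r) ^ p)"
    unfolding Y_eq by simp
  also have "cg (2 * p) \<dots> (\<pi> ^ p * (of_nat j * \<theta> ^ p))"
    unfolding mult_2 by (intro cg_pi_mult cg_mult_left s_power_p_weak A_closed)
  finally have "cg (p * j + 2 * p) (W (\<theta> + \<pi> * r) j) (\<pi> ^ (p * j) * (\<pi> ^ p * (of_nat j * \<theta> ^ p)))"
    unfolding W_def by (rule cg_pi_mult)
  then show ?thesis by (simp add: power_add mult.assoc)
qed

text \<open>For this index the leading order p(p - 2) + p equals M and the next one is p^2, so two
  coefficients matter. The 3 is (p - 2 choose 2) modulo p.\<close>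

lemma W_last:
  "cg (p^2 + 1) (W (\<theta> + \<pi> * r) (p - 2))
     (\<pi> ^ M * (- 2 * \<theta> ^ p) + \<pi> ^ p^2 * (3 * \<theta> ^ (2 * p) - 2 * r ^ p))"
proof -
  define Y where "Y = (\<pi> * (\<theta> + \<pi> * r)) ^ p"
  have n: "M + p = p^2" "p * (p - 2) + p = M" "2 * p \<le> M" using M_facts by auto
  have Y: "Y = \<pi> ^ p * (\<theta> + \<pi> * r) ^ p" "Y \<in> I p" unfolding Y_def using Y_eq Y_I by auto
  have Yc: "cg (3 * p) Y (\<pi> ^ p * (\<theta> ^ p + \<pi> ^ p * r ^ p))"
    using cg_pi_mult[OF s_power_p_2p, of p] unfolding Y by simp
  have Yc2: "cg (3 * p) (Y ^ 2) (\<pi> ^ (2 * p) * \<theta> ^ (2 * p))"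
  proof -
    have "Y ^ 2 = \<pi> ^ (2 * p) * ((\<theta> + \<pi> * r) ^ p) ^ 2"
      unfolding Y by (simp add: power_mult_distrib power_mult[symmetric] mult.commute)
    also have "cg (2 * p + p) \<dots> (\<pi> ^ (2 * p) * (\<theta> ^ p) ^ 2)"
      using th_A1 by (intro cg_pi_mult cg_power s_power_p_weak A_power)
    finally show ?thesis by (simp add: power_mult[symmetric] mult.commute)
  qed
  have n3: "3 * p \<le> p^2" using n by arith
  have "cg (3 * p) ((1 + Y) ^ (p - 2) - 1)
      (1 + of_nat (p - 2) * Y + of_nat ((p - 2) choose 2) * Y ^ 2 - 1)"
    by (intro cg_diff cg_refl cg_one_plus_power_quad Y)
  also have "cg (3 * p) \<dots> (1 + (-2) * Y + 3 * Y ^ 2 - 1)"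
    using I_A[OF Y(2)] cg_mono[OF of_nat_pred_pred n3] cg_mono[OF choose_pred_pred_two n3]
    by (intro cg_diff cg_add cg_refl cg_mult_right A_closed)
  also have "cg (3 * p) \<dots> (1 + (-2) * (\<pi> ^ p * (\<theta> ^ p + \<pi> ^ p * r ^ p)) + 3 * (\<pi> ^ (2 * p) * \<theta> ^ (2 * p)) - 1)"
    by (intro cg_diff cg_add cg_refl cg_mult_left A_closed Yc Yc2)
  also have "\<dots> = \<pi> ^ p * (- 2 * \<theta> ^ p) + \<pi> ^ (2 * p) * (3 * \<theta> ^ (2 * p) - 2 * r ^ p)"
    unfolding mult_2 power_add by (simp add: algebra_simps)
  finally have "cg (p * (p - 2) + 3 * p) (W (\<theta> + \<pi> * r) (p - 2)) (\<pi> ^ (p * (p - 2)) *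
      (\<pi> ^ p * (- 2 * \<theta> ^ p) + \<pi> ^ (2 * p) * (3 * \<theta> ^ (2 * p) - 2 * r ^ p)))"
    unfolding W_def Y_def by (rule cg_pi_mult)
  moreover have "p * (p - 2) + 3 * p = p^2 + p" "p * (p - 2) + 2 * p = p^2"
    unfolding n(1)[symmetric] n(2)[symmetric] by simp_all
  moreover have "\<pi> ^ (p * (p - 2)) * (\<pi> ^ p * x + \<pi> ^ (2 * p) * y) = \<pi> ^ M * x + \<pi> ^ p^2 * y" for x y
  proof -
    have "\<pi> ^ M = \<pi> ^ (p * (p - 2)) * \<pi> ^ p" "\<pi> ^ p^2 = \<pi> ^ (p * (p - 2)) * \<pi> ^ (2 * p)"
      using n(2) calculation(3) by (metis power_add)+
    then show ?thesis by (simp add: algebra_simps)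
  qed
  ultimately have "cg (p^2 + p) (W (\<theta> + \<pi> * r) (p - 2))
     (\<pi> ^ M * (- 2 * \<theta> ^ p) + \<pi> ^ p^2 * (3 * \<theta> ^ (2 * p) - 2 * r ^ p))"
    by metis
  then show ?thesis by (rule cg_mono) (use p_ge_3 in arith)
qed

lemma Cq_leading: "cg (2 * p) (Cq \<theta> (\<theta> + \<pi> * r)) (\<pi> ^ p * (\<theta> ^ (2 * p) - r ^ p))"
proof -
  define s where "s = \<theta> + \<pi> * r"
  have s: "s \<in> A" unfolding s_def by (rule s_in1)
  define Y where "Y = (\<pi> * s) ^ p"
  have Y: "Y = \<pi> ^ p * s ^ p" "Y \<in> I p" unfolding Y_def s_def using Y_eq Y_I by auto
  have n3: "3 * p \<le> p^2" using M_facts by arith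
  have "cg (p + 2 * p) ((1 + Y) ^ (p - 1) - 1)
      (1 + of_nat (p - 1) * Y + of_nat ((p - 1) choose 2) * Y ^ 2 - 1)"
    using cg_one_plus_power_quad[OF Y(2)] by (intro cg_diff cg_refl) simp
  also have "cg (p + 2 * p) \<dots> (1 + (-1) * Y + 1 * Y ^ 2 - 1)"
    using I_A[OF Y(2)] cg_mono[OF of_nat_pred n3] cg_mono[OF choose_pred_two n3]
    by (intro cg_diff cg_add cg_refl cg_mult_right A_closed) simp_all
  also have "1 + (-1) * Y + 1 * Y ^ 2 - 1 = \<pi> ^ p * (- (s ^ p) + \<pi> ^ p * (s ^ p) ^ 2)"
    unfolding Y by (simp add: algebra_simps power2_eq_square)
  finally have "cg (2 * p) (((1 + Y) ^ (p - 1) - 1) / \<pi> ^ p)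
      (\<pi> ^ p * (- (s ^ p) + \<pi> ^ p * (s ^ p) ^ 2) / \<pi> ^ p)"
    by (rule cg_pi_div)
  then have "cg (2 * p) (((1 + Y) ^ (p - 1) - 1) / \<pi> ^ p) (- (s ^ p) + \<pi> ^ p * (s ^ p) ^ 2)"
    using pi_nz by simp
  also have "cg (2 * p) \<dots> (- (\<theta> ^ p + \<pi> ^ p * r ^ p) + \<pi> ^ p * (\<theta> ^ p) ^ 2)"
    unfolding s_def
  proof (intro cg_add cg_uminus s_power_p_2p)
    have "cg (p + p) (\<pi> ^ p * ((\<theta> + \<pi> * r) ^ p) ^ 2) (\<pi> ^ p * (\<theta> ^ p) ^ 2)"
      using th_A1 by (intro cg_pi_mult cg_power s_power_p_weak A_power)
    then show "cg (2 * p) (\<pi> ^ p * ((\<theta> + \<pi> * r) ^ p) ^ 2) (\<pi> ^ p * (\<theta> ^ p) ^ 2)"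
      by (simp only: mult_2)
  qed
  finally have "cg (2 * p) (((1 + Y) ^ (p - 1) - 1) / \<pi> ^ p + \<theta> ^ p)
    (- (\<theta> ^ p + \<pi> ^ p * r ^ p) + \<pi> ^ p * (\<theta> ^ p) ^ 2 + \<theta> ^ p)"
    by (intro cg_add cg_refl)
  then show ?thesis unfolding Cq_def Y_def s_def
    by (simp add: algebra_simps power_mult[symmetric] mult.commute)
qed

text \<open>Modulo p, \<open>T\<close> is built from elements of \<open>R\<close>, powers of \<pi>^p
  and p-th powers. The division by \<pi>^p inside \<open>Cq\<close> is covered by
  \<open>power_p_of_pred_power\<close>, which shows the quotient to be a p-th power up to a multiple
  of p.\<close>

lemma is_power_T: "is_power (T \<theta> r)"
proof -
  define s where "s = \<theta> + \<pi> * r"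
  have s: "s \<in> A" unfolding s_def by (rule s_in1)
  have Y: "is_power ((\<pi> * s) ^ p)" using s by (intro is_power_power A_closed)
  have C: "is_power (Cq \<theta> s)"
  proof -
    have "cg (p^2) ((((1 + \<pi> * s) ^ (p - 1) - 1) / \<pi>) ^ p)
       (((1 + (\<pi> * s) ^ p) ^ (p - 1) - 1) / \<pi> ^ p - of_nat p * s ^ p)"
      by (rule cg_mono[OF power_p_of_pred_power[OF s]]) simp
    moreover have "((1 + \<pi> * s) ^ (p - 1) - 1) / \<pi> \<in> A"
      using one_plus_power_I[OF pi_mult_I[OF s, of 1], of "p - 1"] by (simp add: I_def)
    ultimately have "is_power (((1 + (\<pi> * s) ^ p) ^ (p - 1) - 1) / \<pi> ^ p - of_nat p * s ^ p)"
      by (rule is_power_cg[OF is_power_power, rotated])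
    from is_power_add[OF this is_power_mult[OF is_power_R[OF R_of_nat] is_power_power[OF s]], of p]
    have "is_power (((1 + (\<pi> * s) ^ p) ^ (p - 1) - 1) / \<pi> ^ p)" by simp
    then show ?thesis unfolding Cq_def using is_power_power[OF th_A1] by (rule is_power_add)
  qed
  have Wp: "is_power (W s j)" for j
    unfolding W_def
    by (intro is_power_mult is_power_pi is_power_diff is_power_pow is_power_add Y is_power_R R_1)
  have pin: "is_power (\<pi> ^ p^2)" using is_power_pi[of p] by (simp add: p_sq)
  have piM: "is_power (\<pi> ^ M)" unfolding M_def by (rule is_power_pi)
  have rp: "is_power (r ^ p^2)" using is_power_power[OF A_power[OF r], of p]
    by (simp add: power_mult[symmetric] p_sq)
  have K: "k (p - 1) / \<phi>1 \<in> R" using p_ge_3 by (intro k_phi_R) simp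
  have "is_power (- (\<phi>0 * \<theta> ^ p^2 + \<phi>1 * \<theta> ^ p))" "is_power (of_nat p * (\<gamma> ^ p * \<theta> ^ p))"
    by (intro is_power_R R_closed coeff_R gamma_R th)+
  moreover have "is_power (\<phi>0 * (\<pi> ^ p^2 * r ^ p^2))"
    by (intro is_power_mult[OF is_power_R is_power_mult[OF pin rp]] coeff_R)
  moreover have "is_power ((\<phi>1 + \<gamma> ^ p) * Cq \<theta> s)"
    by (intro is_power_mult[OF is_power_R C] R_closed coeff_R gamma_R)
  moreover have "is_power (\<pi> ^ M * kappa0 \<theta>)"
    by (intro is_power_mult[OF piM is_power_R] kappa0_R th)
  moreover have "is_power (2 * (\<gamma> ^ p * (\<pi> ^ p^2 * \<theta> ^ (p^2 + p))))"
    by (intro is_power_mult[OF is_power_R[OF R_numeral]] is_power_mult[OF is_power_R[OF R_power[OF gamma_R]]]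
        is_power_mult[OF pin is_power_R[OF R_power[OF th]]])
  moreover have "is_power (\<Sum>j\<in>{1..<p-1}. Delta j * W s j)"
    by (rule is_power_sum, rule is_power_mult[OF is_power_R[OF Delta_R] Wp])
  moreover have "is_power ((k (p - 1) / \<phi>1) ^ p * (\<theta> ^ p * \<pi> ^ p^2))"
    by (rule is_power_mult[OF is_power_R[OF R_power[OF K]] is_power_mult[OF is_power_R[OF R_power[OF th]] pin]])
  ultimately show ?thesis unfolding T_def s_def[symmetric]
    by (intro is_power_add is_power_diff)
qed

text \<open>The hypotheses annihilate the coefficients at orders 0, p, p(j + 1) and M modulo p.
  Since these lie in \<open>R\<close>, their terms become multiples of p: the one of order 0 moves
  to order p^2, the others fall below the precision.\<close>

lemma T_final:
  assumes 0: "res (\<phi>0 * \<theta> ^ p^2 + \<phi>1 * \<theta> ^ p) = 0"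
    and 4: "res (\<phi>1 + \<gamma> ^ p) = 0"
    and 5: "\<And>j. j \<in> {1..<p - 2} \<Longrightarrow> res (Delta j) = 0"
    and 6: "res (kappa0 \<theta> - 2 * (Delta (p - 2) * \<theta> ^ p)) = 0"
  shows "cg (p^2 + 1) (T \<theta> r) (\<pi> ^ p^2 * D_const \<theta> r)"
proof -
  define s where "s = \<theta> + \<pi> * r"
  have n: "M + p = p^2" "2 * p \<le> M" "p + 3 \<le> M" by (rule M_facts)+
  define m where "m = (\<phi>0 * \<theta> ^ p^2 + \<phi>1 * \<theta> ^ p) / of_nat p"
  have "\<phi>0 * \<theta> ^ p^2 + \<phi>1 * \<theta> ^ p \<in> R" by (intro R_closed coeff_R th)
  then have m: "m \<in> R" "\<phi>0 * \<theta> ^ p^2 + \<phi>1 * \<theta> ^ p = of_nat p * m"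
    using R_div_p[OF _ 0] by (simp_all add: m_def)
  have inv: "1 / \<phi>0 \<in> A" by (intro A_divide A_1 coeff_A coeff_unit)
  have pc: "cg (p^2 + 1) (of_nat p * x) (\<pi> ^ p^2 * (- (x / \<phi>0)))" if "x \<in> A" for x
  proof -
    have "cg (p^2 + 1) (of_nat p) (- (1 / \<phi>0) * \<pi> ^ p^2)"
      by (rule cg_mono[OF p_approx]) (use n in arith)
    from cg_mult_right[OF that this] show ?thesis by (simp add: mult_ac)
  qed
  have t1: "cg (p^2 + 1) (\<phi>0 * \<theta> ^ p^2 + \<phi>1 * \<theta> ^ p) (\<pi> ^ p^2 * (- (m / \<phi>0)))"
    unfolding m(2) by (intro pc R_A m)
  have t2: "cg (p^2 + 1) (of_nat p * (\<gamma> ^ p * \<theta> ^ p)) (\<pi> ^ p^2 * (\<phi>1 / \<phi>0 * \<theta> ^ p))"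
  proof -
    have "cg (p^2 + 1) (of_nat p * (\<gamma> ^ p * \<theta> ^ p)) (\<pi> ^ p^2 * (- (\<gamma> ^ p * \<theta> ^ p / \<phi>0)))"
      by (intro pc A_closed gamma_A th_A1)
    also have "cg (p^2 + 1) \<dots> (\<pi> ^ p^2 * (\<phi>1 / \<phi>0 * \<theta> ^ p))"
    proof (rule cg_pi_mult)
      have "- (\<gamma> ^ p * \<theta> ^ p / \<phi>0) - \<phi>1 / \<phi>0 * \<theta> ^ p = - ((\<phi>1 + \<gamma> ^ p) * (1 / \<phi>0 * \<theta> ^ p))"
        using coeff_nz by (simp add: field_simps)
      moreover have "\<phi>1 + \<gamma> ^ p \<in> I 1"
        using 4 by (subst res_eq_0_I[symmetric]) (auto intro!: A_closed coeff_A gamma_A)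
      ultimately show "cg 1 (- (\<gamma> ^ p * \<theta> ^ p / \<phi>0)) (\<phi>1 / \<phi>0 * \<theta> ^ p)"
        unfolding cg_def using inv th_A1 by (simp only:) (intro I_uminus I_A_mult A_mult A_power)
    qed
    finally show ?thesis .
  qed
  have t3: "cg (p^2 + 1) ((\<phi>1 + \<gamma> ^ p) * Cq \<theta> s) 0"
  proof -
    have "\<phi>1 + \<gamma> ^ p \<in> I (p^2)" by (intro R_res_0_I 4 R_closed coeff_R gamma_R)
    moreover have "Cq \<theta> s \<in> I 1"
    proof (rule cg_I[OF cg_mono[OF Cq_leading[folded s_def], of 1]])
      have "\<pi> ^ p * (\<theta> ^ (2 * p) - r ^ p) \<in> I p" using th_A1 r by (intro pi_mult_I A_closed)
      then show "\<pi> ^ p * (\<theta> ^ (2 * p) - r ^ p) \<in> I 1" by (rule I_mono) (use p_ge_3 in simp)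
    qed (use p_ge_3 in simp_all)
    ultimately show ?thesis unfolding cg_0_iff by (rule I_mult)
  qed
  have t4: "cg (p^2 + 1) (\<pi> ^ M * kappa0 \<theta> + (\<Sum>j\<in>{1..<p-1}. Delta j * W s j))
     (\<pi> ^ p^2 * (Delta (p - 2) * (3 * \<theta> ^ (2 * p) - 2 * r ^ p)))"
  proof -
    have DA: "Delta (p - 2) \<in> A" by (rule R_A[OF Delta_last_R])
    have "{1..<p-1} = insert (p - 2) {1..<p-2}" using p_ge_3 by auto
    then have "(\<Sum>j\<in>{1..<p-1}. Delta j * W s j) = Delta (p - 2) * W s (p - 2) + (\<Sum>j\<in>{1..<p-2}. Delta j * W s j)"
      by simp
    also have "cg (p^2 + 1) \<dots> (Delta (p - 2) * (\<pi> ^ M * (- 2 * \<theta> ^ p) + \<pi> ^ p^2 * (3 * \<theta> ^ (2 * p) - 2 * r ^ p)) + 0)"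
    proof (intro cg_add)
      show "cg (p^2 + 1) (Delta (p - 2) * W s (p - 2))
         (Delta (p - 2) * (\<pi> ^ M * (- 2 * \<theta> ^ p) + \<pi> ^ p^2 * (3 * \<theta> ^ (2 * p) - 2 * r ^ p)))"
        unfolding s_def by (intro cg_mult_left DA W_last)
      show "cg (p^2 + 1) (\<Sum>j\<in>{1..<p-2}. Delta j * W s j) 0"
        unfolding cg_0_iff
      proof (rule I_sum, rule I_mult)
        fix j assume j: "j \<in> {1..<p-2}"
        show "Delta j \<in> I (p^2)" using j 5 by (intro R_res_0_I Delta_R) auto
        show "W s j \<in> I 1" unfolding s_def by (rule I_mono[OF W_I]) (use p_ge_3 in simp)
      qed
    qed
    finally have "cg (p^2 + 1) (\<pi> ^ M * kappa0 \<theta> + (\<Sum>j\<in>{1..<p-1}. Delta j * W s j))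
      (\<pi> ^ M * kappa0 \<theta> + (Delta (p - 2) * (\<pi> ^ M * (- 2 * \<theta> ^ p) + \<pi> ^ p^2 * (3 * \<theta> ^ (2 * p) - 2 * r ^ p)) + 0))"
      by (intro cg_add cg_refl)
    also have "\<dots> = \<pi> ^ M * (kappa0 \<theta> - 2 * (Delta (p - 2) * \<theta> ^ p)) + \<pi> ^ p^2 * (Delta (p - 2) * (3 * \<theta> ^ (2 * p) - 2 * r ^ p))"
      by (simp add: algebra_simps)
    also have "cg (p^2 + 1) \<dots> (0 + \<pi> ^ p^2 * (Delta (p - 2) * (3 * \<theta> ^ (2 * p) - 2 * r ^ p)))"
    proof (intro cg_add cg_refl, unfold cg_0_iff)
      have "kappa0 \<theta> - 2 * (Delta (p - 2) * \<theta> ^ p) \<in> I (p^2)"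
        by (intro R_res_0_I 6 R_closed kappa0_R th Delta_last_R)
      from I_mult[OF pi_I this, of M]
      show "\<pi> ^ M * (kappa0 \<theta> - 2 * (Delta (p - 2) * \<theta> ^ p)) \<in> I (p^2 + 1)"
        by (rule I_mono) (use n in arith)
    qed
    finally show ?thesis by simp
  qed
  have "T \<theta> r = - (\<phi>0 * \<theta> ^ p^2 + \<phi>1 * \<theta> ^ p) - of_nat p * (\<gamma> ^ p * \<theta> ^ p) + (\<phi>1 + \<gamma> ^ p) * Cq \<theta> s
     + (\<pi> ^ M * kappa0 \<theta> + (\<Sum>j\<in>{1..<p-1}. Delta j * W s j))
     + \<pi> ^ p^2 * (- \<phi>0 * r ^ p^2 + 2 * (\<gamma> ^ p * \<theta> ^ (p^2 + p)) - (k (p - 1) / \<phi>1) ^ p * \<theta> ^ p)"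
    unfolding T_def s_def[symmetric] by (simp add: algebra_simps)
  also have "cg (p^2 + 1) \<dots> (- (\<pi> ^ p^2 * (- (m / \<phi>0))) - \<pi> ^ p^2 * (\<phi>1 / \<phi>0 * \<theta> ^ p) + 0
     + \<pi> ^ p^2 * (Delta (p - 2) * (3 * \<theta> ^ (2 * p) - 2 * r ^ p))
     + \<pi> ^ p^2 * (- \<phi>0 * r ^ p^2 + 2 * (\<gamma> ^ p * \<theta> ^ (p^2 + p)) - (k (p - 1) / \<phi>1) ^ p * \<theta> ^ p))"
    by (intro cg_add cg_diff cg_uminus cg_refl t1 t2 t3 t4)
  also have "\<dots> = \<pi> ^ p^2 * D_const \<theta> r"
    unfolding D_const_def m_def by (simp add: algebra_simps)
  finally show ?thesis .
qed

end

context
  fixes \<theta> r assumes th: "\<theta> \<in> R" and r: "r \<in> A"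
begin

private lemma th_A2: "\<theta> \<in> A" by (rule R_A[OF th])

private lemma Cq_I: "Cq \<theta> (\<theta> + \<pi> * r) \<in> I p"
proof (rule cg_I[OF Cq_leading[OF th r]])
  show "\<pi> ^ p * (\<theta> ^ (2 * p) - r ^ p) \<in> I p" using th_A2 r by (intro pi_mult_I A_closed)
qed simp

lemma T_mod_p_sq:
  "cg (p^2) (T \<theta> r) (- (\<phi>0 * \<theta> ^ p^2 + \<phi>1 * \<theta> ^ p) + (\<phi>1 + \<gamma> ^ p) * Cq \<theta> (\<theta> + \<pi> * r)
     + \<pi> ^ M * kappa0 \<theta> + (\<Sum>j\<in>{1..<p-1}. Delta j * W (\<theta> + \<pi> * r) j))"
proof -
  have K: "k (p - 1) / \<phi>1 \<in> A" using p_ge_3 by (intro k_phi_A) simp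
  have "\<phi>0 * (\<pi> ^ p^2 * r ^ p^2) \<in> I (p^2)"
    by (rule A_I_mult[OF coeff_A(1) I_A_mult[OF pi_I A_power[OF r]]])
  moreover have "of_nat p * (\<gamma> ^ p * \<theta> ^ p) \<in> I (p^2)"
    by (rule I_A_mult[OF p_I A_mult[OF A_power[OF gamma_A] A_power[OF th_A2]]])
  moreover have "2 * (\<gamma> ^ p * (\<pi> ^ p^2 * \<theta> ^ (p^2 + p))) \<in> I (p^2)"
    by (rule A_I_mult[OF A_numeral A_I_mult[OF A_power[OF gamma_A] I_A_mult[OF pi_I A_power[OF th_A2]]]])
  moreover have "(k (p - 1) / \<phi>1) ^ p * (\<theta> ^ p * \<pi> ^ p^2) \<in> I (p^2)"
    by (rule A_I_mult[OF A_power[OF K] A_I_mult[OF A_power[OF th_A2] pi_I]])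
  ultimately have e: "2 * (\<gamma> ^ p * (\<pi> ^ p^2 * \<theta> ^ (p^2 + p))) - \<phi>0 * (\<pi> ^ p^2 * r ^ p^2)
      - of_nat p * (\<gamma> ^ p * \<theta> ^ p) - (k (p - 1) / \<phi>1) ^ p * (\<theta> ^ p * \<pi> ^ p^2) \<in> I (p^2)"
    by (simp only: I_diff)
  show ?thesis unfolding cg_def T_def
    by (rule back_subst[of "\<lambda>x. x \<in> I (p^2)", OF e]) (simp add: algebra_simps)
qed

text \<open>Except for the second, the conclusions belong to the orders 0, p, p(j + 1), M and p^2;
  the second expresses that \<rho> lies in \<open>I 2\<close>. Each vanishing residue makes its
  coefficient divisible by p, so it no longer disturbs the later orders.\<close>

lemma necessity:
  assumes unit: "res \<theta> \<noteq> 0" and root: "Sigma_p (\<theta> + \<pi> * r) \<in> I (p^2 + 1)"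
  shows "res (\<phi>0 * \<theta> ^ p^2 + \<phi>1 * \<theta> ^ p) = 0"
    and "res (\<theta> + \<gamma> * (r - \<theta> ^ 2)) = 0"
    and "res (\<phi>1 + \<gamma> ^ p) = 0"
    and "\<And>j. j \<in> {1..<p - 2} \<Longrightarrow> res (Delta j) = 0"
    and "res (kappa0 \<theta> - 2 * (Delta (p - 2) * \<theta> ^ p)) = 0"
    and "\<exists>\<xi>\<in>A. cg 1 (\<xi> ^ p + \<phi>1 / \<phi>0 * \<xi> + D_const \<theta> r) 0"
proof -
  define s where "s = \<theta> + \<pi> * r"
  define \<rho> where "\<rho> = rho s - \<gamma> * \<theta>"
  have n: "M + p = p^2" "2 * p \<le> M" "p + 3 \<le> M" by (rule M_facts)+
  have q: "\<phi>1 / \<phi>0 \<in> R" "\<phi>0 / \<phi>1 \<in> R" by (intro R_divide coeff_R coeff_unit)+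
  have \<rho>1: "\<rho> \<in> I 1" unfolding \<rho>_def s_def by (rule rho_zeroth_order[OF th r])
  define Z where "Z = \<rho> ^ p + \<phi>1 / \<phi>0 * \<pi> ^ M * \<rho> + T \<theta> r"
  have Z: "Z \<in> I (p^2 + 1)"
    using cg_I[OF cg_sym[OF Sigma_p_expansion[OF th r]] root] unfolding Z_def \<rho>_def s_def by simp
  \<comment> \<open>Solve \<open>Z\<close> for \<open>\<pi>^M * \<rho>\<close>: modulo p,
    \<open>Z\<close> vanishes and the other two terms are p-th powers.\<close>
  have \<rho>p: "\<rho> \<in> I p"
  proof (rule is_power_gap[OF \<rho>1])
    have "is_power (\<phi>0 / \<phi>1 * (Z - \<rho> ^ p - T \<theta> r))"
      using I_mono[OF Z, of "p^2"] I_A[OF \<rho>1]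
      by (intro is_power_mult[OF is_power_R] q is_power_diff is_power_I is_power_power is_power_T th r) simp
    moreover have "\<phi>0 / \<phi>1 * (Z - \<rho> ^ p - T \<theta> r) = \<pi> ^ M * \<rho>"
      using coeff_nz by (simp add: Z_def)
    ultimately show "is_power (\<pi> ^ M * \<rho>)" by simp
  qed
  have "\<rho> ^ p \<in> I (p^2)" using I_power[OF \<rho>p, of p] by (simp add: p_sq)
  moreover have "\<phi>1 / \<phi>0 * \<pi> ^ M * \<rho> \<in> I (p^2)"
    unfolding mult.assoc n(1)[symmetric] by (rule A_I_mult[OF R_A[OF q(1)] I_mult[OF pi_I \<rho>p]])
  moreover have "Z \<in> I (p^2)" by (rule I_mono[OF Z]) simp
  moreover have "T \<theta> r = Z - \<rho> ^ p - \<phi>1 / \<phi>0 * \<pi> ^ M * \<rho>" by (simp add: Z_def)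
  ultimately have T: "T \<theta> r \<in> I (p^2)" by (simp only: I_diff)
  define c where "c = \<phi>1 + \<gamma> ^ p"
  have c: "c \<in> R" unfolding c_def by (intro R_closed coeff_R gamma_R)
  define f0 where "f0 = \<phi>0 * \<theta> ^ p^2 + \<phi>1 * \<theta> ^ p"
  have f0: "f0 \<in> R" unfolding f0_def by (intro R_closed coeff_R th)
  define S where "S = (\<Sum>j\<in>{1..<p-1}. Delta j * W s j)"
  have Ws: "W s j \<in> I (p * j + p)" for j unfolding s_def by (rule W_I[OF th r])
  have Ws2: "W s j \<in> I (2 * p)" if "j \<in> {1..<p-1}" for j
  proof (rule I_mono[OF Ws])
    have "p * 1 \<le> p * j" using that by (intro mult_le_mono2) simp
    then show "2 * p \<le> p * j + p" by linarith
  qed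
  have S: "S \<in> I (2 * p)" unfolding S_def
    by (rule I_sum, rule A_I_mult[OF R_A[OF Delta_R] Ws2])
  have kM: "\<pi> ^ M * kappa0 \<theta> \<in> I (2 * p)"
    using I_mono[OF pi_I n(2)] R_A[OF kappa0_R[OF th]] by (rule I_A_mult)
  have E: "- f0 + c * Cq \<theta> s + \<pi> ^ M * kappa0 \<theta> + S \<in> I (p^2)"
    by (rule cg_I[OF cg_sym[OF T_mod_p_sq[folded s_def, folded f0_def c_def S_def]] T]) simp
  have Cq1: "Cq \<theta> s \<in> I 1" unfolding s_def by (rule I_mono[OF Cq_I]) (use p_ge_3 in simp)
  have p1: "1 \<le> 2 * p" "1 \<le> p^2" "2 * p \<le> p^2" using n p_ge_3 one_le_p_sq by linarith+
  have "f0 = c * Cq \<theta> s + \<pi> ^ M * kappa0 \<theta> + S - (- f0 + c * Cq \<theta> s + \<pi> ^ M * kappa0 \<theta> + S)" by simp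
  also have "\<dots> \<in> I 1"
    by (rule I_diff[OF I_add[OF I_add[OF A_I_mult[OF R_A[OF c] Cq1] I_mono[OF kM p1(1)]]
        I_mono[OF S p1(1)]] I_mono[OF E p1(2)]])
  finally have f01: "f0 \<in> I 1" .
  then show 0: "res (\<phi>0 * \<theta> ^ p^2 + \<phi>1 * \<theta> ^ p) = 0"
    unfolding f0_def[symmetric] using res_eq_0_I R_A f0 by blast
  have f0n: "f0 \<in> I (p^2)" by (rule R_I_1_p[OF f0 f01])
  show first: "res (\<theta> + \<gamma> * (r - \<theta> ^ 2)) = 0"
  proof -
    have w: "\<theta> + \<gamma> * (r - \<theta> ^ 2) \<in> A" using th_A2 r gamma_A by (intro A_closed)
    have "cg 2 (\<gamma> * \<theta> + \<pi> * (\<theta> + \<gamma> * (r - \<theta> ^ 2))) (\<gamma> * \<theta> + 0)"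
    proof -
      have "\<rho> \<in> I 2" by (rule I_mono[OF \<rho>p]) (use p_ge_3 in simp)
      then have "cg 2 (rho s) (\<gamma> * \<theta> + 0)" unfolding cg_def \<rho>_def by simp
      from cg_trans[OF cg_sym[OF rho_first_order[OF th r]] this[unfolded s_def]] show ?thesis .
    qed
    then have "\<pi> ^ 1 * (\<theta> + \<gamma> * (r - \<theta> ^ 2)) \<in> I (1 + 1)" by (simp add: cg_def)
    then have "\<theta> + \<gamma> * (r - \<theta> ^ 2) \<in> I 1" by (simp only: I_pi_mult_iff)
    then show ?thesis using res_eq_0_I[OF w] by simp
  qed
  have E': "c * Cq \<theta> s + \<pi> ^ M * kappa0 \<theta> + S \<in> I (p^2)"
    using I_add[OF E f0n] by (simp add: algebra_simps)
  have c1: "res c = 0"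
  proof -
    have u: "\<theta> ^ (2 * p) - r ^ p \<in> A" using th_A2 r by (intro A_closed)
    \<comment> \<open>If \<theta>^2 and r had the same residue, the relation \<open>first\<close>
      would force \<theta> to have residue 0.\<close>
    have ru: "res (\<theta> ^ (2 * p) - r ^ p) \<noteq> 0"
    proof
      assume "res (\<theta> ^ (2 * p) - r ^ p) = 0"
      then have "(res \<theta> ^ 2) ^ p = res r ^ p" using th_A2 r by (simp add: res_simps A_closed power_mult)
      then have "res \<theta> ^ 2 = res r" by (rule res_power_inj)
      then have "res \<theta> = 0" using first th_A2 r gamma_A by (simp add: res_simps A_closed)
      then show False using unit by simp
    qed
    have "c * Cq \<theta> s = c * Cq \<theta> s + \<pi> ^ M * kappa0 \<theta> + S - \<pi> ^ M * kappa0 \<theta> - S" by simp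
    also have "\<dots> \<in> I (2 * p)" by (rule I_diff[OF I_diff[OF I_mono[OF E' p1(3)] kM] S])
    finally have cC: "c * Cq \<theta> s \<in> I (2 * p)" .
    have "cg (2 * p) (c * Cq \<theta> s) (c * (\<pi> ^ p * (\<theta> ^ (2 * p) - r ^ p)))"
      unfolding s_def by (intro cg_mult_left R_A c Cq_leading th r)
    from cg_I[OF cg_sym[OF this] cC order_refl]
    have "\<pi> ^ p * ((\<theta> ^ (2 * p) - r ^ p) * c) \<in> I (p + p)"
      by (simp only: mult.assoc mult.commute[of c] mult_2[of p, symmetric])
    from I_cancel(2)[OF this u ru] have "c \<in> I p" .
    then have "c \<in> I 1" by (rule I_mono) (use p_ge_3 in simp)
    then show ?thesis using res_eq_0_I[OF R_A[OF c]] by simp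
  qed
  then show 4: "res (\<phi>1 + \<gamma> ^ p) = 0" by (simp add: c_def)
  have cn: "c \<in> I (p^2)" by (rule R_res_0_I[OF c c1])
  have E'': "\<pi> ^ M * kappa0 \<theta> + S \<in> I (p^2)"
    using I_diff[OF E' I_A_mult[OF cn I_A[OF Cq1]]] by (simp add: algebra_simps)
  have lead: "Delta j * W s j - \<pi> ^ (p * j + p) * (of_nat j * \<theta> ^ p * Delta j) \<in> I (p * j + 2 * p)"
    if "j \<in> {1..<p-1}" for j
  proof -
    have "cg (p * j + 2 * p) (Delta j * W s j) (Delta j * (\<pi> ^ (p * j + p) * (of_nat j * \<theta> ^ p)))"
      unfolding s_def by (rule cg_mult_left[OF R_A[OF Delta_R[OF that]] W_leading[OF th r]])
    then show ?thesis by (simp add: cg_def mult_ac)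
  qed
  have u: "of_nat j * \<theta> ^ p \<in> A" "res (of_nat j * \<theta> ^ p) \<noteq> 0" if "j \<in> {1..<p}" for j
    using that unit th_A2 of_nat_unit[OF that] by (auto simp: res_simps A_closed)
  show 5: "res (Delta j) = 0" if "j \<in> {1..<p - 2}" for j
    using that
  proof (induction j rule: less_induct)
    case (less j)
    then have j: "j \<in> {1..<p-1}" "j \<in> {1..<p}" by auto
    have jj: "p * j + 2 * p \<le> M"
    proof -
      have "j + 2 \<le> p - 1" using less by auto
      then have "p * (j + 2) \<le> p * (p - 1)" by (rule mult_le_mono2)
      then show ?thesis unfolding M_def by (simp add: add_mult_distrib2 mult.commute)
    qed
    \<comment> \<open>Smaller indices are gone by the induction hypothesis, and larger ones start at
      least p later.\<close>
    have rest: "(\<Sum>i\<in>{1..<p-1} - {j}. Delta i * W s i) \<in> I (p * j + 2 * p)"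
    proof (rule I_sum)
      fix i assume i: "i \<in> {1..<p-1} - {j}"
      show "Delta i * W s i \<in> I (p * j + 2 * p)"
      proof (cases "i < j")
        case True
        then have "res (Delta i) = 0" using less i by auto
        then have "Delta i \<in> I (p^2)" using i by (intro R_res_0_I Delta_R) auto
        from I_A_mult[OF this I_A[OF Ws]] show ?thesis
          by (rule I_mono) (use jj n in linarith)
      next
        case False
        then have "p * (j + 1) \<le> p * i" using i by (intro mult_le_mono2) auto
        then have "p * j + 2 * p \<le> p * i + p" by (simp add: algebra_simps)
        from I_mono[OF Ws this] show ?thesis using i by (intro A_I_mult R_A Delta_R) auto
      qed
    qed
    have "S = Delta j * W s j + (\<Sum>i\<in>{1..<p-1} - {j}. Delta i * W s i)"
      unfolding S_def by (rule sum.remove) (use j in auto)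
    then have "\<pi> ^ (p * j + p) * (of_nat j * \<theta> ^ p * Delta j)
      = (\<pi> ^ M * kappa0 \<theta> + S) - \<pi> ^ M * kappa0 \<theta> - (\<Sum>i\<in>{1..<p-1} - {j}. Delta i * W s i)
        - (Delta j * W s j - \<pi> ^ (p * j + p) * (of_nat j * \<theta> ^ p * Delta j))" by simp
    also have "\<dots> \<in> I (p * j + 2 * p)"
    proof (rule I_diff[OF I_diff[OF I_diff rest] lead[OF j(1)]])
      show "\<pi> ^ M * kappa0 \<theta> + S \<in> I (p * j + 2 * p)" by (rule I_mono[OF E'']) (use jj n in linarith)
      show "\<pi> ^ M * kappa0 \<theta> \<in> I (p * j + 2 * p)"
        by (rule I_A_mult[OF I_mono[OF pi_I jj] R_A[OF kappa0_R[OF th]]])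
    qed
    finally have "\<pi> ^ (p * j + p) * (of_nat j * \<theta> ^ p * Delta j) \<in> I (p * j + p + p)"
      by (simp add: mult_2 add.assoc)
    from I_cancel(2)[OF this u[OF j(2)]] have "Delta j \<in> I 1"
      by (rule I_mono) (use p_ge_3 in simp)
    then show ?case using res_eq_0_I[OF R_A[OF Delta_R[OF j(1)]]] by simp
  qed
  show 6: "res (kappa0 \<theta> - 2 * (Delta (p - 2) * \<theta> ^ p)) = 0"
  proof -
    have eq: "{1..<p-1} = insert (p - 2) {1..<p-2}" using p_ge_3 by auto
    have "(\<Sum>j\<in>{1..<p-2}. Delta j * W s j) \<in> I (p^2)"
    proof (rule I_sum, rule I_A_mult[OF R_res_0_I I_A[OF Ws]])
      fix j assume "j \<in> {1..<p-2}"
      then show "Delta j \<in> R" "res (Delta j) = 0" using 5 by (auto intro: Delta_R)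
    qed
    from I_diff[OF E'' this] have "\<pi> ^ M * kappa0 \<theta> + Delta (p - 2) * W s (p - 2) \<in> I (p^2)"
      unfolding S_def eq by (simp add: algebra_simps)
    moreover have "cg (p^2) (Delta (p - 2) * W s (p - 2)) (Delta (p - 2) * (\<pi> ^ M * (- 2 * \<theta> ^ p)))"
    proof (rule cg_mult_left[OF R_A[OF Delta_last_R]])
      have "cg (p^2) (W s (p - 2)) (\<pi> ^ M * (- 2 * \<theta> ^ p) + \<pi> ^ p^2 * (3 * \<theta> ^ (2 * p) - 2 * r ^ p))"
        unfolding s_def by (rule cg_mono[OF W_last[OF th r]]) simp
      also have "cg (p^2) \<dots> (\<pi> ^ M * (- 2 * \<theta> ^ p) + 0)"
        using th_A2 r by (intro cg_add cg_refl) (auto simp: cg_0_iff intro!: pi_mult_I A_closed)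
      finally show "cg (p^2) (W s (p - 2)) (\<pi> ^ M * (- 2 * \<theta> ^ p))" by simp
    qed
    ultimately have "\<pi> ^ M * kappa0 \<theta> + Delta (p - 2) * (\<pi> ^ M * (- 2 * \<theta> ^ p)) \<in> I (p^2)"
      using cg_I[OF cg_add[OF cg_refl cg_sym]] by blast
    then have "\<pi> ^ M * (kappa0 \<theta> - 2 * (Delta (p - 2) * \<theta> ^ p)) \<in> I (M + p)"
      unfolding n(1) by (simp add: algebra_simps)
    then have "kappa0 \<theta> - 2 * (Delta (p - 2) * \<theta> ^ p) \<in> I p" by (simp only: I_pi_mult_iff)
    then have "kappa0 \<theta> - 2 * (Delta (p - 2) * \<theta> ^ p) \<in> I 1" by (rule I_mono) (use p_ge_3 in simp)
    then show ?thesis by (subst res_eq_0_I)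
        (auto intro!: A_closed R_A[OF kappa0_R[OF th]] R_A[OF Delta_last_R] th_A2)
  qed
  show "\<exists>\<xi>\<in>A. cg 1 (\<xi> ^ p + \<phi>1 / \<phi>0 * \<xi> + D_const \<theta> r) 0"
  proof -
    obtain \<xi> where \<xi>: "\<xi> \<in> A" "\<rho> = \<pi> ^ p * \<xi>" using \<rho>p by (elim I_E)
    have "cg (p^2 + 1) Z (\<rho> ^ p + \<phi>1 / \<phi>0 * \<pi> ^ M * \<rho> + \<pi> ^ p^2 * D_const \<theta> r)"
      unfolding Z_def by (intro cg_add cg_refl T_final th r 0 4 5 6)
    also have "\<rho> ^ p + \<phi>1 / \<phi>0 * \<pi> ^ M * \<rho> + \<pi> ^ p^2 * D_const \<theta> r
       = \<pi> ^ p^2 * (\<xi> ^ p + \<phi>1 / \<phi>0 * \<xi> + D_const \<theta> r)"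
    proof -
      have "\<rho> ^ p = \<pi> ^ p^2 * \<xi> ^ p" "\<pi> ^ M * \<rho> = \<pi> ^ p^2 * \<xi>"
        unfolding \<xi>(2) power_mult_distrib power_mult[symmetric] p_sq[symmetric] n(1)[symmetric]
        by (simp_all add: power_add)
      then show ?thesis by (simp add: algebra_simps)
    qed
    finally have "\<pi> ^ p^2 * (\<xi> ^ p + \<phi>1 / \<phi>0 * \<xi> + D_const \<theta> r) \<in> I (p^2 + 1)"
      using cg_I[OF cg_sym Z] by blast
    then have "\<xi> ^ p + \<phi>1 / \<phi>0 * \<xi> + D_const \<theta> r \<in> I 1" by (simp only: I_pi_mult_iff)
    then show ?thesis using \<xi>(1) by (auto simp: cg_0_iff)
  qed
qed

end

section \<open>Approximate roots and Newton iteration\<close>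

text \<open>The unit \<gamma> is the derivative of \<open>rho\<close>. It comes from the last
  summand alone, where the division by \<pi> lets a change of s through at full size; the other
  summands depend on \<pi>s only.\<close>

lemma rho_perturb:
  assumes s: "s \<in> A" and t: "t \<in> A"
  shows "cg (k' + 2) (rho (s + \<pi> ^ (k' + 1) * t)) (rho s + \<gamma> * (\<pi> ^ (k' + 1) * t))"
proof -
  define z where "z = \<pi> * s"
  define \<eta> where "\<eta> = \<pi> ^ (k' + 2) * t"
  have z: "z \<in> I 1" "z \<in> A" unfolding z_def using pi_mult_I[OF s, of 1] I_A by auto
  have \<eta>: "\<eta> \<in> I (k' + 2)" "\<eta> \<in> A" unfolding \<eta>_def using pi_mult_I[OF t, of "k' + 2"] I_A by blast+
  have zz: "\<pi> * (s + \<pi> ^ (k' + 1) * t) = z + \<eta>"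
    by (simp add: z_def \<eta>_def algebra_simps numeral_2_eq_2 One_nat_def)
  have z\<eta>: "cg (k' + 2) (z + \<eta>) z" using \<eta> by (simp add: cg_def)
  have L: "cg (k' + 2) (Lam (z + \<eta>)) (Lam z)" by (intro cg_Lam z\<eta> z)
  have S: "cg (k' + 2) (\<Sum>j\<in>{1..<p}. k j / \<phi>1 * (\<pi> ^ j * ((1 + (z + \<eta>)) ^ j - 1)))
     (\<Sum>j\<in>{1..<p}. k j / \<phi>1 * (\<pi> ^ j * ((1 + z) ^ j - 1)))"
    by (rule cg_sum, rule cg_mult_left[OF k_phi_A], assumption)
       (intro cg_mult_left[OF A_power[OF pi_in]] cg_diff cg_refl cg_power z\<eta> cg_add A_closed z)
  have "(k' + 2) * 2 \<le> (k' + 2) * p" using p_ge_3 by (intro mult_le_mono2) simp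
  then have "k' + 3 \<le> (k' + 2) * p" by simp
  with I_power[OF \<eta>(1), of p] have \<eta>p: "\<eta> ^ p \<in> I (k' + 3)" by (rule I_mono)
  have "k' + 3 \<le> p^2 + (k' + 2)" using one_le_p_sq by linarith
  with cg_freshman[OF z(2) \<eta>(1)] have "cg (k' + 3) ((z + \<eta>) ^ p) (z ^ p + \<eta> ^ p)" by (rule cg_mono)
  also have "cg (k' + 3) \<dots> (z ^ p + 0)" using \<eta>p by (intro cg_add cg_refl) (simp add: cg_0_iff)
  finally have Y: "cg (k' + 3) ((z + \<eta>) ^ p) (z ^ p)" by simp
  obtain m where m: "p - 1 = Suc m" using p_ge_3 by (cases "p - 1") auto
  have "cg (2 * (k' + 2)) ((1 + z + \<eta>) ^ (p - 1)) ((1 + z) ^ (p - 1) + of_nat (p - 1) * (1 + z) ^ m * \<eta>)"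
    unfolding m using \<eta> z by (intro cg_power_perturb A_closed)
  then have "cg (k' + 3) ((1 + z + \<eta>) ^ (p - 1)) ((1 + z) ^ (p - 1) + of_nat (p - 1) * (1 + z) ^ m * \<eta>)"
    by (rule cg_mono) simp
  also have "cg (k' + 3) \<dots> ((1 + z) ^ (p - 1) - \<eta>)"
  proof -
    have "cg 1 (of_nat (p - 1) * (1 + z) ^ m) ((- 1) * 1)"
    proof (rule cg_mult)
      show "cg 1 (of_nat (p - 1)) (- 1)" by (rule cg_mono[OF of_nat_pred one_le_p_sq])
      show "cg 1 ((1 + z) ^ m) 1" using one_plus_power_I[OF z(1)] by (simp add: cg_def)
    qed (auto intro: A_closed)
    from cg_mult_I[OF \<eta>(1) this] have "cg (k' + 3) (of_nat (p - 1) * (1 + z) ^ m * \<eta>) (- \<eta>)"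
      by (simp add: mult_ac numeral_3_eq_3 One_nat_def)
    from cg_add[OF cg_refl this] show ?thesis by simp
  qed
  finally have P: "cg (k' + 3) ((1 + (z + \<eta>)) ^ (p - 1)) ((1 + z) ^ (p - 1) - \<eta>)" by (simp add: add.assoc)
  have Yz: "z ^ p \<in> I 1" using I_power[OF z(1), of p] p_ge_3 by (auto intro: I_mono)
  have "cg (k' + 3) ((1 + (z + \<eta>) ^ p) ^ (p - 2) * (1 + (z + \<eta>)) ^ (p - 1))
      ((1 + z ^ p) ^ (p - 2) * ((1 + z) ^ (p - 1) - \<eta>))"
    using z \<eta> by (intro cg_mult cg_power cg_add cg_refl Y P A_closed)
  also have "(1 + z ^ p) ^ (p - 2) * ((1 + z) ^ (p - 1) - \<eta>)
     = (1 + z ^ p) ^ (p - 2) * (1 + z) ^ (p - 1) - \<eta> * (1 + z ^ p) ^ (p - 2)" by (simp add: algebra_simps)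
  also have "cg (k' + 3) \<dots> ((1 + z ^ p) ^ (p - 2) * (1 + z) ^ (p - 1) - \<eta> * 1)"
  proof (rule cg_diff[OF cg_refl])
    have "cg 1 ((1 + z ^ p) ^ (p - 2)) 1" using one_plus_power_I[OF Yz] by (simp add: cg_def)
    from cg_mult_I[OF \<eta>(1) this] show "cg (k' + 3) (\<eta> * (1 + z ^ p) ^ (p - 2)) (\<eta> * 1)"
      by (simp add: numeral_3_eq_3 One_nat_def)
  qed
  finally have B: "cg (k' + 3) ((1 + (z + \<eta>) ^ p) ^ (p - 2) * (1 + (z + \<eta>)) ^ (p - 1) - 1)
     ((1 + z ^ p) ^ (p - 2) * (1 + z) ^ (p - 1) - 1 - \<eta>)"
    by (simp add: cg_def algebra_simps)
  have "cg (k' + 2) (((1 + (z + \<eta>) ^ p) ^ (p - 2) * (1 + (z + \<eta>)) ^ (p - 1) - 1) / \<pi> ^ 1)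
     (((1 + z ^ p) ^ (p - 2) * (1 + z) ^ (p - 1) - 1 - \<eta>) / \<pi> ^ 1)"
  proof (rule cg_pi_div)
    have "1 + (k' + 2) = k' + 3" by simp
    with B show "cg (1 + (k' + 2)) ((1 + (z + \<eta>) ^ p) ^ (p - 2) * (1 + (z + \<eta>)) ^ (p - 1) - 1)
     ((1 + z ^ p) ^ (p - 2) * (1 + z) ^ (p - 1) - 1 - \<eta>)" by (simp only:)
  qed
  also have "((1 + z ^ p) ^ (p - 2) * (1 + z) ^ (p - 1) - 1 - \<eta>) / \<pi> ^ 1
     = ((1 + z ^ p) ^ (p - 2) * (1 + z) ^ (p - 1) - 1) / \<pi> - \<pi> ^ (k' + 1) * t"
    using pi_nz by (simp add: \<eta>_def diff_divide_distrib numeral_2_eq_2 One_nat_def)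
  finally have Bc: "cg (k' + 2) (g / \<phi>1 * (((1 + (z + \<eta>) ^ p) ^ (p - 2) * (1 + (z + \<eta>)) ^ (p - 1) - 1) / \<pi>))
    (g / \<phi>1 * (((1 + z ^ p) ^ (p - 2) * (1 + z) ^ (p - 1) - 1) / \<pi> - \<pi> ^ (k' + 1) * t))"
    using gamma_A unfolding \<gamma>_def by (intro cg_mult_left) simp_all
  have "cg (k' + 2) (rho (s + \<pi> ^ (k' + 1) * t)) (Lam z
     - (\<Sum>j\<in>{1..<p}. k j / \<phi>1 * (\<pi> ^ j * ((1 + z) ^ j - 1)))
     - (g / \<phi>1 * (((1 + z ^ p) ^ (p - 2) * (1 + z) ^ (p - 1) - 1) / \<pi> - \<pi> ^ (k' + 1) * t)))"
    unfolding rho_def zz by (intro cg_diff L S Bc)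
  also have "\<dots> = rho s + \<gamma> * (\<pi> ^ (k' + 1) * t)"
    unfolding rho_def z_def[symmetric] \<gamma>_def[symmetric] by (simp add: right_diff_distrib)
  finally show ?thesis .
qed

text \<open>Successive approximation with the unit derivative \<gamma>, one digit of
  \<open>r\<close> at a time. The start \<open>r = 0\<close> works because \<open>rho\<close> is
  \<open>\<gamma> * \<theta>\<close> modulo \<pi> whatever \<open>r\<close> is.\<close>

lemma solve_rho:
  assumes th: "\<theta> \<in> R" and tau: "\<tau> \<in> I 1"
  shows "\<exists>r\<in>A. rho (\<theta> + \<pi> * r) - \<gamma> * \<theta> - \<tau> \<in> I (k' + 1)"
proof (induction k')
  case 0
  show ?case using rho_zeroth_order[OF th A_0] tau by (intro bexI[of _ 0] A_0) (simp add: I_diff)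
next
  case (Suc k')
  then obtain r where r: "r \<in> A" "rho (\<theta> + \<pi> * r) - \<gamma> * \<theta> - \<tau> \<in> I (k' + 1)" by blast
  then obtain x where x: "x \<in> A" "rho (\<theta> + \<pi> * r) - \<gamma> * \<theta> - \<tau> = \<pi> ^ (k' + 1) * x" by (elim I_E)
  define t where "t = - (x / \<gamma>)"
  have t: "t \<in> A" unfolding t_def by (intro A_uminus A_divide x gamma_A gamma_unit)
  have "\<gamma> \<noteq> 0" using gamma_unit res_0 by auto
  have "cg (k' + 2) (rho (\<theta> + \<pi> * r + \<pi> ^ (k' + 1) * t)) (rho (\<theta> + \<pi> * r) + \<gamma> * (\<pi> ^ (k' + 1) * t))"
    using R_A[OF th] r t by (intro rho_perturb A_closed)
  also have "\<gamma> * (\<pi> ^ (k' + 1) * t) = - (\<pi> ^ (k' + 1) * x)"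
    using \<open>\<gamma> \<noteq> 0\<close> by (simp add: t_def)
  also have "rho (\<theta> + \<pi> * r) + - (\<pi> ^ (k' + 1) * x) = \<gamma> * \<theta> + \<tau>"
    unfolding x(2)[symmetric] by simp
  finally have "rho (\<theta> + \<pi> * r + \<pi> ^ (k' + 1) * t) - \<gamma> * \<theta> - \<tau> \<in> I (k' + 2)"
    by (simp add: cg_def algebra_simps)
  moreover have "\<theta> + \<pi> * r + \<pi> ^ (k' + 1) * t = \<theta> + \<pi> * (r + \<pi> ^ k' * t)"
    by (simp add: algebra_simps power_add)
  moreover have "k' + 2 = Suc k' + 1" by simp
  ultimately have "rho (\<theta> + \<pi> * (r + \<pi> ^ k' * t)) - \<gamma> * \<theta> - \<tau> \<in> I (Suc k' + 1)"
    by (simp only:)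
  then show ?case using r t by (intro bexI[of _ "r + \<pi> ^ k' * t"] A_closed) auto
qed

lemma D_const_cong:
  assumes th: "\<theta> \<in> R" and r: "r \<in> A" "r' \<in> A" "res r = res r'"
  shows "cg 1 (D_const \<theta> r) (D_const \<theta> r')"
proof -
  have rc: "cg 1 r r'" using r by (simp add: cg_1_iff)
  show ?thesis unfolding D_const_def
    by (intro cg_add cg_diff cg_refl cg_mult_left cg_power rc r coeff_A R_A[OF Delta_last_R] A_closed)
qed

text \<open>Prescribe \<rho> = \<pi>^p \<xi> up to order p and solve for \<open>r\<close>. Then
  \<rho> lies in \<open>I 2\<close>, which forces the residue of \<open>r\<close> to be that of
  \<open>r0\<close>, and \<open>D_const\<close> sees only this residue.\<close>

lemma sufficiency:
  assumes th: "\<theta> \<in> R" and r0: "r0 \<in> A" "res (\<theta> + \<gamma> * (r0 - \<theta> ^ 2)) = 0"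
    and 0: "res (\<phi>0 * \<theta> ^ p^2 + \<phi>1 * \<theta> ^ p) = 0"
    and 4: "res (\<phi>1 + \<gamma> ^ p) = 0"
    and 5: "\<And>j. j \<in> {1..<p - 2} \<Longrightarrow> res (Delta j) = 0"
    and 6: "res (kappa0 \<theta> - 2 * (Delta (p - 2) * \<theta> ^ p)) = 0"
    and \<xi>: "\<xi> \<in> A" "cg 1 (\<xi> ^ p + \<phi>1 / \<phi>0 * \<xi> + D_const \<theta> r0) 0"
  shows "\<exists>r\<in>A. res r = res r0 \<and> Sigma_p (\<theta> + \<pi> * r) \<in> I (p^2 + 1)"
proof -
  have n: "M + p = p^2" "2 * p \<le> M" "p + 3 \<le> M" by (rule M_facts)+
  have thA: "\<theta> \<in> A" by (rule R_A[OF th])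
  have q: "\<phi>1 / \<phi>0 \<in> A" by (intro A_divide coeff_A coeff_unit)
  define \<tau> where "\<tau> = \<pi> ^ p * \<xi>"
  have tp: "\<tau> \<in> I p" unfolding \<tau>_def by (rule pi_mult_I[OF \<xi>(1)])
  have t1: "\<tau> \<in> I 1" using tp by (rule I_mono) (use p_ge_3 in simp)
  obtain r where r: "r \<in> A" "rho (\<theta> + \<pi> * r) - \<gamma> * \<theta> - \<tau> \<in> I (p + 1)"
    using solve_rho[OF th t1, of p] by blast
  define \<rho> where "\<rho> = rho (\<theta> + \<pi> * r) - \<gamma> * \<theta>"
  have \<rho>\<tau>: "cg (p + 1) \<rho> \<tau>" using r(2) by (simp add: cg_def \<rho>_def)
  have \<rho>p: "\<rho> \<in> I p" by (rule cg_I[OF \<rho>\<tau> tp]) simp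
  have "res (\<theta> + \<gamma> * (r - \<theta> ^ 2)) = 0"
  proof -
    have w: "\<theta> + \<gamma> * (r - \<theta> ^ 2) \<in> A" using thA r gamma_A by (intro A_closed)
    have "\<rho> \<in> I 2" by (rule I_mono[OF \<rho>p]) (use p_ge_3 in simp)
    then have "cg 2 (rho (\<theta> + \<pi> * r)) (\<gamma> * \<theta>)" unfolding cg_def \<rho>_def .
    from cg_trans[OF cg_sym[OF rho_first_order[OF th r(1)]] this]
    have "\<pi> ^ 1 * (\<theta> + \<gamma> * (r - \<theta> ^ 2)) \<in> I (1 + 1)" by (simp add: cg_def)
    then have "\<theta> + \<gamma> * (r - \<theta> ^ 2) \<in> I 1" by (simp only: I_pi_mult_iff)
    then show ?thesis using res_eq_0_I[OF w] by simp
  qed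
  with r0(2) have "res (\<theta> + \<gamma> * (r - \<theta> ^ 2)) = res (\<theta> + \<gamma> * (r0 - \<theta> ^ 2))" by simp
  then have rr: "res r = res r0"
    using thA r(1) r0(1) gamma_A gamma_unit by (simp add: res_simps A_closed)
  have "cg (p^2 + 1) (Sigma_p (\<theta> + \<pi> * r)) (\<rho> ^ p + \<phi>1 / \<phi>0 * \<pi> ^ M * \<rho> + T \<theta> r)"
    unfolding \<rho>_def by (rule Sigma_p_expansion[OF th r(1)])
  also have "cg (p^2 + 1) \<dots> (\<tau> ^ p + \<phi>1 / \<phi>0 * \<pi> ^ M * \<tau> + \<pi> ^ p^2 * D_const \<theta> r)"
  proof (intro cg_add)
    show "cg (p^2 + 1) (\<rho> ^ p) (\<tau> ^ p)" using cg_power_I[OF \<rho>\<tau> tp \<rho>p, of p] by (simp add: p_sq)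
    have "cg (M + (p + 1)) (\<pi> ^ M * \<rho>) (\<pi> ^ M * \<tau>)" by (rule cg_pi_mult[OF \<rho>\<tau>])
    then have "cg (p^2 + 1) (\<pi> ^ M * \<rho>) (\<pi> ^ M * \<tau>)" using n(1) by (simp add: add.assoc[symmetric])
    then show "cg (p^2 + 1) (\<phi>1 / \<phi>0 * \<pi> ^ M * \<rho>) (\<phi>1 / \<phi>0 * \<pi> ^ M * \<tau>)"
      unfolding mult.assoc by (rule cg_mult_left[OF q])
    show "cg (p^2 + 1) (T \<theta> r) (\<pi> ^ p^2 * D_const \<theta> r)"
      by (intro T_final th r 0 4 5 6)
  qed
  also have "\<tau> ^ p + \<phi>1 / \<phi>0 * \<pi> ^ M * \<tau> + \<pi> ^ p^2 * D_const \<theta> r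
     = \<pi> ^ p^2 * (\<xi> ^ p + \<phi>1 / \<phi>0 * \<xi> + D_const \<theta> r)"
  proof -
    have "\<tau> ^ p = \<pi> ^ p^2 * \<xi> ^ p" "\<pi> ^ M * \<tau> = \<pi> ^ p^2 * \<xi>"
      unfolding \<tau>_def power_mult_distrib power_mult[symmetric] p_sq[symmetric] n(1)[symmetric]
      by (simp_all add: power_add)
    then show ?thesis by (simp add: algebra_simps)
  qed
  also have "cg (p^2 + 1) \<dots> (\<pi> ^ p^2 * 0)"
  proof (rule cg_pi_mult)
    have "cg 1 (\<xi> ^ p + \<phi>1 / \<phi>0 * \<xi> + D_const \<theta> r) (\<xi> ^ p + \<phi>1 / \<phi>0 * \<xi> + D_const \<theta> r0)"
      by (intro cg_add cg_refl D_const_cong th r r0 rr)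
    from cg_trans[OF this \<xi>(2)] show "cg 1 (\<xi> ^ p + \<phi>1 / \<phi>0 * \<xi> + D_const \<theta> r) 0" .
  qed
  finally have "Sigma_p (\<theta> + \<pi> * r) \<in> I (p^2 + 1)" by (simp add: cg_0_iff)
  then show ?thesis using r rr by blast
qed

lemma f_eval_I_iff:
  assumes "s \<in> A"
  shows "f_eval (\<pi> * (1 + \<pi> * s)) \<in> I (3 * p^2 + 1) \<longleftrightarrow> Sigma_p s \<in> I (p^2 + 1)"
proof -
  have "of_nat p * (\<pi> ^ p^2 * Sigma_p s) \<in> I (p^2 + (p^2 + (p^2 + 1))) \<longleftrightarrow> Sigma_p s \<in> I (p^2 + 1)"
    unfolding I_p_mult_iff I_pi_mult_iff ..
  moreover have "p^2 + (p^2 + (p^2 + 1)) = 3 * p^2 + 1" by simp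
  ultimately have "of_nat p * (\<pi> ^ p^2 * Sigma_p s) \<in> I (3 * p^2 + 1) \<longleftrightarrow> Sigma_p s \<in> I (p^2 + 1)"
    by (simp only:)
  then show ?thesis
    using cg_I[OF f_eval_expansion[OF assms]] cg_I[OF cg_sym[OF f_eval_expansion[OF assms]]] by blast
qed

text \<open>Near \<pi> the derivative of f is governed by the monomial \<open>X^(M - 1)\<close>, and
  M - 1 is -1 modulo p. The linear term has valuation 2p^2 + (M - 1) + (p + 1 + k') = 3p^2 + k', so
  it is exactly the term visible at the stated precision.\<close>

lemma f_eval_perturb:
  assumes z: "z \<in> I 1" and \<zeta>: "\<zeta> \<in> I (p + 1 + k')" and k': "k' \<ge> 1"
  shows "cg (3 * p^2 + k' + 1) (f_eval (\<pi> * (1 + z) * (1 + \<zeta>)))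
    (f_eval (\<pi> * (1 + z)) - of_nat p ^ 2 * g * (\<pi> * (1 + z)) ^ (M - 1) * \<zeta>)"
proof -
  define x where "x = \<pi> * (1 + z)"
  have n: "M + p = p^2" "2 * p \<le> M" "p + 3 \<le> M" by (rule M_facts)+
  have zA: "z \<in> A" using z I_A by blast
  have xI: "x ^ i \<in> I i" for i
    unfolding x_def power_mult_distrib using zA by (intro pi_mult_I A_closed)
  have xA: "x \<in> A" using xI[of 1] I_A by simp
  have \<zeta>A: "\<zeta> \<in> A" using \<zeta> I_A by blast
  define u where "u i = x ^ i * ((1 + \<zeta>) ^ i - 1)" for i
  have uI: "u i \<in> I (i + (p + 1 + k'))" for i unfolding u_def by (intro I_mult xI one_plus_power_I \<zeta>)
  have uI': "u i \<in> I (p + 1 + k')" for i by (rule I_mono[OF uI]) simp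
  define E where "E = \<zeta> ^ p + of_nat p * Lam \<zeta>"
  have E: "E \<in> I (p^2 + p + k' + 1)"
  proof -
    have "p^2 + (p + 1 + k') = p^2 + p + k' + 1" by simp
    with p_times_I[OF Lam_I[OF \<zeta>]] have 1: "of_nat p * Lam \<zeta> \<in> I (p^2 + p + k' + 1)" by (simp only:)
    \<comment> \<open>The power \<open>\<zeta>^p\<close> is deep enough only from k' = 1 on; this is
      why the iteration starts at precision 3p^2 + 1.\<close>
    have "k' * 3 \<le> k' * p" using p_ge_3 by (intro mult_le_mono2)
    then have "k' + 1 \<le> k' * p" using k' by linarith
    moreover have "(p + 1 + k') * p = p^2 + p + k' * p" by (simp add: algebra_simps p_sq)
    ultimately have "p^2 + p + k' + 1 \<le> (p + 1 + k') * p" by linarith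
    with I_power[OF \<zeta>, of p] have "\<zeta> ^ p \<in> I (p^2 + p + k' + 1)" by (rule I_mono)
    then show ?thesis unfolding E_def using 1 by (rule I_add)
  qed
  have zE: "(1 + \<zeta>) ^ (p * q) = (1 + E) ^ q" for q
    unfolding E_def by (rule one_plus_power_mult_p[OF \<zeta>A])
  have uq: "u (p * q) \<in> I (p * q + (p^2 + p + k' + 1))" for q
    unfolding u_def zE by (intro I_mult xI one_plus_power_I E)
  have diff: "f_eval (x * (1 + \<zeta>)) - f_eval x = (\<Sum>i\<le>p\<^sup>2. a i * u i)"
    unfolding f_eval_def sum_subtractf[symmetric] u_def
    by (intro sum.cong refl, subst power_mult_distrib) (simp add: algebra_simps)
  have "cg (3 * p^2 + k' + 1) (\<Sum>i\<le>p\<^sup>2. a i * u i) (u (p^2) + of_nat p * \<phi>1 * u M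
      + of_nat p ^ 2 * (\<Sum>q\<in>{1..<p-1}. h q * u (p * q))
      + of_nat p ^ 2 * (\<Sum>j\<in>{1..<p}. k j * u (M + j))
      + of_nat p ^ 2 * g * u (M - 1))"
    by (rule cg_mono[OF sum_decomposition[of u "p + 1 + k'", folded M_def]]) (simp_all add: uI' u_def[of 0])
  also have "cg (3 * p^2 + k' + 1) \<dots> (0 + 0 + 0 + 0 + of_nat p ^ 2 * g * (x ^ (M - 1) * (- \<zeta>)))"
  proof (rule cg_add[OF cg_add[OF cg_add[OF cg_add]]])
    have p2: "of_nat p ^ 2 \<in> I (2 * p^2)" using p_I_power[of 2] by (simp add: mult.commute)
    show "cg (3 * p^2 + k' + 1) (u (p^2)) 0"
    proof -
      have "u (p^2) = x ^ p^2 * (E ^ p + of_nat p * Lam E)"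
        unfolding u_def p_sq zE one_plus_power_p by simp
      also have "\<dots> \<in> I (p^2 + (2 * p^2 + k' + 1))"
      proof (rule I_mult[OF xI I_add])
        have "(p^2 + p + k' + 1) * 2 \<le> (p^2 + p + k' + 1) * p" using p_ge_3 by (intro mult_le_mono2) simp
        moreover have "2 * p^2 + k' + 1 \<le> (p^2 + p + k' + 1) * 2" by simp
        ultimately have "2 * p^2 + k' + 1 \<le> (p^2 + p + k' + 1) * p" by (rule order_trans[rotated])
        with I_power[OF E, of p] show "E ^ p \<in> I (2 * p^2 + k' + 1)" by (rule I_mono)
        show "of_nat p * Lam E \<in> I (2 * p^2 + k' + 1)" by (rule I_mono[OF p_times_I[OF Lam_I[OF E]]]) simp
      qed
      finally show ?thesis unfolding cg_0_iff by (rule I_mono) simp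
    qed
    show "cg (3 * p^2 + k' + 1) (of_nat p * \<phi>1 * u M) 0"
    proof -
      have "of_nat p * \<phi>1 * u M \<in> I (p^2 + (M + (p^2 + p + k' + 1)))"
        using uq[of "p - 1"] unfolding M_def by (intro I_mult I_A_mult p_I coeff_A)
      then show ?thesis unfolding cg_0_iff by (rule I_mono) (use n in linarith)
    qed
    show "cg (3 * p^2 + k' + 1) (of_nat p ^ 2 * (\<Sum>q\<in>{1..<p-1}. h q * u (p * q))) 0"
    proof -
      have "(\<Sum>q\<in>{1..<p-1}. h q * u (p * q)) \<in> I (p^2 + p + k' + 1)"
        by (rule I_sum, rule A_I_mult[OF coeff_A(4) I_mono[OF uq]]) simp_all
      from I_mult[OF p2 this] show ?thesis unfolding cg_0_iff by (rule I_mono) simp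
    qed
    show "cg (3 * p^2 + k' + 1) (of_nat p ^ 2 * (\<Sum>j\<in>{1..<p}. k j * u (M + j))) 0"
    proof -
      have "(\<Sum>j\<in>{1..<p}. k j * u (M + j)) \<in> I (M + (p + 1 + k'))"
        by (rule I_sum, rule A_I_mult[OF coeff_A(5) I_mono[OF uI]]) simp_all
      from I_mult[OF p2 this] show ?thesis unfolding cg_0_iff by (rule I_mono) (use n in linarith)
    qed
    show "cg (3 * p^2 + k' + 1) (of_nat p ^ 2 * g * u (M - 1)) (of_nat p ^ 2 * g * (x ^ (M - 1) * (- \<zeta>)))"
    proof -
      have "cg (p + 2 + k') ((1 + \<zeta>) ^ (M - 1)) (1 + of_nat (M - 1) * \<zeta>)"
        by (rule cg_mono[OF cg_one_plus_power[OF \<zeta>]]) simp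
      also have "cg (p + 2 + k') \<dots> (1 + (- 1) * \<zeta>)"
      proof (rule cg_add[OF cg_refl])
        have "of_nat (M - 1) = of_nat p * of_nat (p - 1) - (1 :: 'b)"
          using n by (simp add: M_def of_nat_diff)
        then have "of_nat (M - 1) - (- 1 :: 'b) = of_nat p * of_nat (p - 1)" by simp
        also have "\<dots> \<in> I 1" by (rule I_A_mult[OF I_mono[OF p_I one_le_p_sq] A_of_nat])
        finally have "cg 1 (of_nat (M - 1)) (- 1)" by (simp add: cg_def)
        from cg_mult_I[OF \<zeta> this] have "cg (p + 1 + k' + 1) (\<zeta> * of_nat (M - 1)) (\<zeta> * (- 1))" .
        moreover have "p + 1 + k' + 1 = p + 2 + k'" by simp
        ultimately show "cg (p + 2 + k') (of_nat (M - 1) * \<zeta>) ((- 1) * \<zeta>)" by (simp only: mult.commute)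
      qed
      finally have "cg (p + 2 + k') ((1 + \<zeta>) ^ (M - 1) - 1) (1 + (- 1) * \<zeta> - 1)"
        by (intro cg_diff cg_refl)
      then have "cg (p + 2 + k') ((1 + \<zeta>) ^ (M - 1) - 1) (- \<zeta>)" by simp
      then have "cg (2 * p^2 + (M - 1 + (p + 2 + k'))) (of_nat p ^ 2 * g * u (M - 1)) (of_nat p ^ 2 * g * (x ^ (M - 1) * (- \<zeta>)))"
        unfolding u_def by (rule cg_mult_I[OF I_A_mult[OF p2 coeff_A(3)] cg_mult_I[OF xI]])
      then show ?thesis by (rule cg_mono) (use n in linarith)
    qed
  qed
  finally have "cg (3 * p^2 + k' + 1) (f_eval (x * (1 + \<zeta>)) - f_eval x) (of_nat p ^ 2 * g * (x ^ (M - 1) * (- \<zeta>)))"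
    unfolding diff by simp
  from cg_add[OF this cg_refl[of _ "f_eval x"]] show ?thesis unfolding x_def by (simp add: algebra_simps)
qed

lemma f_eval_cong:
  assumes "cg j x y" "y \<in> A" shows "cg j (f_eval x) (f_eval y)"
proof -
  have "a i \<in> A" if "i \<le> p^2" for i
  proof -
    have pw: "of_nat p ^ m * (a i / of_nat p ^ m) = a i" for m by simp
    have n: "M + p = p^2" "2 * p \<le> M" "p + 3 \<le> M" by (rule M_facts)+
    have *: "a i \<in> A" if "a i / of_nat p ^ m \<in> R" for m
      using A_mult[OF A_power[OF A_of_nat[of p], of m] R_A[OF that]] unfolding pw .
    consider "i = p^2" | "i < p^2" "p dvd i" | "i < M - 1" "\<not> p dvd i" | "i = M - 1" | "i > M" "i < p^2"
    proof (cases "p dvd i")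
      case True
      then show ?thesis using that \<open>i \<le> p^2\<close> by (cases "i = p^2") auto
    next
      case False
      have "p dvd M" "p dvd p^2" unfolding M_def p_sq by simp_all
      then have "i \<noteq> M" "i \<noteq> p^2" using False by auto
      then have "i < M - 1 \<or> i = M - 1 \<or> i > M \<and> i < p^2" using \<open>i \<le> p^2\<close> n by linarith
      then show ?thesis using that False by blast
    qed
    then show ?thesis
    proof cases
      case 2
      then obtain q where q: "i = p * q" by auto
      have "p * q < p * p" using 2 q by (simp add: p_sq)
      then have "q < p" by simp
      then consider "q = 0" | "q \<in> {1..<p-1}" | "q = p - 1" by force
      then show ?thesis using a_const a_p a_mult_p *[of 1] *[of 2] q by cases auto
    next
      case 3 then show ?thesis using *[of 3] a_low unfolding M_def by blast
    next
      case 4 then show ?thesis using *[of 2] a_different unfolding M_def by blast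
    next
      case 5
      then have "i = M + (i - M)" "i - M \<in> {1..<p}" using n by auto
      then show ?thesis using *[of 2] a_top[of "i - M"] unfolding M_def by simp
    qed (simp add: a_lead A_1)
  qed
  then show ?thesis unfolding f_eval_def using assms by (intro cg_sum cg_mult_left cg_power) auto
qed

lemma hensel_step:
  assumes x: "cg 2 x \<pi>" "x \<in> A" "f_eval x \<in> I (3 * p^2 + k')" and k': "k' \<ge> 1"
  shows "\<exists>y. y - x \<in> I (p + 2 + k') \<and> f_eval y \<in> I (3 * p^2 + (k' + 1))"
proof -
  have n: "M + p = p^2" "2 * p \<le> M" "p + 3 \<le> M" by (rule M_facts)+
  obtain w where w: "w \<in> A" "x - \<pi> = \<pi> ^ 2 * w" using x(1) unfolding cg_def by (elim I_E)
  define z where "z = \<pi> * w"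
  have z: "z \<in> I 1" unfolding z_def using pi_mult_I[OF w(1), of 1] by simp
  have zA: "z \<in> A" using z I_A by blast
  have xz: "x = \<pi> * (1 + z)" using w(2) by (simp add: z_def algebra_simps power2_eq_square)
  define e where "e = 1 + z"
  have e: "e \<in> A" "res e \<noteq> 0"
    using zA z res_eq_0_I[OF zA] by (auto simp: e_def res_simps A_closed)
  \<comment> \<open>The solution of the linear equation in \<open>f_eval_perturb\<close>, with x =
    \<pi> e and \<open>e\<close> a unit.\<close>
  define \<zeta> where "\<zeta> = f_eval x / of_nat p / of_nat p / \<pi> ^ (M - 1) / (g * e ^ (M - 1))"
  have "f_eval x / of_nat p / of_nat p / \<pi> ^ (M - 1) \<in> I (p + 1 + k')"
  proof (intro I_div I_div_p)
    show "f_eval x \<in> I (p^2 + (p^2 + (M - 1 + (p + 1 + k'))))"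
      by (rule I_mono[OF x(3)]) (use n in linarith)
  qed
  moreover have u: "g * e ^ (M - 1) \<in> A" "res (g * e ^ (M - 1)) \<noteq> 0"
    using e coeff_A(3) coeff_unit(3) by (auto simp: res_simps A_closed)
  ultimately have \<zeta>: "\<zeta> \<in> I (p + 1 + k')"
    unfolding \<zeta>_def divide_inverse[of _ "g * e ^ (M - 1)"] by (intro I_A_mult A_inverse)
  have "g * e ^ (M - 1) \<noteq> 0" using u(2) res_0 by metis
  then have "of_nat p ^ 2 * g * (\<pi> * (1 + z)) ^ (M - 1) * \<zeta> = f_eval x"
    unfolding \<zeta>_def e_def[symmetric] power_mult_distrib power2_eq_square using pi_nz by simp
  then have "cg (3 * p^2 + k' + 1) (f_eval (x * (1 + \<zeta>))) (f_eval x - f_eval x)"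
    using f_eval_perturb[OF z \<zeta> k'] unfolding xz by simp
  then have "f_eval (x * (1 + \<zeta>)) \<in> I (3 * p^2 + (k' + 1))" by (simp add: cg_0_iff add.assoc)
  moreover have "x * (1 + \<zeta>) - x \<in> I (p + 2 + k')"
  proof -
    have "x * (1 + \<zeta>) - x = x * \<zeta>" by (simp add: algebra_simps)
    moreover have "x \<in> I 1" unfolding xz using pi_mult_I[of "1 + z" 1] zA by (simp add: A_closed)
    ultimately have "x * (1 + \<zeta>) - x \<in> I (1 + (p + 1 + k'))" using I_mult[OF _ \<zeta>] by metis
    then show ?thesis by (simp add: numeral_2_eq_2 One_nat_def)
  qed
  ultimately show ?thesis by blast
qed

text \<open>All corrections lie in \<pi>^(p + 3). In the form \<pi>(1 + \<pi>(\<theta> + \<pi>r))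
  they change r by a multiple of \<pi>^p, so its residue is preserved.\<close>

lemma hensel:
  assumes r: "r \<in> A" and th: "\<theta> \<in> R" and root: "f_eval (\<pi> * (1 + \<pi> * (\<theta> + \<pi> * r))) \<in> I (3 * p^2 + 1)"
  shows "\<exists>r'\<in>A. res r' = res r \<and> f_eval (\<pi> * (1 + \<pi> * (\<theta> + \<pi> * r'))) = 0"
proof -
  define x0 where "x0 = \<pi> * (1 + \<pi> * (\<theta> + \<pi> * r))"
  have sA: "\<theta> + \<pi> * r \<in> A" using r R_A[OF th] by (intro A_closed)
  have x0: "x0 \<in> A" "cg 2 x0 \<pi>"
  proof -
    show "x0 \<in> A" unfolding x0_def by (intro sA A_mult A_add A_1 pi_in)
    have "x0 - \<pi> = \<pi> ^ 2 * (\<theta> + \<pi> * r)" by (simp add: x0_def algebra_simps power2_eq_square)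
    then show "cg 2 x0 \<pi>" using pi_mult_I[OF sA, of 2] by (simp add: cg_def)
  qed
  define P where "P i x \<longleftrightarrow> x - x0 \<in> I (p + 3) \<and> f_eval x \<in> I (3 * p^2 + (i + 1))" for i :: nat and x
  have "\<exists>S. \<forall>i. P i (S i) \<and> S (Suc i) - S i \<in> I i"
  proof (rule dependent_nat_choice)
    show "\<exists>x. P 0 x" using root unfolding P_def x0_def[symmetric]
      by (intro exI[of _ x0]) (simp add: I_zero)
    fix x i assume "P i x"
    then have x: "x - x0 \<in> I (p + 3)" "f_eval x \<in> I (3 * p^2 + (i + 1))" unfolding P_def by auto
    have "cg 2 x x0" unfolding cg_def by (rule I_mono[OF x(1)]) simp
    from cg_trans[OF this x0(2)] cg_A[OF this x0(1)] have "cg 2 x \<pi>" "x \<in> A" .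
    from hensel_step[OF this x(2)] obtain y where
      y: "y - x \<in> I (p + 2 + (i + 1))" "f_eval y \<in> I (3 * p^2 + (i + 1 + 1))" by auto
    have "y - x0 = (y - x) + (x - x0)" by simp
    also have "\<dots> \<in> I (p + 3)" by (rule I_add[OF I_mono[OF y(1)] x(1)]) simp
    finally have "P (Suc i) y" unfolding P_def using y(2) by simp
    moreover have "y - x \<in> I i" by (rule I_mono[OF y(1)]) simp
    ultimately show "\<exists>y. P (Suc i) y \<and> y - x \<in> I i" by blast
  qed
  then obtain S where S: "\<And>i. P i (S i)" "\<And>i. S (Suc i) - S i \<in> I i" by blast
  have SA: "S i \<in> A" for i
    using A_add[OF I_A x0(1), of "S i - x0" "p + 3"] S(1)[of i] by (simp add: P_def)
  obtain y where y: "y \<in> A" "\<And>i. y - S i \<in> I i"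
    using complete[of S] SA S(2) by (auto simp: I_def)
  have "f_eval y = 0"
  proof (rule separated)
    fix i
    have "cg i (f_eval y) (f_eval (S i))" using y(2)[of i] SA by (intro f_eval_cong) (simp_all add: cg_def)
    moreover have "f_eval (S i) \<in> I i"
      using S(1)[of i] unfolding P_def by (auto intro: I_mono[of _ "3 * p^2 + (i + 1)"])
    ultimately have "f_eval y \<in> I i" by (rule cg_I) simp
    then show "f_eval y / \<pi> ^ i \<in> A" by (simp add: I_def)
  qed
  have "y - x0 = (y - S (p + 3)) + (S (p + 3) - x0)" by simp
  also have "\<dots> \<in> I (p + 3)" using y(2) S(1) unfolding P_def by (intro I_add) auto
  finally obtain t where t: "t \<in> A" "y - x0 = \<pi> ^ (p + 3) * t" by (elim I_E)
  have "y = \<pi> * (1 + \<pi> * (\<theta> + \<pi> * (r + \<pi> ^ p * t)))"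
    using t(2) by (simp add: x0_def algebra_simps power_add power3_eq_cube)
  moreover have "r + \<pi> ^ p * t \<in> A" using r t by (intro A_closed)
  moreover have "res (r + \<pi> ^ p * t) = res r"
    using r t by (simp add: res_simps A_closed res_pi)
  ultimately show ?thesis using \<open>f_eval y = 0\<close> by metis
qed

end

section \<open>Automorphisms and ramification breaks\<close>

lemma sum_choose_Suc:
  fixes d :: "nat \<Rightarrow> 'c :: comm_ring_1"
  shows "(\<Sum>k\<le>Suc m. of_nat (Suc m choose k) * d k)
    = (\<Sum>k\<le>m. of_nat (m choose k) * d k) + (\<Sum>k\<le>m. of_nat (m choose k) * d (Suc k))"
proof -
  have "(\<Sum>k\<le>Suc m. of_nat (Suc m choose k) * d k)
    = d 0 + (\<Sum>k\<le>m. of_nat (Suc m choose Suc k) * d (Suc k))"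
    by (subst sum.atMost_Suc_shift) simp
  also have "(\<Sum>k\<le>m. of_nat (Suc m choose Suc k) * d (Suc k))
    = (\<Sum>k\<le>m. of_nat (m choose k) * d (Suc k)) + (\<Sum>k\<le>m. of_nat (m choose Suc k) * d (Suc k))"
    by (simp add: sum.distrib[symmetric] algebra_simps)
  also have "d 0 + (\<dots>) = (\<Sum>k\<le>m. of_nat (m choose k) * d (Suc k)) + (\<Sum>k\<le>Suc m. of_nat (m choose k) * d k)"
    by (subst sum.atMost_Suc_shift[of _ m]) simp
  also have "(\<Sum>k\<le>Suc m. of_nat (m choose k) * d k) = (\<Sum>k\<le>m. of_nat (m choose k) * d k)"
    by (simp add: binomial_eq_0)
  finally show ?thesis by (simp add: add.commute)
qed

context totally_ramified
begin

section \<open>Valuations and automorphisms of \<open>A\<close>\<close>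

lemma exists_val:
  assumes "x \<in> A" "x \<noteq> 0" shows "\<exists>m. x \<in> I m \<and> x \<notin> I (m + 1)"
proof (rule ccontr)
  assume *: "\<nexists>m. x \<in> I m \<and> x \<notin> I (m + 1)"
  have "x \<in> I m" for m
    using assms(1) * by (induction m) (auto simp: I_0 One_nat_def)
  then have "x = 0" by (intro separated) (simp add: I_def)
  with assms(2) show False by simp
qed

lemma val_unit:
  assumes "x \<in> I m" "x \<notin> I (m + 1)"
  obtains u where "u \<in> A" "res u \<noteq> 0" "x = \<pi> ^ m * u"
proof -
  obtain u where u: "u \<in> A" "x = \<pi> ^ m * u" using assms(1) by (elim I_E)
  moreover have "res u \<noteq> 0"
  proof
    assume "res u = 0"
    then have "u \<in> I 1" using u by (simp add: res_eq_0_I)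
    then have "x \<in> I (m + 1)" using u by (simp add: I_pi_mult_iff)
    with assms show False by simp
  qed
  ultimately show ?thesis using that by blast
qed

lemma unit_not_I:
  assumes "u \<in> A" "res u \<noteq> 0" shows "\<pi> ^ m * u \<notin> I (m + 1)"
  using assms by (simp add: I_pi_mult_iff res_eq_0_I)

text \<open>The condition on \<open>\<sigma> \<pi>\<close> makes \<sigma> respect the filtration,
  which is used in place of bijectivity.\<close>

definition is_auto :: "('b \<Rightarrow> 'b) \<Rightarrow> bool" where
  "is_auto \<sigma> \<longleftrightarrow> (\<forall>x\<in>A. \<sigma> x \<in> A) \<and> (\<forall>x\<in>A. \<forall>y\<in>A. \<sigma> (x + y) = \<sigma> x + \<sigma> y)
     \<and> (\<forall>x\<in>A. \<forall>y\<in>A. \<sigma> (x * y) = \<sigma> x * \<sigma> y) \<and> (\<forall>x\<in>R. \<sigma> x = x) \<and> \<sigma> \<pi> \<in> I 1"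

lemma is_auto_id: "is_auto id"
  unfolding is_auto_def using pi_I[of 1] by simp

context
  fixes \<sigma> assumes auto: "is_auto \<sigma>"
begin

lemma auto_A: "x \<in> A \<Longrightarrow> \<sigma> x \<in> A"
  and auto_add: "\<lbrakk>x \<in> A; y \<in> A\<rbrakk> \<Longrightarrow> \<sigma> (x + y) = \<sigma> x + \<sigma> y"
  and auto_mult: "\<lbrakk>x \<in> A; y \<in> A\<rbrakk> \<Longrightarrow> \<sigma> (x * y) = \<sigma> x * \<sigma> y"
  and auto_R: "x \<in> R \<Longrightarrow> \<sigma> x = x"
  and auto_pi: "\<sigma> \<pi> \<in> I 1"
  using auto unfolding is_auto_def by auto

lemma auto_uminus: "x \<in> A \<Longrightarrow> \<sigma> (- x) = - \<sigma> x"
  using auto_mult[of "-1" x] auto_R[of "-1"] R_closed A_closed by simp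
lemma auto_diff: "\<lbrakk>x \<in> A; y \<in> A\<rbrakk> \<Longrightarrow> \<sigma> (x - y) = \<sigma> x - \<sigma> y"
  using auto_add[of x "-y"] auto_uminus[of y] by (simp add: A_uminus)
lemma auto_power: "x \<in> A \<Longrightarrow> \<sigma> (x ^ m) = \<sigma> x ^ m"
  by (induction m) (auto simp: auto_mult A_closed auto_R R_1)
lemma auto_sum: "(\<And>i. i \<in> S \<Longrightarrow> f i \<in> A) \<Longrightarrow> \<sigma> (sum f S) = (\<Sum>i\<in>S. \<sigma> (f i))"
  by (induction S rule: infinite_finite_induct) (auto simp: auto_add A_closed auto_R R_0)

lemma auto_I: assumes "x \<in> I m" shows "\<sigma> x \<in> I m"
proof -
  obtain y where y: "y \<in> A" "x = \<pi> ^ m * y" using assms by (elim I_E)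
  have "\<sigma> x = \<sigma> \<pi> ^ m * \<sigma> y" unfolding y(2) using y(1) by (simp add: auto_mult auto_power A_closed)
  moreover have "\<sigma> \<pi> ^ m \<in> I m" using I_power[OF auto_pi, of m] by simp
  ultimately show ?thesis using y(1) by (simp add: I_A_mult auto_A)
qed

lemma auto_res: assumes "x \<in> A" shows "res (\<sigma> x) = res x"
proof -
  obtain a where a: "a \<in> R" "x - a \<in> I 1" using A_approx[OF assms] by blast
  have "\<sigma> x - x = \<sigma> (x - a) - (x - a)" using assms a by (simp add: auto_diff R_A auto_R)
  also have "\<dots> \<in> I 1" by (rule I_diff[OF auto_I[OF a(2)] a(2)])
  finally have "res (\<sigma> x - x) = 0" using assms auto_A by (subst res_eq_0_I) (auto intro: A_diff)
  then show ?thesis using assms auto_A by (simp add: res_diff)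
qed

text \<open>With y = a + \<pi>w and a fixed by \<sigma>, the product rule passes from y to w and
  gains one power of \<pi>. The induction on the precision \<open>m\<close>, capped at b + 1,
  replaces a convergent expansion of y.\<close>

lemma delta_I:
  assumes b: "\<sigma> \<pi> - \<pi> \<in> I (b + 1)" and y: "y \<in> A" shows "\<sigma> y - y \<in> I (b + 1)"
proof -
  have "\<sigma> y - y \<in> I (min (b + 1) m)" if "y \<in> A" for m y
    using that
  proof (induction m arbitrary: y)
    case 0 then show ?case by (simp add: I_0 A_diff auto_A)
  next
    case (Suc m)
    obtain a where a: "a \<in> R" "y - a \<in> I 1" using A_approx[OF Suc.prems] by blast
    then obtain w where w: "w \<in> A" "y - a = \<pi> * w" by (auto elim: I_E)
    have yy: "y = a + \<pi> * w" using w by (simp add: algebra_simps)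
    have "\<sigma> y - y = (\<sigma> \<pi> - \<pi>) * \<sigma> w + \<pi> * (\<sigma> w - w)"
      unfolding yy using a w R_A by (simp add: auto_add auto_mult auto_R A_closed algebra_simps)
    also have "\<dots> \<in> I (min (b + 1) (Suc m))"
    proof (rule I_add)
      show "(\<sigma> \<pi> - \<pi>) * \<sigma> w \<in> I (min (b + 1) (Suc m))"
        by (rule I_mono[OF I_A_mult[OF b auto_A[OF w(1)]]]) simp
      have "\<pi> ^ 1 * (\<sigma> w - w) \<in> I (1 + min (b + 1) m)" by (rule I_mult[OF pi_I Suc.IH[OF w(1)]])
      then have "\<pi> * (\<sigma> w - w) \<in> I (1 + min (b + 1) m)" by simp
      then show "\<pi> * (\<sigma> w - w) \<in> I (min (b + 1) (Suc m))" by (rule I_mono) auto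
    qed
    finally show ?case .
  qed
  from this[OF y, of "b + 1"] show ?thesis by simp
qed

text \<open>On graded pieces \<sigma> - 1 is the derivation multiplying \<pi>^j by j \<eta>, with
  \<eta> = (\<sigma> \<pi> - \<pi>)/\<pi>; on the cofactor y it acts one order deeper.\<close>

lemma delta_leading:
  assumes b: "\<sigma> \<pi> - \<pi> \<in> I (b + 1)" "b \<ge> 1" and y: "y \<in> A"
  shows "cg (j + b + 1) (\<sigma> (\<pi> ^ j * y) - \<pi> ^ j * y) (\<pi> ^ j * (of_nat j * ((\<sigma> \<pi> - \<pi>) / \<pi>) * y))"
proof -
  define \<eta> where "\<eta> = (\<sigma> \<pi> - \<pi>) / \<pi>"
  have \<eta>: "\<eta> \<in> I b" using I_div[of "\<sigma> \<pi> - \<pi>" 1 b] b by (simp add: \<eta>_def add.commute)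
  have s\<pi>: "\<sigma> \<pi> = \<pi> * (1 + \<eta>)" using pi_nz by (simp add: \<eta>_def field_simps)
  have "\<sigma> (\<pi> ^ j * y) - \<pi> ^ j * y = \<pi> ^ j * ((1 + \<eta>) ^ j * \<sigma> y - y)"
    using y by (simp add: auto_mult auto_power A_closed s\<pi> power_mult_distrib right_diff_distrib mult.assoc)
  also have "cg (j + (b + 1)) \<dots> (\<pi> ^ j * ((1 + of_nat j * \<eta>) * y - y))"
  proof (rule cg_pi_mult)
    have "cg (b + 1) ((1 + \<eta>) ^ j) (1 + of_nat j * \<eta>)"
      by (rule cg_mono[OF cg_one_plus_power[OF \<eta>]]) (use b in simp)
    moreover have "cg (b + 1) (\<sigma> y) y" using delta_I[OF b(1) y] by (simp add: cg_def)
    ultimately show "cg (b + 1) ((1 + \<eta>) ^ j * \<sigma> y - y) ((1 + of_nat j * \<eta>) * y - y)"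
      using y I_A[OF \<eta>] by (intro cg_diff cg_refl cg_mult A_closed)
  qed
  finally show ?thesis unfolding \<eta>_def by (simp add: algebra_simps add_ac)
qed

lemma delta_I_shift:
  assumes b: "\<sigma> \<pi> - \<pi> \<in> I (b + 1)" "b \<ge> 1" and x: "x \<in> I j"
  shows "\<sigma> x - x \<in> I (j + b)"
proof -
  obtain y where y: "y \<in> A" "x = \<pi> ^ j * y" using x by (elim I_E)
  have \<eta>: "(\<sigma> \<pi> - \<pi>) / \<pi> \<in> I b" using I_div[of "\<sigma> \<pi> - \<pi>" 1 b] b by (simp add: add.commute)
  have "\<pi> ^ j * (of_nat j * ((\<sigma> \<pi> - \<pi>) / \<pi>) * y) \<in> I (j + b)"
    using y(1) \<eta> by (intro I_mult pi_I I_A_mult A_I_mult A_of_nat)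
  then show ?thesis unfolding y(2) by (rule cg_I[OF delta_leading[OF b y(1)]]) simp
qed

lemma delta_iter_I:
  assumes b: "\<sigma> \<pi> - \<pi> \<in> I (b + 1)" "b \<ge> 1" and x: "x \<in> I j"
  shows "((\<lambda>x. \<sigma> x - x) ^^ m) x \<in> I (j + m * b)"
proof (induction m)
  case (Suc m)
  from delta_I_shift[OF b this] show ?case by (simp add: algebra_simps)
qed (simp add: x)

lemma delta_iter_A: "x \<in> A \<Longrightarrow> ((\<lambda>x. \<sigma> x - x) ^^ m) x \<in> A"
  by (induction m) (auto intro: auto_A A_diff)

text \<open>The expansion of (1 + \<delta>)^m for the additive operator \<delta> = \<sigma> -
  1.\<close>

lemma auto_funpow_binomial:
  assumes "x \<in> A"
  shows "(\<sigma> ^^ m) x = (\<Sum>k\<le>m. of_nat (m choose k) * ((\<lambda>x. \<sigma> x - x) ^^ k) x)"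
proof (induction m)
  case 0 then show ?case by simp
next
  case (Suc m)
  define d where "d k = ((\<lambda>x. \<sigma> x - x) ^^ k) x" for k
  have d: "d k \<in> A" for k unfolding d_def by (rule delta_iter_A[OF assms])
  have sd: "\<sigma> (d k) = d k + d (Suc k)" for k by (simp add: d_def)
  have "(\<sigma> ^^ Suc m) x = \<sigma> (\<Sum>k\<le>m. of_nat (m choose k) * d k)" using Suc by (simp add: d_def)
  also have "\<dots> = (\<Sum>k\<le>m. of_nat (m choose k) * (d k + d (Suc k)))"
    using d by (subst auto_sum) (auto simp: auto_mult auto_R R_of_nat A_closed sd)
  also have "\<dots> = (\<Sum>k\<le>Suc m. of_nat (Suc m choose k) * d k)"
    unfolding sum_choose_Suc distrib_left sum.distrib ..
  finally show ?case unfolding d_def .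
qed

lemma auto_funpow_p:
  assumes "x \<in> A"
  shows "(\<sigma> ^^ p) x - x = ((\<lambda>x. \<sigma> x - x) ^^ p) x
    + of_nat p * (\<sigma> x - x + (\<Sum>k\<in>{2..<p}. of_nat ((p choose k) div p) * ((\<lambda>x. \<sigma> x - x) ^^ k) x))"
proof -
  define d where "d k = ((\<lambda>x. \<sigma> x - x) ^^ k) x" for k
  have "(\<sigma> ^^ p) x = (\<Sum>k\<le>p. of_nat (p choose k) * d k)"
    unfolding d_def by (rule auto_funpow_binomial[OF assms])
  also have "{..p} = insert 0 (insert p {1..<p})" using p_ge_3 by auto
  also have "(\<Sum>k\<in>insert 0 (insert p {1..<p}). of_nat (p choose k) * d k)
     = d 0 + (d p + (\<Sum>k\<in>{1..<p}. of_nat (p choose k) * d k))"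
    using p_ge_3 by (simp add: One_nat_def)
  also have "(\<Sum>k\<in>{1..<p}. of_nat (p choose k) * d k) = of_nat p * (\<Sum>k\<in>{1..<p}. of_nat ((p choose k) div p) * d k)"
    unfolding sum_distrib_left
    by (rule sum.cong[OF refl], subst binomial_p_factor) (simp_all add: mult.assoc)
  also have "{1..<p} = insert 1 {2..<p}" using p_ge_3 by auto
  also have "(\<Sum>k\<in>insert 1 {2..<p}. of_nat ((p choose k) div p) * d k)
     = d 1 + (\<Sum>k\<in>{2..<p}. of_nat ((p choose k) div p) * d k)"
    by (simp add: One_nat_def)
  finally show ?thesis by (simp add: d_def One_nat_def)
qed

lemma funpow_is_auto: "is_auto (\<sigma> ^^ m)"
proof (induction m)
  case 0 then show ?case using is_auto_id by (simp add: id_def)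
next
  case (Suc m)
  then show ?case unfolding is_auto_def
    by (auto simp: auto_add auto_mult auto_R intro: auto_A auto_I)
qed

text \<open>In the expansion of \<open>auto_funpow_p\<close> the middle terms carry a factor p and
  at least two applications of \<sigma> - 1, each of which gains b.\<close>

lemma auto_funpow_p_I:
  assumes b: "\<sigma> \<pi> - \<pi> \<in> I (b + 1)" "b \<ge> 1" and x: "x \<in> I j"
  shows "cg (p^2 + j + b) ((\<sigma> ^^ p) x - x) (((\<lambda>x. \<sigma> x - x) ^^ p) x)"
    and "cg (p^2 + j + 2 * b) ((\<sigma> ^^ p) x - x) (((\<lambda>x. \<sigma> x - x) ^^ p) x + of_nat p * (\<sigma> x - x))"
proof -
  define S where "S = (\<Sum>k\<in>{2..<p}. of_nat ((p choose k) div p) * ((\<lambda>x. \<sigma> x - x) ^^ k) x)"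
  have S: "S \<in> I (j + 2 * b)" unfolding S_def
  proof (rule I_sum, rule A_I_mult[OF A_of_nat I_mono[OF delta_iter_I[OF b x]]])
    fix k assume "k \<in> {2..<p}"
    then have "2 * b \<le> k * b" by (intro mult_le_mono1) simp
    then show "j + 2 * b \<le> j + k * b" by simp
  qed
  have eq: "(\<sigma> ^^ p) x - x = ((\<lambda>x. \<sigma> x - x) ^^ p) x + of_nat p * (\<sigma> x - x) + of_nat p * S"
    unfolding auto_funpow_p[OF I_A[OF x]] S_def by (simp add: distrib_left)
  show 2: "cg (p^2 + j + 2 * b) ((\<sigma> ^^ p) x - x) (((\<lambda>x. \<sigma> x - x) ^^ p) x + of_nat p * (\<sigma> x - x))"
    using p_times_I[OF S] unfolding eq by (simp add: cg_def add.assoc)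
  have "of_nat p * (\<sigma> x - x) \<in> I (p^2 + j + b)"
    using p_times_I[OF delta_I_shift[OF b x]] by (simp add: add.assoc)
  then have "cg (p^2 + j + b) (((\<lambda>x. \<sigma> x - x) ^^ p) x + of_nat p * (\<sigma> x - x)) (((\<lambda>x. \<sigma> x - x) ^^ p) x)"
    by (simp add: cg_def)
  with cg_mono[OF 2, of "p^2 + j + b"] show "cg (p^2 + j + b) ((\<sigma> ^^ p) x - x) (((\<lambda>x. \<sigma> x - x) ^^ p) x)"
    using cg_trans by simp
qed

text \<open>The classical bound e/(p - 1) for the lower break of an automorphism of order p, where e
  = p^2 is the absolute ramification index upstairs: p^2/(p - 1) = p + 1 + 1/(p - 1) allows at most
  p + 1. Beyond it, p(\<sigma> \<pi> - \<pi>) would be the unique leading term of \<sigma>^p \<pi> -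
  \<pi> and could not cancel.\<close>

lemma break_bound:
  assumes fix_p: "(\<sigma> ^^ p) \<pi> = \<pi>" and nz: "\<sigma> \<pi> \<noteq> \<pi>"
  shows "\<sigma> \<pi> - \<pi> \<notin> I (p + 3)"
proof
  assume big: "\<sigma> \<pi> - \<pi> \<in> I (p + 3)"
  obtain m where m: "\<sigma> \<pi> - \<pi> \<in> I m" "\<sigma> \<pi> - \<pi> \<notin> I (m + 1)"
    using exists_val[of "\<sigma> \<pi> - \<pi>"] nz by (auto intro: A_diff auto_A pi_in)
  have "m \<ge> p + 3"
  proof (rule ccontr)
    assume "\<not> p + 3 \<le> m"
    then have "m + 1 \<le> p + 3" by simp
    with big m(2) show False using I_mono by blast
  qed
  define c where "c = m - 1"
  have c: "m = c + 1" "c \<ge> p + 2" using \<open>m \<ge> p + 3\<close> by (auto simp: c_def)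
  have b: "\<sigma> \<pi> - \<pi> \<in> I (c + 1)" "c \<ge> 1" using m c by auto
  have pi1: "\<pi> \<in> I 1" using pi_I[of 1] by simp
  have "cg (p^2 + 1 + 2 * c) ((\<sigma> ^^ p) \<pi> - \<pi>) (((\<lambda>x. \<sigma> x - x) ^^ p) \<pi> + of_nat p * (\<sigma> \<pi> - \<pi>))"
    by (rule auto_funpow_p_I(2)[OF b pi1])
  then have "cg (p^2 + 1 + 2 * c) 0 (((\<lambda>x. \<sigma> x - x) ^^ p) \<pi> + of_nat p * (\<sigma> \<pi> - \<pi>))"
    by (simp only: fix_p diff_self)
  from cg_sym[OF this] have 1: "((\<lambda>x. \<sigma> x - x) ^^ p) \<pi> + of_nat p * (\<sigma> \<pi> - \<pi>) \<in> I (p^2 + 1 + 2 * c)"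
    by (simp only: cg_0_iff)
  have 2: "((\<lambda>x. \<sigma> x - x) ^^ p) \<pi> \<in> I (1 + p * c)" by (rule delta_iter_I[OF b pi1])
  \<comment> \<open>Equivalent to (p - 1)c \<ge> p^2 + 1, which for c \<ge> p + 2 holds as soon as p
    \<ge> 3.\<close>
  have "p^2 + (c + 2) \<le> 1 + p * c"
  proof -
    obtain q where q: "p = q + 3" using p_ge_3 by (metis le_add_diff_inverse2)
    obtain e where e: "c = p + 2 + e" using c(2) by (metis le_add_diff_inverse)
    show ?thesis unfolding e q by (simp add: power2_eq_square algebra_simps)
  qed
  then have "of_nat p * (\<sigma> \<pi> - \<pi>) \<in> I (p^2 + (c + 2))"
    using I_diff[OF I_mono[OF 1] I_mono[OF 2], of "p^2 + (c + 2)"] c(2) by simp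
  then have "\<sigma> \<pi> - \<pi> \<in> I (c + 2)" by (simp only: I_p_mult_iff)
  with m(2) c show False by (simp add: numeral_2_eq_2 One_nat_def)
qed

lemma auto_funpow_first_order:
  assumes b: "\<sigma> \<pi> - \<pi> \<in> I (b + 1)" "b \<ge> 1"
  shows "cg (b + 2) ((\<sigma> ^^ m) \<pi> - \<pi>) (of_nat m * (\<sigma> \<pi> - \<pi>))"
proof (induction m)
  case 0 then show ?case by simp
next
  case (Suc m)
  define e where "e = (\<sigma> ^^ m) \<pi> - \<pi> - of_nat m * (\<sigma> \<pi> - \<pi>)"
  have e: "e \<in> I (b + 2)" using Suc by (simp add: e_def cg_def)
  have dA: "\<sigma> \<pi> - \<pi> \<in> A" using b I_A by blast
  have eq: "(\<sigma> ^^ m) \<pi> = \<pi> + of_nat m * (\<sigma> \<pi> - \<pi>) + e" by (simp add: e_def)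
  have "(\<sigma> ^^ Suc m) \<pi> = \<sigma> \<pi> + of_nat m * \<sigma> (\<sigma> \<pi> - \<pi>) + \<sigma> e"
    unfolding funpow.simps o_apply eq using dA I_A[OF e]
    by (simp add: auto_add auto_mult auto_R R_of_nat A_closed)
  then have "(\<sigma> ^^ Suc m) \<pi> - \<pi> - of_nat (Suc m) * (\<sigma> \<pi> - \<pi>)
     = of_nat m * (\<sigma> (\<sigma> \<pi> - \<pi>) - (\<sigma> \<pi> - \<pi>)) + \<sigma> e"
    by (simp add: algebra_simps)
  also have "\<dots> \<in> I (b + 2)"
  proof (intro I_add A_I_mult A_of_nat auto_I e)
    have "\<sigma> (\<sigma> \<pi> - \<pi>) - (\<sigma> \<pi> - \<pi>) \<in> I (b + 1 + b)" by (rule delta_I_shift[OF b b(1)])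
    then show "\<sigma> (\<sigma> \<pi> - \<pi>) - (\<sigma> \<pi> - \<pi>) \<in> I (b + 2)" by (rule I_mono) (use b in simp)
  qed
  finally show ?case by (simp add: cg_def)
qed

lemma auto_funpow_val:
  assumes b: "\<sigma> \<pi> - \<pi> \<in> I (b + 1)" "b \<ge> 1" "\<sigma> \<pi> - \<pi> \<notin> I (b + 2)" and m: "\<not> p dvd m"
  shows "(\<sigma> ^^ m) \<pi> - \<pi> \<in> I (b + 1)" "(\<sigma> ^^ m) \<pi> - \<pi> \<notin> I (b + 2)"
proof -
  have m': "(of_nat m :: 'k) \<noteq> 0" using m by (simp add: of_nat_eq_0_iff_char_dvd CHAR_residue)
  note fo = auto_funpow_first_order[OF b(1,2), of m]
  show "(\<sigma> ^^ m) \<pi> - \<pi> \<in> I (b + 1)"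
    by (rule cg_I[OF fo A_I_mult[OF A_of_nat b(1)]]) simp
  show "(\<sigma> ^^ m) \<pi> - \<pi> \<notin> I (b + 2)"
  proof
    assume "(\<sigma> ^^ m) \<pi> - \<pi> \<in> I (b + 2)"
    from cg_I[OF cg_sym[OF fo] this] have "of_nat m * (\<sigma> \<pi> - \<pi>) \<in> I (b + 2)" by simp
    from A_I_mult[OF A_inverse[OF A_of_nat] this] have "inverse (of_nat m) * (of_nat m * (\<sigma> \<pi> - \<pi>)) \<in> I (b + 2)"
      using m' by (simp add: res_of_nat)
    moreover have "(of_nat m :: 'b) \<noteq> 0" using m by (cases "m = 0") auto
    ultimately show False using b(3) by (simp add: mult.assoc[symmetric])
  qed
qed

text \<open>The test element \<open>\<pi> ^ (p - 1)\<close>: its image under \<open>\<sigma> - 1\<close> starts in degree \<open>p\<close>, where \<open>\<sigma> - 1\<close>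
  gains more than one degree, so the next coefficient decides the depth of \<open>\<sigma> ^ p\<close>.\<close>

lemma delta_test_element:
  assumes th: "\<theta> \<in> R" and r: "r \<in> A" and s: "\<sigma> \<pi> = \<pi> * (1 + \<pi> * (\<theta> + \<pi> * r))"
  shows "cg (2 * p + 1) (((\<lambda>x. \<sigma> x - x) ^^ p) (\<pi> ^ (p - 1)))
    (\<pi> ^ (2 * p) * (of_nat (fact (p - 1)) * \<theta> ^ (p - 1) * (\<theta> ^ 2 - r)))"
proof -
  let ?d = "\<lambda>x. \<sigma> x - x"
  have thA: "\<theta> \<in> A" by (rule R_A[OF th])
  have sA: "\<theta> + \<pi> * r \<in> A" using thA r by (intro A_closed)
  define \<eta> where "\<eta> = \<pi> * (\<theta> + \<pi> * r)"
  have \<eta>: "\<eta> \<in> I 1" unfolding \<eta>_def using pi_mult_I[OF sA, of 1] by simp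
  have "\<sigma> \<pi> - \<pi> = \<pi> ^ (1 + 1) * (\<theta> + \<pi> * r)" unfolding s by (simp add: algebra_simps power2_eq_square)
  then have b: "\<sigma> \<pi> - \<pi> \<in> I (1 + 1)" "1 \<ge> (1::nat)" using pi_mult_I[OF sA, of "1 + 1"] by simp_all
  have add: "(?d ^^ m) (x + y) = (?d ^^ m) x + (?d ^^ m) y" if "x \<in> A" "y \<in> A" for m x y
    by (induction m) (auto simp: that auto_add delta_iter_A algebra_simps)
  define \<eta>' where "\<eta>' = (\<sigma> \<pi> - \<pi>) / \<pi>"
  have \<eta>'c: "cg 2 \<eta>' (\<pi> * \<theta>)"
  proof -
    have "\<eta>' = \<pi> * (\<theta> + \<pi> * r)" using pi_nz unfolding \<eta>'_def s by (simp add: field_simps)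
    then have "\<eta>' = \<pi> * \<theta> + \<pi> ^ 2 * r" by (simp add: power2_eq_square distrib_left mult.assoc)
    then show ?thesis using pi_mult_I[OF r, of 2] by (simp add: cg_def)
  qed
  \<comment> \<open>The coefficient \<theta>^2 - r at \<pi>^2 arises from -\<eta> + \<eta>^2, since
    p - 1 is -1 and (p - 1 choose 2) is 1 modulo p.\<close>
  have e0: "cg 3 ((1 + \<eta>) ^ (p - 1) - 1) (- (\<pi> * \<theta>) + \<pi> ^ 2 * (\<theta> ^ 2 - r))"
  proof -
    have "cg 3 ((1 + \<eta>) ^ (p - 1) - 1) (1 + of_nat (p - 1) * \<eta> + of_nat ((p - 1) choose 2) * \<eta> ^ 2 - 1)"
      using cg_one_plus_power_quad[OF \<eta>, of "p - 1"] by (intro cg_diff cg_refl) simp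
    also have "cg 3 \<dots> (1 + (- 1) * \<eta> + 1 * \<eta> ^ 2 - 1)"
    proof (intro cg_diff cg_add cg_refl cg_mult_right A_power I_A[OF \<eta>])
      have "3 \<le> p^2" using M_facts by arith
      then show "cg 3 (of_nat (p - 1)) (- 1)" "cg 3 (of_nat ((p - 1) choose 2)) 1"
        using cg_mono[OF of_nat_pred] cg_mono[OF choose_pred_two] by auto
    qed
    also have "1 + (- 1) * \<eta> + 1 * \<eta> ^ 2 - 1 = - (\<pi> * \<theta>) + \<pi> ^ 2 * (\<theta> ^ 2 - r) + \<pi> ^ 3 * (2 * \<theta> * r + \<pi> * r ^ 2)"
      by (simp add: \<eta>_def algebra_simps power2_eq_square power3_eq_cube)
    also have "cg 3 \<dots> (- (\<pi> * \<theta>) + \<pi> ^ 2 * (\<theta> ^ 2 - r) + 0)"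
      using thA r by (intro cg_add cg_refl) (auto simp: cg_0_iff intro!: pi_mult_I A_closed)
    finally show ?thesis by simp
  qed
  define q where "q = p - 1"
  have q: "p = q + 1" "q \<ge> 2" using p_ge_3 by (simp_all add: q_def)
  define w where "w = ?d (\<pi> ^ (p - 1)) + \<pi> ^ p * \<theta>"
  have w: "cg (p + 2) w (\<pi> ^ (p + 1) * (\<theta> ^ 2 - r))"
  proof -
    have "\<sigma> (\<pi> ^ (p - 1)) = \<pi> ^ (p - 1) * (1 + \<eta>) ^ (p - 1)"
      by (simp add: auto_power pi_in s \<eta>_def power_mult_distrib)
    then have "?d (\<pi> ^ (p - 1)) = \<pi> ^ q * ((1 + \<eta>) ^ (p - 1) - 1)"
      using q by (simp add: algebra_simps)
    also have "cg (q + 3) \<dots> (\<pi> ^ q * (- (\<pi> * \<theta>) + \<pi> ^ 2 * (\<theta> ^ 2 - r)))"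
      by (rule cg_pi_mult[OF e0])
    also have "\<dots> = - (\<pi> ^ p * \<theta>) + \<pi> ^ (p + 1) * (\<theta> ^ 2 - r)"
      using q by (simp add: algebra_simps power_add power2_eq_square)
    finally have "cg (q + 3) w (- (\<pi> ^ p * \<theta>) + \<pi> ^ (p + 1) * (\<theta> ^ 2 - r) + \<pi> ^ p * \<theta>)"
      unfolding w_def by (intro cg_add cg_refl)
    moreover have "q + 3 = p + 2" using q by simp
    ultimately show ?thesis by simp
  qed
  have wI: "w \<in> I (p + 1)"
    using thA r by (intro cg_I[OF w] pi_mult_I A_closed) simp_all
  have wA: "w \<in> A" using wI I_A by blast
  \<comment> \<open>In degree p + m + 1 the operator multiplies by p + m + 1, which is m + 1 modulo
    p; these factors accumulate to the factorial.\<close>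
  have iter: "cg (p + m + 2) ((?d ^^ m) w) (\<pi> ^ (p + m + 1) * (of_nat (fact m) * \<theta> ^ m * (\<theta> ^ 2 - r)))" for m
  proof (induction m)
    case 0 then show ?case using w by simp
  next
    case (Suc m)
    define c where "c = of_nat (fact m) * \<theta> ^ m * (\<theta> ^ 2 - r)"
    have c: "c \<in> A" unfolding c_def using thA r by (intro A_closed)
    define e where "e = (?d ^^ m) w - \<pi> ^ (p + m + 1) * c"
    have e: "e \<in> I (p + m + 2)" using Suc by (simp add: e_def c_def cg_def)
    have eq: "(?d ^^ m) w = \<pi> ^ (p + m + 1) * c + e" by (simp add: e_def)
    have "(?d ^^ Suc m) w = ?d (\<pi> ^ (p + m + 1) * c) + ?d e"
      unfolding funpow.simps o_apply eq using c I_A[OF e] by (simp add: auto_add A_closed)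
    also have "cg (p + m + 1 + 1 + 1) \<dots> (\<pi> ^ (p + m + 1) * (of_nat (p + m + 1) * \<eta>' * c) + 0)"
    proof (rule cg_add)
      show "cg (p + m + 1 + 1 + 1) (?d (\<pi> ^ (p + m + 1) * c)) (\<pi> ^ (p + m + 1) * (of_nat (p + m + 1) * \<eta>' * c))"
        unfolding \<eta>'_def by (rule delta_leading[OF b c])
      show "cg (p + m + 1 + 1 + 1) (?d e) 0"
        unfolding cg_0_iff by (rule I_mono[OF delta_I_shift[OF b e]]) simp
    qed
    also have "cg (p + m + 1 + 1 + 1) \<dots> (\<pi> ^ (p + m + 1) * (of_nat (m + 1) * (\<pi> * \<theta>) * c) + 0)"
    proof (rule cg_add[OF _ cg_refl])
      have "of_nat (p + m + 1) * \<eta>' = of_nat p * \<eta>' + of_nat (m + 1) * \<eta>'" by (simp add: algebra_simps)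
      also have "cg 2 \<dots> (0 + of_nat (m + 1) * (\<pi> * \<theta>))"
      proof (intro cg_add cg_mult_left A_of_nat \<eta>'c)
        have "\<pi> * \<theta> \<in> A" using thA by (intro A_closed)
        then have "\<eta>' \<in> A" by (rule cg_A[OF \<eta>'c])
        from I_A_mult[OF p_I this] have "of_nat p * \<eta>' \<in> I (p^2)" .
        moreover have "2 \<le> p^2" using M_facts by arith
        ultimately show "cg 2 (of_nat p * \<eta>') 0" unfolding cg_0_iff by (rule I_mono)
      qed
      finally have "cg (p + m + 1 + 2) (\<pi> ^ (p + m + 1) * (of_nat (p + m + 1) * \<eta>' * c)) (\<pi> ^ (p + m + 1) * (of_nat (m + 1) * (\<pi> * \<theta>) * c))"
        by (intro cg_pi_mult cg_mult_right c) simp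
      then show "cg (p + m + 1 + 1 + 1) (\<pi> ^ (p + m + 1) * (of_nat (p + m + 1) * \<eta>' * c)) (\<pi> ^ (p + m + 1) * (of_nat (m + 1) * (\<pi> * \<theta>) * c))"
        by (rule cg_mono) simp
    qed
    also have "\<pi> ^ (p + m + 1) * (of_nat (m + 1) * (\<pi> * \<theta>) * c) + 0
       = \<pi> ^ (p + Suc m + 1) * (of_nat (fact (Suc m)) * \<theta> ^ Suc m * (\<theta> ^ 2 - r))"
      by (simp add: c_def One_nat_def algebra_simps)
    finally show ?case by (rule cg_mono) simp
  qed
  \<comment> \<open>A multiple of \<pi>^p by an element of \<open>R\<close> is exceptional: (1 +
    \<eta>)^p - 1 lies in \<open>I p\<close>, so the first application jumps from degree p to 2p,
    and the remaining ones leave the range considered.\<close>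
  have hd: "(?d ^^ q) (\<pi> ^ p * (- \<theta>)) \<in> I (2 * p + 1)"
  proof -
    obtain q' where q': "q = Suc q'" "q' \<ge> 1" using q by (cases q) (auto simp: One_nat_def)
    have s': "\<sigma> \<pi> = \<pi> * (1 + \<eta>)" by (simp add: s \<eta>_def)
    have "?d (\<pi> ^ p * (- \<theta>)) = - \<theta> * (\<pi> ^ p * ((1 + \<eta>) ^ p - 1))"
      using th thA by (simp add: auto_mult auto_uminus auto_power auto_R A_closed s' power_mult_distrib
          right_diff_distrib mult_ac)
    also have "\<dots> \<in> I (p + p)"
    proof (rule A_I_mult[OF A_uminus[OF thA] I_mult[OF pi_I]])
      have "(1 + \<eta>) ^ p - 1 = \<eta> ^ p + of_nat p * Lam \<eta>" unfolding one_plus_power_p by simp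
      also have "\<dots> \<in> I p"
      proof (rule I_add)
        show "\<eta> ^ p \<in> I p" using I_power[OF \<eta>, of p] by simp
        show "of_nat p * Lam \<eta> \<in> I p"
          by (rule I_mono[OF I_A_mult[OF p_I Lam_A[OF I_A[OF \<eta>]]]]) (use M_facts in arith)
      qed
      finally show "(1 + \<eta>) ^ p - 1 \<in> I p" .
    qed
    finally have "(?d ^^ q') (?d (\<pi> ^ p * (- \<theta>))) \<in> I (p + p + q' * 1)"
      by (rule delta_iter_I[OF b])
    then show ?thesis unfolding q'(1) funpow_Suc_right o_apply by (rule I_mono) (use q' in simp)
  qed
  have "(?d ^^ p) (\<pi> ^ (p - 1)) = (?d ^^ q) (?d (\<pi> ^ (p - 1)))"
    unfolding q(1) by (simp add: funpow_Suc_right One_nat_def del: funpow.simps)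
  also have "?d (\<pi> ^ (p - 1)) = \<pi> ^ p * (- \<theta>) + w" by (simp add: w_def)
  also have "(?d ^^ q) \<dots> = (?d ^^ q) (\<pi> ^ p * (- \<theta>)) + (?d ^^ q) w"
    using thA wA by (intro add A_closed)
  also have "cg (2 * p + 1) \<dots> (0 + \<pi> ^ (p + q + 1) * (of_nat (fact q) * \<theta> ^ q * (\<theta> ^ 2 - r)))"
  proof (rule cg_add)
    show "cg (2 * p + 1) ((?d ^^ q) (\<pi> ^ p * (- \<theta>))) 0" using hd by (simp add: cg_0_iff)
    show "cg (2 * p + 1) ((?d ^^ q) w) (\<pi> ^ (p + q + 1) * (of_nat (fact q) * \<theta> ^ q * (\<theta> ^ 2 - r)))"
      by (rule cg_mono[OF iter]) (use q in simp)
  qed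
  also have "0 + \<pi> ^ (p + q + 1) * (of_nat (fact q) * \<theta> ^ q * (\<theta> ^ 2 - r))
    = \<pi> ^ (2 * p) * (of_nat (fact (p - 1)) * \<theta> ^ (p - 1) * (\<theta> ^ 2 - r))"
  proof -
    have e: "p + q + 1 = 2 * p" "q = p - 1" using q by simp_all
    show ?thesis unfolding e(1) unfolding e(2) by simp
  qed
  finally show ?thesis .
qed

end

end

section \<open>The coefficients of a cyclic polynomial\<close>

text \<open>Absorption gives (k + 1) C(n, k + 1) = (n - k) C(n, k) for n = p q - 1, and n - k is -(k
  + 1) modulo p, hence prime to p.\<close>

lemma not_dvd_binomial_pred:
  fixes p :: nat
  assumes p: "Factorial_Ring.prime p" and q: "q > 0" and k: "k < p"
  shows "\<not> p dvd ((p * q - 1) choose k)"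
  using k
proof (induction k)
  case 0 then show ?case using p by (auto simp: prime_nat_iff)
next
  case (Suc k)
  have pq: "p \<le> p * q" using q by simp
  show ?case
  proof
    assume "p dvd ((p * q - 1) choose Suc k)"
    then have "p dvd Suc k * ((p * q - 1) choose Suc k)" by simp
    also have "Suc k * ((p * q - 1) choose Suc k) = (p * q - 1 - k) * ((p * q - 1) choose k)"
      unfolding binomial_absorption binomial_absorb_comp ..
    finally have "p dvd (p * q - 1 - k) \<or> p dvd ((p * q - 1) choose k)"
      by (rule prime_dvd_multD[OF p])
    then have "p dvd (p * q - 1 - k)" using Suc.IH Suc.prems by (meson Suc_lessD)
    then have "p dvd p * q - (p * q - 1 - k)" by (rule dvd_diff_nat[OF dvd_triv_left])
    moreover have "p * q - (p * q - 1 - k) = Suc k" using Suc.prems pq by linarith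
    ultimately have "p dvd Suc k" by simp
    then show False using Suc.prems by (auto dest: dvd_imp_le)
  qed
qed

text \<open>The binomial is q C(p q - 1, p - 1), a product of two numbers prime to p.\<close>

lemma not_dvd_binomial_p:
  fixes p :: nat
  assumes p: "Factorial_Ring.prime p" and q: "0 < q" "q < p"
  shows "\<not> p dvd ((p * q) choose p)"
proof -
  have p0: "p > 0" using p by (simp add: prime_gt_0_nat)
  have "p * ((p * q) choose p) = p * (q * ((p * q - 1) choose (p - 1)))"
    using times_binomial_minus1_eq[OF p0, of "p * q"] by (simp add: mult.assoc)
  then have "(p * q) choose p = q * ((p * q - 1) choose (p - 1))" using p0 by simp
  moreover have "\<not> p dvd q" using q by (auto dest: dvd_imp_le)
  moreover have "\<not> p dvd ((p * q - 1) choose (p - 1))"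
    using p q p0 by (intro not_dvd_binomial_pred) auto
  ultimately show ?thesis using p by (simp add: prime_dvd_mult_iff)
qed

text \<open>The Taylor coefficients of F at c, that is, the divided derivatives F^(j)(c)/j!.\<close>

lemma coeff_pcompose_shift:
  fixes F :: "'c :: comm_ring_1 poly"
  shows "Polynomial.coeff (pcompose F [:c, 1:]) j
    = (\<Sum>i\<le>Polynomial.degree F. Polynomial.coeff F i * of_nat (i choose j) * c ^ (i - j))"
proof -
  have "pcompose F [:c, 1:] = (\<Sum>i\<le>Polynomial.degree F. pcompose (Polynomial.monom (Polynomial.coeff F i) i) [:c, 1:])"
    by (subst poly_as_sum_of_monoms[of F, symmetric]) (simp only: pcompose_sum)
  also have "\<dots> = (\<Sum>i\<le>Polynomial.degree F. Polynomial.smult (Polynomial.coeff F i) ([:c, 1:] ^ i))"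
  proof (rule sum.cong[OF refl])
    fix i
    have "pcompose (Polynomial.monom (1 :: 'c) i) [:c, 1:] = [:c, 1:] ^ i"
      by (induction i) (simp_all add: Polynomial.monom_Suc pcompose_pCons pcompose_1 flip: one_poly_eq_simps)
    then show "pcompose (Polynomial.monom (Polynomial.coeff F i) i) [:c, 1:] = Polynomial.smult (Polynomial.coeff F i) ([:c, 1:] ^ i)"
      by (metis pcompose_smult smult_monom mult_1_right)
  qed
  finally have "Polynomial.coeff (pcompose F [:c, 1:]) j
    = (\<Sum>i\<le>Polynomial.degree F. Polynomial.coeff F i * Polynomial.coeff ([:c, 1:] ^ i) j)"
    by (simp add: coeff_sum)
  also have "\<dots> = (\<Sum>i\<le>Polynomial.degree F. Polynomial.coeff F i * of_nat (i choose j) * c ^ (i - j))"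
  proof (rule sum.cong[OF refl])
    fix i
    show "Polynomial.coeff F i * Polynomial.coeff ([:c, 1:] ^ i) j = Polynomial.coeff F i * of_nat (i choose j) * c ^ (i - j)"
    proof (cases "j \<le> i")
      case True
      then show ?thesis by (simp add: coeff_linear_poly_power mult.assoc)
    next
      case False
      have "Polynomial.degree ([:c, 1:] ^ i) \<le> 1 * i"
        by (rule order_trans[OF degree_power_le]) simp
      then have "Polynomial.coeff ([:c, 1:] ^ i) j = 0" using False by (intro coeff_eq_0) simp
      then show ?thesis using False by (simp add: binomial_eq_0)
    qed
  qed
  finally show ?thesis .
qed

context totally_ramified
begin

text \<open>The coefficient is an elementary symmetric function of degree card S - j in the
  \<open>d k\<close>.\<close>

lemma coeff_prod_I:
  assumes "finite S" "\<And>k. k \<in> S \<Longrightarrow> d k \<in> I m"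
  shows "Polynomial.coeff (\<Prod>k\<in>S. [:d k, 1:]) j \<in> I (m * (card S - j))"
  using assms
proof (induction S arbitrary: j rule: finite_induct)
  case empty then show ?case by (cases j) (simp_all add: I_0 A_closed coeff_1)
next
  case (insert k S)
  define P where "P = (\<Prod>k\<in>S. [:d k, 1:])"
  have eq: "Polynomial.coeff (\<Prod>k\<in>insert k S. [:d k, 1:]) j = d k * Polynomial.coeff P j + Polynomial.coeff (Polynomial.pCons 0 P) j"
    using insert by (simp add: P_def)
  have "d k * Polynomial.coeff P j \<in> I (m + m * (card S - j))"
    using insert unfolding P_def by (intro I_mult) auto
  then have 1: "d k * Polynomial.coeff P j \<in> I (m * (Suc (card S) - j))"
  proof (rule I_mono)
    have "m * (Suc (card S) - j) \<le> m * (1 + (card S - j))" by (intro mult_le_mono2) simp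
    then show "m * (Suc (card S) - j) \<le> m + m * (card S - j)" by (simp add: add_mult_distrib2)
  qed
  have 2: "Polynomial.coeff (Polynomial.pCons 0 P) j \<in> I (m * (Suc (card S) - j))"
  proof (cases j)
    case 0 then show ?thesis by (simp add: I_zero)
  next
    case (Suc i)
    then show ?thesis using insert.IH[of i] insert.prems unfolding P_def by simp
  qed
  show ?case unfolding eq using I_add[OF 1 2] insert by simp
qed

lemma prod_I:
  assumes "finite S" "\<And>k. k \<in> S \<Longrightarrow> d k \<in> I m"
  shows "(\<Prod>k\<in>S. d k) \<in> I (m * card S)"
  using assms
proof (induction S rule: finite_induct)
  case empty then show ?case by (simp add: I_0 A_1)
next
  case (insert k S)
  have "d k * prod d S \<in> I (m + m * card S)" using insert by (intro I_mult) auto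
  then show ?case using insert by simp
qed

lemma mult_not_I:
  assumes "x \<in> I i" "x \<notin> I (i + 1)" "y \<in> I j" "y \<notin> I (j + 1)"
  shows "x * y \<notin> I (i + j + 1)"
proof -
  obtain u where u: "u \<in> A" "res u \<noteq> 0" "x = \<pi> ^ i * u" using assms val_unit by blast
  obtain w where w: "w \<in> A" "res w \<noteq> 0" "y = \<pi> ^ j * w" using assms val_unit by blast
  have "\<pi> ^ (i + j) * (u * w) \<notin> I (i + j + 1)"
    using u w by (intro unit_not_I A_mult) (simp_all add: res_mult)
  then show ?thesis unfolding u(3) w(3) by (simp add: power_add mult_ac)
qed

lemma prod_not_I:
  assumes "finite S" "\<And>k. k \<in> S \<Longrightarrow> d k \<in> I m" "\<And>k. k \<in> S \<Longrightarrow> d k \<notin> I (m + 1)"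
  shows "(\<Prod>k\<in>S. d k) \<notin> I (m * card S + 1)"
  using assms
proof (induction S rule: finite_induct)
  case empty
  then show ?case using unit_not_I[of 1 0] by (simp add: A_1 res_1)
next
  case (insert k S)
  have "d k * prod d S \<notin> I (m + m * card S + 1)"
    using insert by (intro mult_not_I prod_I) auto
  then show ?case using insert by simp
qed

text \<open>A term whose coefficient is a unit has valuation i, and these valuations are distinct; a
  term whose coefficient has residue 0 has valuation at least p^2. So nothing can cancel below order
  m.\<close>

lemma R_combination_I:
  assumes c: "\<And>i. i < p^2 \<Longrightarrow> c i \<in> R" and S: "(\<Sum>i<p^2. c i * \<pi> ^ i) \<in> I m" and m: "m \<le> p^2" and i: "i < m"
  shows "res (c i) = 0"
  using i
proof (induction i rule: less_induct)
  case (less i)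
  then have i: "i < p^2" using m by simp
  have "(\<Sum>j\<in>{..<p^2} - {i}. c j * \<pi> ^ j) \<in> I (i + 1)"
  proof (rule I_sum)
    fix j assume j: "j \<in> {..<p^2} - {i}"
    show "c j * \<pi> ^ j \<in> I (i + 1)"
    proof (cases "j < i")
      case True
      then have "c j \<in> I (p^2)" using less j c by (intro R_res_0_I) auto
      from I_A_mult[OF this A_power[OF pi_in]] show ?thesis by (rule I_mono) (use i in simp)
    next
      case False
      from j have "c j \<in> A" using c R_A by auto
      from A_I_mult[OF this pi_I] show ?thesis by (rule I_mono) (use False j in auto)
    qed
  qed
  moreover have "(\<Sum>j<p^2. c j * \<pi> ^ j) = c i * \<pi> ^ i + (\<Sum>j\<in>{..<p^2} - {i}. c j * \<pi> ^ j)"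
    using i by (intro sum.remove) auto
  moreover have "(\<Sum>j<p^2. c j * \<pi> ^ j) \<in> I (i + 1)" by (rule I_mono[OF S]) (use less in simp)
  ultimately have "c i * \<pi> ^ i \<in> I (i + 1)" using I_diff by fastforce
  then have "\<pi> ^ i * c i \<in> I (i + 1)" by (simp only: mult.commute)
  then have "c i \<in> I 1" by (simp only: I_pi_mult_iff)
  then show ?case using res_eq_0_I R_A c i by blast
qed

lemma R_combination_div_p:
  assumes c: "\<And>i. i < p^2 \<Longrightarrow> c i \<in> R" and S: "(\<Sum>i<p^2. c i * \<pi> ^ i) \<in> I (p^2 + m)"
  shows "i < p^2 \<Longrightarrow> c i / of_nat p \<in> R" "(\<Sum>i<p^2. c i / of_nat p * \<pi> ^ i) \<in> I m"
proof -
  have "(\<Sum>i<p^2. c i * \<pi> ^ i) \<in> I (p^2)" by (rule I_mono[OF S]) simp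
  then show "c i / of_nat p \<in> R" if "i < p^2" for i
    using that by (intro R_div_p c R_combination_I[OF c]) auto
  have "(\<Sum>i<p^2. c i / of_nat p * \<pi> ^ i) = (\<Sum>i<p^2. c i * \<pi> ^ i) / of_nat p"
    by (simp add: sum_divide_distrib)
  then show "(\<Sum>i<p^2. c i / of_nat p * \<pi> ^ i) \<in> I m" using I_div_p[OF S] by simp
qed

text \<open>Applied in contrapositive form: when the sum does not reach depth m + 1, some
  coefficient up to index m is a unit.\<close>

lemma R_combination_not_I:
  assumes c: "\<And>i. i < p^2 \<Longrightarrow> c i \<in> R" and z: "\<And>i. i < m + 1 \<Longrightarrow> res (c i) = 0" and m: "m < p^2"
  shows "(\<Sum>i<p^2. c i * \<pi> ^ i) \<in> I (m + 1)"
proof (rule I_sum)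
  fix i assume i: "i \<in> {..<p^2}"
  show "c i * \<pi> ^ i \<in> I (m + 1)"
  proof (cases "i < m + 1")
    case True
    then have "c i \<in> I (p^2)" using i c z by (intro R_res_0_I) auto
    from I_A_mult[OF this A_power[OF pi_in]] show ?thesis by (rule I_mono) (use m in simp)
  next
    case False
    from i have "c i \<in> A" using c R_A by auto
    from A_I_mult[OF this pi_I] show ?thesis by (rule I_mono) (use False in simp)
  qed
qed

text \<open>The exponent p - 1 is a unit, so \<sigma>^p moves x = \<pi>^(p - 1) and \<pi> by the
  same relative amount c. Depth 2p = (p - 1) + c on x therefore means depth 1 + c = p + 2 on
  \<pi>.\<close>

lemma funpow_p_depth:
  assumes auto: "is_auto \<sigma>" and th: "\<theta> \<in> R" and r: "r \<in> A"
    and s: "\<sigma> \<pi> = \<pi> * (1 + \<pi> * (\<theta> + \<pi> * r))"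
  shows "(\<sigma> ^^ p) \<pi> - \<pi> \<in> I (p + 2)"
    and "\<lbrakk>res \<theta> \<noteq> 0; res (\<theta> ^ 2 - r) \<noteq> 0\<rbrakk> \<Longrightarrow> (\<sigma> ^^ p) \<pi> - \<pi> \<notin> I (p + 3)"
proof -
  have thA: "\<theta> \<in> A" by (rule R_A[OF th])
  have sA: "\<theta> + \<pi> * r \<in> A" using thA r by (intro A_closed)
  have "\<sigma> \<pi> - \<pi> = \<pi> ^ (1 + 1) * (\<theta> + \<pi> * r)" unfolding s by (simp add: algebra_simps power2_eq_square)
  then have b: "\<sigma> \<pi> - \<pi> \<in> I (1 + 1)" "1 \<ge> (1::nat)" using pi_mult_I[OF sA, of "1 + 1"] by simp_all
  define \<tau> where "\<tau> = \<sigma> ^^ p"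
  have \<tau>: "is_auto \<tau>" unfolding \<tau>_def by (rule funpow_is_auto[OF auto])
  define x where "x = \<pi> ^ (p - 1)"
  define C where "C = of_nat (fact (p - 1)) * \<theta> ^ (p - 1) * (\<theta> ^ 2 - r)"
  have C: "C \<in> A" unfolding C_def using thA r by (intro A_closed)
  have "cg (p^2 + (p - 1) + 1) (\<tau> x - x) (((\<lambda>x. \<sigma> x - x) ^^ p) x)"
    unfolding \<tau>_def x_def by (rule auto_funpow_p_I(1)[OF auto b pi_I])
  then have "cg (2 * p + 1) (\<tau> x - x) (((\<lambda>x. \<sigma> x - x) ^^ p) x)"
    by (rule cg_mono) (use M_facts p_ge_3 in arith)
  also have "cg (2 * p + 1) \<dots> (\<pi> ^ (2 * p) * C)"
    unfolding x_def C_def by (rule delta_test_element[OF auto th r s])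
  finally have tx: "cg (2 * p + 1) (\<tau> x - x) (\<pi> ^ (2 * p) * C)" .
  have tx2: "\<tau> x - x \<in> I (2 * p)" by (rule cg_I[OF tx pi_mult_I[OF C]]) simp
  have \<tau>1: "\<tau> \<pi> - \<pi> \<in> I (1 + 1)"
    unfolding \<tau>_def
    by (rule cg_I[OF auto_funpow_first_order[OF auto b] A_I_mult[OF A_of_nat b(1)]]) simp
  show "(\<sigma> ^^ p) \<pi> - \<pi> \<in> I (p + 2)"
  proof (rule ccontr)
    assume no: "(\<sigma> ^^ p) \<pi> - \<pi> \<notin> I (p + 2)"
    then have "\<tau> \<pi> - \<pi> \<noteq> 0" unfolding \<tau>_def using I_zero by auto
    then obtain m where m: "\<tau> \<pi> - \<pi> \<in> I m" "\<tau> \<pi> - \<pi> \<notin> I (m + 1)"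
      using exists_val[of "\<tau> \<pi> - \<pi>"] by (auto intro: A_diff auto_A[OF \<tau>] pi_in)
    have "m < p + 2"
    proof (rule ccontr)
      assume "\<not> m < p + 2"
      then show False using no I_mono[OF m(1), of "p + 2"] unfolding \<tau>_def by simp
    qed
    have "m \<ge> 2"
    proof (rule ccontr)
      assume "\<not> 2 \<le> m"
      then show False using m(2) I_mono[OF \<tau>1, of "m + 1"] by simp
    qed
    define c where "c = m - 1"
    have c: "m = c + 1" "c \<ge> 1" "c \<le> p" using \<open>m \<ge> 2\<close> \<open>m < p + 2\<close> by (auto simp: c_def)
    define \<eta> where "\<eta> = (\<tau> \<pi> - \<pi>) / \<pi>"
    have "cg (p - 1 + c + 1) (\<tau> (\<pi> ^ (p - 1) * 1) - \<pi> ^ (p - 1) * 1) (\<pi> ^ (p - 1) * (of_nat (p - 1) * \<eta> * 1))"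
      unfolding \<eta>_def by (rule delta_leading[OF \<tau>]) (use m c A_1 in auto)
    then have "cg (p - 1 + c + 1) (\<pi> ^ (p - 1) * (of_nat (p - 1) * \<eta>)) (\<tau> x - x)"
      by (simp add: x_def cg_sym)
    moreover have "\<tau> x - x \<in> I (p - 1 + c + 1)" by (rule I_mono[OF tx2]) (use c in simp)
    ultimately have "\<pi> ^ (p - 1) * (of_nat (p - 1) * \<eta>) \<in> I (p - 1 + c + 1)" by (rule cg_I) simp
    then have "of_nat (p - 1) * \<eta> \<in> I (c + 1)" by (simp only: I_pi_mult_iff add.assoc)
    moreover have unit: "res (of_nat (p - 1)) \<noteq> 0"
      unfolding res_of_nat by (rule of_nat_unit) (use p_ge_3 in auto)
    ultimately have "inverse (of_nat (p - 1)) * (of_nat (p - 1) * \<eta>) \<in> I (c + 1)"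
      by (metis A_I_mult A_inverse A_of_nat)
    moreover have "(of_nat (p - 1) :: 'b) \<noteq> 0" using unit res_0 by metis
    ultimately have "\<eta> \<in> I (c + 1)" by (simp add: mult.assoc[symmetric])
    then have "\<pi> ^ 1 * \<eta> \<in> I (1 + (c + 1))" by (rule I_mult[OF pi_I])
    moreover have "\<pi> ^ 1 * \<eta> = \<tau> \<pi> - \<pi>" using pi_nz by (simp add: \<eta>_def)
    ultimately show False using m(2) c by (simp add: add_ac)
  qed
  show "(\<sigma> ^^ p) \<pi> - \<pi> \<notin> I (p + 3)" if unit: "res \<theta> \<noteq> 0" "res (\<theta> ^ 2 - r) \<noteq> 0"
  proof
    assume "(\<sigma> ^^ p) \<pi> - \<pi> \<in> I (p + 3)"
    then have "\<tau> \<pi> - \<pi> \<in> I (p + 2 + 1)" unfolding \<tau>_def by (rule I_mono) simp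
    from delta_I_shift[OF \<tau> this _ pi_I[of "p - 1"]] have "\<tau> x - x \<in> I (p - 1 + (p + 2))"
      unfolding x_def by simp
    then have "\<tau> x - x \<in> I (2 * p + 1)" by (rule I_mono) simp
    from cg_I[OF cg_sym[OF tx] this] have "\<pi> ^ (2 * p) * C \<in> I (2 * p + 1)" by simp
    then have "C \<in> I 1" by (simp only: I_pi_mult_iff)
    then have "res C = 0" using res_eq_0_I[OF C] by simp
    moreover have "(of_nat (fact (p - 1)) :: 'k) \<noteq> 0"
    proof -
      have "\<not> p dvd fact (p - 1)" using prime_p p_ge_3 by (simp add: prime_dvd_fact_iff)
      then show ?thesis by (simp only: of_nat_eq_0_iff_char_dvd CHAR_residue not_False_eq_True)
    qed
    moreover have "res (of_nat (fact (p - 1)) :: 'b) = (of_nat (fact (p - 1)) :: 'k)" by (rule res_of_nat)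
    ultimately show False using unit thA r unfolding C_def
      by (simp add: res_mult res_power A_closed del: of_nat_fact)
  qed
qed

section \<open>Ramification breaks of a cyclic group of order \<open>p^2\<close>\<close>

lemma funpow_distinct:
  assumes auto: "is_auto \<sigma>" and b: "\<sigma> \<pi> - \<pi> \<in> I 2" "\<sigma> \<pi> - \<pi> \<notin> I 3"
    and bp: "(\<sigma> ^^ p) \<pi> - \<pi> \<in> I (p + 2)" "(\<sigma> ^^ p) \<pi> - \<pi> \<notin> I (p + 3)"
  shows "\<not> p dvd m \<Longrightarrow> (\<sigma> ^^ m) \<pi> - \<pi> \<in> I 2 \<and> (\<sigma> ^^ m) \<pi> - \<pi> \<notin> I 3"
    and "\<lbrakk>p dvd m; 0 < m; m < p^2\<rbrakk> \<Longrightarrow> (\<sigma> ^^ m) \<pi> - \<pi> \<in> I (p + 2) \<and> (\<sigma> ^^ m) \<pi> - \<pi> \<notin> I (p + 3)"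
proof -
  have e: "(1::nat) + 1 = 2" "(1::nat) + 2 = 3" "p + 1 + 1 = p + 2" "p + 1 + 2 = p + 3" by simp_all
  show "(\<sigma> ^^ m) \<pi> - \<pi> \<in> I 2 \<and> (\<sigma> ^^ m) \<pi> - \<pi> \<notin> I 3" if "\<not> p dvd m"
    using auto_funpow_val[OF auto, of 1 m] b that by (simp only: e) simp
  assume m: "p dvd m" "0 < m" "m < p^2"
  then obtain j where j: "m = p * j" by auto
  have "j < p" using m j by (simp add: p_sq)
  moreover have "0 < j" using m j by (cases j) auto
  ultimately have "\<not> p dvd j" by (auto dest: dvd_imp_le)
  moreover have "(\<sigma> ^^ m) = (\<sigma> ^^ p) ^^ j" unfolding j by (simp add: funpow_mult mult.commute)
  ultimately show "(\<sigma> ^^ m) \<pi> - \<pi> \<in> I (p + 2) \<and> (\<sigma> ^^ m) \<pi> - \<pi> \<notin> I (p + 3)"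
    using auto_funpow_val[OF funpow_is_auto[OF auto, of p], of "p + 1" j] bp by (simp only: e) simp
qed

text \<open>The residue of \<sigma> \<pi>/\<pi> is a p^2-th root of unity in characteristic p, hence
  1, so the first break is at least 1. If it were at least 2, then (\<sigma> - 1)^p would gain 2p
  degrees on \<pi>, and \<sigma>^p would be closer to the identity than \<open>break_bound\<close>
  permits.\<close>

lemma cyclic_breaks:
  assumes auto: "is_auto \<sigma>" and per: "(\<sigma> ^^ p^2) \<pi> = \<pi>"
    and dist: "\<And>m. \<lbrakk>0 < m; m < p^2\<rbrakk> \<Longrightarrow> (\<sigma> ^^ m) \<pi> \<noteq> \<pi>"
  shows "\<sigma> \<pi> - \<pi> \<in> I 2" "\<sigma> \<pi> - \<pi> \<notin> I 3"
    "(\<sigma> ^^ p) \<pi> - \<pi> \<in> I (p + 2)" "(\<sigma> ^^ p) \<pi> - \<pi> \<notin> I (p + 3)"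
proof -
  have n: "M + p = p^2" "2 * p \<le> M" "p + 3 \<le> M" by (rule M_facts)+
  have p1: "1 < p^2" "p < p^2" using n p_ge_3 by linarith+
  have s\<pi>: "\<sigma> \<pi> \<in> I 1" by (rule auto_pi[OF auto])
  then obtain e where e: "e \<in> A" "\<sigma> \<pi> = \<pi> * e" by (auto elim: I_E)
  have pow: "\<exists>y\<in>A. res y = res e ^ m \<and> (\<sigma> ^^ m) \<pi> = \<pi> * y" for m
  proof (induction m)
    case 0 then show ?case by (auto intro!: bexI[of _ 1] A_1 simp: res_1)
  next
    case (Suc m)
    then obtain y where "y \<in> A" "res y = res e ^ m" "(\<sigma> ^^ m) \<pi> = \<pi> * y" by blast
    then show ?case using e
      by (intro bexI[of _ "e * \<sigma> y"])
         (auto simp: auto_mult[OF auto] pi_in res_mult auto_A[OF auto] auto_res[OF auto] A_mult)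
  qed
  have "res e ^ p^2 = 1"
  proof -
    obtain y where "y \<in> A" "res y = res e ^ p^2" "(\<sigma> ^^ p^2) \<pi> = \<pi> * y" using pow by blast
    then show ?thesis using per pi_nz res_1 by simp
  qed
  then have "(res e ^ p) ^ p = (1 ^ p) ^ p" by (simp add: power_mult[symmetric] p_sq)
  then have "res e = 1" by (metis res_power_inj power_one)
  then have "e - 1 \<in> I 1" using e res_eq_0_I[of "e - 1"] by (simp add: res_diff res_1 A_closed)
  from I_mult[OF pi_I this, of 1] have s2: "\<sigma> \<pi> - \<pi> \<in> I 2" using e by (simp add: algebra_simps)
  show "\<sigma> \<pi> - \<pi> \<in> I 2" by (rule s2)
  define \<tau> where "\<tau> = \<sigma> ^^ p"
  have \<tau>: "is_auto \<tau>" unfolding \<tau>_def by (rule funpow_is_auto[OF auto])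
  have \<tau>p: "(\<tau> ^^ p) \<pi> = \<pi>" using per unfolding \<tau>_def by (simp add: funpow_mult p_sq)
  have \<tau>n: "\<tau> \<pi> \<noteq> \<pi>" unfolding \<tau>_def using dist[of p] p1 by simp
  show big: "(\<sigma> ^^ p) \<pi> - \<pi> \<notin> I (p + 3)"
    using break_bound[OF \<tau> \<tau>p \<tau>n] unfolding \<tau>_def .
  show s3: "\<sigma> \<pi> - \<pi> \<notin> I 3"
  proof
    assume "\<sigma> \<pi> - \<pi> \<in> I 3"
    then have b: "\<sigma> \<pi> - \<pi> \<in> I (2 + 1)" "(1::nat) \<le> 2" by simp_all
    have "cg (p^2 + 1 + 2) ((\<sigma> ^^ p) \<pi> - \<pi>) (((\<lambda>x. \<sigma> x - x) ^^ p) \<pi>)"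
      using auto_funpow_p_I(1)[OF auto b, of \<pi> 1] pi_I[of 1] by simp
    then have "cg (p + 3) ((\<sigma> ^^ p) \<pi> - \<pi>) (((\<lambda>x. \<sigma> x - x) ^^ p) \<pi>)"
      by (rule cg_mono) (use n in linarith)
    moreover have "((\<lambda>x. \<sigma> x - x) ^^ p) \<pi> \<in> I (p + 3)"
    proof (rule I_mono)
      show "((\<lambda>x. \<sigma> x - x) ^^ p) \<pi> \<in> I (1 + p * 2)"
        using delta_iter_I[OF auto b, of \<pi> 1 p] pi_I[of 1] by simp
      show "p + 3 \<le> 1 + p * 2" using p_ge_3 by simp
    qed
    ultimately have "(\<sigma> ^^ p) \<pi> - \<pi> \<in> I (p + 3)" by (rule cg_I) simp
    with big show False by simp
  qed
  obtain u where u: "u \<in> A" "\<sigma> \<pi> - \<pi> = \<pi> ^ 2 * u" using s2 by (elim I_E)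
  obtain \<theta> where \<theta>: "\<theta> \<in> R" "u - \<theta> \<in> I 1" using A_approx[OF u(1)] by blast
  then obtain r where r: "r \<in> A" "u - \<theta> = \<pi> * r" by (auto elim: I_E)
  have "\<sigma> \<pi> = \<pi> + \<pi> ^ 2 * (\<theta> + \<pi> * r)" using u(2) r(2) by (simp add: algebra_simps)
  then have "\<sigma> \<pi> = \<pi> * (1 + \<pi> * (\<theta> + \<pi> * r))" by (simp add: algebra_simps power2_eq_square)
  from funpow_p_depth(1)[OF auto \<theta>(1) r(1) this] show "(\<sigma> ^^ p) \<pi> - \<pi> \<in> I (p + 2)" .
qed

section \<open>Taylor coefficients at \<pi> from the valuations of the conjugates\<close>

context
  fixes \<sigma> :: "'b \<Rightarrow> 'b" and F :: "'b poly"
  assumes auto: "is_auto \<sigma>"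
    and F_prod: "F = (\<Prod>k<p^2. [:- (\<sigma> ^^ k) \<pi>, 1:])"
    and F_R: "\<And>i. Polynomial.coeff F i \<in> R"
    and F_p: "\<And>i. i < p^2 \<Longrightarrow> Polynomial.coeff F i / of_nat p \<in> R"
    and b: "\<sigma> \<pi> - \<pi> \<in> I 2" "\<sigma> \<pi> - \<pi> \<notin> I 3"
    and bp: "(\<sigma> ^^ p) \<pi> - \<pi> \<in> I (p + 2)" "(\<sigma> ^^ p) \<pi> - \<pi> \<notin> I (p + 3)"
begin

private definition "d k = \<pi> - (\<sigma> ^^ k) \<pi>"

private definition "S1 = {k \<in> {1..<p^2}. p dvd k}"

private definition "S2 = {k \<in> {1..<p^2}. \<not> p dvd k}"

private definition "H1 = (\<Prod>k\<in>S1. [:d k, 1:])"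

private definition "H2 = (\<Prod>k\<in>S2. [:d k, 1:])"

private lemma fin: "finite S1" "finite S2" unfolding S1_def S2_def by simp_all

private lemma S_un: "{1..<p^2} = S1 \<union> S2" "S1 \<inter> S2 = {}" unfolding S1_def S2_def by auto

private lemma card_S1: "card S1 = p - 1"
proof -
  have "S1 = (\<lambda>j. p * j) ` {1..<p}"
  proof (intro equalityI subsetI)
    fix k assume k: "k \<in> S1"
    then obtain j where j: "k = p * j" unfolding S1_def by auto
    have k': "1 \<le> k" "k < p^2" using k unfolding S1_def by auto
    then have lt: "p * j < p * p" unfolding j p_sq by metis
    have "j < p" using lt(1) by simp
    moreover have "1 \<le> j" using k'(1) j by (cases j) (simp_all add: One_nat_def)
    ultimately have "j < p" "1 \<le> j" .
    then show "k \<in> (\<lambda>j. p * j) ` {1..<p}" using j by auto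
  next
    fix k assume "k \<in> (\<lambda>j. p * j) ` {1..<p}"
    then obtain j where j: "k = p * j" "j \<in> {1..<p}" by blast
    then have "p * j < p * p" "1 \<le> p * j" using one_le_p_mult by auto
    then show "k \<in> S1" unfolding S1_def p_sq using j by auto
  qed
  moreover have "inj_on (\<lambda>j. p * j) {1..<p}" by (auto simp: inj_on_def)
  ultimately show ?thesis by (simp add: card_image)
qed

private lemma card_S2: "card S2 = M"
proof -
  have "card {1..<p^2} = card S1 + card S2" unfolding S_un(1) by (rule card_Un_disjoint[OF fin S_un(2)])
  moreover have "card {1..<p^2} = p^2 - 1" by simp
  ultimately have "card S1 + card S2 = p^2 - 1" by simp
  then show ?thesis using M_facts(1) p_ge_3 unfolding card_S1 by linarith
qed

private lemma d1: "k \<in> S1 \<Longrightarrow> d k \<in> I (p + 2)" "k \<in> S1 \<Longrightarrow> d k \<notin> I (p + 2 + 1)"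
proof -
  assume k: "k \<in> S1"
  then have "p dvd k" "0 < k" "k < p^2" unfolding S1_def by auto
  note * = funpow_distinct(2)[OF auto b bp this]
  have "d k = - ((\<sigma> ^^ k) \<pi> - \<pi>)" by (simp add: d_def)
  then show "d k \<in> I (p + 2)" using * I_uminus by metis
  have "(\<sigma> ^^ k) \<pi> - \<pi> = - d k" by (simp add: d_def)
  moreover have "p + 2 + 1 = p + 3" by simp
  ultimately show "d k \<notin> I (p + 2 + 1)" using * I_uminus[of "d k" "p + 3"] by metis
qed

private lemma d2: "k \<in> S2 \<Longrightarrow> d k \<in> I 2" "k \<in> S2 \<Longrightarrow> d k \<notin> I (2 + 1)"
proof -
  assume k: "k \<in> S2"
  then have "\<not> p dvd k" unfolding S2_def by auto
  note * = funpow_distinct(1)[OF auto b bp this]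
  have "d k = - ((\<sigma> ^^ k) \<pi> - \<pi>)" by (simp add: d_def)
  then show "d k \<in> I 2" using * I_uminus by metis
  have "(\<sigma> ^^ k) \<pi> - \<pi> = - d k" by (simp add: d_def)
  then show "d k \<notin> I (2 + 1)" using * I_uminus[of "d k" 3] by auto
qed

text \<open>The factor of the trivial conjugate is X. So \<open>H1 * H2\<close> has F'(\<pi>) in
  degree 0 and the p-th divided derivative at \<pi> in degree p - 1.\<close>

private lemma shifted: "pcompose F [:\<pi>, 1:] = Polynomial.pCons 0 (H1 * H2)"
proof -
  have "pcompose F [:\<pi>, 1:] = (\<Prod>k<p^2. [:d k, 1:])"
    unfolding F_prod pcompose_prod by (rule prod.cong) (simp_all add: pcompose_pCons d_def)
  also have "{..<p^2} = insert 0 {1..<p^2}" using one_le_p_sq by (auto simp: One_nat_def)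
  also have "(\<Prod>k\<in>insert 0 {1..<p^2}. [:d k, 1:]) = [:d 0, 1:] * (\<Prod>k\<in>{1..<p^2}. [:d k, 1:])"
    by simp
  also have "(\<Prod>k\<in>{1..<p^2}. [:d k, 1:]) = H1 * H2"
    unfolding S_un(1) H1_def H2_def by (rule prod.union_disjoint[OF fin S_un(2)])
  finally show ?thesis by (simp add: d_def)
qed

private lemma degree_F: "Polynomial.degree F = p^2"
  unfolding F_prod by (subst degree_prod_eq_sum_degree) auto

private lemma coeff_H_eq:
  assumes j: "j \<ge> 1"
  shows "Polynomial.coeff (H1 * H2) (j - 1)
    = (\<Sum>i<p^2. Polynomial.coeff F (i + j) * of_nat ((i + j) choose j) * \<pi> ^ i)"
proof -
  define f where "f i = Polynomial.coeff F i * of_nat (i choose j) * \<pi> ^ (i - j)" for i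
  have "Polynomial.coeff (H1 * H2) (j - 1) = Polynomial.coeff (pcompose F [:\<pi>, 1:]) j"
    unfolding shifted using j by (cases j) (simp_all add: One_nat_def)
  also have "\<dots> = (\<Sum>i\<le>p\<^sup>2. f i)" unfolding coeff_pcompose_shift degree_F f_def ..
  also have "\<dots> = (\<Sum>i\<in>{0+j..<p^2+j}. f i)"
  proof (rule sum.mono_neutral_cong)
    fix i assume "i \<in> {0+j..<p^2+j} - {..p^2}"
    then have "i > p^2" by auto
    then show "f i = 0" unfolding f_def by (simp add: coeff_eq_0 degree_F)
  next
    fix i assume i: "i \<in> {..p^2} - {0+j..<p^2+j}"
    then have "i < j" using j by auto
    then show "f i = 0" unfolding f_def by (simp add: binomial_eq_0)
  qed auto
  also have "\<dots> = (\<Sum>i\<in>{0..<p^2}. f (i + j))" by (rule sum.shift_bounds_nat_ivl)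
  finally show ?thesis unfolding f_def by (simp add: atLeast0LessThan)
qed

private lemma coeff_0_H: "Polynomial.coeff (\<Prod>k\<in>S. [:d k, 1:]) 0 = prod d S"
  by (simp add: poly_0_coeff_0[symmetric] poly_prod)

private lemma H2_0: "Polynomial.coeff H2 0 \<in> I (2 * M)" "Polynomial.coeff H2 0 \<notin> I (2 * M + 1)"
  unfolding H2_def coeff_0_H using prod_I[OF fin(2) d2(1)] prod_not_I[OF fin(2) d2] card_S2 by auto

private lemma H1_0: "Polynomial.coeff H1 0 \<in> I ((p + 2) * (p - 1))" "Polynomial.coeff H1 0 \<notin> I ((p + 2) * (p - 1) + 1)"
  unfolding H1_def coeff_0_H using prod_I[OF fin(1) d1(1)] prod_not_I[OF fin(1) d1] card_S1 by auto

text \<open>The exponent of the different: p + 2 for each of the p - 1 nontrivial elements of the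
  subgroup of order p, and 2 for each of the M others. The right-hand side is arranged for two
  divisions by p.\<close>

private lemma different_exponent: "(p + 2) * (p - 1) + 2 * M = p^2 + (p^2 + (M - 2))"
proof -
  have "(p + 2) * (p - 1) = M + 2 * (p - 1)" unfolding M_def by (rule add_mult_distrib)
  then show ?thesis using M_facts(1,3) p_ge_3 by linarith
qed

private lemma H_0: "Polynomial.coeff (H1 * H2) 0 \<in> I (p^2 + (p^2 + (M - 2)))"
    "Polynomial.coeff (H1 * H2) 0 \<notin> I (p^2 + (p^2 + (M - 2)) + 1)"
  unfolding different_exponent[symmetric] coeff_mult
  using I_mult[OF H1_0(1) H2_0(1)] mult_not_I[OF H1_0 H2_0] by simp_all

text \<open>Taking X from all p - 1 factors of \<open>H1\<close> and the constants from
  \<open>H2\<close> gives valuation 2M. Every other choice replaces constants of valuation 2 by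
  constants of valuation p + 2 and is strictly deeper.\<close>

private lemma H_p: "Polynomial.coeff (H1 * H2) (p - 1) \<in> I (2 * M)" "Polynomial.coeff (H1 * H2) (p - 1) \<notin> I (2 * M + 1)"
proof -
  have n: "M + p = p^2" "2 * p \<le> M" "p + 3 \<le> M" by (rule M_facts)+
  have deg: "Polynomial.degree H1 = p - 1"
    unfolding H1_def by (subst degree_prod_eq_sum_degree) (auto simp: card_S1)
  have "Polynomial.lead_coeff H1 = 1" unfolding H1_def by (simp add: lead_coeff_prod)
  then have c1: "Polynomial.coeff H1 (p - 1) = 1" unfolding deg .
  have "{..p - 1} = insert (p - 1) {..<p - 1}" by auto
  then have eq: "Polynomial.coeff (H1 * H2) (p - 1) = Polynomial.coeff H2 0
      + (\<Sum>i<p - 1. Polynomial.coeff H1 i * Polynomial.coeff H2 (p - 1 - i))"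
    unfolding coeff_mult by (simp add: c1)
  have rest: "(\<Sum>i<p - 1. Polynomial.coeff H1 i * Polynomial.coeff H2 (p - 1 - i)) \<in> I (2 * M + 1)"
  proof (rule I_sum)
    fix i assume i: "i \<in> {..<p - 1}"
    define t where "t = p - 1 - i"
    have t: "1 \<le> t" "t \<le> M" using i n by (auto simp: t_def)
    have "Polynomial.coeff H1 i * Polynomial.coeff H2 t \<in> I ((p + 2) * t + 2 * (M - t))"
      using coeff_prod_I[OF fin(1) d1(1), where j = i] coeff_prod_I[OF fin(2) d2(1), where j = t]
      unfolding H1_def H2_def card_S1 card_S2 t_def by (rule I_mult)
    moreover have "2 * M + 1 \<le> (p + 2) * t + 2 * (M - t)"
    proof -
      have "(p + 2) * t + 2 * (M - t) = p * t + 2 * (t + (M - t))" by (simp only: distrib_left distrib_right add.assoc)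
      also have "t + (M - t) = M" using t(2) by (rule le_add_diff_inverse)
      finally have eq: "(p + 2) * t + 2 * (M - t) = p * t + 2 * M" .
      have "1 \<le> p * t" by (rule one_le_p_mult[OF t(1)])
      then show ?thesis unfolding eq by (simp only: add.commute[of "p * t"] add_le_cancel_left)
    qed
    ultimately show "Polynomial.coeff H1 i * Polynomial.coeff H2 (p - 1 - i) \<in> I (2 * M + 1)"
      unfolding t_def by (rule I_mono)
  qed
  show "Polynomial.coeff (H1 * H2) (p - 1) \<in> I (2 * M)"
    unfolding eq by (rule I_add[OF H2_0(1) I_mono[OF rest]]) simp
  show "Polynomial.coeff (H1 * H2) (p - 1) \<notin> I (2 * M + 1)"
  proof
    assume "Polynomial.coeff (H1 * H2) (p - 1) \<in> I (2 * M + 1)"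
    from I_diff[OF this[unfolded eq] rest] H2_0(2) show False by simp
  qed
qed

private lemma of_nat_R_unit: "\<not> p dvd i \<Longrightarrow> res (of_nat i) \<noteq> 0"
  by (simp add: res_of_nat of_nat_eq_0_iff_char_dvd CHAR_residue)

private lemma R_cancel:
  assumes "\<not> p dvd i" "x * of_nat i / y \<in> R" shows "x / y \<in> R"
proof -
  have "inverse (of_nat i) * (x * of_nat i / y) \<in> R"
    using of_nat_R_unit[OF assms(1)] assms(2) by (intro R_mult R_inverse R_of_nat)
  moreover have "(of_nat i :: 'b) \<noteq> 0" using assms(1) by (cases "i = 0") auto
  ultimately show ?thesis by (simp add: field_simps)
qed

text \<open>F'(\<pi>) is the sum of the (i + 1) F_(i+1) \<pi>^i with coefficients in
  \<open>R\<close>. Its valuation 2p^2 + (M - 2) makes all of them divisible by p^2 and those before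
  index M - 2 by p^3, and it makes the one at M - 2 exactly divisible by p^2. For exponents prime to
  p the integer factor is a unit.\<close>

lemma cyclic_coefficients_first:
  shows "\<And>i. \<lbrakk>i < M - 1; \<not> p dvd i\<rbrakk> \<Longrightarrow> Polynomial.coeff F i / of_nat p ^ 3 \<in> R"
    and "\<And>i. \<lbrakk>i < p^2; \<not> p dvd i\<rbrakk> \<Longrightarrow> Polynomial.coeff F i / of_nat p ^ 2 \<in> R"
    and "res (Polynomial.coeff F (M - 1) / of_nat p ^ 2) \<noteq> 0"
proof -
  have n: "M + p = p^2" "2 * p \<le> M" "p + 3 \<le> M" by (rule M_facts)+
  define c where "c i = Polynomial.coeff F (i + 1) * of_nat (i + 1)" for i
  have c: "c i \<in> R" for i unfolding c_def by (intro R_mult F_R R_of_nat)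
  have H: "Polynomial.coeff (H1 * H2) 0 = (\<Sum>i<p^2. c i * \<pi> ^ i)"
    using coeff_H_eq[of 1] unfolding c_def by (simp only: choose_one diff_self_eq_0 order_refl simp_thms)
  note 1 = R_combination_div_p[OF c H_0(1)[unfolded H]]
  note 2 = R_combination_div_p[OF 1]
  have c2: "c i / of_nat p / of_nat p = Polynomial.coeff F (i + 1) * of_nat (i + 1) / of_nat p ^ 2" for i
    by (simp add: c_def power2_eq_square)
  show sq: "Polynomial.coeff F i / of_nat p ^ 2 \<in> R" if "i < p^2" "\<not> p dvd i" for i
  proof -
    from that(2) have "i \<noteq> 0" by (metis dvd_0_right)
    then obtain i' where i': "i = i' + 1" by (metis Suc_eq_plus1 not0_implies_Suc)
    have "c i' / of_nat p / of_nat p \<in> R" by (rule 2(1)) (use that i' in auto)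
    then show ?thesis unfolding c2 i'[symmetric] by (rule R_cancel[OF that(2)])
  qed
  show "Polynomial.coeff F i / of_nat p ^ 3 \<in> R" if i: "i < M - 1" "\<not> p dvd i" for i
  proof -
    from that(2) have "i \<noteq> 0" by (metis dvd_0_right)
    then obtain i' where i': "i = i' + 1" by (metis Suc_eq_plus1 not0_implies_Suc)
    have lt: "i' < p^2" "i' < M - 2" using i i' n by linarith+
    have "res (c i' / of_nat p / of_nat p) = 0"
      by (rule R_combination_I[OF 2 _ lt(2)]) (use n in auto)
    then have "c i' / of_nat p / of_nat p / of_nat p \<in> R" by (intro R_div_p 2(1) lt)
    then have "Polynomial.coeff F i * of_nat i / of_nat p ^ 3 \<in> R"
      unfolding c2 i'[symmetric] by (simp add: power2_eq_square power3_eq_cube mult.assoc)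
    then show ?thesis by (rule R_cancel[OF i(2)])
  qed
  show "res (Polynomial.coeff F (M - 1) / of_nat p ^ 2) \<noteq> 0"
  proof
    assume z: "res (Polynomial.coeff F (M - 1) / of_nat p ^ 2) = 0"
    have M2: "M - 2 < p^2" "M - 2 + 1 = M - 1" "M - 1 < p^2" using n by linarith+
    have z': "res (c i / of_nat p / of_nat p) = 0" if "i < M - 2 + 1" for i
    proof (cases "i = M - 2")
      case True
      have "\<not> p dvd M - 1"
      proof
        assume "p dvd M - 1"
        then have "p dvd M - (M - 1)" by (rule dvd_diff_nat[rotated]) (simp only: M_def dvd_triv_left)
        moreover have "M - (M - 1) = 1" using n by linarith
        ultimately have "p dvd 1" by metis
        then show False using p_ge_3 dvd_imp_le[of p 1] by simp
      qed
      then have A1: "Polynomial.coeff F (M - 1) / of_nat p ^ 2 \<in> A" by (intro R_A sq M2)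
      have "c i / of_nat p / of_nat p = Polynomial.coeff F (M - 1) / of_nat p ^ 2 * of_nat (M - 1)"
        unfolding c2 True M2(2) by simp
      then show ?thesis using z by (simp only: res_mult[OF A1 A_of_nat] mult_zero_left)
    next
      case False
      then show ?thesis
        by (intro R_combination_I[OF 2]) (use that n in auto)
    qed
    have "(\<Sum>i<p^2. c i / of_nat p / of_nat p * \<pi> ^ i) \<in> I (M - 2 + 1)"
      by (rule R_combination_not_I[OF 2(1) z' M2(1)])
    from I_mult[OF p_I I_mult[OF p_I this]]
    have "of_nat p * (of_nat p * (\<Sum>i<p^2. c i / of_nat p / of_nat p * \<pi> ^ i)) \<in> I (p^2 + (p^2 + (M - 2)) + 1)"
      by (simp add: add.assoc)
    moreover have "of_nat p * (of_nat p * (\<Sum>i<p^2. c i / of_nat p / of_nat p * \<pi> ^ i)) = (\<Sum>i<p^2. c i * \<pi> ^ i)"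
      unfolding sum_distrib_left by (intro sum.cong refl) simp
    ultimately show False using H_0(2) unfolding H by simp
  qed
qed

text \<open>The same reading of the p-th divided derivative, whose valuation is 2M = p^2 + (M - p).
  The binomial factors at the exponents p q are prime to p; the index M - p, i.e. the exponent M,
  carries the unit.\<close>

lemma cyclic_coefficients_second:
  shows "\<And>q. q \<in> {1..<p - 1} \<Longrightarrow> Polynomial.coeff F (p * q) / of_nat p ^ 2 \<in> R"
    and "res (Polynomial.coeff F M / of_nat p) \<noteq> 0"
proof -
  have n: "M + p = p^2" "2 * p \<le> M" "p + 3 \<le> M" by (rule M_facts)+
  define c where "c i = Polynomial.coeff F (i + p) * of_nat ((i + p) choose p)" for i
  have c: "c i \<in> R" for i unfolding c_def by (intro R_mult F_R R_of_nat)
  have H: "Polynomial.coeff (H1 * H2) (p - 1) = (\<Sum>i<p^2. c i * \<pi> ^ i)"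
    using coeff_H_eq[of p] p_ge_3 by (simp add: c_def)
  have e: "2 * M = p^2 + (M - p)" using n by linarith
  note 1 = R_combination_div_p[OF c H_p(1)[unfolded H e]]
  show "Polynomial.coeff F (p * q) / of_nat p ^ 2 \<in> R" if q: "q \<in> {1..<p - 1}" for q
  proof -
    define i where "i = p * (q - 1)"
    have ip: "i + p = p * q" using q by (cases q) (auto simp: i_def)
    have "p * q < p * (p - 1)" using q by simp
    then have i: "i < M - p" "i < p^2" using ip n unfolding M_def by linarith+
    have "res (c i / of_nat p) = 0" by (rule R_combination_I[OF 1 _ i(1)]) (use n in auto)
    then have "c i / of_nat p / of_nat p \<in> R" by (intro R_div_p 1(1) i)
    then have "Polynomial.coeff F (p * q) * of_nat ((p * q) choose p) / of_nat p ^ 2 \<in> R"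
      unfolding c_def ip by (simp add: power2_eq_square)
    moreover have "\<not> p dvd ((p * q) choose p)"
      using q by (intro not_dvd_binomial_p prime_p) auto
    ultimately show ?thesis by (rule R_cancel[rotated])
  qed
  show "res (Polynomial.coeff F M / of_nat p) \<noteq> 0"
  proof
    assume z: "res (Polynomial.coeff F M / of_nat p) = 0"
    have Mp: "M - p < p^2" "M - p + p = M" "M < p^2" using n p_ge_3 by linarith+
    have z': "res (c i / of_nat p) = 0" if "i < M - p + 1" for i
    proof (cases "i = M - p")
      case True
      have "c i / of_nat p = Polynomial.coeff F M / of_nat p * of_nat (M choose p)"
        unfolding c_def True Mp(2) by simp
      then show ?thesis using z by (simp only: res_mult[OF R_A[OF F_p[OF Mp(3)]] A_of_nat] mult_zero_left)
    next
      case False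
      then show ?thesis by (intro R_combination_I[OF 1]) (use that n in auto)
    qed
    have "(\<Sum>i<p^2. c i / of_nat p * \<pi> ^ i) \<in> I (M - p + 1)"
      by (rule R_combination_not_I[OF 1(1) z' Mp(1)])
    from I_mult[OF p_I this]
    have "of_nat p * (\<Sum>i<p^2. c i / of_nat p * \<pi> ^ i) \<in> I (2 * M + 1)"
      unfolding e by (simp add: add.assoc)
    moreover have "of_nat p * (\<Sum>i<p^2. c i / of_nat p * \<pi> ^ i) = (\<Sum>i<p^2. c i * \<pi> ^ i)"
      unfolding sum_distrib_left by (intro sum.cong refl) simp
    ultimately show False using H_p(2) unfolding H by simp
  qed
qed

end

section \<open>The conditions in the residue field\<close>

lemma res_power_diff: "((x :: 'k) - y) ^ p = x ^ p - y ^ p"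
  using res_power_add[of "x - y" y] by simp

lemma res_power_of_nat: "(of_nat m :: 'k) ^ p = of_nat m"
proof (induction m)
  case (Suc m)
  have "(1 + of_nat m :: 'k) ^ p = 1 ^ p + of_nat m ^ p" by (rule res_power_add)
  then show ?case using Suc by simp
qed simp

lemma pth_root_eqI: "(x :: 'k) ^ p = y \<Longrightarrow> pth_root p y = x"
  unfolding pth_root_def by (rule the_equality) (auto intro: res_power_inj)

text \<open>X^p - X has at most p roots, and the p elements of the prime field already supply
  them.\<close>

lemma fermat_converse:
  assumes "(x :: 'k) ^ p = x" shows "\<exists>j. x = of_nat j"
proof -
  define f where "f = Polynomial.monom (1 :: 'k) p - Polynomial.monom 1 1"
  have "Polynomial.degree f = p" unfolding f_def
    using degree_add_eq_left[of "- Polynomial.monom 1 1" "Polynomial.monom (1 :: 'k) p"] p_ge_3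
    by (simp add: Polynomial.degree_monom_eq)
  then have f: "f \<noteq> 0" "Polynomial.degree f = p" using p_ge_3 by auto
  have roots: "poly f y = 0 \<longleftrightarrow> y ^ p = y" for y
    unfolding f_def by (simp add: poly_monom)
  have inj: "inj_on (of_nat :: nat \<Rightarrow> 'k) {..<p}"
  proof (rule inj_onI)
    fix i j assume "i \<in> {..<p}" "j \<in> {..<p}" "(of_nat i :: 'k) = of_nat j"
    then have "of_nat (max i j - min i j) = (0 :: 'k)" by (simp add: of_nat_diff max_def min_def)
    then have "p dvd max i j - min i j" by (simp only: of_nat_eq_0_iff_char_dvd CHAR_residue)
    moreover have "max i j - min i j < p" using \<open>i \<in> {..<p}\<close> \<open>j \<in> {..<p}\<close> by auto
    ultimately have "max i j - min i j = 0" using dvd_imp_le by fastforce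
    then show "i = j" by (simp add: max_def min_def split: if_splits)
  qed
  have "of_nat ` {..<p} = {y. poly f y = 0}"
  proof (rule card_seteq)
    show "finite {y. poly f y = 0}" by (rule poly_roots_finite[OF f(1)])
    show "of_nat ` {..<p} \<subseteq> {y. poly f y = 0}" using roots res_power_of_nat by auto
    show "card {y. poly f y = 0} \<le> card ((of_nat :: nat \<Rightarrow> 'k) ` {..<p})"
      using card_poly_roots_bound[OF f(1)] f(2) by (simp add: card_image inj)
  qed
  then show ?thesis using assms roots by blast
qed

text \<open>The relation says s = t^2 - t/\<Gamma>, and Frobenius turns \<Gamma> into -P.\<close>

lemma residue_quadratic_power:
  fixes P \<Gamma> t s :: 'k
  assumes nz: "P \<noteq> 0" and s: "t + \<Gamma> * (s - t ^ 2) = 0" and \<Gamma>: "\<Gamma> ^ p = - P"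
  shows "s ^ p = (t ^ p) ^ 2 + t ^ p / P" "s ^ p^2 = (t ^ p^2) ^ 2 + t ^ p^2 / P ^ p"
proof -
  have "\<Gamma> \<noteq> 0" using \<Gamma> nz by auto
  then have "s = t ^ 2 - t / \<Gamma>" using s by (simp add: field_simps eq_neg_iff_add_eq_0)
  then have "s ^ p = (t ^ 2) ^ p - t ^ p / \<Gamma> ^ p" by (simp only: res_power_diff power_divide)
  then show sp: "s ^ p = (t ^ p) ^ 2 + t ^ p / P" unfolding \<Gamma> by (simp add: power_mult[symmetric] mult.commute)
  have "s ^ p^2 = (s ^ p) ^ p" "t ^ p^2 = (t ^ p) ^ p" by (simp_all add: p_sq power_mult)
  then show "s ^ p^2 = (t ^ p^2) ^ 2 + t ^ p^2 / P ^ p"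
    unfolding sp by (simp add: res_power_add power_divide power_mult[symmetric] mult_ac)
qed

lemma two_power_p: "(2 :: 'k) ^ p = 2"
  using res_power_of_nat[of 2] by simp

text \<open>\<open>L\<close> is the additive polynomial of (7), with N, P, K standing for F_(p^2),
  F_p, G_1. The constant obtained from the expansion and the constant of (7) differ by values of
  \<open>L\<close> only, so one equation is solvable exactly when the other is. The hypotheses
  eliminate t^(p^2), the powers of s, \<Gamma>^p and \<Delta>.\<close>

lemma residue_constant:
  fixes N P \<Gamma> K t s \<Delta> m :: 'k
  defines "L \<equiv> \<lambda>x. N * x ^ p + P * x"
  assumes nz: "N \<noteq> 0" "P \<noteq> 0" "t \<noteq> 0" and t: "N * t ^ p^2 + P * t ^ p = 0"
    and s: "t + \<Gamma> * (s - t ^ 2) = 0" and \<Gamma>: "\<Gamma> ^ p = - P"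
    and \<Delta>: "P / N * \<Gamma> * t - (P + 2 * \<Gamma> ^ p) * t ^ p^2 = 2 * (\<Delta> * t ^ p)"
  shows "N * (m / N - N * s ^ p^2 - P / N * t ^ p + 2 * (\<Gamma> ^ p * t ^ (p^2 + p)) - (K / P) ^ p * t ^ p
       + \<Delta> * (3 * t ^ (2 * p) - 2 * s ^ p))
    = m + K * t - L (K * t / P) - L (\<Gamma> * t / P) + L (\<Gamma> * t ^ (p + 1) / 2)"
proof -
  define a b Q Kp where "a = t ^ p" and "b = t ^ p^2" and "Q = P ^ p" and "Kp = K ^ p"
  have Q: "Q \<noteq> 0" "a \<noteq> 0" using nz by (simp_all add: Q_def a_def)
  have b: "b = - (P * a / N)" using t nz by (simp add: a_def b_def field_simps eq_neg_iff_add_eq_0)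
  have ap: "a ^ p = b" by (simp add: a_def b_def p_sq power_mult)
  have e: "t ^ (p + 1) = a * t" "t ^ (p^2 + p) = b * a" "t ^ (2 * p) = a ^ 2"
    by (simp_all add: a_def b_def power_add power_mult[symmetric] mult.commute)
  have sp: "s ^ p = a ^ 2 + a / P" "s ^ p^2 = b ^ 2 + b / Q"
    using residue_quadratic_power[OF nz(2) s \<Gamma>] by (simp_all add: a_def b_def Q_def)
  have L1: "L (K * t / P) = N * (Kp * a / Q) + K * t"
    using nz by (simp add: L_def Kp_def a_def Q_def power_divide power_mult_distrib)
  have L2: "L (\<Gamma> * t / P) = - (N * (P * a / Q)) + \<Gamma> * t"
    using nz by (simp add: L_def a_def Q_def power_divide power_mult_distrib \<Gamma>)
  have L3: "L (\<Gamma> * (a * t) / 2) = - (N * P * b * a / 2) + P * (\<Gamma> * a * t / 2)"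
    by (simp add: L_def a_def[symmetric] ap power_divide power_mult_distrib \<Gamma> two_power_p mult_ac)
  \<comment> \<open>With \<Gamma>^p = -P the bracket P + 2 \<Gamma>^p becomes -P.\<close>
  have D: "2 * (\<Delta> * a) = P / N * \<Gamma> * t + P * b"
    using \<Delta> unfolding \<Gamma> a_def b_def by (simp add: algebra_simps)
  have "\<Delta> * (3 * a ^ 2 - 2 * (a ^ 2 + a / P)) = 2 * (\<Delta> * a) * (a / 2 - 1 / P)"
    using nz two_nz by (simp add: field_simps power2_eq_square)
  then have \<Delta>': "\<Delta> * (3 * a ^ 2 - 2 * (a ^ 2 + a / P)) = (P / N * \<Gamma> * t + P * b) * (a / 2 - 1 / P)"
    unfolding D .
  show ?thesis
    unfolding L1 L2 L3 sp e \<Gamma> \<Delta>' power_divide a_def[symmetric] Kp_def[symmetric] Q_def[symmetric] b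
    using nz Q two_nz by (simp add: field_simps power2_eq_square)
qed

end

context wild_eisenstein
begin

abbreviation "residue_form x \<equiv> res \<phi>0 * x ^ p + res \<phi>1 * x"

abbreviation "lift_quotient \<theta> \<equiv> (\<phi>0 * \<theta> ^ p^2 + \<phi>1 * \<theta> ^ p) / of_nat p"

lemma residue_form_add: "residue_form (x + y) = residue_form x + residue_form y"
  by (simp add: res_power_add algebra_simps)

lemma residue_form_diff: "residue_form (x - y) = residue_form x - residue_form y"
  by (simp add: res_power_diff algebra_simps)

lemma lift_quotient_R:
  assumes "\<theta> \<in> R" "res (\<phi>0 * \<theta> ^ p^2 + \<phi>1 * \<theta> ^ p) = 0"
  shows "lift_quotient \<theta> \<in> R"
  using assms by (intro R_div_p R_closed coeff_R)

lemma res_k_phi: "j \<in> {1..<p} \<Longrightarrow> res (k j / \<phi>1) = res (k j) / res \<phi>1"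
  by (intro res_divide R_A coeff_R coeff_unit) auto

lemma res_Delta:
  assumes j: "j \<in> {1..<p - 1}"
  shows "res (Delta j) = (res (k j) / res \<phi>1) ^ p - res (h j) / res \<phi>0"
proof -
  have j': "j \<in> {1..<p}" using j by auto
  have "h j / \<phi>0 \<in> A" "k j / \<phi>1 \<in> A" using j j' by (intro A_divide R_A coeff_R coeff_unit; simp)+
  moreover have "res (h j / \<phi>0) = res (h j) / res \<phi>0" using j by (intro res_divide R_A coeff_R coeff_unit)
  ultimately show ?thesis unfolding Delta_def by (simp add: res_simps A_closed res_k_phi[OF j'])
qed

lemma residue_relation:
  "\<theta> \<in> A \<Longrightarrow> res (\<phi>0 * \<theta> ^ p^2 + \<phi>1 * \<theta> ^ p) = res \<phi>0 * res \<theta> ^ p^2 + res \<phi>1 * res \<theta> ^ p"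
  using coeff_A by (simp add: res_simps A_closed)

lemma residue_relation_iff:
  assumes t: "t \<noteq> 0"
  shows "res \<phi>0 * t ^ p^2 + res \<phi>1 * t ^ p = 0 \<longleftrightarrow> t ^ (p * (p - 1)) = - res \<phi>1 / res \<phi>0"
proof -
  have "t ^ p^2 = t ^ (p * (p - 1)) * t ^ p"
    using M_facts(1) unfolding M_def by (metis power_add)
  then have "res \<phi>0 * t ^ p^2 + res \<phi>1 * t ^ p = (res \<phi>0 * t ^ (p * (p - 1)) + res \<phi>1) * t ^ p"
    by (simp add: algebra_simps)
  moreover have "res \<phi>0 * t ^ (p * (p - 1)) + res \<phi>1 = 0 \<longleftrightarrow> t ^ (p * (p - 1)) = - res \<phi>1 / res \<phi>0"
    using coeff_unit(1) by (simp only: eq_divide_eq eq_neg_iff_add_eq_0 mult.commute[of "res \<phi>0"]) simp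
  ultimately show ?thesis using t by simp
qed

lemma res_kappa0:
  "\<theta> \<in> A \<Longrightarrow> res (kappa0 \<theta>) = res \<phi>1 / res \<phi>0 * res \<gamma> * res \<theta> - (res \<phi>1 + 2 * res \<gamma> ^ p) * res \<theta> ^ p^2"
  unfolding kappa0_def using coeff_A coeff_unit gamma_A
  by (simp add: res_simps A_closed res_divide A_divide)

lemma res_D_const:
  assumes th: "\<theta> \<in> R" and r: "r \<in> A" and 0: "res (\<phi>0 * \<theta> ^ p^2 + \<phi>1 * \<theta> ^ p) = 0"
  shows "D_const \<theta> r \<in> A"
    and "res (D_const \<theta> r) = res (lift_quotient \<theta>) / res \<phi>0 - res \<phi>0 * res r ^ p^2
      - res \<phi>1 / res \<phi>0 * res \<theta> ^ p + 2 * (res \<gamma> ^ p * res \<theta> ^ (p^2 + p))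
      - (res (k (p - 1)) / res \<phi>1) ^ p * res \<theta> ^ p
      + res (Delta (p - 2)) * (3 * res \<theta> ^ (2 * p) - 2 * res r ^ p)"
proof -
  have j: "p - 1 \<in> {1..<p}" "p - 2 \<in> {1..<p - 1}" using p_ge_3 by auto
  have m: "lift_quotient \<theta> \<in> A" by (rule R_A[OF lift_quotient_R[OF th 0]])
  have q: "lift_quotient \<theta> / \<phi>0 \<in> A" "\<phi>1 / \<phi>0 \<in> A" "k (p - 1) / \<phi>1 \<in> A" "Delta (p - 2) \<in> A"
    by (rule A_divide[OF m coeff_A(1) coeff_unit(1)], rule A_divide[OF coeff_A(2,1) coeff_unit(1)],
        rule A_divide[OF coeff_A(5)[OF j(1)] coeff_A(2) coeff_unit(2)], rule R_A[OF Delta_R[OF j(2)]])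
  have rq: "res (lift_quotient \<theta> / \<phi>0) = res (lift_quotient \<theta>) / res \<phi>0" "res (\<phi>1 / \<phi>0) = res \<phi>1 / res \<phi>0"
    by (rule res_divide[OF m coeff_A(1) coeff_unit(1)], rule res_divide[OF coeff_A(2,1) coeff_unit(1)])
  have thA: "\<theta> \<in> A" by (rule R_A[OF th])
  show "D_const \<theta> r \<in> A" unfolding D_const_def using q thA r gamma_A coeff_A by (intro A_closed)
  show "res (D_const \<theta> r) = res (lift_quotient \<theta>) / res \<phi>0 - res \<phi>0 * res r ^ p^2
      - res \<phi>1 / res \<phi>0 * res \<theta> ^ p + 2 * (res \<gamma> ^ p * res \<theta> ^ (p^2 + p))
      - (res (k (p - 1)) / res \<phi>1) ^ p * res \<theta> ^ p
      + res (Delta (p - 2)) * (3 * res \<theta> ^ (2 * p) - 2 * res r ^ p)"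
    unfolding D_const_def rq[symmetric] res_k_phi[OF j(1), symmetric] using q thA r gamma_A coeff_A
    by (simp only: res_simps A_closed)
qed

text \<open>Condition (7) for one choice of \<open>\<theta>\<close> is the last congruence of the expansion of \<open>f\<close>, after
  adding values of the additive polynomial to its constant term.\<close>

lemma final_congruence_iff:
  assumes th: "\<theta> \<in> R" "res \<theta> \<noteq> 0" and r: "r \<in> A"
    and 1: "res (\<phi>0 * \<theta> ^ p^2 + \<phi>1 * \<theta> ^ p) = 0"
    and 2: "res (\<theta> + \<gamma> * (r - \<theta> ^ 2)) = 0"
    and 3: "res \<gamma> ^ p = - res \<phi>1"
    and 5: "res (kappa0 \<theta> - 2 * (Delta (p - 2) * \<theta> ^ p)) = 0"
  shows "(\<exists>\<xi>\<in>A. cg 1 (\<xi> ^ p + \<phi>1 / \<phi>0 * \<xi> + D_const \<theta> r) 0)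
    \<longleftrightarrow> (\<exists>x. residue_form x = res (lift_quotient \<theta>) + res (k (p - 1)) * res \<theta>)"
proof -
  have thA: "\<theta> \<in> A" by (rule R_A[OF th(1)])
  have j: "p - 2 \<in> {1..<p - 1}" using p_ge_3 by auto
  define P N \<Gamma> t s D where "P = res \<phi>1" and "N = res \<phi>0" and "\<Gamma> = res \<gamma>" and "t = res \<theta>" and "s = res r"
    and "D = res (D_const \<theta> r)"
  have nz: "N \<noteq> 0" "P \<noteq> 0" "t \<noteq> 0" using coeff_unit th(2) by (simp_all add: N_def P_def t_def)
  have t: "N * t ^ p^2 + P * t ^ p = 0" using 1 residue_relation[OF thA] by (simp add: N_def P_def t_def)
  have s: "t + \<Gamma> * (s - t ^ 2) = 0"
    using 2 thA r gamma_A by (simp add: t_def s_def \<Gamma>_def res_simps A_closed)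
  have \<Gamma>: "\<Gamma> ^ p = - P" using 3 by (simp add: \<Gamma>_def P_def)
  have "kappa0 \<theta> \<in> A" "Delta (p - 2) \<in> A" using j by (intro R_A[OF kappa0_R] R_A[OF Delta_R] th; simp)+
  then have \<Delta>: "P / N * \<Gamma> * t - (P + 2 * \<Gamma> ^ p) * t ^ p^2 = 2 * (res (Delta (p - 2)) * t ^ p)"
    using 5 res_kappa0[OF thA] thA by (simp add: P_def N_def \<Gamma>_def t_def res_simps A_closed)
  \<comment> \<open>The total of the \<open>L\<close>-values in \<open>residue_constant\<close>; by
    additivity it is a single value, taken at \<open>c0\<close>.\<close>
  define c where "c = residue_form (res (k (p - 1)) * t / P) + residue_form (\<Gamma> * t / P) - residue_form (\<Gamma> * t ^ (p + 1) / 2)"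
  define c0 where "c0 = res (k (p - 1)) * t / P + \<Gamma> * t / P - \<Gamma> * t ^ (p + 1) / 2"
  have c: "c = residue_form c0" unfolding c_def c0_def residue_form_add residue_form_diff by simp
  have D: "N * D = res (lift_quotient \<theta>) + res (k (p - 1)) * t - c"
    using residue_constant[OF nz t s \<Gamma> \<Delta>, of "res (lift_quotient \<theta>)" "res (k (p - 1))"]
    unfolding D_def res_D_const(2)[OF th(1) r 1] c_def
    by (simp add: P_def N_def t_def s_def \<Gamma>_def)
  have cg: "cg 1 (\<xi> ^ p + \<phi>1 / \<phi>0 * \<xi> + D_const \<theta> r) 0 \<longleftrightarrow> residue_form (res \<xi>) + N * D = 0" if "\<xi> \<in> A" for \<xi>
  proof -
    have q: "\<phi>1 / \<phi>0 \<in> A" "res (\<phi>1 / \<phi>0) = P / N"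
      unfolding P_def N_def by (intro A_divide res_divide coeff_A coeff_unit)+
    have "\<xi> ^ p + \<phi>1 / \<phi>0 * \<xi> + D_const \<theta> r \<in> A"
      using that q(1) res_D_const(1)[OF th(1) r 1] by (intro A_closed)
    then have "cg 1 (\<xi> ^ p + \<phi>1 / \<phi>0 * \<xi> + D_const \<theta> r) 0
        \<longleftrightarrow> res (\<xi> ^ p + \<phi>1 / \<phi>0 * \<xi> + D_const \<theta> r) = 0"
      by (simp add: cg_1_iff A_0 res_0)
    also have "res (\<xi> ^ p + \<phi>1 / \<phi>0 * \<xi> + D_const \<theta> r) = res \<xi> ^ p + P / N * res \<xi> + D"
      using that q res_D_const(1)[OF th(1) r 1] by (simp only: res_simps A_closed D_def)
    also have "\<dots> = 0 \<longleftrightarrow> N * (res \<xi> ^ p + P / N * res \<xi> + D) = 0" using nz by simp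
    also have "N * (res \<xi> ^ p + P / N * res \<xi> + D) = residue_form (res \<xi>) + N * D"
      using nz by (simp add: algebra_simps P_def N_def)
    finally show ?thesis .
  qed
  show ?thesis
  proof
    assume "\<exists>\<xi>\<in>A. cg 1 (\<xi> ^ p + \<phi>1 / \<phi>0 * \<xi> + D_const \<theta> r) 0"
    then obtain \<xi> where "\<xi> \<in> A" "residue_form (res \<xi>) + N * D = 0" using cg by blast
    then have "residue_form (c0 - res \<xi>) = res (lift_quotient \<theta>) + res (k (p - 1)) * t"
      unfolding residue_form_diff D c by (simp add: algebra_simps eq_neg_iff_add_eq_0)
    then show "\<exists>x. residue_form x = res (lift_quotient \<theta>) + res (k (p - 1)) * res \<theta>" unfolding t_def by blast
  next
    assume "\<exists>x. residue_form x = res (lift_quotient \<theta>) + res (k (p - 1)) * res \<theta>"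
    then obtain x where x: "residue_form x = res (lift_quotient \<theta>) + res (k (p - 1)) * t" unfolding t_def by blast
    obtain \<xi> where \<xi>: "\<xi> \<in> R" "res \<xi> = c0 - x" using res_lift by blast
    have "residue_form (res \<xi>) + N * D = 0" unfolding \<xi> residue_form_diff D c x by simp
    then show "\<exists>\<xi>\<in>A. cg 1 (\<xi> ^ p + \<phi>1 / \<phi>0 * \<xi> + D_const \<theta> r) 0" using cg R_A \<xi>(1) by blast
  qed
qed

text \<open>The solutions of \<open>t\<^sup>p\<^sup>(\<^sup>p\<^sup>-\<^sup>1\<^sup>) = - \<phi>1 / \<phi>0\<close> differ by factors in the prime field, and
  all terms of condition (7) are homogeneous of degree one for such factors.\<close>

lemma residue_form_root_scale:
  assumes th: "\<theta> \<in> R" "res \<theta> \<noteq> 0" "res \<theta> ^ (p * (p - 1)) = - res \<phi>1 / res \<phi>0"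
    and th': "\<theta>' \<in> R" "res \<theta>' ^ (p * (p - 1)) = - res \<phi>1 / res \<phi>0"
    and x: "residue_form x = res (lift_quotient \<theta>) + c * res \<theta>"
  shows "\<exists>x. residue_form x = res (lift_quotient \<theta>') + c * res \<theta>'"
proof -
  define u where "u = res \<theta>' / res \<theta>"
  have nz: "res \<phi>1 \<noteq> 0" "res \<phi>0 \<noteq> 0" using coeff_unit by simp_all
  have "u ^ (p * (p - 1)) = 1" using th th'(2) nz by (simp add: u_def power_divide)
  then have "(u ^ (p - 1)) ^ p = 1 ^ p" by (simp add: power_mult[symmetric] mult.commute)
  then have "u ^ (p - 1) = 1" by (rule res_power_inj)
  then have "u ^ p = u" using p_ge_3 by (metis mult.right_neutral p_pos(1) power_minus_mult mult.commute)
  then obtain j where j: "u = of_nat j" using fermat_converse by blast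
  have thj: "res \<theta>' = of_nat j * res \<theta>" using th(2) j by (simp add: u_def field_simps)
  have thA: "\<theta> \<in> A" "\<theta>' \<in> A" using th th' R_A by auto
  have rel: "res (\<phi>0 * y ^ p^2 + \<phi>1 * y ^ p) = 0" if "y \<in> A" "res y ^ (p * (p - 1)) = - res \<phi>1 / res \<phi>0" for y
  proof -
    have "res y \<noteq> 0" using that(2) nz p_ge_3 by (auto simp: zero_power)
    then show ?thesis using residue_relation_iff that residue_relation by simp
  qed
  define w where "w = of_nat j * \<theta>"
  have w: "w \<in> R" "w \<in> A" "res w = res \<theta>'"
    using th(1) thA by (auto simp: w_def thj res_simps A_closed intro!: R_closed)
  \<comment> \<open>Elements of \<open>R\<close> congruent modulo p have p-th powers congruent
    modulo p^2, so the quotient by p still has residue 0. This is used for \<theta>' against j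
    \<theta>, for their p-th powers, and for j^p against j.\<close>
  have pw: "(x ^ p - y ^ p) / of_nat p \<in> R \<and> res ((x ^ p - y ^ p) / of_nat p) = 0"
    if xy: "x \<in> R" "y \<in> R" "res x = res y" for x y
  proof -
    have e: "x - y \<in> I (p^2)" using xy by (intro R_res_0_I R_diff) (simp_all add: res_diff R_A)
    have "cg (p^2 + p^2) (x ^ p) (y ^ p + (x - y) ^ p)"
      using cg_freshman[OF R_A[OF xy(2)] e] by simp
    then have "x ^ p - y ^ p - (x - y) ^ p \<in> I (p^2 + p^2)" by (simp add: cg_def algebra_simps)
    then have "x ^ p - y ^ p - (x - y) ^ p \<in> I (p^2 + 1)" by (rule I_mono) (simp add: one_le_p_sq)
    moreover have "(x - y) ^ p \<in> I (p^2 + 1)"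
    proof (rule I_mono[OF I_power[OF e]])
      have "p^2 * 2 \<le> p^2 * p" using p_ge_3 by (intro mult_le_mono2) simp
      then show "p^2 + 1 \<le> p^2 * p" using one_le_p_sq by linarith
    qed
    ultimately have "x ^ p - y ^ p - (x - y) ^ p + (x - y) ^ p \<in> I (p^2 + 1)" by (rule I_add)
    then have d: "x ^ p - y ^ p \<in> I (p^2 + 1)" by simp
    have 1: "(x ^ p - y ^ p) / of_nat p \<in> R"
      using xy by (intro R_div_p R_closed) (simp_all add: res_simps A_closed R_A)
    moreover from 1 have "res ((x ^ p - y ^ p) / of_nat p) = 0"
      using I_div_p[OF d] res_eq_0_I[OF R_A[OF 1]] by simp
    ultimately show ?thesis ..
  qed
  have rp: "x ^ p \<in> R" "res (x ^ p) = res x ^ p" if "x \<in> R" for x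
    using that by (auto simp: res_power R_A intro: R_power)
  define E1 E2 E3 where "E1 = ((\<theta>' ^ p) ^ p - (w ^ p) ^ p) / of_nat p" and "E2 = (\<theta>' ^ p - w ^ p) / of_nat p"
    and "E3 = ((of_nat j ^ p) ^ p - of_nat j ^ p :: 'b) / of_nat p"
  have E: "E1 \<in> A" "E2 \<in> A" "E3 \<in> A" "res E1 = 0" "res E2 = 0" "res E3 = 0"
    using pw[of "\<theta>' ^ p" "w ^ p"] pw[of "\<theta>'" w] pw[of "of_nat j ^ p" "of_nat j"] th'(1) w
    unfolding E1_def E2_def E3_def by (auto simp: rp R_of_nat R_A res_of_nat res_power_of_nat)
  have m: "lift_quotient \<theta> \<in> A"
    using rel[OF thA(1) th(3)] lift_quotient_R[OF th(1)] R_A by blast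
  have "lift_quotient \<theta>' = of_nat j ^ p * lift_quotient \<theta> + \<phi>0 * (E1 + (\<theta> ^ p) ^ p * E3) + \<phi>1 * E2"
    unfolding E1_def E2_def E3_def w_def p_sq power_mult power_mult_distrib by (simp add: field_simps)
  then have "res (lift_quotient \<theta>')
      = res (of_nat j ^ p * lift_quotient \<theta> + \<phi>0 * (E1 + (\<theta> ^ p) ^ p * E3) + \<phi>1 * E2)" by (rule arg_cong)
  also have "\<dots> = of_nat j ^ p * res (lift_quotient \<theta>) + res \<phi>0 * (res E1 + (res \<theta> ^ p) ^ p * res E3) + res \<phi>1 * res E2"
    using E(1-3) m thA coeff_A(1,2) by (simp only: res_simps A_closed)
  finally have "res (lift_quotient \<theta>') = of_nat j ^ p * res (lift_quotient \<theta>)" using E(4-6) by simp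
  then have "residue_form (of_nat j * x) = res (lift_quotient \<theta>') + c * res \<theta>'"
    using arg_cong[OF x, of "\<lambda>y. of_nat j * y"]
    by (simp add: res_power_of_nat power_mult_distrib thj algebra_simps)
  then show ?thesis by blast
qed

text \<open>In the residue field \<phi>0 t^(p^2) = -\<phi>1 t^p = (\<gamma> t)^p.\<close>

lemma pth_root_phi0:
  assumes t: "t \<noteq> 0" "res \<phi>0 * t ^ p^2 + res \<phi>1 * t ^ p = 0" and \<Gamma>: "res \<gamma> ^ p = - res \<phi>1"
  shows "pth_root p (res \<phi>0) = res \<gamma> * t / t ^ p"
proof (rule pth_root_eqI)
  have "(t ^ p) ^ p = t ^ p^2" by (simp add: p_sq power_mult)
  then have "(res \<gamma> * t / t ^ p) ^ p = - (res \<phi>1 * t ^ p) / t ^ p^2"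
    by (simp add: power_divide power_mult_distrib \<Gamma>)
  also have "- (res \<phi>1 * t ^ p) = res \<phi>0 * t ^ p^2" using t(2) by (metis add_eq_0_iff2 minus_minus add.commute)
  finally show "(res \<gamma> * t / t ^ p) ^ p = res \<phi>0" using t by simp
qed

text \<open>This is condition (6). Dividing the coefficient of order M by \<theta>^p leaves \<theta>
  only in the quotient \<gamma> \<theta>/\<theta>^p, which is the p-th root of F_(p^2) by
  \<open>pth_root_phi0\<close>.\<close>

lemma Delta_last_iff:
  assumes th: "\<theta> \<in> R" "res \<theta> \<noteq> 0" and rel: "res (\<phi>0 * \<theta> ^ p^2 + \<phi>1 * \<theta> ^ p) = 0" and \<Gamma>: "res \<gamma> ^ p = - res \<phi>1"
  shows "res (kappa0 \<theta> - 2 * (Delta (p - 2) * \<theta> ^ p)) = 0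
    \<longleftrightarrow> res (h (p - 2)) = res \<phi>0 * (res (k (p - 2)) / res \<phi>1) ^ p
      + 1 / 2 * res \<phi>1 * (res \<phi>1 - pth_root p (res \<phi>0))"
proof -
  have j: "p - 2 \<in> {1..<p - 1}" using p_ge_3 by auto
  have thA: "\<theta> \<in> A" by (rule R_A[OF th(1)])
  define P N t a \<Delta> where "P = res \<phi>1" and "N = res \<phi>0" and "t = res \<theta>" and "a = t ^ p" and "\<Delta> = res (Delta (p - 2))"
  have nz: "P \<noteq> 0" "N \<noteq> 0" "t \<noteq> 0" "a \<noteq> 0" using coeff_unit th(2) by (simp_all add: P_def N_def t_def a_def)
  have t: "N * t ^ p^2 + P * a = 0" using rel residue_relation[OF thA] by (simp add: N_def P_def t_def a_def)
  then have b: "t ^ p^2 = - (P * a) / N"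
    using nz by (simp only: eq_divide_eq eq_neg_iff_add_eq_0 mult.commute[of "t ^ p^2"]) simp
  have root: "pth_root p N = res \<gamma> * t / a"
    using pth_root_phi0[of t] t nz \<Gamma> by (simp add: N_def P_def a_def)
  have A: "kappa0 \<theta> \<in> A" "Delta (p - 2) \<in> A"
    by (rule R_A[OF kappa0_R[OF th(1)]], rule R_A[OF Delta_R[OF j]])
  have "res (kappa0 \<theta> - 2 * (Delta (p - 2) * \<theta> ^ p))
      = P / N * res \<gamma> * t - (P + 2 * res \<gamma> ^ p) * t ^ p^2 - 2 * (\<Delta> * a)"
    using A thA res_kappa0[OF thA] by (simp only: res_simps A_closed P_def N_def t_def a_def \<Delta>_def)
  also have "\<dots> = 2 * a / N * (1 / 2 * P * (pth_root p N - P) - N * \<Delta>)"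
    unfolding \<Gamma> P_def[symmetric] b root using nz two_nz by (simp add: field_simps)
  finally have 1: "res (kappa0 \<theta> - 2 * (Delta (p - 2) * \<theta> ^ p)) = 0 \<longleftrightarrow> N * \<Delta> = 1 / 2 * P * (pth_root p N - P)"
    using nz two_nz by auto
  have 2: "1 / 2 * P * (pth_root p N - P) = - (1 / 2 * P * (P - pth_root p N))"
    by (simp add: right_diff_distrib)
  have 3: "N * \<Delta> = N * (res (k (p - 2)) / P) ^ p - res (h (p - 2))"
    unfolding \<Delta>_def res_Delta[OF j] using nz by (simp add: N_def P_def algebra_simps)
  have 4: "x - y = - z \<longleftrightarrow> y = x + z" for x y z :: 'k by (auto simp: algebra_simps)
  show ?thesis unfolding 1 2 3 4 unfolding N_def P_def ..
qed

lemma gamma_power_iff: "res (\<phi>1 + \<gamma> ^ p) = 0 \<longleftrightarrow> res g ^ p = - (res \<phi>1 ^ (p + 1))"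
  "res \<gamma> ^ p = - res \<phi>1 \<longleftrightarrow> res g ^ p = - (res \<phi>1 ^ (p + 1))"
proof -
  show 2: "res \<gamma> ^ p = - res \<phi>1 \<longleftrightarrow> res g ^ p = - (res \<phi>1 ^ (p + 1))"
    unfolding res_gamma power_divide power_add power_one_right using coeff_unit(2)
    by (simp add: divide_eq_eq mult.commute)
  have "res (\<phi>1 + \<gamma> ^ p) = res \<phi>1 + res \<gamma> ^ p" using coeff_A(2) gamma_A by (simp add: res_simps A_closed)
  then show "res (\<phi>1 + \<gamma> ^ p) = 0 \<longleftrightarrow> res g ^ p = - (res \<phi>1 ^ (p + 1))"
    unfolding 2[symmetric] by (simp add: eq_neg_iff_add_eq_0 add.commute)
qed

lemma Delta_iff:
  assumes j: "j \<in> {1..<p - 1}"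
  shows "res (Delta j) = 0 \<longleftrightarrow> res (h j) = res \<phi>0 * (res (k j) / res \<phi>1) ^ p"
  unfolding res_Delta[OF j] using coeff_unit(1) by (auto simp: field_simps)

text \<open>Conditions (4) to (7), with j = p - \<ell> in place of \<ell>. Condition (3) is kept
  apart: it says that some \<theta> as in (7) exists.\<close>

definition residue_conditions :: bool where
  "residue_conditions \<longleftrightarrow> res g ^ p = - (res \<phi>1 ^ (p + 1))
    \<and> (\<forall>j\<in>{1..<p - 2}. res (h j) = res \<phi>0 * (res (k j) / res \<phi>1) ^ p)
    \<and> res (h (p - 2)) = res \<phi>0 * (res (k (p - 2)) / res \<phi>1) ^ p
        + 1 / 2 * res \<phi>1 * (res \<phi>1 - pth_root p (res \<phi>0))
    \<and> (\<forall>\<theta>\<in>R. res \<theta> ^ (p * (p - 1)) = - res \<phi>1 / res \<phi>0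
        \<longrightarrow> (\<exists>x. residue_form x = res (lift_quotient \<theta>) + res (k (p - 1)) * res \<theta>))"

theorem root_imp_residue_conditions:
  assumes th: "\<theta> \<in> R" "res \<theta> \<noteq> 0" and r: "r \<in> A" and root: "Sigma_p (\<theta> + \<pi> * r) \<in> I (p^2 + 1)"
  shows "res \<theta> ^ (p * (p - 1)) = - res \<phi>1 / res \<phi>0" "residue_conditions"
    and "res (\<theta> + \<gamma> * (r - \<theta> ^ 2)) = 0"
proof -
  note nec = necessity[OF th(1) r th(2) root]
  have thA: "\<theta> \<in> A" by (rule R_A[OF th(1)])
  show exp: "res \<theta> ^ (p * (p - 1)) = - res \<phi>1 / res \<phi>0"
    using nec(1) residue_relation_iff[OF th(2)] residue_relation[OF thA] by simp
  show "res (\<theta> + \<gamma> * (r - \<theta> ^ 2)) = 0" by (rule nec(2))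
  have g: "res g ^ p = - (res \<phi>1 ^ (p + 1))" using nec(3) gamma_power_iff(1) by blast
  then have \<Gamma>: "res \<gamma> ^ p = - res \<phi>1" using gamma_power_iff(2) by blast
  have "res (h j) = res \<phi>0 * (res (k j) / res \<phi>1) ^ p" if "j \<in> {1..<p - 2}" for j
    using nec(4)[OF that] Delta_iff[of j] that by auto
  moreover have "\<exists>x. residue_form x = res (lift_quotient \<theta>') + res (k (p - 1)) * res \<theta>'"
    if "\<theta>' \<in> R" "res \<theta>' ^ (p * (p - 1)) = - res \<phi>1 / res \<phi>0" for \<theta>'
    using final_congruence_iff[OF th r nec(1,2) \<Gamma> nec(5)] nec(6) residue_form_root_scale[OF th exp that] by blast
  ultimately show "residue_conditions"
    unfolding residue_conditions_def using g Delta_last_iff[OF th nec(1) \<Gamma>] nec(5) by blast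
qed

theorem residue_conditions_imp_root:
  assumes c: "residue_conditions" and th: "\<theta> \<in> R" "res \<theta> ^ (p * (p - 1)) = - res \<phi>1 / res \<phi>0"
  shows "\<exists>r\<in>A. res (\<theta> + \<gamma> * (r - \<theta> ^ 2)) = 0 \<and> Sigma_p (\<theta> + \<pi> * r) \<in> I (p^2 + 1)"
proof -
  have thA: "\<theta> \<in> A" by (rule R_A[OF th(1)])
  have thnz: "res \<theta> \<noteq> 0" using th(2) coeff_unit p_ge_3 by (auto simp: zero_power)
  have g: "res g ^ p = - (res \<phi>1 ^ (p + 1))" using c unfolding residue_conditions_def by blast
  then have \<Gamma>: "res \<gamma> ^ p = - res \<phi>1" using gamma_power_iff(2) by blast
  have \<Gamma>nz: "res \<gamma> \<noteq> 0" using \<Gamma> coeff_unit(2) by auto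
  have 1: "res (\<phi>0 * \<theta> ^ p^2 + \<phi>1 * \<theta> ^ p) = 0"
    using th(2) residue_relation_iff[OF thnz] residue_relation[OF thA] by simp
  \<comment> \<open>The exact solution of the relation that puts \<rho> into
    \<open>I 2\<close>.\<close>
  define r0 where "r0 = \<theta> ^ 2 - \<theta> / \<gamma>"
  have r0: "r0 \<in> A" unfolding r0_def using thA gamma_A \<Gamma>nz by (intro A_closed A_divide)
  have "\<gamma> \<noteq> 0" using \<Gamma>nz res_0 by auto
  then have z: "\<theta> + \<gamma> * (r0 - \<theta> ^ 2) = 0" by (simp add: r0_def)
  then have 2: "res (\<theta> + \<gamma> * (r0 - \<theta> ^ 2)) = 0" by (simp add: res_0)
  have 4: "res (Delta j) = 0" if "j \<in> {1..<p - 2}" for j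
    using c that Delta_iff[of j] unfolding residue_conditions_def by auto
  have 5: "res (kappa0 \<theta> - 2 * (Delta (p - 2) * \<theta> ^ p)) = 0"
    using c Delta_last_iff[OF th(1) thnz 1 \<Gamma>] unfolding residue_conditions_def by blast
  obtain \<xi> where \<xi>: "\<xi> \<in> A" "cg 1 (\<xi> ^ p + \<phi>1 / \<phi>0 * \<xi> + D_const \<theta> r0) 0"
    using final_congruence_iff[OF th(1) thnz r0 1 2 \<Gamma> 5] c th unfolding residue_conditions_def by blast
  obtain r where r: "r \<in> A" "res r = res r0" "Sigma_p (\<theta> + \<pi> * r) \<in> I (p^2 + 1)"
    using sufficiency[OF th(1) r0 2 1 _ 4 5 \<xi>] gamma_power_iff(1) g by blast
  have "res (\<theta> + \<gamma> * (r - \<theta> ^ 2)) = res (\<theta> + \<gamma> * (r0 - \<theta> ^ 2))"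
    using r r0 thA gamma_A by (simp only: res_simps A_closed)
  then show ?thesis using r 2 by auto
qed

end

section \<open>Cyclic simple extensions\<close>

definition ev :: "'a :: field poly \<Rightarrow> 'a alg_closure \<Rightarrow> 'a alg_closure" where
  "ev g x = poly (map_poly to_ac g) x"

lemma map_poly_to_ac_add: "map_poly to_ac (g + h) = map_poly to_ac g + map_poly to_ac h"
  by (simp add: poly_eq_iff coeff_map_poly)

lemma map_poly_to_ac_mult: "map_poly to_ac (g * h) = map_poly to_ac g * map_poly to_ac h"
  by (simp add: poly_eq_iff coeff_map_poly coeff_mult to_ac_sum)

lemma map_poly_to_ac_pderiv: "map_poly to_ac (pderiv g) = pderiv (map_poly to_ac g)"
  by (simp add: poly_eq_iff coeff_map_poly coeff_pderiv)

lemma degree_map_poly_to_ac [simp]: "Polynomial.degree (map_poly to_ac g) = Polynomial.degree g"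
  by (rule degree_map_poly) simp

lemma map_poly_to_ac_eq_0_iff: "map_poly to_ac g = 0 \<longleftrightarrow> g = 0"
  by (simp add: poly_eq_iff coeff_map_poly)

lemma ev_0 [simp]: "ev 0 x = 0" by (simp add: ev_def)
lemma ev_pCons [simp]: "ev (Polynomial.pCons a g) x = to_ac a + x * ev g x"
  by (simp add: ev_def map_poly_pCons)
lemma ev_1 [simp]: "ev 1 x = 1" by (simp add: one_pCons)
lemma ev_add: "ev (g + h) x = ev g x + ev h x" by (simp add: ev_def map_poly_to_ac_add)
lemma ev_mult: "ev (g * h) x = ev g x * ev h x" by (simp add: ev_def map_poly_to_ac_mult)
lemma ev_uminus: "ev (- g) x = - ev g x"
  using ev_add[of g "- g" x] by (simp add: eq_neg_iff_add_eq_0 add.commute)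
lemma ev_diff: "ev (g - h) x = ev g x - ev h x" using ev_add[of g "- h" x] by (simp add: ev_uminus)
lemma ev_pcompose: "ev (pcompose g h) x = ev g (ev h x)"
  by (induction g) (simp_all add: pcompose_pCons ev_add ev_mult)
lemma ev_sum: "ev (sum g S) x = (\<Sum>i\<in>S. ev (g i) x)"
  by (induction S rule: infinite_finite_induct) (simp_all add: ev_add)
lemma ev_altdef: "ev g x = (\<Sum>i\<le>Polynomial.degree g. to_ac (Polynomial.coeff g i) * x ^ i)"
  by (simp add: ev_def poly_altdef coeff_map_poly)
lemma ev_monom: "ev (Polynomial.monom c i) x = to_ac c * x ^ i"
  by (induction i) (simp_all add: monom_0 monom_Suc mult_ac)

text \<open>A nonzero combination of least degree divides both f and g by division with remainder;
  since f is irreducible and does not divide g, it is a unit.\<close>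

lemma irreducible_bezout:
  fixes f g :: "'a :: field poly"
  assumes irr: "Factorial_Ring.irreducible f" and ndvd: "\<not> f dvd g"
  shows "\<exists>u w. u * f + w * g = 1"
proof -
  define S where "S = {h. h \<noteq> 0 \<and> (\<exists>u w. h = u * f + w * g)}"
  have "f = 1 * f + 0 * g" "f \<noteq> 0" using irr by auto
  then have "f \<in> S" unfolding S_def by blast
  then obtain d where d: "d \<in> S" and min: "\<And>h. h \<in> S \<Longrightarrow> Polynomial.degree d \<le> Polynomial.degree h"
    using ex_has_least_nat[of "\<lambda>h. h \<in> S" f Polynomial.degree] by blast
  obtain u w where uw: "d = u * f + w * g" "d \<noteq> 0" using d unfolding S_def by blast
  have dvd: "d dvd h" if h: "h = u' * f + w' * g" for h u' w'
  proof (rule ccontr)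
    assume "\<not> d dvd h"
    then have nz: "h mod d \<noteq> 0" by (simp add: dvd_eq_mod_eq_0)
    have "h mod d = h - h div d * d" by (simp add: minus_div_mult_eq_mod)
    also have "\<dots> = (u' - h div d * u) * f + (w' - h div d * w) * g"
      unfolding h uw(1) by (simp add: algebra_simps)
    finally have "h mod d \<in> S" using nz unfolding S_def by blast
    then show False using min degree_mod_less'[OF uw(2) nz] by fastforce
  qed
  have df: "d dvd f" using dvd[of f 1 0] by simp
  have dg: "d dvd g" using dvd[of g 0 1] by simp
  obtain q where q: "f = d * q" using df by blast
  have "is_unit d"
  proof (rule ccontr)
    assume "\<not> is_unit d"
    then have "is_unit q" using irr q by (auto dest: irreducibleD)
    then have "f dvd d" unfolding q by (simp add: mult_unit_dvd_iff)
    then show False using dg ndvd dvd_trans by blast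
  qed
  then obtain c where "1 = d * c" by blast
  then have "c * u * f + c * w * g = 1" unfolding uw(1) by (simp add: algebra_simps)
  then show ?thesis by blast
qed

lemma irreducible_dvd_iff_ev:
  assumes irr: "Factorial_Ring.irreducible f" and root: "ev f x = 0"
  shows "ev g x = 0 \<longleftrightarrow> f dvd g"
proof
  assume g: "ev g x = 0"
  show "f dvd g"
  proof (rule ccontr)
    assume "\<not> f dvd g"
    then obtain u w where "u * f + w * g = 1" using irreducible_bezout[OF irr] by blast
    then have "ev (u * f + w * g) x = 1" by simp
    then show False by (simp add: ev_add ev_mult g root)
  qed
qed (auto simp: ev_mult root)

text \<open>A multiple root would make g divide its derivative, which is nonzero of smaller degree
  in characteristic 0.\<close>

lemma irreducible_imp_rsquarefree:
  fixes g :: "'a :: field_char_0 poly"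
  assumes irr: "Factorial_Ring.irreducible g"
  shows "rsquarefree (map_poly to_ac g)"
  unfolding rsquarefree_roots
proof (intro allI notI)
  fix x assume "poly (map_poly to_ac g) x = 0 \<and> poly (pderiv (map_poly to_ac g)) x = 0"
  then have x: "ev g x = 0" "ev (pderiv g) x = 0" by (simp_all add: ev_def map_poly_to_ac_pderiv)
  have deg: "Polynomial.degree g > 0"
    using irr by (metis irreducible_def gr0I is_unit_iff_degree)
  have "g dvd pderiv g" using irreducible_dvd_iff_ev[OF irr x(1)] x(2) by blast
  moreover have "pderiv g \<noteq> 0" using deg by (simp add: pderiv_eq_0_iff)
  ultimately have "Polynomial.degree g \<le> Polynomial.degree (pderiv g)" by (rule dvd_imp_degree_le)
  then show False using deg by (simp add: degree_pderiv)
qed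

section \<open>Subfields of a field type\<close>

lemma ring_of_type_algebra_sel [simp]:
  "carrier ring_of_type_algebra = UNIV" "monoid.mult ring_of_type_algebra = (*)"
  "one ring_of_type_algebra = 1" "ring.zero ring_of_type_algebra = 0" "ring.add ring_of_type_algebra = (+)"
  by (simp_all add: ring_of_type_algebra_def)

lemma m_inv_ring_of_type_algebra:
  "x \<noteq> 0 \<Longrightarrow> m_inv (ring_of_type_algebra :: 'c :: field ring) x = inverse x"
proof -
  assume x: "x \<noteq> 0"
  interpret field "ring_of_type_algebra :: 'c ring" by (rule field_from_type_algebra)
  show ?thesis by (rule inv_char) (use x in auto)
qed

lemma a_inv_ring_of_type_algebra: "a_inv (ring_of_type_algebra :: 'c :: field ring) x = - x"
proof -
  interpret field "ring_of_type_algebra :: 'c ring" by (rule field_from_type_algebra)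
  have "x \<oplus>\<^bsub>ring_of_type_algebra\<^esub> (- x) = \<zero>\<^bsub>ring_of_type_algebra\<^esub>" by simp
  then show ?thesis using minus_equality[of "- x" x] by simp
qed

lemma subfieldI_type:
  fixes L :: "'c :: field set"
  assumes "1 \<in> L" "\<And>x. x \<in> L \<Longrightarrow> - x \<in> L" "\<And>x y. \<lbrakk>x \<in> L; y \<in> L\<rbrakk> \<Longrightarrow> x + y \<in> L"
    "\<And>x y. \<lbrakk>x \<in> L; y \<in> L\<rbrakk> \<Longrightarrow> x * y \<in> L" "\<And>x. \<lbrakk>x \<in> L; x \<noteq> 0\<rbrakk> \<Longrightarrow> inverse x \<in> L"
  shows "subfield L ring_of_type_algebra"
proof -
  interpret field "ring_of_type_algebra :: 'c ring" by (rule field_from_type_algebra)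
  show ?thesis
    by (rule subfieldI') (use assms in \<open>auto intro!: subringI simp: a_inv_ring_of_type_algebra m_inv_ring_of_type_algebra\<close>)
qed

lemma subfield_type_closed:
  fixes L :: "'c :: field set"
  assumes "subfield L ring_of_type_algebra"
  shows "1 \<in> L" "x \<in> L \<Longrightarrow> - x \<in> L" "\<lbrakk>x \<in> L; y \<in> L\<rbrakk> \<Longrightarrow> x + y \<in> L"
    "\<lbrakk>x \<in> L; y \<in> L\<rbrakk> \<Longrightarrow> x * y \<in> L" "x \<in> L \<Longrightarrow> inverse x \<in> L"
proof -
  interpret field "ring_of_type_algebra :: 'c ring" by (rule field_from_type_algebra)
  note L = subringE[OF subfieldE(1)[OF assms]]
  show 1: "1 \<in> L" using L(3) by simp
  show u: "x \<in> L \<Longrightarrow> - x \<in> L" for x using L(5)[of x] by (simp add: a_inv_ring_of_type_algebra)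
  show a: "\<lbrakk>x \<in> L; y \<in> L\<rbrakk> \<Longrightarrow> x + y \<in> L" for x y using L(7)[of x y] by simp
  show "\<lbrakk>x \<in> L; y \<in> L\<rbrakk> \<Longrightarrow> x * y \<in> L" using L(6)[of x y] by simp
  show "x \<in> L \<Longrightarrow> inverse x \<in> L"
    using subfield_m_inv(1)[OF assms, of x] a[OF 1 u[OF 1]]
    by (cases "x = 0") (auto simp: m_inv_ring_of_type_algebra)
qed

lemma funpow_split: "i \<le> j \<Longrightarrow> (f ^^ j) x = (f ^^ i) ((f ^^ (j - i)) x)"
  using funpow_add[of i "j - i" f] by simp

text \<open>The polynomial splits into linear factors, and a repeated factor would be a common root
  with the derivative.\<close>

lemma rsquarefree_card_roots:
  fixes P :: "'c :: {alg_closed_field, field_char_0} poly"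
  assumes sf: "rsquarefree P" shows "card {x. poly P x = 0} = Polynomial.degree P"
proof -
  have nz: "P \<noteq> 0" using sf by (auto simp: rsquarefree_def)
  obtain A where A: "size A = Polynomial.degree P" "P = Polynomial.smult (Polynomial.lead_coeff P) (\<Prod>x\<in>#A. [:- x, 1:])"
    using alg_closed_imp_factorization[OF nz] by blast
  have cnt: "count A x = 1" if "x \<in># A" for x
  proof (rule ccontr)
    assume "count A x \<noteq> 1"
    then have "x \<in># A - {#x#}" using that by (metis One_nat_def Suc_diff_1 count_diff count_greater_zero_iff count_single diff_is_0_eq' in_diff_count less_one nat_less_le not_gr_zero not_le)
    then obtain B where "A - {#x#} = add_mset x B" by (blast dest: multi_member_split)
    then have "A = add_mset x (add_mset x B)" using that by (metis insert_DiffM)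
    then have P: "P = Polynomial.smult (Polynomial.lead_coeff P) (\<Prod>x\<in>#B. [:- x, 1:]) * [:- x, 1:] * [:- x, 1:]"
      using A(2) by (simp add: mult_ac)
    define C where "C = Polynomial.smult (Polynomial.lead_coeff P) (\<Prod>x\<in>#B. [:- x, 1:])"
    have P: "P = C * [:- x, 1:] * [:- x, 1:]" unfolding C_def by (rule P)
    have "pderiv P = C * [:- x, 1:] * pderiv [:- x, 1:] + [:- x, 1:] * pderiv (C * [:- x, 1:])"
      unfolding P by (rule pderiv_mult)
    then have "poly (pderiv P) x = 0" by (simp only: poly_add poly_mult) simp
    moreover have "poly P x = 0" by (subst P) simp
    ultimately show False using sf unfolding rsquarefree_roots by blast
  qed
  have "poly P x = Polynomial.lead_coeff P * (\<Prod>y\<in>#A. x - y)" for x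
    by (subst A(2)) (simp add: poly_prod_mset image_mset.compositionality o_def)
  then have "{x. poly P x = 0} = set_mset A" using nz by auto
  moreover have "size A = card (set_mset A)" unfolding size_multiset_overloaded_eq using cnt by simp
  ultimately show ?thesis using A(1) by simp
qed

section \<open>Simple extensions and their embeddings\<close>

locale simple_extension =
  fixes f :: "'a :: field_char_0 poly" and \<alpha> :: "'a alg_closure" and n :: nat
  assumes irr: "Factorial_Ring.irreducible f" and monic: "Polynomial.lead_coeff f = 1"
    and deg: "Polynomial.degree f = n" and root: "ev f \<alpha> = 0"
begin

definition "L = range (\<lambda>g. ev g \<alpha>)"

lemma ev_in_L: "ev g \<alpha> \<in> L" unfolding L_def by blast

lemma L_E: assumes "x \<in> L" obtains g where "x = ev g \<alpha>" using assms unfolding L_def by blast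

lemma n_pos: "n > 0" using irr deg by (metis irreducible_def gr0I is_unit_iff_degree)

lemma to_ac_L: "to_ac c \<in> L" using ev_in_L[of "[:c:]"] by simp
lemma alpha_L: "\<alpha> \<in> L" using ev_in_L[of "[:0, 1:]"] by simp
lemma L_add: "\<lbrakk>x \<in> L; y \<in> L\<rbrakk> \<Longrightarrow> x + y \<in> L" by (auto elim!: L_E intro: ev_in_L simp flip: ev_add)
lemma L_mult: "\<lbrakk>x \<in> L; y \<in> L\<rbrakk> \<Longrightarrow> x * y \<in> L" by (auto elim!: L_E intro: ev_in_L simp flip: ev_mult)
lemma L_uminus: "x \<in> L \<Longrightarrow> - x \<in> L" by (auto elim!: L_E intro: ev_in_L simp flip: ev_uminus)
lemma L_1: "1 \<in> L" using to_ac_L[of 1] by simp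
lemma L_0: "0 \<in> L" using to_ac_L[of 0] by simp

lemma L_inverse:
  assumes x: "x \<in> L" "x \<noteq> 0" shows "inverse x \<in> L"
proof -
  obtain g where g: "x = ev g \<alpha>" using x by (elim L_E)
  have "\<not> f dvd g" using irreducible_dvd_iff_ev[OF irr root] x(2) unfolding g by blast
  then obtain u w where "u * f + w * g = 1" using irreducible_bezout[OF irr] by blast
  then have "ev (u * f + w * g) \<alpha> = 1" by simp
  then have "ev w \<alpha> * x = 1" by (simp add: ev_add ev_mult root g)
  then have "inverse x = ev w \<alpha>" by (metis inverse_unique mult.commute)
  then show ?thesis using ev_in_L by simp
qed

lemma L_eq: "adjoin_root \<alpha> = L"
proof
  have sub: "subfield L ring_of_type_algebra"
    by (intro subfieldI_type L_1 L_uminus L_add L_mult L_inverse)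
  interpret field "ring_of_type_algebra :: 'a alg_closure ring" by (rule field_from_type_algebra)
  show "adjoin_root \<alpha> \<subseteq> L"
    unfolding adjoin_root_def by (rule generate_field_min_subfield1[OF _ sub]) (use to_ac_L alpha_L in auto)
  have "subfield (adjoin_root \<alpha>) ring_of_type_algebra"
    unfolding adjoin_root_def by (rule generate_field_is_subfield) simp
  note cl = subfield_type_closed[OF this]
  have in1: "to_ac c \<in> adjoin_root \<alpha>" "\<alpha> \<in> adjoin_root \<alpha>" for c
    unfolding adjoin_root_def by (auto intro!: generate_field.incl)
  have "ev g \<alpha> \<in> adjoin_root \<alpha>" for g
  proof (induction g)
    case 0 show ?case using in1(1)[of 0] by simp
  next
    case (pCons c g) then show ?case using cl in1 by simp
  qed
  then show "L \<subseteq> adjoin_root \<alpha>" unfolding L_def by blast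
qed

lemma L_subfield: "subfield L ring_of_type_algebra"
  by (intro subfieldI_type L_1 L_uminus L_add L_mult L_inverse)

lemma L_rep:
  assumes "x \<in> L" obtains g where "x = ev g \<alpha>" "Polynomial.degree g < n"
proof -
  obtain g where g: "x = ev g \<alpha>" using assms by (elim L_E)
  have f0: "f \<noteq> 0" using irr by auto
  have "ev g \<alpha> = ev (g div f * f + g mod f) \<alpha>" by simp
  also have "\<dots> = ev (g mod f) \<alpha>" by (simp only: ev_add ev_mult root) simp
  finally have "x = ev (g mod f) \<alpha>" unfolding g .
  moreover have "Polynomial.degree (g mod f) < n"
    using degree_mod_less[OF f0, of g] n_pos deg by auto
  ultimately show ?thesis by (rule that)
qed

lemma ev_eq_0_small: "\<lbrakk>ev g \<alpha> = 0; Polynomial.degree g < n\<rbrakk> \<Longrightarrow> g = 0"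
  using irreducible_dvd_iff_ev[OF irr root, of g] dvd_imp_degree_le[of f g] deg by auto

text \<open>The sets \<open>E k\<close> are the spans of the first k powers of \<alpha>. Each step
  is a line extension because \<alpha>^k in \<open>E k\<close> would give a nonzero polynomial of
  degree below n vanishing at \<alpha>.\<close>

lemma dimension_L: "ring.dimension ring_of_type_algebra n (range to_ac) L"
proof -
  interpret field "ring_of_type_algebra :: 'a alg_closure ring" by (rule field_from_type_algebra)
  define E where "E k = {ev g \<alpha> | g. \<forall>i\<ge>k. Polynomial.coeff g i = 0}" for k
  have "dimension k (range to_ac) (E k)" if "k \<le> n" for k
    using that
  proof (induction k)
    case 0
    have "(\<forall>i\<ge>0. Polynomial.coeff g i = 0) \<longleftrightarrow> g = 0" for g :: "'a poly" by (simp add: poly_eq_iff)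
    then have "E 0 = {0}" unfolding E_def by simp
    then show ?case using dimension.zero_dim by simp
  next
    case (Suc k)
    have "\<alpha> ^ k \<notin> E k"
    proof
      assume "\<alpha> ^ k \<in> E k"
      then obtain g where g: "\<alpha> ^ k = ev g \<alpha>" "\<forall>i\<ge>k. Polynomial.coeff g i = 0" unfolding E_def by blast
      define h where "h = Polynomial.monom 1 k - g"
      have "ev h \<alpha> = 0" using g(1) by (simp add: h_def ev_diff ev_monom)
      moreover have "Polynomial.degree h \<le> k"
        unfolding h_def using g(2) by (intro degree_le) (auto simp: coeff_monom)
      ultimately have "h = 0" using Suc.prems by (intro ev_eq_0_small) auto
      then have "Polynomial.coeff h k = 0" by simp
      then show False using g(2) by (simp add: h_def coeff_monom)
    qed
    moreover have "line_extension (range to_ac) (\<alpha> ^ k) (E k) = E (Suc k)"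
    proof (intro equalityI subsetI)
      fix x assume "x \<in> line_extension (range to_ac) (\<alpha> ^ k) (E k)"
      then obtain c g where g: "x = to_ac c * \<alpha> ^ k + ev g \<alpha>" "\<forall>i\<ge>k. Polynomial.coeff g i = 0"
        unfolding line_extension_mem_iff E_def by auto
      then have "x = ev (Polynomial.monom c k + g) \<alpha>" by (simp add: ev_add ev_monom)
      then show "x \<in> E (Suc k)" unfolding E_def using g(2) by (auto simp: coeff_monom)
    next
      fix x assume "x \<in> E (Suc k)"
      then obtain g where g: "x = ev g \<alpha>" "\<forall>i\<ge>Suc k. Polynomial.coeff g i = 0" unfolding E_def by blast
      define h where "h = g - Polynomial.monom (Polynomial.coeff g k) k"
      have h: "\<forall>i\<ge>k. Polynomial.coeff h i = 0"
      proof (intro allI impI)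
        fix i assume "k \<le> i"
        then show "Polynomial.coeff h i = 0" using g(2) by (cases "i = k") (auto simp: h_def coeff_monom)
      qed
      have "x = to_ac (Polynomial.coeff g k) * \<alpha> ^ k + ev h \<alpha>"
        unfolding g(1) h_def by (simp add: ev_diff ev_monom)
      then show "x \<in> line_extension (range to_ac) (\<alpha> ^ k) (E k)"
        unfolding line_extension_mem_iff E_def using h by auto
    qed
    ultimately show ?case
      using dimension.Suc_dim[of "\<alpha> ^ k" "E k" k "range to_ac"] Suc by simp
  qed
  from this[of n] have "dimension n (range to_ac) (E n)" by simp
  moreover have "E n = L"
  proof (intro equalityI subsetI)
    fix x assume "x \<in> L"
    then obtain g where "x = ev g \<alpha>" "Polynomial.degree g < n" by (rule L_rep)
    then show "x \<in> E n" unfolding E_def by (auto intro!: coeff_eq_0 exI[of _ g])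
  qed (auto simp: E_def intro: ev_in_L)
  ultimately show ?thesis by simp
qed

lemma card_roots_le: "finite {x. ev f x = 0}" "card {x. ev f x = 0} \<le> n"
proof -
  have nz: "map_poly to_ac f \<noteq> 0" using irr by (auto simp: map_poly_to_ac_eq_0_iff)
  show "finite {x. ev f x = 0}" unfolding ev_def by (rule poly_roots_finite[OF nz])
  show "card {x. ev f x = 0} \<le> n"
    unfolding ev_def using card_poly_roots_bound[OF nz] deg by simp
qed

text \<open>Two representing polynomials differ by a multiple of f, so the choice does not affect
  the value when \<beta> is a root of f.\<close>

definition emb :: "'a alg_closure \<Rightarrow> 'a alg_closure \<Rightarrow> 'a alg_closure" where
  "emb \<beta> x = ev (SOME g. x = ev g \<alpha>) \<beta>"

lemma emb_ev:
  assumes "ev f \<beta> = 0" shows "emb \<beta> (ev g \<alpha>) = ev g \<beta>"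
proof -
  define h where "h = (SOME h. ev g \<alpha> = ev h \<alpha>)"
  have "ev g \<alpha> = ev h \<alpha>" unfolding h_def by (rule someI) simp
  then have "ev (g - h) \<alpha> = 0" by (simp add: ev_diff)
  then have "ev (g - h) \<beta> = 0"
    using irreducible_dvd_iff_ev[OF irr root] irreducible_dvd_iff_ev[OF irr assms] by blast
  then show ?thesis unfolding emb_def h_def[symmetric] by (simp add: ev_diff)
qed

text \<open>Values outside \<open>L\<close> are left free; bijectivity on \<open>L\<close> is a
  consequence.\<close>

definition K_hom :: "('a alg_closure \<Rightarrow> 'a alg_closure) \<Rightarrow> bool" where
  "K_hom \<sigma> \<longleftrightarrow> (\<forall>x\<in>L. \<sigma> x \<in> L) \<and> (\<forall>x\<in>L. \<forall>y\<in>L. \<sigma> (x + y) = \<sigma> x + \<sigma> y \<and> \<sigma> (x * y) = \<sigma> x * \<sigma> y)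
    \<and> (\<forall>c. \<sigma> (to_ac c) = to_ac c)"

lemma K_homD:
  assumes "K_hom \<sigma>"
  shows "x \<in> L \<Longrightarrow> \<sigma> x \<in> L" "\<lbrakk>x \<in> L; y \<in> L\<rbrakk> \<Longrightarrow> \<sigma> (x + y) = \<sigma> x + \<sigma> y"
    "\<lbrakk>x \<in> L; y \<in> L\<rbrakk> \<Longrightarrow> \<sigma> (x * y) = \<sigma> x * \<sigma> y" "\<sigma> (to_ac c) = to_ac c"
  using assms unfolding K_hom_def by blast+

lemma emb_K_hom:
  assumes "ev f \<beta> = 0" "\<beta> \<in> L" shows "K_hom (emb \<beta>)"
proof -
  note e = emb_ev[OF assms(1)]
  obtain b where b: "\<beta> = ev b \<alpha>" using assms(2) by (elim L_E)
  have "ev g \<beta> \<in> L" for g unfolding b by (simp add: ev_in_L flip: ev_pcompose)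
  then show ?thesis
    using e[of "[:_:]"] unfolding K_hom_def by (auto elim!: L_E simp: e simp flip: ev_add ev_mult)
qed

lemma ev_L: "x \<in> L \<Longrightarrow> ev g x \<in> L" by (auto elim!: L_E intro: ev_in_L simp flip: ev_pcompose)

lemma K_hom_ev:
  assumes "K_hom \<sigma>" "x \<in> L" shows "\<sigma> (ev g x) = ev g (\<sigma> x)"
proof (induction g)
  case 0 show ?case using K_homD(4)[OF assms(1), of 0] by simp
next
  case (pCons c g)
  then show ?case using K_homD[OF assms(1)] assms(2) by (simp add: to_ac_L L_mult ev_L)
qed

lemma K_hom_eqI:
  assumes "K_hom \<sigma>" "K_hom \<tau>" "\<sigma> \<alpha> = \<tau> \<alpha>" "x \<in> L" shows "\<sigma> x = \<tau> x"
  using assms K_hom_ev[OF assms(1) alpha_L] K_hom_ev[OF assms(2) alpha_L] by (auto elim!: L_E)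

lemma K_hom_root: "\<lbrakk>K_hom \<sigma>; x \<in> L; ev f x = 0\<rbrakk> \<Longrightarrow> ev f (\<sigma> x) = 0"
  using K_hom_ev[of \<sigma> x f] K_homD(4)[of \<sigma> 0] by simp

lemma K_hom_inj: "K_hom \<sigma> \<Longrightarrow> inj_on \<sigma> L"
proof (rule inj_onI)
  fix x y assume \<sigma>: "K_hom \<sigma>" and xy: "x \<in> L" "y \<in> L" "\<sigma> x = \<sigma> y"
  have d: "x - y \<in> L" using L_add[OF xy(1) L_uminus[OF xy(2)]] by simp
  have "\<sigma> (x - y + y) = \<sigma> (x - y) + \<sigma> y" by (rule K_homD(2)[OF \<sigma> d xy(2)])
  then have z: "\<sigma> (x - y) = 0" using xy(3) by simp
  show "x = y"
  proof (rule ccontr)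
    assume "x \<noteq> y"
    then have "(x - y) * inverse (x - y) = 1" "inverse (x - y) \<in> L" using L_inverse[OF d] by auto
    then have "\<sigma> 1 = \<sigma> (x - y) * \<sigma> (inverse (x - y))" using K_homD(3)[OF \<sigma> d] by metis
    then show False using z K_homD(4)[OF \<sigma>, of 1] by simp
  qed
qed

lemma K_hom_funpow: "K_hom \<sigma> \<Longrightarrow> K_hom (\<sigma> ^^ k)"
  by (induction k) (auto simp: K_hom_def)

text \<open>Being injective, \<sigma> permutes the finitely many roots of f in \<open>L\<close>; so
  it attains \<alpha>, which generates \<open>L\<close>.\<close>

lemma K_hom_surj:
  assumes "K_hom \<sigma>" shows "\<sigma> ` L = L"
proof
  show "\<sigma> ` L \<subseteq> L" using K_homD(1)[OF assms] by blast
  define S where "S = {x \<in> L. ev f x = 0}"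
  have fin: "finite S" using card_roots_le(1) by (rule finite_subset[rotated]) (auto simp: S_def)
  have "\<sigma> ` S = S"
  proof (rule card_subset_eq[OF fin])
    show "\<sigma> ` S \<subseteq> S" using K_hom_root[OF assms] K_homD(1)[OF assms] by (auto simp: S_def)
    show "card (\<sigma> ` S) = card S"
      by (rule card_image, rule inj_on_subset[OF K_hom_inj[OF assms]]) (auto simp: S_def)
  qed
  moreover have "\<alpha> \<in> S" using alpha_L root by (simp add: S_def)
  ultimately have "\<alpha> \<in> \<sigma> ` S" by simp
  then obtain \<gamma> where \<gamma>: "\<gamma> \<in> L" "\<sigma> \<gamma> = \<alpha>" unfolding S_def by auto
  have "ev g \<alpha> = \<sigma> (ev g \<gamma>)" for g using K_hom_ev[OF assms \<gamma>(1)] \<gamma>(2) by simp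
  then show "L \<subseteq> \<sigma> ` L" using ev_L[OF \<gamma>(1)] by (auto elim!: L_E)
qed

section \<open>Conjugates under a homomorphism with n distinct images of \<alpha>\<close>

context
  fixes \<sigma> :: "'a alg_closure \<Rightarrow> 'a alg_closure"
  assumes \<sigma>: "K_hom \<sigma>" and distinct: "\<And>m. \<lbrakk>0 < m; m < n\<rbrakk> \<Longrightarrow> (\<sigma> ^^ m) \<alpha> \<noteq> \<alpha>"
begin

lemma conjugates_inj: "inj_on (\<lambda>k. (\<sigma> ^^ k) \<alpha>) {..<n}"
proof -
  have less: "(\<sigma> ^^ i) \<alpha> \<noteq> (\<sigma> ^^ j) \<alpha>" if "i < j" "j < n" for i j
  proof
    assume eq: "(\<sigma> ^^ i) \<alpha> = (\<sigma> ^^ j) \<alpha>"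
    have "(\<sigma> ^^ i) ((\<sigma> ^^ (j - i)) \<alpha>) = (\<sigma> ^^ i) \<alpha>"
      unfolding eq by (rule funpow_split[symmetric]) (use that in simp)
    then have "(\<sigma> ^^ (j - i)) \<alpha> = \<alpha>"
      by (rule inj_onD[OF K_hom_inj[OF K_hom_funpow[OF \<sigma>]]])
        (intro alpha_L K_homD(1)[OF K_hom_funpow[OF \<sigma>]])+
    then show False using distinct[of "j - i"] that by simp
  qed
  show ?thesis
  proof (rule inj_onI)
    fix i j assume "i \<in> {..<n}" "j \<in> {..<n}" "(\<sigma> ^^ i) \<alpha> = (\<sigma> ^^ j) \<alpha>"
    then show "i = j" using less[of i j] less[of j i] by (cases i j rule: linorder_cases) auto
  qed
qed

lemma conjugate_L: "(\<sigma> ^^ k) \<alpha> \<in> L" by (rule K_homD(1)[OF K_hom_funpow[OF \<sigma>] alpha_L])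

lemma conjugate_root: "ev f ((\<sigma> ^^ k) \<alpha>) = 0" by (rule K_hom_root[OF K_hom_funpow[OF \<sigma>] alpha_L root])

lemma roots_eq: "{x. ev f x = 0} = (\<lambda>k. (\<sigma> ^^ k) \<alpha>) ` {..<n}"
proof (rule card_seteq[symmetric])
  show "card {x. ev f x = 0} \<le> card ((\<lambda>k. (\<sigma> ^^ k) \<alpha>) ` {..<n})"
    using card_roots_le(2) by (simp add: card_image conjugates_inj)
qed (use card_roots_le(1) conjugate_root in auto)

lemma funpow_n_alpha: "(\<sigma> ^^ n) \<alpha> = \<alpha>"
proof -
  obtain k where k: "k < n" "(\<sigma> ^^ n) \<alpha> = (\<sigma> ^^ k) \<alpha>" using roots_eq conjugate_root[of n] by auto
  have "(\<sigma> ^^ k) ((\<sigma> ^^ (n - k)) \<alpha>) = (\<sigma> ^^ k) \<alpha>"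
    unfolding k(2)[symmetric] by (rule funpow_split[symmetric]) (use k(1) in simp)
  then have "(\<sigma> ^^ (n - k)) \<alpha> = \<alpha>"
    by (rule inj_onD[OF K_hom_inj[OF K_hom_funpow[OF \<sigma>]]]) (intro alpha_L conjugate_L)+
  then show ?thesis using distinct[of "n - k"] k by (cases "k = 0") auto
qed

lemma funpow_n: "x \<in> L \<Longrightarrow> (\<sigma> ^^ n) x = x"
  using K_hom_eqI[OF K_hom_funpow[OF \<sigma>, of n], of id] funpow_n_alpha by (simp add: K_hom_def)

text \<open>Both sides are monic of degree n, so their difference has smaller degree, and it
  vanishes at the n distinct conjugates.\<close>

lemma poly_eq_prod: "map_poly to_ac f = (\<Prod>k<n. [:- (\<sigma> ^^ k) \<alpha>, 1:])"
proof (rule ccontr)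
  define P where "P = (\<Prod>k<n. [:- (\<sigma> ^^ k) \<alpha>, 1:])"
  define D where "D = map_poly to_ac f - P"
  assume "map_poly to_ac f \<noteq> (\<Prod>k<n. [:- (\<sigma> ^^ k) \<alpha>, 1:])"
  then have D: "D \<noteq> 0" by (simp add: D_def P_def)
  have degP: "Polynomial.degree P = n" "Polynomial.lead_coeff P = 1"
    unfolding P_def by (subst degree_prod_eq_sum_degree, auto simp: lead_coeff_prod)
  have "Polynomial.coeff D n = 0" using degP deg monic by (simp add: D_def coeff_map_poly)
  moreover have "Polynomial.degree D \<le> n" unfolding D_def using degP deg by (intro degree_diff_le) auto
  ultimately have "Polynomial.degree D < n" using D by (metis leading_coeff_0_iff le_neq_implies_less)
  moreover have "n \<le> card {x. poly D x = 0}"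
  proof -
    have "(\<lambda>k. (\<sigma> ^^ k) \<alpha>) ` {..<n} \<subseteq> {x. poly D x = 0}"
      using conjugate_root by (auto simp: D_def P_def poly_prod ev_def)
    from card_mono[OF poly_roots_finite[OF D] this] show ?thesis by (simp add: card_image conjugates_inj)
  qed
  ultimately show False using card_poly_roots_bound[OF D] by simp
qed

text \<open>Write y = g(\<alpha>) with deg g < n. As y is fixed, g - y vanishes at all n conjugates,
  hence identically, and y is the constant coefficient of g.\<close>

lemma fixed_field:
  assumes y: "y \<in> L" "\<sigma> y = y" shows "y \<in> range to_ac"
proof -
  obtain g where g: "y = ev g \<alpha>" "Polynomial.degree g < n" using y(1) by (rule L_rep)
  have fy: "(\<sigma> ^^ k) y = y" for k using y(2) by (induction k) auto
  define D where "D = map_poly to_ac g - [:y:]"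
  have r: "poly D ((\<sigma> ^^ k) \<alpha>) = 0" for k
    using fy[of k] K_hom_ev[OF K_hom_funpow[OF \<sigma>] alpha_L, of k g] by (simp add: D_def g(1) ev_def)
  have "D = 0"
  proof (rule ccontr)
    assume D: "D \<noteq> 0"
    have "(\<lambda>k. (\<sigma> ^^ k) \<alpha>) ` {..<n} \<subseteq> {x. poly D x = 0}" using r by auto
    from card_mono[OF poly_roots_finite[OF D] this] have "n \<le> card {x. poly D x = 0}"
      by (simp add: card_image conjugates_inj)
    moreover have "Polynomial.degree D \<le> Polynomial.degree g" unfolding D_def by (intro degree_diff_le) auto
    ultimately show False using card_poly_roots_bound[OF D] g(2) by simp
  qed
  then have "Polynomial.coeff D 0 = 0" by simp
  then have "y = to_ac (Polynomial.coeff g 0)" by (simp add: D_def coeff_map_poly)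
  then show ?thesis by blast
qed

lemma coeff_prod_linear_hom:
  assumes "finite S" "\<And>k. k \<in> S \<Longrightarrow> y k \<in> L"
  shows "Polynomial.coeff (\<Prod>k\<in>S. [:- y k, 1:]) j \<in> L
    \<and> \<sigma> (Polynomial.coeff (\<Prod>k\<in>S. [:- y k, 1:]) j) = Polynomial.coeff (\<Prod>k\<in>S. [:- \<sigma> (y k), 1:]) j"
  using assms
proof (induction S arbitrary: j rule: finite_induct)
  case empty
  show ?case using K_homD(4)[OF \<sigma>, of 1] K_homD(4)[OF \<sigma>, of 0] L_1 L_0 by (simp add: coeff_1)
next
  case (insert k S)
  define P where "P = (\<Prod>k\<in>S. [:- y k, 1:])"
  define P' where "P' = (\<Prod>k\<in>S. [:- \<sigma> (y k), 1:])"
  have IH: "Polynomial.coeff P j \<in> L" "\<sigma> (Polynomial.coeff P j) = Polynomial.coeff P' j" for j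
    using insert unfolding P_def P'_def by auto
  have yk: "y k \<in> L" using insert by simp
  have "\<sigma> (- y k) + \<sigma> (y k) = \<sigma> 0" using K_homD(2)[OF \<sigma> L_uminus[OF yk] yk] by simp
  then have um: "\<sigma> (- y k) = - \<sigma> (y k)" using K_homD(4)[OF \<sigma>, of 0] by (simp add: eq_neg_iff_add_eq_0)
  have c: "Polynomial.coeff ([:- y k, 1:] * P) j = (- y k) * Polynomial.coeff P j + (case j of 0 \<Rightarrow> 0 | Suc j \<Rightarrow> Polynomial.coeff P j)"
      "Polynomial.coeff ([:- \<sigma> (y k), 1:] * P') j = (- \<sigma> (y k)) * Polynomial.coeff P' j + (case j of 0 \<Rightarrow> 0 | Suc j \<Rightarrow> Polynomial.coeff P' j)"
    by (cases j; simp)+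
  have 1: "(- y k) * Polynomial.coeff P j \<in> L" by (intro L_mult L_uminus yk IH)
  have 2: "(case j of 0 \<Rightarrow> 0 | Suc j \<Rightarrow> Polynomial.coeff P j) \<in> L" using IH L_0 by (cases j) auto
  have 3: "\<sigma> (case j of 0 \<Rightarrow> 0 | Suc j \<Rightarrow> Polynomial.coeff P j) = (case j of 0 \<Rightarrow> 0 | Suc j \<Rightarrow> Polynomial.coeff P' j)"
    using IH K_homD(4)[OF \<sigma>, of 0] by (cases j) auto
  have "\<sigma> (Polynomial.coeff ([:- y k, 1:] * P) j) = Polynomial.coeff ([:- \<sigma> (y k), 1:] * P') j"
    unfolding c K_homD(2)[OF \<sigma> 1 2] 3 K_homD(3)[OF \<sigma> L_uminus[OF yk] IH(1)] IH(2) um ..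
  moreover have "Polynomial.coeff ([:- y k, 1:] * P) j \<in> L" unfolding c by (rule L_add[OF 1 2])
  ultimately show ?case using insert.hyps unfolding P_def P'_def by simp
qed

text \<open>Applying \<sigma> shifts the factors cyclically because \<sigma>^n is the identity on
  \<open>L\<close>; the coefficients are therefore fixed and lie in the base field.\<close>

lemma orbit_poly:
  assumes x: "x \<in> L"
  shows "\<exists>h. map_poly to_ac h = (\<Prod>k<n. [:- (\<sigma> ^^ k) x, 1:])"
proof -
  define P where "P = (\<Prod>k<n. [:- (\<sigma> ^^ k) x, 1:])"
  have xk: "(\<sigma> ^^ k) x \<in> L" for k by (rule K_homD(1)[OF K_hom_funpow[OF \<sigma>] x])
  have shift: "(\<Prod>k<n. [:- \<sigma> ((\<sigma> ^^ k) x), 1:]) = P"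
  proof -
    define w where "w k = [:- (\<sigma> ^^ k) x, 1:]" for k
    have "w 0 * (\<Prod>k<n. w (Suc k)) = (\<Prod>k<Suc n. w k)" by (rule prod.lessThan_Suc_shift[symmetric])
    also have "\<dots> = (\<Prod>k<n. w k) * w 0" using funpow_n[OF x] by (simp add: w_def)
    finally have "w 0 * (\<Prod>k<n. w (Suc k)) = w 0 * (\<Prod>k<n. w k)" by (simp only: mult.commute)
    moreover have "w 0 \<noteq> 0" by (simp add: w_def)
    ultimately have "(\<Prod>k<n. w (Suc k)) = (\<Prod>k<n. w k)" by simp
    then show ?thesis by (simp add: w_def P_def)
  qed
  have "Polynomial.coeff P j \<in> range to_ac" for j
    using coeff_prod_linear_hom[of "{..<n}" "\<lambda>k. (\<sigma> ^^ k) x" j] xk shift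
    by (intro fixed_field) (simp_all add: P_def[symmetric])
  then have c: "to_ac (of_ac (Polynomial.coeff P j)) = Polynomial.coeff P j" for j by (rule to_ac_of_ac)
  define h where "h = map_poly of_ac P"
  have "map_poly to_ac h = P" by (simp add: poly_eq_iff h_def coeff_map_poly c)
  then show ?thesis unfolding P_def by blast
qed

text \<open>An irreducible polynomial with a root x in \<open>L\<close> divides the orbit polynomial
  of x, all of whose roots lie in \<open>L\<close>.\<close>

lemma galois_L: "galois_extension L"
  unfolding galois_extension_def
proof (intro conjI allI impI)
  show "subfield L ring_of_type_algebra" by (rule L_subfield)
  show "range to_ac \<subseteq> L" using to_ac_L by blast
next
  fix g :: "'a poly" and y
  assume g: "Factorial_Ring.irreducible g \<and> (\<exists>x\<in>L. poly (map_poly to_ac g) x = 0)" and y: "poly (map_poly to_ac g) y = 0"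
  then obtain x where x: "x \<in> L" "ev g x = 0" unfolding ev_def by blast
  obtain h where h: "map_poly to_ac h = (\<Prod>k<n. [:- (\<sigma> ^^ k) x, 1:])" using orbit_poly[OF x(1)] by blast
  have "ev h x = 0" unfolding ev_def h poly_prod using n_pos by (auto intro!: prod_zero bexI[of _ 0])
  then have "g dvd h" using irreducible_dvd_iff_ev[of g x h] g x(2) by blast
  then have "ev h y = 0" using y by (auto simp: ev_mult simp flip: ev_def)
  then obtain k where "y = (\<sigma> ^^ k) x" unfolding ev_def h poly_prod by auto
  then show "y \<in> L" using K_homD(1)[OF K_hom_funpow[OF \<sigma>] x(1)] by simp
next
  fix g :: "'a poly"
  assume "Factorial_Ring.irreducible g \<and> (\<exists>x\<in>L. poly (map_poly to_ac g) x = 0)"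
  then show "rsquarefree (map_poly to_ac g)" using irreducible_imp_rsquarefree by blast
qed

end

section \<open>The Galois group of \<open>L\<close>\<close>

abbreviation "\<G> \<equiv> galois_group L"

lemma galois_group_carrier: "\<tau> \<in> carrier (\<G>) \<longleftrightarrow> \<tau> \<in> extensional L \<and> K_hom \<tau>"
proof
  assume "\<tau> \<in> carrier (\<G>)"
  then show "\<tau> \<in> extensional L \<and> K_hom \<tau>"
    unfolding galois_group_def K_hom_def Bij_def ring_hom_def by auto
next
  assume \<tau>: "\<tau> \<in> extensional L \<and> K_hom \<tau>"
  then have "\<tau> \<in> Bij L" using K_hom_inj K_hom_surj by (simp add: Bij_def bij_betw_def)
  moreover have "\<tau> 1 = 1" using K_homD(4)[of \<tau> 1] \<tau> by simp
  ultimately show "\<tau> \<in> carrier (\<G>)"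
    using \<tau> K_homD[of \<tau>] unfolding galois_group_def ring_hom_def by auto
qed

lemma galois_group_mult:
  "\<lbrakk>\<sigma> \<in> carrier (\<G>); \<tau> \<in> carrier (\<G>)\<rbrakk>
    \<Longrightarrow> \<sigma> \<otimes>\<^bsub>\<G>\<^esub> \<tau> = compose L \<sigma> \<tau>"
  unfolding galois_group_def BijGroup_def by simp

lemma galois_group_one: "\<one>\<^bsub>\<G>\<^esub> = (\<lambda>x\<in>L. x)"
  unfolding galois_group_def BijGroup_def by simp

lemma K_hom_restrict: "K_hom \<sigma> \<Longrightarrow> K_hom (restrict \<sigma> L)"
  unfolding K_hom_def using L_add L_mult to_ac_L by simp

lemma K_hom_compose: "\<lbrakk>K_hom \<sigma>; K_hom \<tau>\<rbrakk> \<Longrightarrow> K_hom (compose L \<sigma> \<tau>)"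
  unfolding compose_def by (rule K_hom_restrict) (simp add: K_hom_def)

lemma K_hom_inverse:
  assumes "K_hom \<sigma>" shows "\<exists>\<tau>. K_hom \<tau> \<and> (\<forall>x\<in>L. \<tau> (\<sigma> x) = x)"
proof (intro exI conjI ballI)
  define \<tau> where "\<tau> = inv_into L \<sigma>"
  show inv: "\<tau> (\<sigma> x) = x" if "x \<in> L" for x
    unfolding \<tau>_def by (rule inv_into_f_f[OF K_hom_inj[OF assms] that])
  have sur: "\<exists>y\<in>L. x = \<sigma> y" if "x \<in> L" for x using that K_hom_surj[OF assms] by blast
  have "\<tau> x \<in> L" if "x \<in> L" for x using sur[OF that] inv by auto
  moreover have "\<tau> (x + y) = \<tau> x + \<tau> y \<and> \<tau> (x * y) = \<tau> x * \<tau> y" if "x \<in> L" "y \<in> L" for x y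
  proof -
    from sur[OF that(1)] sur[OF that(2)] obtain x' y'
      where x': "x' \<in> L" "x = \<sigma> x'" and y': "y' \<in> L" "y = \<sigma> y'" by blast
    show ?thesis
      unfolding x' y' K_homD(2)[OF assms x'(1) y'(1), symmetric] K_homD(3)[OF assms x'(1) y'(1), symmetric]
      using x' y' by (simp add: inv L_add L_mult)
  qed
  moreover have "\<tau> (to_ac c) = to_ac c" for c using inv[OF to_ac_L[of c]] K_homD(4)[OF assms] by simp
  ultimately show "K_hom \<tau>" unfolding K_hom_def by blast
qed

lemma group_galois_group: "group (\<G>)"
proof (rule groupI)
  have id: "K_hom (\<lambda>x\<in>L. x)" by (rule K_hom_restrict) (simp add: K_hom_def)
  then show "\<one>\<^bsub>\<G>\<^esub> \<in> carrier (\<G>)"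
    by (simp add: galois_group_carrier galois_group_one)
  have cl: "compose L \<sigma> \<tau> \<in> carrier (\<G>)"
    if "\<sigma> \<in> carrier (\<G>)" "\<tau> \<in> carrier (\<G>)" for \<sigma> \<tau>
    using that K_hom_compose by (simp add: galois_group_carrier)
  then show "\<sigma> \<otimes>\<^bsub>\<G>\<^esub> \<tau> \<in> carrier (\<G>)"
    if "\<sigma> \<in> carrier (\<G>)" "\<tau> \<in> carrier (\<G>)" for \<sigma> \<tau>
    using that by (simp add: galois_group_mult)
  show "\<rho> \<otimes>\<^bsub>\<G>\<^esub> \<sigma> \<otimes>\<^bsub>\<G>\<^esub> \<tau> = \<rho> \<otimes>\<^bsub>\<G>\<^esub> (\<sigma> \<otimes>\<^bsub>\<G>\<^esub> \<tau>)"
    if "\<rho> \<in> carrier (\<G>)" "\<sigma> \<in> carrier (\<G>)" "\<tau> \<in> carrier (\<G>)" for \<rho> \<sigma> \<tau>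
  proof -
    have "\<tau> \<in> L \<rightarrow> L" using that(3) K_homD(1)[of \<tau>] by (auto simp: galois_group_carrier)
    then show ?thesis using that cl by (simp add: galois_group_mult compose_assoc[of \<tau> L L \<rho> \<sigma>])
  qed
  show "\<one>\<^bsub>\<G>\<^esub> \<otimes>\<^bsub>\<G>\<^esub> \<sigma> = \<sigma>" if "\<sigma> \<in> carrier (\<G>)" for \<sigma>
  proof -
    have "(\<lambda>x\<in>L. x) \<in> carrier (\<G>)" using id by (simp add: galois_group_carrier)
    moreover have "compose L (\<lambda>x\<in>L. x) \<sigma> = \<sigma>"
      by (rule Id_compose) (use that K_homD(1)[of \<sigma>] in \<open>auto simp: galois_group_carrier\<close>)
    ultimately show ?thesis using that by (simp add: galois_group_mult galois_group_one)
  qed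
  show "\<exists>\<tau>\<in>carrier (\<G>). \<tau> \<otimes>\<^bsub>\<G>\<^esub> \<sigma> = \<one>\<^bsub>\<G>\<^esub>"
    if \<sigma>: "\<sigma> \<in> carrier (\<G>)" for \<sigma>
  proof -
    obtain \<tau> where \<tau>: "K_hom \<tau>" "\<forall>x\<in>L. \<tau> (\<sigma> x) = x"
      using K_hom_inverse[of \<sigma>] \<sigma> by (auto simp: galois_group_carrier)
    have "restrict \<tau> L \<in> carrier (\<G>)" using K_hom_restrict[OF \<tau>(1)] by (simp add: galois_group_carrier)
    moreover have "compose L (restrict \<tau> L) \<sigma> = (\<lambda>x\<in>L. x)"
      using \<tau> \<sigma> K_homD(1)[of \<sigma>] by (auto simp: compose_def galois_group_carrier restrict_def)
    ultimately show ?thesis using \<sigma> by (intro bexI[of _ "restrict \<tau> L"]) (simp_all add: galois_group_mult galois_group_one)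
  qed
qed

lemma galois_group_pow:
  assumes "\<sigma> \<in> carrier (\<G>)" "x \<in> L"
  shows "(\<sigma> [^]\<^bsub>\<G>\<^esub> (k :: nat)) x = (\<sigma> ^^ k) x"
  using assms(2)
proof (induction k arbitrary: x)
  case 0 then show ?case by (simp add: galois_group_one)
next
  case (Suc k)
  interpret group "\<G>" by (rule group_galois_group)
  have "\<sigma> x \<in> L" using assms(1) Suc.prems K_homD(1) by (simp add: galois_group_carrier)
  then have "(\<sigma> [^]\<^bsub>\<G>\<^esub> Suc k) x = (\<sigma> ^^ k) (\<sigma> x)"
    using assms(1) Suc by (simp add: galois_group_mult compose_def)
  then show ?case by (simp add: funpow_swap1)
qed

text \<open>An automorphism is determined by the image of \<alpha>, and every root of f has the form
  \<sigma>^k \<alpha>.\<close>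

theorem galois_cyclicI:
  assumes \<sigma>: "K_hom \<sigma>" and distinct: "\<And>m. \<lbrakk>0 < m; m < n\<rbrakk> \<Longrightarrow> (\<sigma> ^^ m) \<alpha> \<noteq> \<alpha>"
  shows "galois_cyclic_of_degree n (adjoin_root \<alpha>)"
proof -
  interpret group "\<G>" by (rule group_galois_group)
  define s where "s = restrict \<sigma> L"
  have s: "s \<in> carrier (\<G>)" using K_hom_restrict[OF \<sigma>] by (simp add: s_def galois_group_carrier)
  then have sK: "K_hom s" by (simp add: galois_group_carrier)
  have pow: "(s ^^ k) \<alpha> = (\<sigma> ^^ k) \<alpha>" for k
    using K_homD(1)[OF K_hom_funpow[OF \<sigma>] alpha_L] by (induction k) (simp_all add: s_def)
  have "carrier (\<G>) \<subseteq> range (\<lambda>k::int. s [^]\<^bsub>\<G>\<^esub> k)"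
  proof
    fix \<tau> assume \<tau>: "\<tau> \<in> carrier (\<G>)"
    then have \<tau>K: "K_hom \<tau>" and \<tau>e: "\<tau> \<in> extensional L" by (simp_all add: galois_group_carrier)
    have "ev f (\<tau> \<alpha>) = 0" by (rule K_hom_root[OF \<tau>K alpha_L root])
    then obtain k where k: "\<tau> \<alpha> = (s ^^ k) \<alpha>" using roots_eq[OF \<sigma> distinct] pow by auto
    have "\<tau> = s [^]\<^bsub>\<G>\<^esub> k"
    proof (rule extensionalityI[OF \<tau>e])
      show "s [^]\<^bsub>\<G>\<^esub> k \<in> extensional L"
        using nat_pow_closed[OF s, of k] by (simp add: galois_group_carrier)
      show "\<tau> x = (s [^]\<^bsub>\<G>\<^esub> k) x" if "x \<in> L" for x
        using K_hom_eqI[OF \<tau>K K_hom_funpow[OF sK] k that] galois_group_pow[OF s that] by simp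
    qed
    then show "\<tau> \<in> range (\<lambda>k::int. s [^]\<^bsub>\<G>\<^esub> k)" by (metis int_pow_int rangeI)
  qed
  then have "carrier (\<G>) = range (\<lambda>k::int. s [^]\<^bsub>\<G>\<^esub> k)" using s by auto
  then have "cyclic_group (\<G>)" using s cyclic_group by blast
  then show ?thesis
    unfolding galois_cyclic_of_degree_def L_eq using dimension_L galois_L[OF \<sigma> distinct] by blast
qed

text \<open>Normality and separability give n roots in \<open>L\<close>. Each is the image of
  \<alpha> under an embedding, hence lies in the orbit of \<alpha> under a generator, so this orbit
  has exactly n elements and no shorter period.\<close>

theorem galois_cyclicD:
  assumes "galois_cyclic_of_degree n (adjoin_root \<alpha>)"
  shows "\<exists>\<sigma>. K_hom \<sigma> \<and> (\<forall>m. 0 < m \<and> m < n \<longrightarrow> (\<sigma> ^^ m) \<alpha> \<noteq> \<alpha>)"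
proof -
  have gal: "galois_extension L" "cyclic_group (\<G>)"
    using assms unfolding galois_cyclic_of_degree_def L_eq by blast+
  have roots: "{x. ev f x = 0} \<subseteq> L" and sf: "rsquarefree (map_poly to_ac f)"
    using gal(1) irr root alpha_L unfolding galois_extension_def ev_def by blast+
  have card: "card {x. ev f x = 0} = n"
    using rsquarefree_card_roots[OF sf] deg by (simp add: ev_def)
  interpret group "\<G>" by (rule group_galois_group)
  obtain s where s: "s \<in> carrier (\<G>)" "carrier (\<G>) = range (\<lambda>k::int. s [^]\<^bsub>\<G>\<^esub> k)"
    using gal(2) cyclic_group by blast
  have sK: "K_hom s" using s(1) galois_group_carrier by blast
  define S where "S = range (\<lambda>k. (s ^^ k) \<alpha>)"
  have S: "S \<subseteq> L" "S \<subseteq> {x. ev f x = 0}" unfolding S_def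
    using K_homD(1)[OF K_hom_funpow[OF sK] alpha_L] K_hom_root[OF K_hom_funpow[OF sK] alpha_L root] by auto
  have finS: "finite S" by (rule finite_subset[OF S(2) card_roots_le(1)])
  have surS: "(s ^^ k) ` S = S" for k
  proof (rule card_subset_eq[OF finS])
    show "(s ^^ k) ` S \<subseteq> S" unfolding S_def by (auto simp flip: funpow_add[THEN fun_cong, unfolded comp_apply])
    show "card ((s ^^ k) ` S) = card S"
      by (rule card_image, rule inj_on_subset[OF K_hom_inj[OF K_hom_funpow[OF sK]] S(1)])
  qed
  \<comment> \<open>A cyclic group provides integer exponents. Negative ones stay in
    \<open>S\<close> as well, because powers of the generator permute this finite set.\<close>
  have orbit: "(s [^]\<^bsub>\<G>\<^esub> k) \<alpha> \<in> S" for k :: int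
  proof (cases "k \<ge> 0")
    case True
    then have "s [^]\<^bsub>\<G>\<^esub> k = s [^]\<^bsub>\<G>\<^esub> nat k" by (metis int_pow_int nat_0_le)
    then show ?thesis using galois_group_pow[OF s(1) alpha_L, of "nat k"] by (simp add: S_def)
  next
    case False
    define m where "m = nat (- k)"
    have k: "- int m = k" using False by (simp add: m_def)
    define \<tau> where "\<tau> = s [^]\<^bsub>\<G>\<^esub> k"
    have \<tau>: "\<tau> \<in> carrier (\<G>)" unfolding \<tau>_def using s(1) by simp
    have pm: "s [^]\<^bsub>\<G>\<^esub> m \<in> carrier (\<G>)" using s(1) by simp
    have "\<tau> = inv\<^bsub>\<G>\<^esub> (s [^]\<^bsub>\<G>\<^esub> m)"
      using int_pow_neg_int[OF s(1), of m] unfolding k \<tau>_def .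
    then have "(s [^]\<^bsub>\<G>\<^esub> m) \<otimes>\<^bsub>\<G>\<^esub> \<tau> = \<one>\<^bsub>\<G>\<^esub>" using pm by simp
    then have "compose L (s [^]\<^bsub>\<G>\<^esub> m) \<tau> \<alpha> = \<alpha>"
      using alpha_L \<tau> pm by (simp add: galois_group_mult galois_group_one)
    moreover have t: "\<tau> \<alpha> \<in> L" using \<tau> K_homD(1) alpha_L by (simp add: galois_group_carrier)
    ultimately have "(s ^^ m) (\<tau> \<alpha>) = \<alpha>" using alpha_L galois_group_pow[OF s(1) t] by (simp add: compose_def)
    moreover have "\<alpha> \<in> (s ^^ m) ` S" unfolding surS unfolding S_def by (rule range_eqI[of _ _ 0]) simp
    then obtain y where y: "y \<in> S" "(s ^^ m) y = \<alpha>" by auto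
    ultimately have "\<tau> \<alpha> = y"
      using inj_onD[OF K_hom_inj[OF K_hom_funpow[OF sK]], of m "\<tau> \<alpha>" y] t S(1) by auto
    then show ?thesis using y(1) unfolding \<tau>_def by simp
  qed
  have "{x. ev f x = 0} \<subseteq> S"
  proof
    fix x assume "x \<in> {x. ev f x = 0}"
    then have x: "ev f x = 0" "x \<in> L" using roots by auto
    define \<tau> where "\<tau> = restrict (emb x) L"
    have "\<tau> \<in> carrier (\<G>)"
      using K_hom_restrict[OF emb_K_hom[OF x]] by (simp add: \<tau>_def galois_group_carrier)
    then obtain k :: int where "\<tau> = s [^]\<^bsub>\<G>\<^esub> k" unfolding s(2) by blast
    then have "\<tau> \<alpha> \<in> S" using orbit by simp
    moreover have "\<tau> \<alpha> = x" using emb_ev[OF x(1), of "[:0, 1:]"] alpha_L by (simp add: \<tau>_def)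
    ultimately show "x \<in> S" by simp
  qed
  then have cardS: "card S = n" using S(2) card by auto
  have "(s ^^ m) \<alpha> \<noteq> \<alpha>" if m: "0 < m" "m < n" for m
  proof
    assume per: "(s ^^ m) \<alpha> = \<alpha>"
    have "S \<subseteq> (\<lambda>k. (s ^^ k) \<alpha>) ` {..<m}"
    proof
      fix x assume "x \<in> S"
      then obtain k where "x = (s ^^ k) \<alpha>" unfolding S_def by blast
      then have "x = (s ^^ (k mod m)) \<alpha>" by (simp add: funpow_mod_eq[OF per])
      then show "x \<in> (\<lambda>k. (s ^^ k) \<alpha>) ` {..<m}" using m(1) by simp
    qed
    then have "card S \<le> card {..<m}" by (meson card_image_le card_mono finite_imageI finite_lessThan order_trans)
    then show False using cardS m by simp
  qed
  then show ?thesis using sK by blast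
qed

end

section \<open>The valuation ring of an unramified extension\<close>

locale residue_field = finite_unramified_extension p v Q
  for p :: nat and v :: "'a :: field_char_0 \<Rightarrow> ereal" and Q :: "'a set" +
  fixes res :: "'a \<Rightarrow> 'k :: field"
  assumes residue: "residue_map p v res"
begin

abbreviation "\<O> \<equiv> valuation_ring v"

lemma O_iff: "x \<in> \<O> \<longleftrightarrow> 0 \<le> v x" by (simp add: valuation_ring_def)

lemma v_0 [simp]: "v 0 = \<infinity>" using val_eq_PInf_iff[of 0] by simp

lemma v_real: "x \<noteq> 0 \<Longrightarrow> \<exists>r. v x = ereal r"
  using val_not_MInf[of x] val_eq_PInf_iff[of x] by (cases "v x") auto

lemma v_1 [simp]: "v 1 = 0"
proof -
  obtain r where r: "v 1 = ereal r" using v_real[of 1] by auto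
  have "v (1 * 1) = v 1 + v 1" by (rule val_mult)
  then show ?thesis by (simp add: r)
qed

lemma v_uminus [simp]: "v (- x) = v x"
proof -
  obtain r where r: "v (- 1) = ereal r" using v_real[of "- 1"] by auto
  have "v (- 1 * - 1) = v (- 1) + v (- 1)" by (rule val_mult)
  then have "v (- 1) = 0" by (simp add: r)
  then show ?thesis using val_mult[of "- 1" x] by simp
qed

lemma v_inverse: "x \<noteq> 0 \<Longrightarrow> v (inverse x) = - v x"
proof -
  assume x: "x \<noteq> 0"
  obtain r s where r: "v x = ereal r" and s: "v (inverse x) = ereal s"
    using v_real[of x] v_real[of "inverse x"] x by auto
  have "v (x * inverse x) = v x + v (inverse x)" by (rule val_mult)
  then show ?thesis using x by (simp add: r s)
qed

lemma v_add_eq: "v x < v y \<Longrightarrow> v (x + y) = v x"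
proof -
  assume xy: "v x < v y"
  have "min (v x) (v y) \<le> v (x + y)" by (rule val_add)
  moreover have "min (v (x + y)) (v (- y)) \<le> v (x + y + - y)" by (rule val_add)
  ultimately show ?thesis using xy by (auto simp: min_def split: if_splits)
qed

lemma O_1: "1 \<in> \<O>" by (simp add: O_iff)
lemma O_0: "0 \<in> \<O>" by (simp add: O_iff)
lemma O_add: "\<lbrakk>x \<in> \<O>; y \<in> \<O>\<rbrakk> \<Longrightarrow> x + y \<in> \<O>"
  using val_add[of x y] by (auto simp: O_iff min_def split: if_splits)
lemma O_mult: "\<lbrakk>x \<in> \<O>; y \<in> \<O>\<rbrakk> \<Longrightarrow> x * y \<in> \<O>"
  by (simp add: O_iff val_mult)
lemma O_uminus: "x \<in> \<O> \<Longrightarrow> - x \<in> \<O>" by (simp add: O_iff)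
lemma O_diff: "\<lbrakk>x \<in> \<O>; y \<in> \<O>\<rbrakk> \<Longrightarrow> x - y \<in> \<O>" using O_add[of x "- y"] O_uminus by simp
lemma O_sum: "(\<And>i. i \<in> S \<Longrightarrow> g i \<in> \<O>) \<Longrightarrow> sum g S \<in> \<O>"
  by (induction S rule: infinite_finite_induct) (auto intro: O_0 O_add)
lemma O_of_nat: "of_nat m \<in> \<O>" by (induction m) (auto intro: O_0 O_1 O_add)
lemma O_of_int: "of_int m \<in> \<O>" by (cases m) (auto intro!: O_of_nat O_uminus O_diff O_1 simp: O_diff)
lemma O_power: "x \<in> \<O> \<Longrightarrow> x ^ m \<in> \<O>" by (induction m) (auto intro: O_1 O_mult)

lemmas O_closed = O_0 O_1 O_add O_mult O_uminus O_diff O_of_nat O_of_int O_power O_sum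

lemma p_nz: "(of_nat p :: 'a) \<noteq> 0" using prime_p by (simp add: prime_gt_0_nat)

lemma v_p: "v (of_nat p) = 1"
  using val_of_nat[of p] prime_p by (simp add: prime_gt_0_nat one_ereal_def not_prime_unit)

lemma v_p_power: "v (of_nat p ^ k) = ereal (real k)"
  by (induction k) (simp_all add: val_mult v_p zero_ereal_def one_ereal_def)

lemma v_ge_iff: "ereal (real k) \<le> v x \<longleftrightarrow> x / of_nat p ^ k \<in> \<O>"
proof (cases "x = 0")
  case False
  then obtain r where r: "v x = ereal r" using v_real by blast
  have "v (x / of_nat p ^ k) = v x - ereal (real k)"
    using p_nz by (simp add: divide_inverse val_mult v_inverse v_p_power r)
  then show ?thesis by (simp add: O_iff r)
qed (simp add: O_0)

lemma O_div_p_power_mono: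
  assumes "x / of_nat p ^ k \<in> \<O>" "j \<le> k" shows "x / of_nat p ^ j \<in> \<O>"
proof -
  have "ereal (real j) \<le> ereal (real k)" using assms(2) by simp
  then show ?thesis using assms(1) unfolding v_ge_iff[symmetric] by (rule order_trans)
qed

lemma res_hom: "res \<in> ring_hom (ring_of_type_algebra\<lparr>carrier := \<O>\<rparr>) ring_of_type_algebra"
  and res_surj: "res ` \<O> = UNIV" and res_ker: "{x \<in> \<O>. res x = 0} = (\<lambda>y. of_nat p * y) ` \<O>"
  using residue unfolding residue_map_def by blast+

lemma res_add: "\<lbrakk>x \<in> \<O>; y \<in> \<O>\<rbrakk> \<Longrightarrow> res (x + y) = res x + res y"
  and res_mult: "\<lbrakk>x \<in> \<O>; y \<in> \<O>\<rbrakk> \<Longrightarrow> res (x * y) = res x * res y"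
  and res_1: "res 1 = 1"
  using res_hom unfolding ring_hom_def by auto

lemma res_0_iff: "x \<in> \<O> \<Longrightarrow> res x = 0 \<longleftrightarrow> x / of_nat p \<in> \<O>"
proof
  assume "x \<in> \<O>" "res x = 0"
  then have "x \<in> (\<lambda>y. of_nat p * y) ` \<O>" using res_ker by blast
  then show "x / of_nat p \<in> \<O>" using p_nz by auto
next
  assume "x \<in> \<O>" "x / of_nat p \<in> \<O>"
  then have "x \<in> (\<lambda>y. of_nat p * y) ` \<O>" using p_nz by (intro image_eqI[of _ _ "x / of_nat p"]) auto
  then show "res x = 0" using res_ker by blast
qed

lemma res_0: "res 0 = 0" by (simp add: res_0_iff O_0)
lemma res_uminus: "x \<in> \<O> \<Longrightarrow> res (- x) = - res x"
  using res_add[of x "- x"] by (simp add: O_uminus res_0 eq_neg_iff_add_eq_0 add.commute)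
lemma res_diff: "\<lbrakk>x \<in> \<O>; y \<in> \<O>\<rbrakk> \<Longrightarrow> res (x - y) = res x - res y"
  using res_add[of x "- y"] by (simp add: O_uminus res_uminus)
lemma res_power: "x \<in> \<O> \<Longrightarrow> res (x ^ m) = res x ^ m"
  by (induction m) (auto simp: res_1 res_mult O_power)
lemma res_sum: "(\<And>i. i \<in> S \<Longrightarrow> g i \<in> \<O>) \<Longrightarrow> res (sum g S) = (\<Sum>i\<in>S. res (g i))"
  by (induction S rule: infinite_finite_induct) (auto simp: res_0 res_add O_sum)
lemma res_of_nat: "res (of_nat m) = of_nat m"
  by (induction m) (auto simp: res_0 res_1 res_add O_closed)
lemma res_of_int: "res (of_int m) = of_int m"
  by (cases m) (auto simp: res_of_nat res_uminus res_diff res_1 O_closed)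

lemma res_p: "(of_nat p :: 'k) = 0"
  using res_0_iff[OF O_of_nat[of p]] p_nz O_1 by (simp add: res_of_nat)

lemma res_lift: "\<exists>x\<in>\<O>. res x = t" using res_surj by (metis UNIV_I imageE)

text \<open>If y lifts the inverse residue, then x y differs from 1 by a multiple of p, so v x + v y
  = 0 with both summands nonnegative.\<close>

lemma v_eq_0_iff: "x \<in> \<O> \<Longrightarrow> v x = 0 \<longleftrightarrow> res x \<noteq> 0"
proof
  assume "x \<in> \<O>" "v x = 0"
  then show "res x \<noteq> 0" using v_ge_iff[of 1 x] by (simp add: res_0_iff zero_ereal_def)
next
  assume x: "x \<in> \<O>" "res x \<noteq> 0"
  obtain y where y: "y \<in> \<O>" "res y = inverse (res x)" using res_lift by blast
  have xy: "x * y \<in> \<O>" using x y by (intro O_mult)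
  have "res (x * y - 1) = 0" using x y xy by (simp add: res_diff res_mult res_1 O_1)
  then have "(x * y - 1) / of_nat p ^ 1 \<in> \<O>" using res_0_iff[of "x * y - 1"] xy O_1 by (simp add: O_diff)
  then have "ereal (real 1) \<le> v (x * y - 1)" unfolding v_ge_iff .
  then have "v 1 < v (x * y - 1)" by (simp add: zero_ereal_def less_le_trans[of "ereal 0" "ereal 1"])
  then have "v (x * y) = 0" using v_add_eq[of 1 "x * y - 1"] by simp
  then have "v x + v y = 0" by (simp add: val_mult)
  then show "v x = 0" using x y by (cases "v x"; cases "v y") (auto simp: O_iff zero_ereal_def)
qed

lemma v_eq_iff: "v x = ereal (real k) \<longleftrightarrow> x / of_nat p ^ k \<in> \<O> \<and> res (x / of_nat p ^ k) \<noteq> 0"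
proof (cases "x = 0")
  case False
  then obtain r where r: "v x = ereal r" using v_real by blast
  have e: "v (x / of_nat p ^ k) = v x - ereal (real k)"
    using p_nz by (simp add: divide_inverse val_mult v_inverse v_p_power r)
  have "v x = ereal (real k) \<longleftrightarrow> v (x / of_nat p ^ k) = 0" unfolding e r by (simp add: zero_ereal_def)
  then show ?thesis using v_eq_0_iff[of "x / of_nat p ^ k"] by (auto simp: O_iff)
qed (simp add: res_0)

lemma O_inverse: "\<lbrakk>x \<in> \<O>; res x \<noteq> 0\<rbrakk> \<Longrightarrow> inverse x \<in> \<O>"
  using v_eq_0_iff[of x] v_inverse[of x] by (cases "x = 0") (auto simp: O_iff)

lemma O_or_inverse: "x \<in> \<O> \<or> (inverse x \<in> \<O> \<and> res (inverse x) = 0)"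
proof (cases "x \<in> \<O>")
  case False
  then have x: "x \<noteq> 0" "v x < 0" using O_0 by (auto simp: O_iff)
  then have "v (inverse x) > 0" using v_inverse v_real[OF x(1)] by auto
  then have "0 \<le> v (inverse x)" "v (inverse x) \<noteq> 0" by auto
  then show ?thesis using v_eq_0_iff[of "inverse x"] by (auto simp: O_iff)
qed simp

text \<open>Divide by a nonzero member of least valuation.\<close>

lemma primitive_scaling:
  assumes S: "finite S" and nz: "\<exists>i\<in>S. c i \<noteq> (0 :: 'a)"
  obtains i where "i \<in> S" "c i \<noteq> 0" "\<And>j. j \<in> S \<Longrightarrow> c j / c i \<in> \<O>"
proof -
  define S' where "S' = {i \<in> S. c i \<noteq> 0}"
  have "finite S'" "S' \<noteq> {}" using S nz unfolding S'_def by auto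
  then obtain i where i: "i \<in> S'" "\<And>j. j \<in> S' \<Longrightarrow> v (c i) \<le> v (c j)"
    using arg_min_if_finite[of S' "\<lambda>i. v (c i)"] by (metis linorder_not_le)
  have "c j / c i \<in> \<O>" if j: "j \<in> S" for j
  proof (cases "c j = 0")
    case False
    then obtain r s where "v (c i) = ereal r" "v (c j) = ereal s"
      using v_real i(1) unfolding S'_def by blast
    then show ?thesis using i(1) i(2)[of j] j False
      unfolding S'_def by (simp add: O_iff divide_inverse val_mult v_inverse)
  qed (simp add: O_0)
  then show ?thesis using that i(1) unfolding S'_def by blast
qed

section \<open>Finiteness of the residue field\<close>

lemma v_of_int_unit:
  assumes "\<not> int p dvd z" shows "v (of_int z) = 0"
proof -
  have "z \<noteq> 0" using assms by auto
  then have "nat \<bar>z\<bar> > 0" by simp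
  moreover have "\<not> p dvd nat \<bar>z\<bar>" using assms by (simp flip: int_dvd_int_iff)
  ultimately have z: "nat \<bar>z\<bar> > 0" "\<not> p dvd nat \<bar>z\<bar>" by blast+
  then have "v (of_nat (nat \<bar>z\<bar>)) = 0"
    using val_of_nat[of "nat \<bar>z\<bar>"] by (simp add: not_dvd_imp_multiplicity_0 zero_ereal_def)
  moreover have "(of_nat (nat \<bar>z\<bar>) :: 'a) = of_int \<bar>z\<bar>" by simp
  ultimately show ?thesis by (cases "z \<ge> 0") (simp_all add: abs_if)
qed

lemma finite_range_of_int: "finite (range (of_int :: int \<Rightarrow> 'k))"
proof -
  have "range (of_int :: int \<Rightarrow> 'k) \<subseteq> of_int ` {0..<int p}"
  proof clarify
    fix z
    have "(of_int z :: 'k) = of_int (int p * (z div int p) + z mod int p)" by simp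
    also have "\<dots> = of_nat p * of_int (z div int p) + of_int (z mod int p)"
      by (simp only: of_int_add of_int_mult of_int_of_nat_eq)
    also have "\<dots> = of_int (z mod int p)" by (simp add: res_p)
    finally show "(of_int z :: 'k) \<in> of_int ` {0..<int p}"
      using prime_p by (auto simp: prime_gt_0_nat intro!: image_eqI[of _ _ "z mod int p"])
  qed
  then show ?thesis by (rule finite_subset) simp
qed

text \<open>By density every integral element of \<open>Q\<close> is congruent modulo p to a
  fraction, whose residue is a quotient of elements of the prime field.\<close>

lemma finite_res_Q: "finite (res ` (Q \<inter> \<O>))"
proof -
  define P where "P = range (of_int :: int \<Rightarrow> 'k)"
  have "res ` (Q \<inter> \<O>) \<subseteq> (\<lambda>(x, y). x / y) ` (P \<times> P)"
  proof clarify
    fix c assume c: "c \<in> Q" "c \<in> \<O>"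
    obtain r where r: "r \<in> \<rat>" "ereal 1 \<le> v (c - r)" using Rats_dense[OF c(1)] by blast
    obtain a b where ab: "r = of_int a / of_int b" "b > 0" "coprime a b"
      using Rats_cases'[OF r(1)] by metis
    have "(c - r) / of_nat p ^ 1 \<in> \<O>" using v_ge_iff[of 1 "c - r"] r(2) by simp
    then have cr: "(c - r) / of_nat p \<in> \<O>" by simp
    have crO: "c - r \<in> \<O>" using r(2) by (auto simp: O_iff intro: order_trans[of 0 "ereal 1"])
    have "c - (c - r) \<in> \<O>" by (rule O_diff[OF c(2) crO])
    then have rO: "r \<in> \<O>" by simp
    have eq: "res c = res r" using res_diff[OF c(2) rO] res_0_iff[OF crO] cr by simp
    have ba: "of_int b * r = of_int a" using ab(1,2) by simp
    have rb: "res (of_int b) * res r = res (of_int a)" using res_mult[OF O_of_int rO, of b] ba by simp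
    \<comment> \<open>The fraction is integral and in lowest terms: if p divided b, it would have to
      divide a as well.\<close>
    have "res (of_int b) \<noteq> 0"
    proof
      assume z: "res (of_int b) = 0"
      then have "v (of_int b) \<noteq> 0" using v_eq_0_iff[OF O_of_int, of b] by simp
      then have "int p dvd b" using v_of_int_unit by blast
      moreover have "int p dvd a"
      proof (rule ccontr)
        assume "\<not> int p dvd a"
        then have "res (of_int a) \<noteq> 0" using v_of_int_unit v_eq_0_iff[OF O_of_int] by blast
        then show False using rb z by simp
      qed
      ultimately have "int p dvd 1" using ab(3) by (metis coprime_common_divisor)
      then show False using prime_p by (simp add: not_prime_1 prime_nat_iff)
    qed
    then have "res c = of_int a / of_int b" using rb eq by (simp add: res_of_int field_simps)
    then show "res c \<in> (\<lambda>(x, y). x / y) ` (P \<times> P)" unfolding P_def by auto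
  qed
  moreover have "finite (P \<times> P)" using finite_range_of_int unfolding P_def by (intro finite_cartesian_product)
  ultimately show ?thesis by (meson finite_imageI finite_subset)
qed

text \<open>The powers 1, ..., x^d are one more than the dimension. The bound d is uniform in x,
  which keeps the set of reduced relations finite.\<close>

lemma power_relation:
  obtains d where "\<And>x. \<exists>c. (\<forall>i\<le>d. c i \<in> Q) \<and> (\<exists>i\<le>d. c i \<noteq> 0) \<and> (\<Sum>i\<le>d. c i * x ^ i) = 0"
proof -
  interpret field "ring_of_type_algebra :: 'a ring" by (rule field_from_type_algebra)
  obtain d where d: "dimension d Q (UNIV :: 'a set)"
    using finite_degree unfolding finite_dimension_def by blast
  have combine: "combine (map c [0..<m]) (map u [0..<m]) = (\<Sum>i<m. c i * u i)" for c u :: "nat \<Rightarrow> 'a" and m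
  proof (induction m arbitrary: c u)
    case (Suc m)
    have "[0..<Suc m] = 0 # map Suc [0..<m]" by (simp add: map_Suc_upt upt_conv_Cons)
    then have "combine (map c [0..<Suc m]) (map u [0..<Suc m])
        = c 0 * u 0 + combine (map (c \<circ> Suc) [0..<m]) (map (u \<circ> Suc) [0..<m])"
      by simp
    then show ?case by (simp only: Suc.IH sum.lessThan_Suc_shift o_apply)
  qed simp
  have "\<exists>c. (\<forall>i\<le>d. c i \<in> Q) \<and> (\<exists>i\<le>d. c i \<noteq> 0) \<and> (\<Sum>i\<le>d. c i * x ^ i) = 0" for x
  proof -
    define Us where "Us = map (\<lambda>i. x ^ i) [0..<Suc d]"
    have "dependent Q Us"
    proof
      assume "independent Q Us"
      from independent_length_le_dimension[OF subfield_Q d this] show False by (simp add: Us_def)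
    qed
    then obtain Ks where Ks: "length Ks = length Us" "combine Ks Us = 0" "set Ks \<subseteq> Q" "set Ks \<noteq> {0}"
      using dependent_imp_non_trivial_combine[OF subfield_Q, of Us] by auto
    have len: "length Ks = Suc d" using Ks(1) by (simp add: Us_def)
    have Ks': "Ks = map (\<lambda>i. Ks ! i) [0..<Suc d]" using len by (metis map_nth)
    have "combine (map (\<lambda>i. Ks ! i) [0..<Suc d]) (map (\<lambda>i. x ^ i) [0..<Suc d]) = 0"
      using Ks(2) Ks' unfolding Us_def by simp
    then have "(\<Sum>i<Suc d. Ks ! i * x ^ i) = 0" unfolding combine .
    then have s: "(\<Sum>i\<le>d. Ks ! i * x ^ i) = 0" by (simp only: lessThan_Suc_atMost)
    have "\<exists>i\<le>d. Ks ! i \<noteq> 0"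
    proof (rule ccontr)
      assume "\<not> (\<exists>i\<le>d. Ks ! i \<noteq> 0)"
      then have "set Ks \<subseteq> {0}" using len by (auto simp: in_set_conv_nth less_Suc_eq_le)
      moreover have "set Ks \<noteq> {}" using len by auto
      ultimately show False using Ks(4) subset_singletonD by metis
    qed
    moreover have "\<forall>i\<le>d. Ks ! i \<in> Q" using Ks(3) len by (auto simp: less_Suc_eq_le)
    ultimately show ?thesis using s by blast
  qed
  then show ?thesis using that by blast
qed

text \<open>A relation for a lift, scaled to be primitive, reduces to a nonzero polynomial. So every
  residue is a root of one of finitely many polynomials, of bounded degree and with coefficients
  among the residues of \<open>Q\<close>.\<close>

lemma finite_residue_field: "finite (UNIV :: 'k set)"
proof -
  obtain d where d: "\<And>x. \<exists>c. (\<forall>i\<le>d. c i \<in> Q) \<and> (\<exists>i\<le>d. c i \<noteq> 0) \<and> (\<Sum>i\<le>d. c i * x ^ i) = 0"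
    by (rule power_relation) blast
  define F where "F = res ` (Q \<inter> \<O>)"
  define G where "G = {g :: 'k poly. g \<noteq> 0 \<and> Polynomial.degree g \<le> d \<and> (\<forall>i\<le>d. Polynomial.coeff g i \<in> F)}"
  have "G \<subseteq> (\<lambda>c. \<Sum>i\<le>d. Polynomial.monom (c i) i) ` ({..d} \<rightarrow>\<^sub>E F)"
  proof
    fix g assume "g \<in> G"
    then have g: "Polynomial.degree g \<le> d" "\<forall>i\<le>d. Polynomial.coeff g i \<in> F" unfolding G_def by auto
    define c where "c = restrict (Polynomial.coeff g) {..d}"
    have "g = (\<Sum>i\<le>d. Polynomial.monom (Polynomial.coeff g i) i)" using poly_as_sum_of_monoms'[OF g(1)] by simp
    also have "\<dots> = (\<Sum>i\<le>d. Polynomial.monom (c i) i)" by (rule sum.cong) (simp_all add: c_def)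
    finally show "g \<in> (\<lambda>c. \<Sum>i\<le>d. Polynomial.monom (c i) i) ` ({..d} \<rightarrow>\<^sub>E F)"
      using g(2) by (intro image_eqI[of _ _ c]) (auto simp: c_def)
  qed
  moreover have "finite ({..d} \<rightarrow>\<^sub>E F)" unfolding F_def using finite_res_Q by (intro finite_PiE) auto
  ultimately have finG: "finite G" using finite_surj by blast
  have "(UNIV :: 'k set) \<subseteq> (\<Union>g\<in>G. {t. poly g t = 0})"
  proof
    fix t :: 'k
    obtain x where x: "x \<in> \<O>" "res x = t" using res_lift by blast
    obtain c where c: "\<forall>i\<le>d. c i \<in> Q" "\<exists>i\<le>d. c i \<noteq> 0" "(\<Sum>i\<le>d. c i * x ^ i) = 0" using d[of x] by blast
    obtain i0 where i0: "i0 \<in> {..d}" "c i0 \<noteq> 0" "\<And>j. j \<in> {..d} \<Longrightarrow> c j / c i0 \<in> \<O>"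
      by (rule primitive_scaling[of "{..d}" c]) (use c(2) in auto)
    define e where "e i = c i / c i0" for i
    have e: "e i \<in> \<O>" "e i \<in> Q" if "i \<le> d" for i
    proof -
      show "e i \<in> \<O>" using i0(3) that by (simp add: e_def)
      have "inverse (c i0) \<in> Q" using subfield_type_closed(5)[OF subfield_Q] c(1) i0(1) by simp
      then show "e i \<in> Q" using subfield_type_closed(4)[OF subfield_Q] c(1) that by (simp add: e_def divide_inverse)
    qed
    define g where "g = (\<Sum>i\<le>d. Polynomial.monom (res (e i)) i)"
    have cg: "Polynomial.coeff g i = (if i \<le> d then res (e i) else 0)" for i
      unfolding g_def by (simp add: coeff_sum coeff_monom sum.delta)
    have "Polynomial.coeff g i0 \<noteq> 0" using i0 by (simp add: cg e_def res_1)
    then have "g \<noteq> 0" by auto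
    moreover have "Polynomial.degree g \<le> d" by (rule degree_le) (simp add: cg)
    moreover have "\<forall>i\<le>d. Polynomial.coeff g i \<in> F" using e by (auto simp: cg F_def)
    ultimately have "g \<in> G" unfolding G_def by blast
    have "(\<Sum>i\<le>d. e i * x ^ i) = (\<Sum>i\<le>d. c i * x ^ i) / c i0" by (simp add: e_def sum_divide_distrib)
    then have z: "(\<Sum>i\<le>d. e i * x ^ i) = 0" using c(3) by simp
    have "poly g t = (\<Sum>i\<le>d. res (e i) * t ^ i)" unfolding g_def by (simp add: poly_sum poly_monom)
    also have "\<dots> = res (\<Sum>i\<le>d. e i * x ^ i)"
      using e x by (subst res_sum) (auto simp: res_mult res_power O_power O_mult)
    finally have "poly g t = 0" using z by (simp add: res_0)
    then show "t \<in> (\<Union>g\<in>G. {t. poly g t = 0})" using \<open>g \<in> G\<close> by blast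
  qed
  moreover have "finite (\<Union>g\<in>G. {t. poly g t = 0})"
    using finG by (intro finite_UN_I) (auto simp: G_def intro: poly_roots_finite)
  ultimately show ?thesis by (rule finite_subset)
qed

lemma CHAR_k: "CHAR('k) = p"
proof -
  have "CHAR('k) dvd p" using res_p by (simp add: of_nat_eq_0_iff_char_dvd)
  then have "CHAR('k) = 1 \<or> CHAR('k) = p" using prime_p unfolding prime_nat_iff by blast
  then show ?thesis using CHAR_not_1'[where ?'a = 'k] by simp
qed

lemma frobenius_surj: "\<exists>u. u ^ p = (t :: 'k)"
proof -
  have "inj (\<lambda>u :: 'k. u ^ p)"
  proof (rule injI)
    fix x y :: 'k assume "x ^ p = y ^ p"
    moreover have "(x - y + y) ^ p = (x - y) ^ p + y ^ p"
      by (rule freshmans_dream) (simp_all only: CHAR_k prime_p)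
    ultimately have "(x - y) ^ p = 0" by simp
    then show "x = y" by simp
  qed
  then have "surj (\<lambda>u :: 'k. u ^ p)" using finite_residue_field by (rule finite_UNIV_inj_surj[rotated])
  then show ?thesis by (metis surjD)
qed

section \<open>Integral polynomials and their reduction\<close>

definition integral_poly :: "'a poly \<Rightarrow> bool" where
  "integral_poly g \<longleftrightarrow> (\<forall>i. Polynomial.coeff g i \<in> \<O>)"

definition red :: "'a poly \<Rightarrow> 'k poly" where "red = map_poly res"

lemma coeff_red: "Polynomial.coeff (red g) i = res (Polynomial.coeff g i)"
  unfolding red_def by (rule coeff_map_poly) (rule res_0)

lemma integral_coeff: "integral_poly g \<Longrightarrow> Polynomial.coeff g i \<in> \<O>"
  by (simp add: integral_poly_def)

lemma integral_0 [simp]: "integral_poly 0" by (simp add: integral_poly_def O_0)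
lemma integral_pCons [simp]: "integral_poly (Polynomial.pCons a g) \<longleftrightarrow> a \<in> \<O> \<and> integral_poly g"
proof
  assume g: "integral_poly (Polynomial.pCons a g)"
  then have "Polynomial.coeff (Polynomial.pCons a g) 0 \<in> \<O>" "Polynomial.coeff (Polynomial.pCons a g) (Suc i) \<in> \<O>" for i
    unfolding integral_poly_def by blast+
  then show "a \<in> \<O> \<and> integral_poly g" by (simp add: integral_poly_def)
qed (auto simp: integral_poly_def coeff_pCons split: nat.split)
lemma integral_add: "\<lbrakk>integral_poly g; integral_poly h\<rbrakk> \<Longrightarrow> integral_poly (g + h)"
  by (simp add: integral_poly_def O_add)
lemma integral_diff: "\<lbrakk>integral_poly g; integral_poly h\<rbrakk> \<Longrightarrow> integral_poly (g - h)"
  by (simp add: integral_poly_def O_diff)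
lemma integral_uminus: "integral_poly g \<Longrightarrow> integral_poly (- g)"
  by (simp add: integral_poly_def O_uminus)
lemma integral_mult: "\<lbrakk>integral_poly g; integral_poly h\<rbrakk> \<Longrightarrow> integral_poly (g * h)"
  by (simp add: integral_poly_def coeff_mult O_sum O_mult)
lemma integral_smult: "\<lbrakk>c \<in> \<O>; integral_poly h\<rbrakk> \<Longrightarrow> integral_poly (Polynomial.smult c h)"
  by (simp add: integral_poly_def O_mult)

lemma red_mult: "\<lbrakk>integral_poly g; integral_poly h\<rbrakk> \<Longrightarrow> red (g * h) = red g * red h"
  by (simp add: poly_eq_iff coeff_red coeff_mult res_sum res_mult integral_poly_def O_mult)

lemma red_smult: "\<lbrakk>c \<in> \<O>; integral_poly h\<rbrakk> \<Longrightarrow> red (Polynomial.smult c h) = Polynomial.smult (res c) (red h)"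
  by (simp add: poly_eq_iff coeff_red res_mult integral_poly_def)

lemma red_add: "\<lbrakk>integral_poly g; integral_poly h\<rbrakk> \<Longrightarrow> red (g + h) = red g + red h"
  by (simp add: poly_eq_iff coeff_red res_add integral_poly_def)

lemma degree_red_le: "Polynomial.degree (red g) \<le> Polynomial.degree g"
  by (rule degree_le) (simp add: coeff_red coeff_eq_0 res_0)

lemma poly_primitive:
  assumes "g \<noteq> 0"
  obtains c where "c \<noteq> 0" "integral_poly (Polynomial.smult (inverse c) g)" "red (Polynomial.smult (inverse c) g) \<noteq> 0"
proof -
  have "\<exists>i\<in>{..Polynomial.degree g}. Polynomial.coeff g i \<noteq> 0"
    using assms by (intro bexI[of _ "Polynomial.degree g"]) auto
  then obtain i where i: "Polynomial.coeff g i \<noteq> 0"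
      "\<And>j. j \<in> {..Polynomial.degree g} \<Longrightarrow> Polynomial.coeff g j / Polynomial.coeff g i \<in> \<O>"
    by (rule primitive_scaling[of "{..Polynomial.degree g}" "Polynomial.coeff g", OF finite_atMost]) blast
  have "Polynomial.coeff g j / Polynomial.coeff g i \<in> \<O>" for j
    using i(2)[of j] by (cases "j \<le> Polynomial.degree g") (simp_all add: coeff_eq_0 O_0)
  then have "integral_poly (Polynomial.smult (inverse (Polynomial.coeff g i)) g)"
    by (simp add: integral_poly_def divide_inverse mult.commute)
  moreover have "Polynomial.coeff (red (Polynomial.smult (inverse (Polynomial.coeff g i)) g)) i \<noteq> 0"
    using i(1) by (simp add: coeff_red res_1)
  then have "red (Polynomial.smult (inverse (Polynomial.coeff g i)) g) \<noteq> 0" by auto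
  ultimately show ?thesis using that i(1) by blast
qed

lemma order_0_le: "g \<noteq> 0 \<Longrightarrow> Polynomial.order 0 g \<le> Polynomial.degree g" for g :: "'k poly"
  by (rule order_degree)

lemma order_0_monom: "Polynomial.order 0 (Polynomial.monom (1 :: 'k) m) = m"
  using order_power_n_n[of "0 :: 'k" m] by (simp add: monom_altdef)

text \<open>The completeness of \<open>Q\<close> enters here. The digits 0 and 1 suffice because the
  series will record the positions of one residue class at a time.\<close>

lemma padic_series:
  assumes c: "\<And>q. c q \<in> {0, 1 :: 'a}"
  shows "\<exists>y\<in>Q. \<forall>m. (y - (\<Sum>q<m. c q * of_nat p ^ q)) / of_nat p ^ m \<in> \<O>"
proof -
  define s where "s m = (\<Sum>q<m. c q * of_nat p ^ q)" for m
  note Qc = subfield_type_closed[OF subfield_Q]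
  have Q0: "0 \<in> Q" using Qc(3)[OF Qc(1) Qc(2)[OF Qc(1)]] by simp
  have "of_nat p \<in> Q" for p :: nat by (induction p) (auto simp: Q0 Qc)
  then have "of_nat p ^ q \<in> Q" for q by (induction q) (auto simp: Qc)
  moreover have "c q \<in> Q" for q using c[of q] Q0 Qc(1) by auto
  ultimately have sQ: "s m \<in> Q" for m unfolding s_def by (induction m) (auto simp: Q0 Qc)
  have step: "ereal (real m) \<le> v (s n - s m)" if "m \<le> n" for m n
  proof -
    have "s n - s m = (\<Sum>q\<in>{m..<n}. c q * of_nat p ^ q)"
      unfolding s_def using sum_diff_nat_ivl[of 0 m n "\<lambda>q. c q * of_nat p ^ q"] that
      by (simp add: atLeast0LessThan)
    also have "\<dots> / of_nat p ^ m = (\<Sum>q\<in>{m..<n}. c q * of_nat p ^ (q - m))"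
      unfolding sum_divide_distrib using p_nz by (intro sum.cong refl) (auto simp: power_diff)
    also have "\<dots> \<in> \<O>" using c O_0 O_1 by (intro O_sum O_mult O_power O_of_nat) (metis insertE singletonD)
    finally show ?thesis unfolding v_ge_iff .
  qed
  have sym: "v (x - y) = v (y - x)" for x y using v_uminus[of "x - y"] by simp
  have step': "ereal (real N) \<le> v (s m - s n)" if "m \<ge> N" "n \<ge> N" for m n N
  proof (cases "m \<le> n")
    case True
    then have "ereal (real m) \<le> v (s m - s n)" using step[OF True] sym by simp
    then show ?thesis using that(1) by (meson ereal_less_eq(3) of_nat_le_iff order_trans)
  next
    case False
    then have "ereal (real n) \<le> v (s m - s n)" using step[of n m] by simp
    then show ?thesis using that(2) by (meson ereal_less_eq(3) of_nat_le_iff order_trans)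
  qed
  have "\<forall>B::real. \<exists>N::nat. \<forall>m\<ge>N. \<forall>n\<ge>N. ereal B \<le> v (s m - s n)"
  proof
    fix B :: real
    obtain N :: nat where "B \<le> real N" using real_arch_simple by blast
    then show "\<exists>N::nat. \<forall>m\<ge>N. \<forall>n\<ge>N. ereal B \<le> v (s m - s n)"
      using step' by (meson ereal_less_eq(3) order_trans)
  qed
  then obtain y where y: "y \<in> Q" "\<forall>B::real. \<exists>N::nat. \<forall>n\<ge>N. ereal B \<le> v (s n - y)"
    using complete_Q[of s] sQ by blast
  have "ereal (real m) \<le> v (y - s m)" for m
  proof -
    obtain N where N: "\<forall>n\<ge>N. ereal (real m) \<le> v (s n - y)" using y(2) by blast
    define n where "n = max N m"
    have "ereal (real m) \<le> v (y - s n)" "ereal (real m) \<le> v (s n - s m)"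
      using N step[of m n] sym by (simp_all add: n_def)
    moreover have "min (v (y - s n)) (v (s n - s m)) \<le> v (y - s n + (s n - s m))" by (rule val_add)
    ultimately show ?thesis by (simp add: min_def split: if_splits)
  qed
  then show ?thesis using y(1) unfolding v_ge_iff s_def by blast
qed

end

section \<open>Eisenstein polynomials\<close>

locale eisenstein_poly = residue_field p v Q res
  for p :: nat and v :: "'a :: field_char_0 \<Rightarrow> ereal" and Q :: "'a set" and res :: "'a \<Rightarrow> 'k :: field" +
  fixes f :: "'a poly" and n :: nat
  assumes eis: "eisenstein v f" and deg: "Polynomial.degree f = n"
begin

lemma n_pos: "n > 0" using eis deg by (simp add: eisenstein_def)

lemma coeff_n: "Polynomial.coeff f n = 1" using eis deg by (auto simp: eisenstein_def)

lemma coeff_div_p: "i < n \<Longrightarrow> Polynomial.coeff f i / of_nat p \<in> \<O>"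
  using eis deg v_ge_iff[of 1 "Polynomial.coeff f i"] by (simp add: eisenstein_def one_ereal_def)

lemma coeff_0_unit: "res (Polynomial.coeff f 0 / of_nat p) \<noteq> 0"
  using eis v_eq_iff[of "Polynomial.coeff f 0" 1] by (simp add: eisenstein_def one_ereal_def)

lemma coeff_O: "Polynomial.coeff f i \<in> \<O>"
proof (cases i n rule: linorder_cases)
  case less
  then have "of_nat p * (Polynomial.coeff f i / of_nat p) \<in> \<O>" by (intro O_mult O_of_nat coeff_div_p)
  then show ?thesis using p_nz by simp
qed (simp_all add: coeff_n O_1 O_0 coeff_eq_0 deg)

lemma integral_f: "integral_poly f" by (simp add: integral_poly_def coeff_O)

lemma red_f: "red f = Polynomial.monom 1 n"
proof (rule poly_eqI)
  fix i
  show "Polynomial.coeff (red f) i = Polynomial.coeff (Polynomial.monom 1 n) i"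
  proof (cases i n rule: linorder_cases)
    case less
    then show ?thesis using res_0_iff[OF coeff_O, of i] coeff_div_p by (simp add: coeff_red coeff_monom)
  qed (simp_all add: coeff_red coeff_monom coeff_n res_1 coeff_eq_0 deg res_0)
qed

lemma f_nz: "f \<noteq> 0" using coeff_n by auto

text \<open>After scaling, both factors are primitive, hence powers of \<open>X\<close> modulo \<open>p\<close>; this puts the constant
  term of \<open>f\<close> into \<open>p\<^sup>2\<O>\<close>.\<close>

lemma irreducible_f: "Factorial_Ring.irreducible f"
proof (rule irreducibleI)
  show "f \<noteq> 0" by (rule f_nz)
  show "\<not> is_unit f" using n_pos deg f_nz by (simp add: is_unit_iff_degree)
next
  fix g h assume fgh: "f = g * h"
  show "is_unit g \<or> is_unit h"
  proof (rule ccontr)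
    assume nu: "\<not> (is_unit g \<or> is_unit h)"
    have nz: "g \<noteq> 0" "h \<noteq> 0" using fgh f_nz by auto
    have dg: "Polynomial.degree g > 0" "Polynomial.degree h > 0" using nu nz is_unit_iff_degree by auto
    have dsum: "Polynomial.degree g + Polynomial.degree h = n" using degree_mult_eq[OF nz] fgh deg by simp
    obtain c where c: "c \<noteq> 0" "integral_poly (Polynomial.smult (inverse c) g)" "red (Polynomial.smult (inverse c) g) \<noteq> 0"
      using poly_primitive[OF nz(1)] by blast
    obtain d where d: "d \<noteq> 0" "integral_poly (Polynomial.smult (inverse d) h)" "red (Polynomial.smult (inverse d) h) \<noteq> 0"
      using poly_primitive[OF nz(2)] by blast
    define g' h' u where "g' = Polynomial.smult (inverse c) g" and "h' = Polynomial.smult (inverse d) h"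
      and "u = inverse c * inverse d"
    have g'h': "g' * h' = Polynomial.smult u f" by (simp add: g'_def h'_def u_def fgh mult_ac)
    have int: "integral_poly g'" "integral_poly h'" using c d by (simp_all add: g'_def h'_def)
    have rnz: "red g' \<noteq> 0" "red h' \<noteq> 0" using c d by (simp_all add: g'_def h'_def)
    have "integral_poly (Polynomial.smult u f)" unfolding g'h'[symmetric] by (rule integral_mult[OF int])
    then have "Polynomial.coeff (Polynomial.smult u f) n \<in> \<O>" unfolding integral_poly_def by blast
    then have uO: "u \<in> \<O>" by (simp add: coeff_n)
    have red: "red g' * red h' = Polynomial.smult (res u) (Polynomial.monom 1 n)"
      unfolding red_mult[OF int, symmetric] g'h' red_smult[OF uO integral_f] red_f ..
    then have u: "res u \<noteq> 0" using rnz by auto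
    \<comment> \<open>The orders of vanishing at 0 add up to n and are bounded by the degrees, which
      also add up to n; so they equal the degrees and are positive.\<close>
    have "Polynomial.order 0 (red g') + Polynomial.order 0 (red h') = Polynomial.order 0 (red g' * red h')"
      using rnz by (intro order_mult[symmetric]) simp
    also have "\<dots> = n" unfolding red using u by (simp add: order_smult order_0_monom)
    finally have "Polynomial.order 0 (red g') + Polynomial.order 0 (red h') = n" .
    moreover have "Polynomial.order 0 (red g') \<le> Polynomial.degree g" "Polynomial.order 0 (red h') \<le> Polynomial.degree h"
      using order_0_le[OF rnz(1)] order_0_le[OF rnz(2)] degree_red_le[of g'] degree_red_le[of h'] c d
      by (simp_all add: g'_def h'_def)
    ultimately have "Polynomial.order 0 (red g') \<noteq> 0" "Polynomial.order 0 (red h') \<noteq> 0" using dg dsum by linarith+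
    then have "poly (red g') 0 = 0" "poly (red h') 0 = 0" using order_root by blast+
    then have z: "res (Polynomial.coeff g' 0) = 0" "res (Polynomial.coeff h' 0) = 0"
      by (simp_all add: poly_0_coeff_0 coeff_red)
    have gO: "Polynomial.coeff g' 0 \<in> \<O>" "Polynomial.coeff h' 0 \<in> \<O>" using int by (simp_all add: integral_poly_def)
    have "Polynomial.coeff g' 0 / of_nat p \<in> \<O>" using z(1) res_0_iff[OF gO(1)] by blast
    then have "Polynomial.coeff g' 0 / of_nat p * Polynomial.coeff h' 0 \<in> \<O>"
        "res (Polynomial.coeff g' 0 / of_nat p * Polynomial.coeff h' 0) = 0"
      using O_mult[of "Polynomial.coeff g' 0 / of_nat p", OF _ gO(2)] res_mult[of "Polynomial.coeff g' 0 / of_nat p", OF _ gO(2)] z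
      by simp_all
    moreover have "Polynomial.coeff g' 0 / of_nat p * Polynomial.coeff h' 0 = u * (Polynomial.coeff f 0 / of_nat p)"
      using arg_cong[OF g'h', of "\<lambda>g. Polynomial.coeff g 0"] by (simp add: coeff_mult)
    ultimately have "res (u * (Polynomial.coeff f 0 / of_nat p)) = 0" by metis
    then have "res u * res (Polynomial.coeff f 0 / of_nat p) = 0"
      using res_mult[OF uO coeff_div_p[OF n_pos]] by metis
    then show False using u coeff_0_unit by simp
  qed
qed

text \<open>The divisor is monic, so division does not introduce denominators; the leading
  coefficient is removed after each Horner step.\<close>

lemma division:
  assumes "integral_poly g"
  shows "\<exists>h q. integral_poly h \<and> integral_poly q \<and> g = h + f * q \<and> Polynomial.degree h < n"
  using assms
proof (induction g)
  case 0 then show ?case using n_pos by (intro exI[of _ 0]) simp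
next
  case (pCons a g)
  then obtain h q where h: "integral_poly h" "integral_poly q" "g = h + f * q" "Polynomial.degree h < n" by auto
  define c where "c = Polynomial.coeff h (n - 1)"
  have cO: "c \<in> \<O>" using h(1) by (simp add: c_def integral_poly_def)
  define h' where "h' = Polynomial.pCons a h - Polynomial.smult c f"
  have "integral_poly h'"
    unfolding h'_def using pCons.prems h(1) cO by (intro integral_diff integral_smult integral_f) simp_all
  moreover have "integral_poly (Polynomial.pCons c q)" using cO h(2) by simp
  moreover have "Polynomial.pCons a g = h' + f * Polynomial.pCons c q" unfolding h(3) h'_def by simp
  moreover have "Polynomial.degree h' < n"
  proof -
    have "Polynomial.coeff h' i = 0" if "i \<ge> n" for i
    proof (cases "i = n")
      case True
      then obtain m where m: "i = Suc m" "n = Suc m" using n_pos by (cases i) auto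
      then show ?thesis using coeff_n by (simp add: h'_def c_def)
    next
      case False
      then have "i > n" using that by simp
      then show ?thesis using h(4) deg by (cases i) (simp_all add: h'_def coeff_eq_0)
    qed
    then have "Polynomial.degree h' \<le> n - 1" by (intro degree_le) auto
    then show ?thesis using n_pos by linarith
  qed
  ultimately show ?case by blast
qed

end

locale eisenstein_root = eisenstein_poly p v Q res f n
  for p :: nat and v :: "'a :: field_char_0 \<Rightarrow> ereal" and Q :: "'a set" and res :: "'a \<Rightarrow> 'k :: field"
    and f :: "'a poly" and n :: nat +
  fixes \<pi> :: "'a alg_closure"
  assumes n_ge_2: "n \<ge> 2" and root_f: "poly (map_poly to_ac f) \<pi> = 0"
begin

sublocale simple_extension f \<pi> n
  by unfold_locales (use irreducible_f deg coeff_n root_f in \<open>simp_all add: ev_def\<close>)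

section \<open>The ring \<open>A\<close>, its residue map and its uniformizer\<close>

definition "A = {ev g \<pi> | g. integral_poly g}"

text \<open>Two integral representations differ by an integral multiple of f, whose constant
  coefficient is divisible by p; so the value does not depend on the choice.\<close>

definition res_A :: "'a alg_closure \<Rightarrow> 'k" where
  "res_A x = res (Polynomial.coeff (SOME g. integral_poly g \<and> x = ev g \<pi>) 0)"

lemma coeff_mult_f_0: "integral_poly q \<Longrightarrow> res (Polynomial.coeff (f * q) 0) = 0"
proof -
  assume q: "integral_poly q"
  have "res (Polynomial.coeff f 0) = 0" using res_0_iff[OF coeff_O] coeff_div_p[OF n_pos] by blast
  moreover have "Polynomial.coeff q 0 \<in> \<O>" using q by (simp add: integral_poly_def)
  ultimately show ?thesis by (simp add: coeff_mult res_mult coeff_O)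
qed

lemma integral_ev_eq_0:
  assumes "integral_poly g" "ev g \<pi> = 0" obtains q where "integral_poly q" "g = f * q"
proof -
  obtain h q where h: "integral_poly h" "integral_poly q" "g = h + f * q" "Polynomial.degree h < n"
    using division[OF assms(1)] by blast
  have "ev h \<pi> = 0" using assms(2) by (simp add: h(3) ev_add ev_mult root)
  then have "h = 0" using ev_eq_0_small h(4) by blast
  then show ?thesis using that h by simp
qed

lemma res_A_ev:
  assumes "integral_poly g" shows "res_A (ev g \<pi>) = res (Polynomial.coeff g 0)"
proof -
  define h where "h = (SOME h. integral_poly h \<and> ev g \<pi> = ev h \<pi>)"
  have "integral_poly h \<and> ev g \<pi> = ev h \<pi>" unfolding h_def by (rule someI[of _ g]) (simp add: assms)
  then have h: "integral_poly h" "ev (g - h) \<pi> = 0" by (simp_all add: ev_diff)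
  obtain q where q: "integral_poly q" "g - h = f * q"
    using integral_ev_eq_0[OF integral_diff[OF assms h(1)] h(2)] by blast
  have "res (Polynomial.coeff (g - h) 0) = 0" unfolding q(2) by (rule coeff_mult_f_0[OF q(1)])
  then have "res (Polynomial.coeff g 0) = res (Polynomial.coeff h 0)"
    using assms h(1) by (simp add: res_diff integral_poly_def)
  then show ?thesis unfolding res_A_def h_def[symmetric] by simp
qed

lemma ev_in_A: "integral_poly g \<Longrightarrow> ev g \<pi> \<in> A" unfolding A_def by blast

lemma A_E: assumes "x \<in> A" obtains g where "integral_poly g" "x = ev g \<pi>" using assms unfolding A_def by blast

lemma A_E':
  assumes "x \<in> A" obtains g where "integral_poly g" "x = ev g \<pi>" "Polynomial.degree g < n"
proof -
  obtain g where g: "integral_poly g" "x = ev g \<pi>" using assms by (elim A_E)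
  obtain h q where h: "integral_poly h" "integral_poly q" "g = h + f * q" "Polynomial.degree h < n"
    using division[OF g(1)] by blast
  have "x = ev h \<pi>" unfolding g(2) h(3) by (simp add: ev_add ev_mult root)
  then show ?thesis using that h by blast
qed

lemma A_addI: "\<lbrakk>x \<in> A; y \<in> A\<rbrakk> \<Longrightarrow> x + y \<in> A"
  by (elim A_E) (metis ev_add ev_in_A integral_add)
lemma A_multI: "\<lbrakk>x \<in> A; y \<in> A\<rbrakk> \<Longrightarrow> x * y \<in> A"
  by (elim A_E) (metis ev_mult ev_in_A integral_mult)
lemma A_uminusI: "x \<in> A \<Longrightarrow> - x \<in> A"
  by (elim A_E) (metis ev_uminus ev_in_A integral_uminus)
lemma A_L: "x \<in> A \<Longrightarrow> x \<in> L" by (auto elim!: A_E intro: ev_in_L)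

lemma res_A_add: "\<lbrakk>x \<in> A; y \<in> A\<rbrakk> \<Longrightarrow> res_A (x + y) = res_A x + res_A y"
  by (auto elim!: A_E simp: res_A_ev integral_add res_add integral_coeff simp flip: ev_add)

lemma res_A_mult: "\<lbrakk>x \<in> A; y \<in> A\<rbrakk> \<Longrightarrow> res_A (x * y) = res_A x * res_A y"
  by (auto elim!: A_E simp: res_A_ev integral_mult res_mult integral_coeff coeff_mult simp flip: ev_mult)

lemma to_ac_A: "c \<in> \<O> \<Longrightarrow> to_ac c \<in> A" using ev_in_A[of "[:c:]"] by simp

lemma res_A_to_ac: "c \<in> \<O> \<Longrightarrow> res_A (to_ac c) = res c" using res_A_ev[of "[:c:]"] by simp

lemma pi_A: "\<pi> \<in> A" using ev_in_A[of "[:0, 1:]"] by (simp add: O_0 O_1)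

lemma res_A_pi: "res_A \<pi> = 0" using res_A_ev[of "[:0, 1:]"] by (simp add: O_0 O_1 res_0)

lemma res_A_1: "res_A 1 = 1" using res_A_to_ac[of 1] by (simp add: O_1 res_1)

text \<open>Modulo \<open>p\<close>, the ring \<open>A\<close> is \<open>'k[X]/(X\<^sup>n)\<close>; so a product of a unit residue with a primitive element
  is not divisible by \<open>p\<close>.\<close>

lemma A_inverseI:
  assumes x: "x \<in> A" "res_A x \<noteq> 0" shows "inverse x \<in> A"
proof -
  obtain g where g: "integral_poly g" "x = ev g \<pi>" using x(1) by (elim A_E)
  have xnz: "x \<noteq> 0" using x(2) res_A_to_ac[of 0] by (auto simp: O_0 res_0)
  obtain h where h: "inverse x = ev h \<pi>" "Polynomial.degree h < n" using L_inverse[OF A_L[OF x(1)] xnz] by (elim L_rep)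
  have "h \<noteq> 0" using h(1) xnz by auto
  then obtain c where c: "c \<noteq> 0" "integral_poly (Polynomial.smult (inverse c) h)" "red (Polynomial.smult (inverse c) h) \<noteq> 0"
    using poly_primitive by blast
  define h' where "h' = Polynomial.smult (inverse c) h"
  have h': "integral_poly h'" "red h' \<noteq> 0" "Polynomial.degree h' < n" using c h(2) by (simp_all add: h'_def)
  have evh: "ev (Polynomial.smult a w) \<pi> = to_ac a * ev w \<pi>" for a w
    using ev_mult[of "[:a:]" w \<pi>] by simp
  have inv: "inverse x = to_ac c * ev h' \<pi>" unfolding h(1) h'_def evh using c(1) by simp
  show ?thesis
  proof (cases "c \<in> \<O>")
    case True
    then show ?thesis unfolding inv by (intro A_multI to_ac_A ev_in_A h')
  next
    case False
    then have e: "inverse c \<in> \<O>" "res (inverse c) = 0" using O_or_inverse by blast+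
    have "x * (to_ac c * ev h' \<pi>) = 1" using xnz by (simp flip: inv)
    then have "ev g \<pi> * ev h' \<pi> = to_ac (inverse c)" using c(1) by (simp add: g(2) field_simps)
    then have z: "ev (g * h' - [:inverse c:]) \<pi> = 0" by (simp add: ev_diff ev_mult)
    have int: "integral_poly (g * h')" "integral_poly [:inverse c:]" using g h' e by (simp_all add: integral_mult)
    obtain q where q: "integral_poly q" "g * h' - [:inverse c:] = f * q"
      using integral_ev_eq_0[OF integral_diff[OF int] z] by blast
    have "g * h' = f * q + [:inverse c:]" using q(2) by (simp add: algebra_simps)
    then have "red (g * h') = red (f * q) + red [:inverse c:]"
      using red_add[OF integral_mult[OF integral_f q(1)] int(2)] by simp
    moreover have "red [:inverse c:] = 0" using e(2) by (simp add: red_def map_poly_pCons res_0)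
    ultimately have eq: "red g * red h' = Polynomial.monom 1 n * red q"
      using g(1) h'(1) q(1) by (simp add: red_mult integral_f red_f)
    have g0: "Polynomial.coeff (red g) 0 \<noteq> 0" using x(2) g by (simp add: coeff_red res_A_ev)
    then have "red g \<noteq> 0" by auto
    then have nz: "red g * red h' \<noteq> 0" using h'(2) by simp
    have "Polynomial.order 0 (red g) = 0" using g0 by (simp add: order_0I poly_0_coeff_0)
    then have "Polynomial.order 0 (red g * red h') \<le> Polynomial.degree (red h')"
      using order_mult[OF nz] order_0_le[OF h'(2)] by simp
    also have "\<dots> < n" using degree_red_le[of h'] h'(3) by simp
    finally have "Polynomial.order 0 (Polynomial.monom 1 n * red q) < n" unfolding eq .
    moreover have "Polynomial.order 0 (Polynomial.monom 1 n * red q) = n + Polynomial.order 0 (red q)"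
      using order_mult[of "Polynomial.monom 1 n" "red q" 0] nz eq by (simp add: order_0_monom)
    ultimately show ?thesis by simp
  qed
qed

text \<open>The equation f(\<pi>) = 0 reads \<pi>^n = -p U. The residue of U is that of f_n/p, which
  is nonzero.\<close>

definition "U = (\<Sum>i<n. to_ac (Polynomial.coeff f i / of_nat p) * \<pi> ^ i)"

lemma pi_power_n: "\<pi> ^ n = - (of_nat p * U)"
proof -
  have "0 = (\<Sum>i\<le>n. to_ac (Polynomial.coeff f i) * \<pi> ^ i)" using root by (simp add: ev_altdef deg)
  also have "{..n} = insert n {..<n}" by auto
  finally have "0 = \<pi> ^ n + (\<Sum>i<n. to_ac (Polynomial.coeff f i) * \<pi> ^ i)" by (simp add: coeff_n)
  moreover have "of_nat p * U = (\<Sum>i<n. to_ac (Polynomial.coeff f i) * \<pi> ^ i)"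
    unfolding U_def sum_distrib_left using prime_p by (intro sum.cong) (auto simp: prime_gt_0_nat)
  ultimately show ?thesis by (simp add: eq_neg_iff_add_eq_0)
qed

lemma U_unit: "U \<in> A" "res_A U \<noteq> 0"
proof -
  define g where "g = (\<Sum>i<n. Polynomial.monom (Polynomial.coeff f i / of_nat p) i)"
  have c: "Polynomial.coeff g i = (if i < n then Polynomial.coeff f i / of_nat p else 0)" for i
    unfolding g_def by (simp add: coeff_sum coeff_monom sum.delta)
  have int: "integral_poly g" unfolding integral_poly_def c using coeff_div_p O_0 by simp
  have U: "U = ev g \<pi>" unfolding U_def g_def by (simp add: ev_sum ev_monom)
  show "U \<in> A" unfolding U by (rule ev_in_A[OF int])
  show "res_A U \<noteq> 0" unfolding U res_A_ev[OF int] c using n_pos coeff_0_unit by simp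
qed

lemma pi_nz: "\<pi> \<noteq> 0"
proof
  assume "\<pi> = 0"
  then have "of_nat p * U = 0" using pi_power_n n_pos by (simp add: zero_power)
  then have "U = 0" using prime_p by (simp add: prime_gt_0_nat)
  then show False using U_unit(2) res_A_to_ac[of 0] by (simp add: O_0 res_0)
qed

lemma res_A_0_iff:
  assumes "x \<in> A" shows "res_A x = 0 \<longleftrightarrow> x / \<pi> \<in> A"
proof
  assume "x / \<pi> \<in> A"
  then have z: "res_A (\<pi> * (x / \<pi>)) = 0" unfolding res_A_mult[OF pi_A \<open>x / \<pi> \<in> A\<close>] res_A_pi by simp
  have "\<pi> * (x / \<pi>) = x" using pi_nz by simp
  then show "res_A x = 0" using z by metis
next
  assume z: "res_A x = 0"
  obtain g where g: "integral_poly g" "x = ev g \<pi>" using assms by (elim A_E)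
  obtain c h where ch: "g = Polynomial.pCons c h" by (cases g)
  have c: "c \<in> \<O>" "res c = 0" "integral_poly h" using g z res_A_ev[OF g(1)] by (simp_all add: ch)
  have "c / of_nat p \<in> \<O>" using res_0_iff[OF c(1)] c(2) by blast
  then have cA: "to_ac (c / of_nat p) \<in> A" by (rule to_ac_A)
  obtain m where m: "n = Suc m" using n_pos by (cases n) auto
  have Unz: "U \<noteq> 0" using pi_power_n pi_nz n_pos by auto
  have "to_ac c = of_nat p * to_ac (c / of_nat p)" using prime_p by (simp add: prime_gt_0_nat)
  moreover have "of_nat p = - (\<pi> ^ n * inverse U)" using pi_power_n Unz by (simp add: field_simps)
  ultimately have "to_ac c / \<pi> = - (\<pi> ^ m * inverse U) * to_ac (c / of_nat p)"
    using pi_nz by (simp add: m del: to_ac_divide)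
  moreover have "- (\<pi> ^ m * inverse U) \<in> A"
  proof -
    have "\<pi> ^ m \<in> A" using pi_A res_A_1 to_ac_A[OF O_1] by (induction m) (auto intro: A_multI)
    then show ?thesis by (intro A_uminusI A_multI A_inverseI U_unit)
  qed
  ultimately have "to_ac c / \<pi> \<in> A" using A_multI[OF _ cA] by metis
  moreover have "x / \<pi> = to_ac c / \<pi> + ev h \<pi>" using pi_nz by (simp add: g(2) ch add_divide_distrib)
  ultimately show "x / \<pi> \<in> A" using ev_in_A[OF c(3)] by (simp add: A_addI)
qed

definition "J k = {x. x / \<pi> ^ k \<in> A}"

lemma A_0: "0 \<in> A" using to_ac_A[OF O_0] by simp
lemma A_1: "1 \<in> A" using to_ac_A[OF O_1] by simp
lemma A_powerI: "x \<in> A \<Longrightarrow> x ^ k \<in> A" by (induction k) (auto intro: A_1 A_multI)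
lemma A_sumI: "(\<And>i. i \<in> S \<Longrightarrow> g i \<in> A) \<Longrightarrow> sum g S \<in> A"
  by (induction S rule: infinite_finite_induct) (auto intro: A_0 A_addI)

lemma J_iff: "x \<in> J k \<longleftrightarrow> (\<exists>y\<in>A. x = \<pi> ^ k * y)"
  using pi_nz by (force simp: J_def)
lemma J_add: "\<lbrakk>x \<in> J k; y \<in> J k\<rbrakk> \<Longrightarrow> x + y \<in> J k"
  by (simp add: J_def add_divide_distrib A_addI)
lemma J_uminus: "x \<in> J k \<Longrightarrow> - x \<in> J k"
  using A_uminusI[of "x / \<pi> ^ k"] by (simp add: J_def)
lemma J_mono: "\<lbrakk>x \<in> J k; j \<le> k\<rbrakk> \<Longrightarrow> x \<in> J j"
proof -
  assume "x \<in> J k" "j \<le> k"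
  then obtain y where "y \<in> A" "x = \<pi> ^ k * y" unfolding J_iff by blast
  then have "x = \<pi> ^ j * (\<pi> ^ (k - j) * y)"
    using \<open>j \<le> k\<close> by (simp add: power_add[symmetric] mult.assoc[symmetric])
  then show ?thesis using \<open>y \<in> A\<close> unfolding J_iff by (auto intro: A_multI A_powerI pi_A)
qed

lemma U_nz: "U \<noteq> 0" using pi_power_n pi_nz n_pos by auto

definition "E = - inverse U"

lemma E: "E \<in> A" "inverse E \<in> A" "E \<noteq> 0"
  unfolding E_def using U_nz A_inverseI[OF U_unit] U_unit(1) by (auto intro: A_uminusI)

lemma p_eq: "of_nat p = \<pi> ^ n * E" using pi_power_n U_nz by (simp add: E_def field_simps)

text \<open>Powers of \<pi> can be exchanged for powers of p up to units. Representations of degree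
  below n are unique, so every coefficient is divisible by all powers of p.\<close>

lemma separated_A:
  assumes x: "\<And>k. x / \<pi> ^ k \<in> A" shows "x = 0"
proof -
  obtain g where g: "integral_poly g" "x = ev g \<pi>" "Polynomial.degree g < n" using x[of 0] by (auto elim: A_E')
  have ck: "Polynomial.coeff g i / of_nat p ^ k \<in> \<O>" for i k
  proof -
    have "x / of_nat p ^ k = x / \<pi> ^ (n * k) * inverse E ^ k"
      unfolding p_eq by (simp add: power_mult power_mult_distrib divide_inverse power_inverse)
    also have "\<dots> \<in> A" using x E(2) by (intro A_multI A_powerI)
    finally obtain h where h: "integral_poly h" "x / of_nat p ^ k = ev h \<pi>" "Polynomial.degree h < n" by (elim A_E')
    have pk: "(of_nat p ^ k :: 'a alg_closure) \<noteq> 0" using prime_p by (simp add: prime_gt_0_nat)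
    have "ev ([:of_nat p ^ k:] * h) \<pi> = of_nat p ^ k * (x / of_nat p ^ k)" unfolding ev_mult h(2) by simp
    also have "\<dots> = x" using pk by simp
    finally have "ev (g - [:of_nat p ^ k:] * h) \<pi> = 0" unfolding ev_diff g(2) by simp
    moreover have "Polynomial.degree (g - [:of_nat p ^ k:] * h) < n"
      using g(3) h(3) by (intro degree_diff_less) (simp_all add: degree_smult_eq)
    ultimately have "g - [:of_nat p ^ k:] * h = 0" by (rule ev_eq_0_small)
    then have "Polynomial.coeff g i = of_nat p ^ k * Polynomial.coeff h i" by simp
    then show ?thesis using p_nz integral_coeff[OF h(1)] by simp
  qed
  have "Polynomial.coeff g i = 0" for i
  proof (rule ccontr)
    assume "Polynomial.coeff g i \<noteq> 0"
    then obtain r where r: "v (Polynomial.coeff g i) = ereal r" using v_real by blast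
    obtain k :: nat where "r < real k" using reals_Archimedean2 by blast
    then show False using ck[of i k] unfolding v_ge_iff[symmetric] r by simp
  qed
  then have "g = 0" by (simp add: poly_eq_iff)
  then show ?thesis using g(2) by simp
qed

text \<open>Digits with respect to the elements \<open>p\<^sup>q \<pi>\<^sup>i\<close>, \<open>i < n\<close>: only finitely many digits occur, and the
  positions of a given digit and a given \<open>i\<close> define a convergent series in \<open>Q\<close>.\<close>

lemma complete_A:
  assumes s: "\<And>k. s k \<in> A" and step: "\<And>k. (s (Suc k) - s k) / \<pi> ^ k \<in> A"
  shows "\<exists>y\<in>A. \<forall>k. (y - s k) / \<pi> ^ k \<in> A"
proof -
  \<comment> \<open>\<open>w j\<close> is \<pi>^j up to a unit, but it separates the power of p from
    an exponent of \<pi> below n.\<close>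
  define w where "w j = of_nat p ^ (j div n) * \<pi> ^ (j mod n)" for j
  have w: "w j = \<pi> ^ j * E ^ (j div n)" for j
  proof -
    have "\<pi> ^ j = \<pi> ^ (n * (j div n) + j mod n)" by simp
    then show ?thesis unfolding w_def p_eq power_mult_distrib power_add power_mult by (simp add: mult_ac)
  qed
  have w_nz: "w j \<noteq> 0" for j using pi_nz E(3) by (simp add: w)
  have dig: "\<exists>d. \<forall>t :: 'k. d t \<in> \<O> \<and> res (d t) = t"
    by (rule choice) (use res_lift in blast)
  then obtain d where d: "\<And>t. d t \<in> \<O>" "\<And>t. res (d t) = t" by blast
  \<comment> \<open>The partial digit expansion of the limit; the digit at position k is the residue
    of what is missing, divided by \<open>w k\<close>.\<close>
  define T where "T = rec_nat 0 (\<lambda>k x. x + w k * to_ac (d (res_A ((s (Suc k) - x) / w k))))"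
  define \<tau> where "\<tau> k = res_A ((s (Suc k) - T k) / w k)" for k
  have T: "T 0 = 0" "T (Suc k) = T k + w k * to_ac (d (\<tau> k))" for k by (simp_all add: T_def \<tau>_def)
  have inv: "s k - T k \<in> J k" for k
  proof (induction k)
    case 0 then show ?case using s[of 0] by (simp add: J_def T)
  next
    case (Suc k)
    define x where "x = (s (Suc k) - T k) / w k"
    have "s (Suc k) - s k + (s k - T k) \<in> J k" by (rule J_add[OF _ Suc]) (use step in \<open>simp add: J_def\<close>)
    then have "(s (Suc k) - T k) / \<pi> ^ k * inverse E ^ (k div n) \<in> A"
      using E(2) by (intro A_multI A_powerI) (simp_all add: J_def)
    moreover have "x = (s (Suc k) - T k) / \<pi> ^ k * inverse E ^ (k div n)"
      unfolding x_def w by (simp add: divide_inverse power_inverse)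
    ultimately have xA: "x \<in> A" by simp
    have dA: "- to_ac (d (\<tau> k)) \<in> A" by (intro A_uminusI to_ac_A d)
    then have y: "x + - to_ac (d (\<tau> k)) \<in> A" using xA by (intro A_addI)
    have "res_A (- to_ac (d (\<tau> k))) = - \<tau> k"
      using res_A_to_ac[OF O_uminus[OF d(1)]] by (simp add: res_uminus d)
    moreover have "res_A x = \<tau> k" by (simp add: \<tau>_def x_def)
    ultimately have "res_A (x + - to_ac (d (\<tau> k))) = 0" unfolding res_A_add[OF xA dA] by simp
    then have "(x + - to_ac (d (\<tau> k))) / \<pi> \<in> A" using res_A_0_iff[OF y] by blast
    then have "E ^ (k div n) * ((x + - to_ac (d (\<tau> k))) / \<pi>) \<in> A" using E(1) by (intro A_multI A_powerI)
    moreover have "s (Suc k) - T (Suc k) = w k * (x + - to_ac (d (\<tau> k)))"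
      using w_nz[of k] by (simp add: T x_def algebra_simps)
    then have "(s (Suc k) - T (Suc k)) / \<pi> ^ Suc k = E ^ (k div n) * ((x + - to_ac (d (\<tau> k))) / \<pi>)"
      unfolding w using pi_nz by simp
    ultimately show ?case by (simp add: J_def)
  qed
  have "\<exists>y\<in>Q. \<forall>m. (y - (\<Sum>q<m. (if \<tau> (q * n + i) = t then 1 else 0) * of_nat p ^ q)) / of_nat p ^ m \<in> \<O>" for i t
    by (rule padic_series) simp
  then obtain y where y: "\<And>i t m. (y i t - (\<Sum>q<m. (if \<tau> (q * n + i) = t then 1 else 0) * of_nat p ^ q)) / of_nat p ^ m \<in> \<O>"
    by metis
  define z where "z = (\<Sum>i<n. \<pi> ^ i * to_ac (\<Sum>t\<in>UNIV. d t * y i t))"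
  have z: "z - T (m * n) \<in> J (m * n)" for m
  proof -
    define b where "b i t = (\<Sum>q<m. (if \<tau> (q * n + i) = t then 1 else (0 :: 'a)) * of_nat p ^ q)" for i t
    have "T k = (\<Sum>j<k. w j * to_ac (d (\<tau> j)))" for k by (induction k) (simp_all add: T)
    \<comment> \<open>Positions are grouped into blocks of length n, one block for each power of
      p.\<close>
    then have "T (m * n) = (\<Sum>q<m. \<Sum>j\<in>{q * n..<q * n + n}. w j * to_ac (d (\<tau> j)))"
      by (simp add: sum.nat_group)
    also have "\<dots> = (\<Sum>q<m. \<Sum>i<n. w (i + q * n) * to_ac (d (\<tau> (i + q * n))))"
    proof (rule sum.cong[OF refl])
      fix q
      have "{q * n..<q * n + n} = {0 + q * n..<n + q * n}" by (simp add: add.commute)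
      then show "(\<Sum>j\<in>{q * n..<q * n + n}. w j * to_ac (d (\<tau> j))) = (\<Sum>i<n. w (i + q * n) * to_ac (d (\<tau> (i + q * n))))"
        by (simp only: sum.shift_bounds_nat_ivl atLeast0LessThan)
    qed
    also have "\<dots> = (\<Sum>i<n. \<Sum>q<m. \<pi> ^ i * to_ac (\<Sum>t\<in>UNIV. d t * ((if \<tau> (q * n + i) = t then 1 else 0) * of_nat p ^ q)))"
    proof (subst sum.swap, intro sum.cong refl)
      fix i q assume "i \<in> {..<n}"
      then have wi: "w (i + q * n) = of_nat p ^ q * \<pi> ^ i" unfolding w_def by simp
      have "(\<Sum>t\<in>UNIV. d t * ((if \<tau> (q * n + i) = t then 1 else 0) * of_nat p ^ q))
          = (\<Sum>t\<in>UNIV. if \<tau> (q * n + i) = t then d t * of_nat p ^ q else 0)"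
        by (intro sum.cong) auto
      also have "\<dots> = d (\<tau> (q * n + i)) * of_nat p ^ q" using finite_residue_field by (simp add: sum.delta)
      finally show "w (i + q * n) * to_ac (d (\<tau> (i + q * n)))
          = \<pi> ^ i * to_ac (\<Sum>t\<in>UNIV. d t * ((if \<tau> (q * n + i) = t then 1 else 0) * of_nat p ^ q))"
        unfolding wi by (simp add: add.commute)
    qed
    also have "\<dots> = (\<Sum>i<n. \<pi> ^ i * to_ac (\<Sum>t\<in>UNIV. d t * b i t))"
      unfolding b_def sum_distrib_left[symmetric] to_ac_sum[symmetric]
      by (rule sum.cong[OF refl], subst sum.swap) (simp only: sum_distrib_left)
    finally have Tm: "T (m * n) = (\<Sum>i<n. \<pi> ^ i * to_ac (\<Sum>t\<in>UNIV. d t * b i t))" .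
    have pm: "(of_nat p ^ m :: 'a) \<noteq> 0" "(of_nat p ^ m :: 'a alg_closure) \<noteq> 0" using prime_p by (auto simp: prime_gt_0_nat)
    have "z - T (m * n) = (\<Sum>i<n. \<pi> ^ i * to_ac (\<Sum>t\<in>UNIV. d t * (y i t - b i t)))"
      unfolding z_def Tm by (simp add: sum_subtractf right_diff_distrib)
    also have "\<dots> = of_nat p ^ m * (\<Sum>i<n. \<pi> ^ i * to_ac (\<Sum>t\<in>UNIV. d t * ((y i t - b i t) / of_nat p ^ m)))"
      unfolding sum_distrib_left
    proof (intro sum.cong refl)
      fix i
      have "(\<Sum>t\<in>UNIV. d t * (y i t - b i t)) = of_nat p ^ m * (\<Sum>t\<in>UNIV. d t * ((y i t - b i t) / of_nat p ^ m))"
        unfolding sum_distrib_left using pm by (intro sum.cong refl) simp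
      then show "\<pi> ^ i * to_ac (\<Sum>t\<in>UNIV. d t * (y i t - b i t))
          = of_nat p ^ m * (\<pi> ^ i * to_ac (\<Sum>t\<in>UNIV. d t * ((y i t - b i t) / of_nat p ^ m)))"
        by simp
    qed
    finally have eq: "z - T (m * n) = of_nat p ^ m * (\<Sum>i<n. \<pi> ^ i * to_ac (\<Sum>t\<in>UNIV. d t * ((y i t - b i t) / of_nat p ^ m)))" .
    define S where "S = (\<Sum>i<n. \<pi> ^ i * to_ac (\<Sum>t\<in>UNIV. d t * ((y i t - b i t) / of_nat p ^ m)))"
    have "S \<in> A" unfolding S_def
      using d y unfolding b_def by (intro A_sumI A_multI A_powerI pi_A to_ac_A O_sum O_mult)
    then have "E ^ m * S \<in> A" using E(1) by (intro A_multI A_powerI)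
    moreover have "(of_nat p ^ m :: 'a alg_closure) = \<pi> ^ (m * n) * E ^ m"
      unfolding p_eq by (simp add: power_mult_distrib mult.commute[of m n] power_mult)
    then have "z - T (m * n) = \<pi> ^ (m * n) * (E ^ m * S)" unfolding eq S_def[symmetric] by (simp only: mult.assoc)
    ultimately show ?thesis unfolding J_iff by blast
  qed
  have far: "s (k + l) - s k \<in> J k" for k l
  proof (induction l)
    case (Suc l)
    have "s (Suc (k + l)) - s (k + l) \<in> J (k + l)" using step by (simp add: J_def)
    then have "s (Suc (k + l)) - s (k + l) \<in> J k" by (rule J_mono) simp
    from J_add[OF this Suc] show ?case by simp
  qed (simp add: J_def A_0)
  have lim: "z - s k \<in> J k" for k
  proof -
    have nk: "k \<le> k * n" using n_pos by simp
    have 1: "z - T (k * n) \<in> J k" by (rule J_mono[OF z nk])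
    have 2: "- (s (k * n) - T (k * n)) \<in> J k" by (rule J_uminus[OF J_mono[OF inv nk]])
    have "s (k + (k * n - k)) - s k \<in> J k" by (rule far)
    then have 3: "s (k * n) - s k \<in> J k" using nk by simp
    from J_add[OF J_add[OF 1 2] 3] show ?thesis by simp
  qed
  have "z - s 0 \<in> A" using lim[of 0] by (simp add: J_def)
  then have "z \<in> A" using A_addI[OF _ s[of 0]] by fastforce
  then show ?thesis using lim unfolding J_def by blast
qed

theorem totally_ramified_A:
  assumes odd: "odd p" and n: "n = p^2"
  shows "totally_ramified p (to_ac ` \<O>) A \<pi> res_A"
proof
  show "Factorial_Ring.prime p" by (rule prime_p)
  show "odd p" by (rule odd)
  show "to_ac ` \<O> \<subseteq> A" using to_ac_A by blast
  show "1 \<in> to_ac ` \<O>" using O_1 by (intro image_eqI[of _ _ 1]) auto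
  show "x + y \<in> to_ac ` \<O>" if "x \<in> to_ac ` \<O>" "y \<in> to_ac ` \<O>" for x y
    using that O_add by (auto simp flip: to_ac_add)
  show "x * y \<in> to_ac ` \<O>" if "x \<in> to_ac ` \<O>" "y \<in> to_ac ` \<O>" for x y
    using that O_mult by (auto simp flip: to_ac_mult)
  show "- x \<in> to_ac ` \<O>" if "x \<in> to_ac ` \<O>" for x
    using that O_uminus by (auto simp flip: to_ac_minus)
  show "\<exists>x\<in>to_ac ` \<O>. res_A x = t" for t using res_lift[of t] res_A_to_ac by auto
  show "\<exists>u. u ^ p = t" for t :: 'k by (rule frobenius_surj)
  show "x / of_nat p \<in> to_ac ` \<O>" if x: "x \<in> to_ac ` \<O>" "res_A x = 0" for x
  proof -
    obtain c where c: "c \<in> \<O>" "x = to_ac c" using x(1) by blast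
    then have "c / of_nat p \<in> \<O>" using x(2) res_0_iff res_A_to_ac by simp
    then show ?thesis unfolding c(2) by (intro image_eqI[of _ _ "c / of_nat p"]) simp_all
  qed
  show "inverse x \<in> to_ac ` \<O>" if x: "x \<in> to_ac ` \<O>" "res_A x \<noteq> 0" for x
  proof -
    obtain c where c: "c \<in> \<O>" "x = to_ac c" using x(1) by blast
    then have "inverse c \<in> \<O>" using x(2) O_inverse res_A_to_ac by simp
    then show ?thesis unfolding c(2) by (intro image_eqI[of _ _ "inverse c"]) simp_all
  qed
  show "of_nat p / \<pi> ^ p^2 \<in> A" using p_eq E(1) pi_nz by (simp add: n)
  have "\<pi> ^ p^2 / of_nat p = inverse E" unfolding p_eq n[symmetric] using pi_nz by (simp add: divide_inverse)
  then show "\<pi> ^ p^2 / of_nat p \<in> A" using E(2) by metis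
  show "\<exists>y\<in>A. \<forall>k. (y - s k) / \<pi> ^ k \<in> A" if "\<And>k. s k \<in> A" "\<And>k. (s (Suc k) - s k) / \<pi> ^ k \<in> A" for s
    using that by (rule complete_A)
qed (use A_addI A_multI A_uminusI pi_nz pi_A res_A_add res_A_mult res_A_1 res_A_0_iff A_inverseI separated_A in auto)

end

section \<open>The criterion\<close>

locale cyclic_criterion = eisenstein_root p v Q res f "p^2" \<pi>
  for p :: nat and v :: "'a :: field_char_0 \<Rightarrow> ereal" and Q :: "'a set" and res :: "'a \<Rightarrow> 'k :: field"
    and f :: "'a poly" and \<pi> :: "'a alg_closure" +
  assumes odd_p: "odd p"
begin

lemma TR: "totally_ramified p (to_ac ` \<O>) A \<pi> res_A"
  by (rule totally_ramified_A[OF odd_p refl])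

sublocale TR: totally_ramified p "to_ac ` \<O>" A \<pi> res_A
  by (rule TR)

lemma to_ac_R_iff: "to_ac x \<in> to_ac ` \<O> \<longleftrightarrow> x \<in> \<O>" by auto

definition "valuation_conditions \<longleftrightarrow>
  Polynomial.coeff f (p * (p - 1)) / of_nat p \<in> \<O> \<and> res (Polynomial.coeff f (p * (p - 1)) / of_nat p) \<noteq> 0
  \<and> (\<forall>q\<in>{1..<p - 1}. Polynomial.coeff f (p * q) / of_nat p ^ 2 \<in> \<O>)
  \<and> (\<forall>j\<in>{1..<p}. Polynomial.coeff f (p * (p - 1) + j) / of_nat p ^ 2 \<in> \<O>)
  \<and> Polynomial.coeff f (p * (p - 1) - 1) / of_nat p ^ 2 \<in> \<O>
  \<and> res (Polynomial.coeff f (p * (p - 1) - 1) / of_nat p ^ 2) \<noteq> 0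
  \<and> (\<forall>i<p * (p - 1) - 1. \<not> p dvd i \<longrightarrow> Polynomial.coeff f i / of_nat p ^ 3 \<in> \<O>)"

text \<open>A root y not divisible by \<pi> has its inverse t in \<open>A\<close>. Then t^(p^2) f(y)
  = 0 writes 1 as a combination of the lower coefficients of f, all of residue 0, which is
  impossible.\<close>

lemma root_in_I_1:
  assumes y: "y \<in> L" "ev f y = 0" shows "y \<in> TR.I 1"
proof (cases "y = 0")
  case True then show ?thesis by (simp add: TR.I_zero)
next
  case False
  obtain h where h: "y = ev h \<pi>" using y(1) by (elim L_E)
  then have "h \<noteq> 0" using False by auto
  then obtain c where c: "c \<noteq> 0" "integral_poly (Polynomial.smult (inverse c) h)" using poly_primitive by blast
  define w where "w = ev (Polynomial.smult (inverse c) h) \<pi>"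
  have w: "w \<in> A" unfolding w_def by (rule ev_in_A[OF c(2)])
  have "w = to_ac (inverse c) * y" unfolding w_def h using ev_mult[of "[:inverse c:]" h \<pi>] by simp
  then have yw: "y = to_ac c * w" using c(1) by simp
  have "\<exists>a b. a \<in> A \<and> b \<in> A \<and> b \<noteq> 0 \<and> y = a / b"
  proof (cases "c \<in> \<O>")
    case True
    then show ?thesis using w yw by (intro exI[of _ y] exI[of _ 1]) (simp add: A_1 A_multI to_ac_A)
  next
    case False
    then have "inverse c \<in> \<O>" using O_or_inverse by blast
    then have "to_ac (inverse c) \<in> A" by (rule to_ac_A)
    moreover have "to_ac (inverse c) \<noteq> 0" "y = w / to_ac (inverse c)" using yw c(1) by (simp_all add: divide_inverse)
    ultimately show ?thesis using w by blast
  qed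
  then obtain a b where ab: "a \<in> A" "b \<in> A" "b \<noteq> 0" "y = a / b" by blast
  have "a \<noteq> 0" using ab False by auto
  obtain j where "a \<in> TR.I j" "a \<notin> TR.I (j + 1)" using TR.exists_val[OF ab(1) \<open>a \<noteq> 0\<close>] by blast
  then obtain u where u: "u \<in> A" "res_A u \<noteq> 0" "a = \<pi> ^ j * u" by (rule TR.val_unit)
  obtain k where "b \<in> TR.I k" "b \<notin> TR.I (k + 1)" using TR.exists_val[OF ab(2,3)] by blast
  then obtain w where w: "w \<in> A" "res_A w \<noteq> 0" "b = \<pi> ^ k * w" by (rule TR.val_unit)
  have nz: "u \<noteq> 0" "w \<noteq> 0" using u w TR.res_0 by auto
  show ?thesis
  proof (cases "k < j")
    case True
    have "y = \<pi> ^ (j - k) * (u / w)"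
      unfolding ab(4) u(3) w(3) using nz True pi_nz by (simp add: power_diff)
    then have "y \<in> TR.I (j - k)" using TR.pi_mult_I[OF TR.A_divide[OF u(1) w(1,2)], of "j - k"] by simp
    then show ?thesis by (rule TR.I_mono) (use True in simp)
  next
    case False
    define t where "t = \<pi> ^ (k - j) * (w / u)"
    have t: "t \<in> A" unfolding t_def using TR.A_divide[OF w(1) u(1,2)] by (intro A_multI A_powerI pi_A)
    have ty: "t * y = 1"
      unfolding ab(4) u(3) w(3) t_def using nz False pi_nz by (simp add: power_diff field_simps)
    have cI: "to_ac (Polynomial.coeff f i) \<in> TR.I 1" if "i < p^2" for i
    proof -
      have "res (Polynomial.coeff f i) = 0" using res_0_iff[OF coeff_O] coeff_div_p[OF that] by blast
      then show ?thesis using TR.res_eq_0_I[OF to_ac_A[OF coeff_O]] res_A_to_ac[OF coeff_O] by simp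
    qed
    have "0 = t ^ p^2 * (\<Sum>i\<le>p\<^sup>2. to_ac (Polynomial.coeff f i) * y ^ i)" using y(2) by (simp add: ev_altdef deg)
    also have "{..p^2} = insert (p^2) {..<p^2}" by auto
    also have "t ^ p^2 * (\<Sum>i\<in>insert (p^2) {..<p^2}. to_ac (Polynomial.coeff f i) * y ^ i)
        = (t * y) ^ p^2 + (\<Sum>i<p^2. t ^ p^2 * (to_ac (Polynomial.coeff f i) * y ^ i))"
      by (simp add: coeff_n sum_distrib_left power_mult_distrib algebra_simps)
    finally have one: "1 = - (\<Sum>i<p^2. t ^ p^2 * (to_ac (Polynomial.coeff f i) * y ^ i))"
      unfolding ty by (simp add: eq_neg_iff_add_eq_0)
    have "t ^ p^2 * (to_ac (Polynomial.coeff f i) * y ^ i) \<in> TR.I 1" if "i \<in> {..<p^2}" for i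
    proof -
      have "t ^ p^2 * y ^ i = t ^ (p^2 - i) * (t * y) ^ i"
        using that by (simp add: power_mult_distrib mult.assoc[symmetric] flip: power_add)
      then have "t ^ p^2 * (to_ac (Polynomial.coeff f i) * y ^ i) = t ^ (p^2 - i) * to_ac (Polynomial.coeff f i)"
        unfolding ty by (simp add: mult_ac)
      moreover have "t ^ (p^2 - i) * to_ac (Polynomial.coeff f i) \<in> TR.I 1"
        using that t cI by (intro TR.A_I_mult A_powerI) auto
      ultimately show ?thesis by (simp only:)
    qed
    then have "1 \<in> TR.I 1" by (subst one) (intro TR.I_uminus TR.I_sum)
    then have "res_A 1 = 0" using TR.res_eq_0_I[OF A_1] by blast
    then show ?thesis using res_A_1 by simp
  qed
qed

lemma K_hom_is_auto:
  assumes "K_hom \<sigma>" shows "TR.is_auto \<sigma>"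
proof -
  have s\<pi>: "\<sigma> \<pi> \<in> TR.I 1"
    by (rule root_in_I_1) (intro K_homD(1)[OF assms alpha_L] K_hom_root[OF assms alpha_L root])+
  have sA: "\<sigma> \<pi> \<in> A" by (rule TR.I_A[OF s\<pi>])
  have ev: "ev g (\<sigma> \<pi>) \<in> A" if "integral_poly g" for g
    using that
  proof (induction g)
    case 0 then show ?case by (simp add: A_0)
  next
    case (pCons c g) then show ?case using sA by (simp add: A_addI A_multI to_ac_A)
  qed
  have "\<sigma> x \<in> A" if "x \<in> A" for x
  proof -
    from that obtain g where g: "integral_poly g" "x = ev g \<pi>" by (elim A_E)
    show ?thesis unfolding g(2) K_hom_ev[OF assms alpha_L] by (rule ev[OF g(1)])
  qed
  then show ?thesis unfolding TR.is_auto_def using s\<pi> K_homD[OF assms] A_L by blast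
qed

lemma wild_eisensteinI:
  assumes "valuation_conditions"
  shows "wild_eisenstein p (to_ac ` \<O>) A \<pi> res_A (\<lambda>i. to_ac (Polynomial.coeff f i))"
proof -
  have e: "to_ac x / of_nat p = to_ac (x / of_nat p)" "to_ac x / of_nat p ^ k = to_ac (x / of_nat p ^ k)" for x :: 'a and k
    by simp_all
  note V = assms[unfolded valuation_conditions_def]
  have p2: "0 < p^2" using TR.p_pos by simp
  show ?thesis
  proof (intro wild_eisenstein.intro TR wild_eisenstein_axioms.intro, unfold e to_ac_R_iff)
    show "to_ac (Polynomial.coeff f (p^2)) = 1" by (simp add: coeff_n)
    show 0: "Polynomial.coeff f 0 / of_nat p \<in> \<O>" by (rule coeff_div_p[OF p2])
    show "res_A (to_ac (Polynomial.coeff f 0 / of_nat p)) \<noteq> 0"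
      unfolding res_A_to_ac[OF 0] by (rule coeff_0_unit)
    show "(\<Sum>i\<le>p\<^sup>2. to_ac (Polynomial.coeff f i) * \<pi> ^ i) = 0" using root by (simp add: ev_altdef deg)
    show "res_A (to_ac (Polynomial.coeff f (p * (p - 1)) / of_nat p)) \<noteq> 0"
        "res_A (to_ac (Polynomial.coeff f (p * (p - 1) - 1) / of_nat p ^ 2)) \<noteq> 0"
      using V res_A_to_ac by metis+
  qed (use V in blast)+
qed

lemma galois_cyclic_imp_valuation_conditions:
  assumes \<sigma>: "K_hom \<sigma>" and distinct: "\<And>m. \<lbrakk>0 < m; m < p^2\<rbrakk> \<Longrightarrow> (\<sigma> ^^ m) \<pi> \<noteq> \<pi>"
  shows "valuation_conditions" "\<sigma> \<pi> - \<pi> \<in> TR.I 2" "\<sigma> \<pi> - \<pi> \<notin> TR.I 3"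
proof -
  have auto: "TR.is_auto \<sigma>" by (rule K_hom_is_auto[OF \<sigma>])
  have per: "(\<sigma> ^^ p^2) \<pi> = \<pi>" by (rule funpow_n_alpha[OF \<sigma>]) (rule distinct)
  show b: "\<sigma> \<pi> - \<pi> \<in> TR.I 2" by (rule TR.cyclic_breaks(1)[OF auto per]) (rule distinct)
  show b': "\<sigma> \<pi> - \<pi> \<notin> TR.I 3" by (rule TR.cyclic_breaks(2)[OF auto per]) (rule distinct)
  have b3: "(\<sigma> ^^ p) \<pi> - \<pi> \<in> TR.I (p + 2)" by (rule TR.cyclic_breaks(3)[OF auto per]) (rule distinct)
  have b4: "(\<sigma> ^^ p) \<pi> - \<pi> \<notin> TR.I (p + 3)" by (rule TR.cyclic_breaks(4)[OF auto per]) (rule distinct)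
  have e: "to_ac x / of_nat p = to_ac (x / of_nat p)" "to_ac x / of_nat p ^ k = to_ac (x / of_nat p ^ k)" for x :: 'a and k
    by simp_all
  have c: "Polynomial.coeff (map_poly to_ac f) i = to_ac (Polynomial.coeff f i)" for i by (simp add: coeff_map_poly)
  have F: "map_poly to_ac f = (\<Prod>k<p^2. [:- (\<sigma> ^^ k) \<pi>, 1:])" by (rule poly_eq_prod[OF \<sigma>]) (rule distinct)
  have FR: "Polynomial.coeff (map_poly to_ac f) i \<in> to_ac ` \<O>" for i unfolding c using coeff_O by blast
  note first' = TR.cyclic_coefficients_first[OF auto F FR _ b b' b3 b4, unfolded c e to_ac_R_iff]
  note second' = TR.cyclic_coefficients_second[OF auto F FR _ b b' b3 b4, unfolded c e to_ac_R_iff]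
  have first: "\<And>i. \<lbrakk>i < TR.M - 1; \<not> p dvd i\<rbrakk> \<Longrightarrow> Polynomial.coeff f i / of_nat p ^ 3 \<in> \<O>"
      "\<And>i. \<lbrakk>i < p^2; \<not> p dvd i\<rbrakk> \<Longrightarrow> Polynomial.coeff f i / of_nat p ^ 2 \<in> \<O>"
      "res_A (to_ac (Polynomial.coeff f (TR.M - 1) / of_nat p ^ 2)) \<noteq> 0"
    using first'[OF coeff_div_p] by blast+
  have second: "\<And>q. q \<in> {1..<p - 1} \<Longrightarrow> Polynomial.coeff f (p * q) / of_nat p ^ 2 \<in> \<O>"
      "res_A (to_ac (Polynomial.coeff f TR.M / of_nat p)) \<noteq> 0"
    using second'[OF coeff_div_p] by blast+
  have M: "TR.M = p * (p - 1)" by (rule TR.M_def)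
  have n: "TR.M + p = p^2" "2 * p \<le> TR.M" "p + 3 \<le> TR.M" by (rule TR.M_facts)+
  have M1: "\<not> p dvd TR.M - 1"
  proof
    assume "p dvd TR.M - 1"
    then have "p dvd TR.M - (TR.M - 1)" by (rule dvd_diff_nat[rotated]) (simp only: M dvd_triv_left)
    moreover have "TR.M - (TR.M - 1) = 1" using n by linarith
    ultimately have "p dvd 1" by metis
    then show False using TR.p_ge_3 dvd_imp_le[of p 1] by simp
  qed
  have Mp: "Polynomial.coeff f TR.M / of_nat p \<in> \<O>" by (rule coeff_div_p) (use n TR.p_ge_3 in linarith)
  moreover have "res (Polynomial.coeff f TR.M / of_nat p) \<noteq> 0"
    using second(2) unfolding res_A_to_ac[OF Mp] .
  moreover have "Polynomial.coeff f (TR.M + j) / of_nat p ^ 2 \<in> \<O>" if "j \<in> {1..<p}" for j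
  proof (rule first(2))
    show "TR.M + j < p^2" using that n by simp
    have "\<not> p dvd j" using that by (auto dest: dvd_imp_le)
    then show "\<not> p dvd TR.M + j" using dvd_add_right_iff[of p TR.M j] unfolding M by simp
  qed
  moreover have M1': "Polynomial.coeff f (TR.M - 1) / of_nat p ^ 2 \<in> \<O>"
    by (rule first(2)[OF _ M1]) (use n TR.p_ge_3 in linarith)
  moreover have "res (Polynomial.coeff f (TR.M - 1) / of_nat p ^ 2) \<noteq> 0"
    using first(3) unfolding res_A_to_ac[OF M1'] .
  ultimately show "valuation_conditions"
    unfolding valuation_conditions_def M using first(1)[unfolded M] second(1) by blast
qed

lemma f_eval_eq:
  assumes "valuation_conditions"
  shows "wild_eisenstein.f_eval p (\<lambda>i. to_ac (Polynomial.coeff f i)) x = ev f x"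
proof -
  interpret W: wild_eisenstein p "to_ac ` \<O>" A \<pi> res_A "\<lambda>i. to_ac (Polynomial.coeff f i)"
    by (rule wild_eisensteinI[OF assms])
  show ?thesis unfolding W.f_eval_def by (simp add: ev_altdef deg)
qed

theorem galois_cyclic_iff:
  "galois_cyclic_of_degree (p^2) (adjoin_root \<pi>) \<longleftrightarrow> valuation_conditions
    \<and> (\<exists>\<theta>\<in>\<O>. res \<theta> ^ (p * (p - 1))
        = - res (Polynomial.coeff f (p * (p - 1)) / of_nat p) / res (Polynomial.coeff f 0 / of_nat p))
    \<and> wild_eisenstein.residue_conditions p (to_ac ` \<O>) res_A (\<lambda>i. to_ac (Polynomial.coeff f i))"
  (is "_ \<longleftrightarrow> _ \<and> ?root \<and> ?conditions")
proof
  assume "galois_cyclic_of_degree (p^2) (adjoin_root \<pi>)"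
  then obtain \<sigma> where \<sigma>: "K_hom \<sigma>" "\<And>m. \<lbrakk>0 < m; m < p^2\<rbrakk> \<Longrightarrow> (\<sigma> ^^ m) \<pi> \<noteq> \<pi>"
    using galois_cyclicD by blast
  have V: "valuation_conditions" by (rule galois_cyclic_imp_valuation_conditions(1)[OF \<sigma>(1)]) (rule \<sigma>(2))
  have b: "\<sigma> \<pi> - \<pi> \<in> TR.I 2" by (rule galois_cyclic_imp_valuation_conditions(2)[OF \<sigma>(1)]) (rule \<sigma>(2))
  have b': "\<sigma> \<pi> - \<pi> \<notin> TR.I 3" by (rule galois_cyclic_imp_valuation_conditions(3)[OF \<sigma>(1)]) (rule \<sigma>(2))
  interpret W: wild_eisenstein p "to_ac ` \<O>" A \<pi> res_A "\<lambda>i. to_ac (Polynomial.coeff f i)"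
    by (rule wild_eisensteinI[OF V])
  obtain s where s: "s \<in> A" "\<sigma> \<pi> - \<pi> = \<pi> ^ 2 * s" using b by (elim TR.I_E)
  \<comment> \<open>The quotient (\<sigma> \<pi> - \<pi>)/\<pi>^2 is split into an element of the
    base with the same residue and a multiple of \<pi>.\<close>
  obtain \<theta> where \<theta>: "\<theta> \<in> to_ac ` \<O>" "s - \<theta> \<in> TR.I 1" using TR.A_approx[OF s(1)] by blast
  then obtain r where r: "r \<in> A" "s - \<theta> = \<pi> ^ 1 * r" by (elim TR.I_E)
  have sr: "s = \<theta> + \<pi> * r" using r(2) by (simp add: algebra_simps)
  have unit: "res_A \<theta> \<noteq> 0"
  proof
    assume "res_A \<theta> = 0"
    then have "\<theta> \<in> TR.I 1" using TR.res_eq_0_I[OF TR.R_A[OF \<theta>(1)]] by blast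
    then have "s \<in> TR.I 1" using TR.I_add[OF \<theta>(2), of \<theta>] by simp
    from TR.I_mult[OF TR.pi_I[of 2] this] have "\<sigma> \<pi> - \<pi> \<in> TR.I (2 + 1)" unfolding s(2) .
    then show False using b' by simp
  qed
  have "\<sigma> \<pi> = \<pi> * (1 + \<pi> * s)" using s(2) by (simp add: algebra_simps power2_eq_square)
  moreover have "W.f_eval (\<sigma> \<pi>) = 0"
    unfolding f_eval_eq[OF V] by (rule K_hom_root[OF \<sigma>(1) alpha_L root])
  ultimately have "W.f_eval (\<pi> * (1 + \<pi> * s)) \<in> TR.I (3 * p^2 + 1)" by (simp add: TR.I_zero)
  then have Sig: "W.Sigma_p (\<theta> + \<pi> * r) \<in> TR.I (p^2 + 1)" using W.f_eval_I_iff[OF s(1)] unfolding sr by blast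
  note R = W.root_imp_residue_conditions[OF \<theta>(1) unit r(1) Sig]
  obtain t where t: "t \<in> \<O>" "\<theta> = to_ac t" using \<theta>(1) by blast
  have "res_A W.\<phi>1 = res (Polynomial.coeff f (p * (p - 1)) / of_nat p)"
    using V res_A_to_ac unfolding W.\<phi>1_def valuation_conditions_def by (metis to_ac_divide to_ac_of_nat)
  moreover have "res_A W.\<phi>0 = res (Polynomial.coeff f 0 / of_nat p)"
    using res_A_to_ac[OF coeff_div_p[of 0]] unfolding W.\<phi>0_def by simp
  ultimately have ?root using R(1) t res_A_to_ac by auto
  then show "valuation_conditions \<and> ?root \<and> ?conditions" using V R(2) by blast
next
  assume H: "valuation_conditions \<and> ?root \<and> ?conditions"
  then have V: "valuation_conditions" by blast
  interpret W: wild_eisenstein p "to_ac ` \<O>" A \<pi> res_A "\<lambda>i. to_ac (Polynomial.coeff f i)"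
    by (rule wild_eisensteinI[OF V])
  obtain t where t: "t \<in> \<O>" "res t ^ (p * (p - 1))
      = - res (Polynomial.coeff f (p * (p - 1)) / of_nat p) / res (Polynomial.coeff f 0 / of_nat p)" using H by blast
  have "res_A W.\<phi>1 = res (Polynomial.coeff f (p * (p - 1)) / of_nat p)"
    using V res_A_to_ac unfolding W.\<phi>1_def valuation_conditions_def by (metis to_ac_divide to_ac_of_nat)
  moreover have "res_A W.\<phi>0 = res (Polynomial.coeff f 0 / of_nat p)"
    using res_A_to_ac[OF coeff_div_p[of 0]] unfolding W.\<phi>0_def by simp
  ultimately have th: "to_ac t \<in> to_ac ` \<O>" "res_A (to_ac t) ^ (p * (p - 1)) = - res_A W.\<phi>1 / res_A W.\<phi>0"
    using t res_A_to_ac by auto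
  define \<theta> where "\<theta> = to_ac t"
  note th = th[folded \<theta>_def]
  have unit: "res_A \<theta> \<noteq> 0" using th(2) W.coeff_unit TR.p_ge_3 by (auto simp: zero_power)
  obtain r0 where r0: "r0 \<in> A" "res_A (\<theta> + W.\<gamma> * (r0 - \<theta> ^ 2)) = 0" "W.Sigma_p (\<theta> + \<pi> * r0) \<in> TR.I (p^2 + 1)"
    using W.residue_conditions_imp_root[OF _ th] H by blast
  have sA: "\<theta> + \<pi> * r0 \<in> A" using TR.R_A[OF th(1)] r0(1) by (intro TR.A_closed)
  have "W.f_eval (\<pi> * (1 + \<pi> * (\<theta> + \<pi> * r0))) \<in> TR.I (3 * p^2 + 1)" using W.f_eval_I_iff[OF sA] r0(3) by blast
  from W.hensel[OF r0(1) th(1) this] obtain r where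
    r: "r \<in> A" "res_A r = res_A r0" "W.f_eval (\<pi> * (1 + \<pi> * (\<theta> + \<pi> * r))) = 0" by blast
  define \<beta> where "\<beta> = \<pi> * (1 + \<pi> * (\<theta> + \<pi> * r))"
  have \<beta>A: "\<beta> \<in> A" unfolding \<beta>_def using TR.R_A[OF th(1)] r(1) by (intro TR.A_closed)
  have \<beta>: "ev f \<beta> = 0" "\<beta> \<in> L" using r(3) f_eval_eq[OF V] A_L[OF \<beta>A] by (simp_all add: \<beta>_def)
  have K: "K_hom (emb \<beta>)" by (rule emb_K_hom[OF \<beta>])
  have auto: "TR.is_auto (emb \<beta>)" by (rule K_hom_is_auto[OF K])
  have s: "emb \<beta> \<pi> = \<pi> * (1 + \<pi> * (\<theta> + \<pi> * r))" using emb_ev[OF \<beta>(1), of "[:0, 1:]"] by (simp add: \<beta>_def)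
  \<comment> \<open>In the residue field \<theta> = \<gamma>(\<theta>^2 - r). So this is a unit, as
    needed for the exact depth of the p-th power.\<close>
  have "res_A (\<theta> ^ 2 - r) \<noteq> 0"
  proof
    assume z: "res_A (\<theta> ^ 2 - r) = 0"
    have "res_A (\<theta> + W.\<gamma> * (r0 - \<theta> ^ 2)) = res_A \<theta> - res_A W.\<gamma> * res_A (\<theta> ^ 2 - r)"
      using TR.R_A[OF th(1)] r r0(1) W.gamma_A by (simp add: TR.res_simps TR.A_closed algebra_simps)
    then show False using z r0(2) unit by simp
  qed
  note bp = TR.funpow_p_depth[OF auto th(1) r(1) s] this
  have d: "emb \<beta> \<pi> - \<pi> = \<pi> ^ 2 * (\<theta> + \<pi> * r)" unfolding s by (simp add: algebra_simps power2_eq_square)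
  have sA': "\<theta> + \<pi> * r \<in> A" using TR.R_A[OF th(1)] r(1) by (intro TR.A_closed)
  have b2: "emb \<beta> \<pi> - \<pi> \<in> TR.I 2" unfolding d by (rule TR.pi_mult_I[OF sA'])
  have "res_A (\<theta> + \<pi> * r) \<noteq> 0"
    using unit TR.R_A[OF th(1)] r(1) by (simp add: TR.res_simps TR.A_closed TR.res_pi)
  then have b3: "emb \<beta> \<pi> - \<pi> \<notin> TR.I 3" unfolding d using TR.unit_not_I[OF sA', of 2] by simp
  have "(emb \<beta> ^^ m) \<pi> \<noteq> \<pi>" if m: "0 < m" "m < p^2" for m
  proof
    assume "(emb \<beta> ^^ m) \<pi> = \<pi>"
    then have z: "(emb \<beta> ^^ m) \<pi> - \<pi> \<in> TR.I k" for k by (simp add: TR.I_zero)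
    show False
      using TR.funpow_distinct[OF auto b2 b3 bp(1) bp(2)[OF unit bp(3)], of m] z m by blast
  qed
  then show "galois_cyclic_of_degree (p^2) (adjoin_root \<pi>)" by (rule galois_cyclicI[OF K])
qed

section \<open>From coefficients numbered from the top to exponents\<close>

lemma coprime_range_small: "\<lbrakk>1 \<le> a; b \<le> p - 1\<rbrakk> \<Longrightarrow> coprime_range p a b = {a..b}"
proof -
  assume ab: "1 \<le> a" "b \<le> p - 1"
  have "coprime i p" if "a \<le> i" "i \<le> b" for i
  proof -
    have "0 < i" "i < p" using that ab TR.p_ge_3 by linarith+
    then have "\<not> p dvd i" by (auto dest: dvd_imp_le)
    then show ?thesis using prime_imp_coprime[OF prime_p] by (simp add: coprime_commute)
  qed
  then show ?thesis unfolding coprime_range_def by auto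
qed

lemma index_multiple: "i \<le> p \<Longrightarrow> p^2 - p * i = p * (p - i)"
  by (simp add: TR.p_sq diff_mult_distrib2)

lemma index_top: "1 \<le> i \<Longrightarrow> i \<le> p \<Longrightarrow> p^2 - i = p * (p - 1) + (p - i)"
  using TR.M_facts(1) TR.M_def by linarith

lemma reindex_multiples:
  "(\<forall>i\<in>coprime_range p 2 (p - 1). P (p^2 - p * i)) \<longleftrightarrow> (\<forall>q\<in>{1..<p - 1}. P (p * q))"
proof -
  have eq: "coprime_range p 2 (p - 1) = {2..p - 1}" by (rule coprime_range_small) simp_all
  have 1: "P (p * q)" if "\<forall>i\<in>{2..p - 1}. P (p^2 - p * i)" "q \<in> {1..<p - 1}" for q
  proof -
    have "p - q \<in> {2..p - 1}" "p - (p - q) = q" using that(2) by auto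
    then show ?thesis using that(1) index_multiple[of "p - q"] by fastforce
  qed
  have 2: "P (p^2 - p * i)" if "\<forall>q\<in>{1..<p - 1}. P (p * q)" "i \<in> {2..p - 1}" for i
  proof -
    have "p - i \<in> {1..<p - 1}" "i \<le> p" using that(2) by auto
    then show ?thesis using that(1) index_multiple[of i] by simp
  qed
  show ?thesis unfolding eq using 1 2 by blast
qed

lemma reindex_pairs:
  "(\<forall>l\<in>coprime_range p 3 (p - 1). P (p^2 - p * l) (p^2 - l)) \<longleftrightarrow> (\<forall>j\<in>{1..<p - 2}. P (p * j) (p * (p - 1) + j))"
proof -
  have eq: "coprime_range p 3 (p - 1) = {3..p - 1}" by (rule coprime_range_small) simp_all
  have 1: "P (p * j) (p * (p - 1) + j)" if "\<forall>l\<in>{3..p - 1}. P (p^2 - p * l) (p^2 - l)" "j \<in> {1..<p - 2}" for j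
  proof -
    have "p - j \<in> {3..p - 1}" "p - (p - j) = j" "1 \<le> p - j" using that(2) by auto
    then show ?thesis using that(1) index_multiple[of "p - j"] index_top[of "p - j"] by fastforce
  qed
  have 2: "P (p^2 - p * l) (p^2 - l)" if "\<forall>j\<in>{1..<p - 2}. P (p * j) (p * (p - 1) + j)" "l \<in> {3..p - 1}" for l
  proof -
    have "p - l \<in> {1..<p - 2}" "l \<le> p" "1 \<le> l" using that(2) by auto
    then show ?thesis using that(1) unfolding index_multiple[OF \<open>l \<le> p\<close>] index_top[OF \<open>1 \<le> l\<close> \<open>l \<le> p\<close>] by blast
  qed
  show ?thesis unfolding eq using 1 2 by blast
qed

lemma reindex_top:
  "(\<forall>i\<in>coprime_range p 1 (p - 1). P (p^2 - i)) \<longleftrightarrow> (\<forall>j\<in>{1..<p}. P (p * (p - 1) + j))"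
proof -
  have eq: "coprime_range p 1 (p - 1) = {1..p - 1}" by (rule coprime_range_small) simp_all
  have 1: "P (p * (p - 1) + j)" if "\<forall>i\<in>{1..p - 1}. P (p^2 - i)" "j \<in> {1..<p}" for j
  proof -
    have "p - j \<in> {1..p - 1}" "p - (p - j) = j" "1 \<le> p - j" using that(2) by auto
    then show ?thesis using that(1) index_top[of "p - j"] by fastforce
  qed
  have 2: "P (p^2 - i)" if "\<forall>j\<in>{1..<p}. P (p * (p - 1) + j)" "i \<in> {1..p - 1}" for i
  proof -
    have "p - i \<in> {1..<p}" "i \<le> p" "1 \<le> i" using that(2) by auto
    then show ?thesis using that(1) unfolding index_top[OF \<open>1 \<le> i\<close> \<open>i \<le> p\<close>] by blast
  qed
  show ?thesis unfolding eq using 1 2 by blast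
qed

text \<open>Reflection at p^2 preserves divisibility by p, and p + 2 corresponds to M - 2, the
  largest exponent below M - 1.\<close>

lemma reindex_low:
  "(\<forall>i\<in>coprime_range p (p + 2) (p^2 - 1). P (p^2 - i)) \<longleftrightarrow> (\<forall>i<p * (p - 1) - 1. \<not> p dvd i \<longrightarrow> P i)"
proof -
  have n: "p * (p - 1) + p = p^2" "p + 3 \<le> p * (p - 1)" using TR.M_facts(1,3) unfolding TR.M_def by blast+
  have cop: "coprime (p^2 - i) p \<longleftrightarrow> \<not> p dvd i" if "i \<le> p^2" for i
  proof -
    have "coprime (p^2 - i) p \<longleftrightarrow> \<not> p dvd p^2 - i"
      using prime_imp_coprime[OF prime_p, of "p^2 - i"] prime_p
      by (metis coprime_absorb_right coprime_commute not_prime_unit)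
    also have "p dvd p^2 - i \<longleftrightarrow> p dvd i"
    proof -
      have "p dvd (p^2 - i) + i" using that by (simp add: TR.p_sq)
      then show ?thesis by (metis dvd_add_left_iff dvd_add_right_iff)
    qed
    finally show ?thesis .
  qed
  have 1: "P i" if "\<forall>i\<in>coprime_range p (p + 2) (p^2 - 1). P (p^2 - i)" "i < p * (p - 1) - 1" "\<not> p dvd i" for i
  proof -
    have "i \<noteq> 0" using that(3) by (metis dvd_0_right)
    then have i: "p + 2 \<le> p^2 - i" "p^2 - i \<le> p^2 - 1" "i \<le> p^2" "p^2 - (p^2 - i) = i" using that(2) n by linarith+
    then have "p^2 - i \<in> coprime_range p (p + 2) (p^2 - 1)" using cop[OF i(3)] that(3) by (simp add: coprime_range_def)
    then show ?thesis using that(1) i(4) by fastforce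
  qed
  have 2: "P (p^2 - i)" if "\<forall>i<p * (p - 1) - 1. \<not> p dvd i \<longrightarrow> P i" "i \<in> coprime_range p (p + 2) (p^2 - 1)" for i
  proof -
    have i: "p + 2 \<le> i" "i \<le> p^2 - 1" "coprime i p" using that(2) by (auto simp: coprime_range_def)
    have i': "p^2 - i < p * (p - 1) - 1" "p^2 - i \<le> p^2" "p^2 - (p^2 - i) = i" using i(1,2) n by linarith+
    then show ?thesis using that(1) cop[OF i'(2)] i(3) by auto
  qed
  show ?thesis using 1 2 by blast
qed

definition fc :: "nat \<Rightarrow> 'a" where "fc i = Polynomial.coeff f (p^2 - i)"

lemma fc_eq: "fc p = Polynomial.coeff f (p * (p - 1))" "fc (p^2) = Polynomial.coeff f 0"
    "fc (p + 1) = Polynomial.coeff f (p * (p - 1) - 1)" "fc 1 = Polynomial.coeff f (p * (p - 1) + (p - 1))"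
    "fc 2 = Polynomial.coeff f (p * (p - 1) + (p - 2))" "fc (2 * p) = Polynomial.coeff f (p * (p - 2))"
proof -
  have n: "p * (p - 1) + p = p^2" using TR.M_facts(1) unfolding TR.M_def .
  have "p^2 - p = p * (p - 1)" "p^2 - (p + 1) = p * (p - 1) - 1" using n by linarith+
  then show "fc p = Polynomial.coeff f (p * (p - 1))" "fc (p + 1) = Polynomial.coeff f (p * (p - 1) - 1)"
    unfolding fc_def by (simp_all only:)
  show "fc (p^2) = Polynomial.coeff f 0" by (simp add: fc_def)
  show "fc 1 = Polynomial.coeff f (p * (p - 1) + (p - 1))" "fc 2 = Polynomial.coeff f (p * (p - 1) + (p - 2))"
    unfolding fc_def using index_top[of 1] index_top[of 2] TR.p_ge_3 by (simp_all only:)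
  show "fc (2 * p) = Polynomial.coeff f (p * (p - 2))"
    unfolding fc_def mult.commute[of 2 p] using index_multiple[of 2] TR.p_ge_3 by simp
qed

lemma valuation_conditions_iff:
  "valuation_conditions \<longleftrightarrow>
    (v (fc p) = 1 \<and> (\<forall>i \<in> coprime_range p 2 (p - 1). v (fc (p * i)) \<ge> 2)) \<and>
    ((\<forall>i \<in> coprime_range p 1 (p - 1). v (fc i) \<ge> 2) \<and> v (fc (p + 1)) = 2 \<and>
      (\<forall>i \<in> coprime_range p (p + 2) (p^2 - 1). v (fc i) \<ge> 3))"
proof -
  have g: "2 \<le> v x \<longleftrightarrow> x / of_nat p ^ 2 \<in> \<O>" "3 \<le> v x \<longleftrightarrow> x / of_nat p ^ 3 \<in> \<O>" for x
    using v_ge_iff[of 2 x] v_ge_iff[of 3 x] by simp_all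
  have e: "v x = 1 \<longleftrightarrow> x / of_nat p \<in> \<O> \<and> res (x / of_nat p) \<noteq> 0"
      "v x = 2 \<longleftrightarrow> x / of_nat p ^ 2 \<in> \<O> \<and> res (x / of_nat p ^ 2) \<noteq> 0" for x
    using v_eq_iff[of x 1] v_eq_iff[of x 2] by (simp_all add: one_ereal_def)
  have 1: "(\<forall>i \<in> coprime_range p 2 (p - 1). v (fc (p * i)) \<ge> 2) \<longleftrightarrow> (\<forall>q\<in>{1..<p - 1}. Polynomial.coeff f (p * q) / of_nat p ^ 2 \<in> \<O>)"
    unfolding fc_def g by (rule reindex_multiples)
  have 2: "(\<forall>i \<in> coprime_range p 1 (p - 1). v (fc i) \<ge> 2) \<longleftrightarrow> (\<forall>j\<in>{1..<p}. Polynomial.coeff f (p * (p - 1) + j) / of_nat p ^ 2 \<in> \<O>)"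
    unfolding fc_def g by (rule reindex_top)
  have 3: "(\<forall>i \<in> coprime_range p (p + 2) (p^2 - 1). v (fc i) \<ge> 3)
      \<longleftrightarrow> (\<forall>i<p * (p - 1) - 1. \<not> p dvd i \<longrightarrow> Polynomial.coeff f i / of_nat p ^ 3 \<in> \<O>)"
    unfolding fc_def g by (rule reindex_low)
  show ?thesis unfolding valuation_conditions_def 1 2 3 e fc_eq by blast
qed

abbreviation "F i \<equiv> res (fc i / of_nat p)"
abbreviation "G i \<equiv> res (fc i / of_nat p ^ 2)"

lemma residue_conditions_iff:
  assumes V: "valuation_conditions"
  shows "wild_eisenstein.residue_conditions p (to_ac ` \<O>) res_A (\<lambda>i. to_ac (Polynomial.coeff f i)) \<longleftrightarrow>
    G (p + 1) ^ p = - (F p ^ (p + 1)) \<and>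
    (\<forall>l \<in> coprime_range p 3 (p - 1). G (p * l) = F (p^2) * (G l / F p) ^ p) \<and>
    G (2 * p) = F (p^2) * (G 2 / F p) ^ p + 1 / 2 * F p * (F p - pth_root p (F (p^2))) \<and>
    (\<forall>\<theta> \<in> \<O>. res \<theta> ^ (p * (p - 1)) = - F p / F (p^2) \<longrightarrow>
      (\<exists>x. poly (Polynomial.monom (F (p^2)) p + Polynomial.monom (F p) 1
              - [: res ((fc (p^2) * \<theta> ^ (p^2) + fc p * \<theta> ^ p) / of_nat p ^ 2) :]
              - [: G 1 * res \<theta> :]) x = 0))"
proof -
  interpret W: wild_eisenstein p "to_ac ` \<O>" A \<pi> res_A "\<lambda>i. to_ac (Polynomial.coeff f i)"
    by (rule wild_eisensteinI[OF V])
  note Vs = V[unfolded valuation_conditions_def]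
  have p2: "0 < p^2" using TR.p_pos by simp
  have ra: "res_A (to_ac x / of_nat p ^ k) = res (x / of_nat p ^ k)" "res_A (to_ac x / of_nat p) = res (x / of_nat p)"
    if "x / of_nat p ^ k \<in> \<O>" "x / of_nat p \<in> \<O>" for x :: 'a and k
    using res_A_to_ac[OF that(1)] res_A_to_ac[OF that(2)] by simp_all
  have o2: "x / of_nat p ^ 2 \<in> \<O> \<Longrightarrow> x / of_nat p \<in> \<O>" for x using O_div_p_power_mono[of x 2 1] by simp
  have ra2: "res_A (to_ac x / of_nat p ^ 2) = res (x / of_nat p ^ 2)" if "x / of_nat p ^ 2 \<in> \<O>" for x :: 'a
    using ra(1)[OF that o2[OF that]] .
  have ra1: "res_A (to_ac x / of_nat p) = res (x / of_nat p)" if "x / of_nat p \<in> \<O>" for x :: 'a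
    using ra(2)[of x 1] that by simp
  have N: "res_A W.\<phi>0 = F (p^2)" unfolding W.\<phi>0_def fc_eq by (rule ra1[OF coeff_div_p[OF p2]])
  have P: "res_A W.\<phi>1 = F p" unfolding W.\<phi>1_def fc_eq by (rule ra1) (use Vs in blast)
  have g: "res_A W.g = G (p + 1)" unfolding W.g_def fc_eq by (rule ra2) (use Vs in blast)
  have k: "res_A (W.k j) = res (Polynomial.coeff f (p * (p - 1) + j) / of_nat p ^ 2)" if "j \<in> {1..<p}" for j
    unfolding W.k_def by (rule ra2) (use Vs that in blast)
  have h: "res_A (W.h q) = res (Polynomial.coeff f (p * q) / of_nat p ^ 2)" if "q \<in> {1..<p - 1}" for q
    unfolding W.h_def by (rule ra2) (use Vs that in blast)
  have p3: "3 \<le> p" by (rule TR.p_ge_3)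
  have k1: "res_A (W.k (p - 1)) = G 1" unfolding fc_eq by (rule k) (use p3 in auto)
  have k2: "res_A (W.k (p - 2)) = G 2" unfolding fc_eq by (rule k) (use p3 in auto)
  have h2: "res_A (W.h (p - 2)) = G (2 * p)" unfolding fc_eq by (rule h) (use p3 in auto)
  have "(\<forall>j\<in>{1..<p - 2}. res_A (W.h j) = res_A W.\<phi>0 * (res_A (W.k j) / res_A W.\<phi>1) ^ p)
      \<longleftrightarrow> (\<forall>j\<in>{1..<p - 2}. res (Polynomial.coeff f (p * j) / of_nat p ^ 2)
            = F (p^2) * (res (Polynomial.coeff f (p * (p - 1) + j) / of_nat p ^ 2) / F p) ^ p)"
  proof (rule ball_cong[OF refl])
    fix j assume "j \<in> {1..<p - 2}"
    then have j: "j \<in> {1..<p - 1}" "j \<in> {1..<p}" by auto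
    show "res_A (W.h j) = res_A W.\<phi>0 * (res_A (W.k j) / res_A W.\<phi>1) ^ p
      \<longleftrightarrow> res (Polynomial.coeff f (p * j) / of_nat p ^ 2)
            = F (p^2) * (res (Polynomial.coeff f (p * (p - 1) + j) / of_nat p ^ 2) / F p) ^ p"
      unfolding N P h[OF j(1)] k[OF j(2)] ..
  qed
  also have "\<dots> \<longleftrightarrow> (\<forall>l \<in> coprime_range p 3 (p - 1). G (p * l) = F (p^2) * (G l / F p) ^ p)"
    unfolding fc_def[of "p * _"] by (subst (3) fc_def) (rule reindex_pairs[symmetric])
  finally have 5: "(\<forall>j\<in>{1..<p - 2}. res_A (W.h j) = res_A W.\<phi>0 * (res_A (W.k j) / res_A W.\<phi>1) ^ p)
      \<longleftrightarrow> (\<forall>l \<in> coprime_range p 3 (p - 1). G (p * l) = F (p^2) * (G l / F p) ^ p)" .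
  have 7: "(\<exists>x. res_A W.\<phi>0 * x ^ p + res_A W.\<phi>1 * x = res_A ((W.\<phi>0 * to_ac \<theta> ^ p^2 + W.\<phi>1 * to_ac \<theta> ^ p) / of_nat p)
          + res_A (W.k (p - 1)) * res_A (to_ac \<theta>))
      \<longleftrightarrow> (\<exists>x. poly (Polynomial.monom (F (p^2)) p + Polynomial.monom (F p) 1
              - [: res ((fc (p^2) * \<theta> ^ (p^2) + fc p * \<theta> ^ p) / of_nat p ^ 2) :]
              - [: G 1 * res \<theta> :]) x = 0)"
    if th: "\<theta> \<in> \<O>" "res \<theta> ^ (p * (p - 1)) = - F p / F (p^2)" for \<theta>
  proof -
    have r: "res_A (to_ac \<theta>) = res \<theta>" by (rule res_A_to_ac[OF th(1)])
    have "res \<theta> \<noteq> 0" using th(2) W.coeff_unit p3 unfolding N P by (auto simp: zero_power)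
    then have "res_A (W.\<phi>0 * to_ac \<theta> ^ p^2 + W.\<phi>1 * to_ac \<theta> ^ p) = 0"
      using W.residue_relation_iff[of "res \<theta>"] W.residue_relation[OF to_ac_A[OF th(1)]] th(2) unfolding N P r by simp
    then have L: "(W.\<phi>0 * to_ac \<theta> ^ p^2 + W.\<phi>1 * to_ac \<theta> ^ p) / of_nat p \<in> to_ac ` \<O>"
      using W.lift_quotient_R[of "to_ac \<theta>"] th(1) by blast
    define m where "m = (fc (p^2) * \<theta> ^ (p^2) + fc p * \<theta> ^ p) / of_nat p ^ 2"
    have eq: "(W.\<phi>0 * to_ac \<theta> ^ p^2 + W.\<phi>1 * to_ac \<theta> ^ p) / of_nat p = to_ac m"
      unfolding m_def W.\<phi>0_def W.\<phi>1_def fc_eq by (simp add: power2_eq_square add_divide_distrib)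
    have "m \<in> \<O>" using L unfolding eq to_ac_R_iff .
    then have m: "res_A (to_ac m) = res m" by (rule res_A_to_ac)
    have "poly (Polynomial.monom (F (p^2)) p + Polynomial.monom (F p) 1 - [: res m :] - [: G 1 * res \<theta> :]) x = 0
        \<longleftrightarrow> F (p^2) * x ^ p + F p * x = res m + G 1 * res \<theta>" for x
      by (simp add: poly_monom) (simp add: algebra_simps)
    then show ?thesis unfolding eq m N P k1 r m_def[symmetric] by simp
  qed
  have "(\<forall>\<theta>\<in>to_ac ` \<O>. res_A \<theta> ^ (p * (p - 1)) = - res_A W.\<phi>1 / res_A W.\<phi>0
      \<longrightarrow> (\<exists>x. res_A W.\<phi>0 * x ^ p + res_A W.\<phi>1 * x = res_A ((W.\<phi>0 * \<theta> ^ p^2 + W.\<phi>1 * \<theta> ^ p) / of_nat p)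
          + res_A (W.k (p - 1)) * res_A \<theta>))
    \<longleftrightarrow> (\<forall>\<theta> \<in> \<O>. res \<theta> ^ (p * (p - 1)) = - F p / F (p^2) \<longrightarrow>
      (\<exists>x. poly (Polynomial.monom (F (p^2)) p + Polynomial.monom (F p) 1
              - [: res ((fc (p^2) * \<theta> ^ (p^2) + fc p * \<theta> ^ p) / of_nat p ^ 2) :]
              - [: G 1 * res \<theta> :]) x = 0))"
    unfolding ball_simps(9)
  proof (rule ball_cong[OF refl], rule imp_cong)
    fix \<theta> assume "\<theta> \<in> \<O>"
    then show "(res_A (to_ac \<theta>) ^ (p * (p - 1)) = - res_A W.\<phi>1 / res_A W.\<phi>0) = (res \<theta> ^ (p * (p - 1)) = - F p / F (p^2))"
      by (simp only: res_A_to_ac N P)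
  qed (rule 7)
  note 7 = this
  show ?thesis unfolding W.residue_conditions_def 5 7 unfolding N P g h2 k2 ..
qed

text \<open>Frobenius is surjective on the residue field, so every (p - 1)-th power is also a p(p -
  1)-th power, and its base lifts to the valuation ring.\<close>

lemma residue_root_iff:
  "(\<exists>\<theta>\<in>\<O>. res \<theta> ^ (p * (p - 1))
      = - res (Polynomial.coeff f (p * (p - 1)) / of_nat p) / res (Polynomial.coeff f 0 / of_nat p))
    \<longleftrightarrow> - F p / F (p^2) \<in> powers_of (p - 1)"
proof
  assume "\<exists>\<theta>\<in>\<O>. res \<theta> ^ (p * (p - 1))
      = - res (Polynomial.coeff f (p * (p - 1)) / of_nat p) / res (Polynomial.coeff f 0 / of_nat p)"
  then show "- F p / F (p^2) \<in> powers_of (p - 1)"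
    unfolding powers_of_def fc_eq by (metis power_mult rangeI)
next
  assume "- F p / F (p^2) \<in> powers_of (p - 1)"
  then obtain y where y: "- F p / F (p^2) = y ^ (p - 1)" unfolding powers_of_def by blast
  obtain u where u: "u ^ p = y" using frobenius_surj by blast
  obtain \<theta> where \<theta>: "\<theta> \<in> \<O>" "res \<theta> = u" using res_lift by blast
  have "res \<theta> ^ (p * (p - 1)) = - F p / F (p^2)" unfolding y u[symmetric] \<theta>(2) by (rule power_mult)
  then show "\<exists>\<theta>\<in>\<O>. res \<theta> ^ (p * (p - 1))
      = - res (Polynomial.coeff f (p * (p - 1)) / of_nat p) / res (Polynomial.coeff f 0 / of_nat p)"
    using \<theta>(1) unfolding fc_eq by blast
qed

end

theorem theorem1:
  fixes p :: nat
    and v :: "'a :: field_char_0 \<Rightarrow> ereal"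
    and Qp :: "'a set"
    and res :: "'a \<Rightarrow> 'k :: field"
    and f :: "'a poly"
    and \<pi> :: "'a alg_closure"
    and c :: "nat \<Rightarrow> 'a"
    and F G :: "nat \<Rightarrow> 'k"
  assumes "finite_unramified_extension p v Qp"
    and "odd p"
    and "residue_map p v res"
    and "eisenstein v f"
    and "Polynomial.degree f = p ^ 2"
    and "poly (map_poly to_ac f) \<pi> = 0"
  defines "c \<equiv> (\<lambda>i. Polynomial.coeff f (p ^ 2 - i))"
    and "F \<equiv> (\<lambda>i. res (c i / of_nat p))"
    and "G \<equiv> (\<lambda>i. res (c i / of_nat p ^ 2))"
  shows "galois_cyclic_of_degree (p ^ 2) (adjoin_root \<pi>) \<longleftrightarrow>
    (v (c p) = 1 \<and> (\<forall>i \<in> coprime_range p 2 (p - 1). v (c (p * i)) \<ge> 2)) \<and>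
    ((\<forall>i \<in> coprime_range p 1 (p - 1). v (c i) \<ge> 2) \<and>
      v (c (p + 1)) = 2 \<and>
      (\<forall>i \<in> coprime_range p (p + 2) (p ^ 2 - 1). v (c i) \<ge> 3)) \<and>
    - F p / F (p ^ 2) \<in> powers_of (p - 1) \<and>
    G (p + 1) ^ p = - (F p ^ (p + 1)) \<and>
    (\<forall>l \<in> coprime_range p 3 (p - 1). G (p * l) = F (p ^ 2) * (G l / F p) ^ p) \<and>
    G (2 * p) = F (p ^ 2) * (G 2 / F p) ^ p + 1 / 2 * F p * (F p - pth_root p (F (p ^ 2))) \<and>
    (\<forall>\<theta> \<in> valuation_ring v. res \<theta> ^ (p * (p - 1)) = - F p / F (p ^ 2) \<longrightarrow>
      (\<exists>x. poly (monom (F (p ^ 2)) p + monom (F p) 1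
              - [: res ((c (p ^ 2) * \<theta> ^ (p ^ 2) + c p * \<theta> ^ p) / of_nat p ^ 2) :]
              - [: G 1 * res \<theta> :]) x = 0))"
proof -
  note defs = c_def F_def G_def
  interpret finite_unramified_extension p v Qp by fact
  have "Factorial_Ring.prime p" by (rule prime_p)
  then have "2 \<le> p\<^sup>2" using prime_ge_2_nat[of p] by (simp add: power2_eq_square) (metis le_trans le_square)
  then interpret cyclic_criterion p v Qp res f \<pi>
    by unfold_locales (use assms in auto)
  have c: "c = fc" unfolding defs(1) fc_def ..
  have combine: "(V \<and> r \<and> W) = (C1 \<and> C2 \<and> r \<and> Z)"
    if "V = (C1 \<and> C2)" "V \<Longrightarrow> W = Z" for V r W C1 C2 Z
    using that by blast
  show ?thesis
    unfolding defs(2,3) c galois_cyclic_iff residue_root_iff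
    by (rule combine[OF valuation_conditions_iff residue_conditions_iff])
qed

end
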